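(* Let $\dagger$ denote one of the four splittings ABOBA, AOBOA, BOAOB, OABAO, and let $Q^{\dagger,U}_{h,\gamma}$ be its transition kernel with step size $h>0$ and friction $\gamma>0$. Put $\beta=e^{-\gamma h}$ and $$s_\dagger=\frac{h^2}{2}(1+\beta)\ \text{ for ABOBA and OABAO},\qquad s_\dagger=\sqrt\beta\,h^2\ \text{ for AOBOA and BOAOB}.$$ Fix $C_\star>(3+\sqrt5)^2$, let $\kappa\ge2C_\star$, set $q_\kappa=\frac{1-C_\star/\kappa}{1+C_\star/\kappa}$, and assume $0<s_\dagger<2(1+\beta)/\kappa$. Then at least one of the following two cases holds. (Q) There is $\lambda\in[1,\kappa]$ such that, for the quadratic potential $U_\lambda(x)=\lambda|x|^2/2$ on $\mathbb R^2$, two initial states $z,\widetilde z\in\mathbb R^4$ satisfy $$\lim_{n\to\infty}\bigl\|\delta_z(Q_{h,\gamma}^{\dagger,U_\lambda})^n-\delta_{\widetilde z}(Q_{h,\gamma}^{\dagger,U_\lambda})^n\bigr\|_{\mathrm{TV}}^{1/n}=\rho_{\mathrm q}(s_\dagger,\beta;\kappa)\ge q_\kappa .$$ (C) There exist $U\in\mathcal U_\kappa^2$ and constants $c_0,C_0>0$ such that, for every $R\ge1$: the dilated potential $U_R(x)=R^2U(x/R)$ belongs to $\mathcal U_\kappa^2$, the kernel $Q_{h,\gamma}^{\dagger,U_R}$ has a unique invariant law $\pi_R$, and there is an initial state $z_R\in\mathbb R^4$ satisfying $W_2(\delta_{z_R},\pi_R)\le C_0(1+R)$ while $$\bigl\|\delta_{z_R}(Q_{h,\gamma}^{\dagger,U_R})^n-\pi_R\bigr\|_{\mathrm{TV}}\ge\frac38\qquad\text{for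 all integers }0\le n\le N_R,$$ where $N_R=\lfloor\frac1{16}e^{c_0R^2}\rfloor$ for ABOBA, AOBOA and BOAOB, and $N_R=\lfloor\frac1{32}e^{c_0R^2}\rfloor$ for OABAO.
   Context: Splittings. For differentiable $U:\mathbb R^d\to\mathbb R$, $\gamma>0$ and $t>0$, define on $\mathbb R^d\times\mathbb R^d$ the maps $\mathrm A_t(x,v)=(x+tv,v)$, $\mathrm B_t(x,v)=(x,v-t\nabla U(x))$, $\mathrm O_t(x,v)=(x,e^{-\gamma t}v+(1-e^{-2\gamma t})^{1/2}\xi)$, where $\xi\sim\mathcal N(0,\mathrm{Id}_d)$ is drawn independently at each application of $\mathrm O_t$. One step with step size $h$ applies successively, in the order of the letters of the name, full steps for the middle letter and half steps for the others: ABOBA: $\mathrm A_{h/2},\mathrm B_{h/2},\mathrm O_h,\mathrm B_{h/2},\mathrm A_{h/2}$; AOBOA: $\mathrm A_{h/2},\mathrm O_{h/2},\mathrm B_h,\mathrm O_{h/2},\mathrm A_{h/2}$; BOAOB: $\mathrm B_{h/2},\mathrm O_{h/2},\mathrm A_h,\mathrm O_{h/2},\mathrm B_{h/2}$; OABAO: $\mathrm O_{h/2},\mathrm A_{h/2},\mathrm B_h,\mathrm A_{h/2},\mathrm O_{h/2}$. Iterating defines a Markov chain on $\mathbb R^d\times\mathbb R^d$ with transition kernel $Q^{\dagger,U}_{h,\gamma}$. $\mathcal U_\kappa^d=\{U\in C^\infty(\mathbb R^d): \mathrm{Id}_d\preceq\nabla^2U(x)\preceq\kappa\,\mathrm{Id}_d\text{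 for every }x\}$. $\|\nu-\widetilde\nu\|_{\mathrm{TV}}=\sup_A|\nu(A)-\widetilde\nu(A)|$; $W_2$ is the Euclidean $2$-Wasserstein distance; $\delta_z$ is the Dirac mass at $z$. $A_\lambda(s,\beta)=\begin{pmatrix}1+\beta-s\lambda&-\beta\\1&0\end{pmatrix}$ and $\rho_{\mathrm q}(s,\beta;\kappa)=\max_{\lambda\in[1,\kappa]}\rho(A_\lambda(s,\beta))$, with $\rho(\cdot)$ the spectral radius. *)

theory Defs
  imports "HOL-Probability.Probability" "Jordan_Normal_Form.Spectral_Radius"
begin

text \<open>In finite dimension, continuity of all iterated partial derivatives up to order \<open>k\<close>
  characterises \<open>C\<^sup>k\<close>; \<open>frechet_derivative f (at x) b\<close> is the partial derivative along \<open>b\<close>.\<close>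

primrec C_k :: "nat \<Rightarrow> ('a::euclidean_space \<Rightarrow> real) \<Rightarrow> bool" where
  "C_k 0 f \<longleftrightarrow> continuous_on UNIV f"
| "C_k (Suc k) f \<longleftrightarrow> (\<forall>x. f differentiable (at x)) \<and>
     (\<forall>b\<in>Basis. C_k k (\<lambda>x. frechet_derivative f (at x) b))"

definition C_infinity :: "('a::euclidean_space \<Rightarrow> real) \<Rightarrow> bool" where
  "C_infinity f \<longleftrightarrow> (\<forall>k. C_k k f)"

definition grad :: "('a::euclidean_space \<Rightarrow> real) \<Rightarrow> 'a \<Rightarrow> 'a" where
  "grad U x = (THE g. GDERIV U x :> g)"

definition hessian :: "('a::euclidean_space \<Rightarrow> real) \<Rightarrow> 'a \<Rightarrow> 'a \<Rightarrow> 'a" where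
  "hessian U x = frechet_derivative (grad U) (at x)"

definition loewner_le :: "('a::euclidean_space \<Rightarrow> 'a) \<Rightarrow> ('a \<Rightarrow> 'a) \<Rightarrow> bool" where
  "loewner_le F G \<longleftrightarrow> (\<forall>u. inner u (F u) \<le> inner u (G u))"

definition potentials :: "real \<Rightarrow> ('a::euclidean_space \<Rightarrow> real) set" where
  "potentials \<kappa> = {U. C_infinity U \<and>
     (\<forall>x. loewner_le (\<lambda>u. u) (hessian U x) \<and> loewner_le (hessian U x) (\<lambda>u. \<kappa> *\<^sub>R u))}"

definition quadratic_potential :: "real \<Rightarrow> 'a::euclidean_space \<Rightarrow> real" where
  "quadratic_potential l x = l * (norm x)\<^sup>2 / 2"

definition dilate :: "real \<Rightarrow> ('a::euclidean_space \<Rightarrow> real) \<Rightarrow> 'a \<Rightarrow> real" where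
  "dilate R U x = R\<^sup>2 * U (x /\<^sub>R R)"

definition std_gaussian :: "'a::euclidean_space measure" where
  "std_gaussian = density lborel (\<lambda>x. ennreal (\<Prod>b\<in>Basis. std_normal_density (inner x b)))"

text \<open>A state is a pair \<open>(x, v)\<close>; on the product type \<open>dist\<close> is the Euclidean distance.\<close>

type_synonym 'a kernel = "'a \<times> 'a \<Rightarrow> ('a \<times> 'a) measure"

definition kernel_A :: "real \<Rightarrow> 'a::euclidean_space kernel" where
  "kernel_A t = (\<lambda>(x, v). return borel (x + t *\<^sub>R v, v))"

definition kernel_B :: "('a::euclidean_space \<Rightarrow> real) \<Rightarrow> real \<Rightarrow> 'a kernel" where
  "kernel_B U t = (\<lambda>(x, v). return borel (x, v - t *\<^sub>R grad U x))"

definition kernel_O :: "real \<Rightarrow> real \<Rightarrow> 'a::euclidean_space kernel" where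
  "kernel_O \<gamma> t = (\<lambda>(x, v). distr std_gaussian borel
     (\<lambda>\<xi>. (x, exp (- \<gamma> * t) *\<^sub>R v + sqrt (1 - exp (- 2 * \<gamma> * t)) *\<^sub>R \<xi>)))"

text \<open>\<open>K \<rhd> L\<close> applies \<open>K\<close> first and then \<open>L\<close>, with fresh randomness.\<close>

definition kernel_then :: "'a::euclidean_space kernel \<Rightarrow> 'a kernel \<Rightarrow> 'a kernel" (infixl \<open>\<rhd>\<close> 55)
  where "K \<rhd> L = (\<lambda>z. bind (K z) L)"

datatype splitting = ABOBA | AOBOA | BOAOB | OABAO

primrec splitting_kernel ::
    "splitting \<Rightarrow> ('a::euclidean_space \<Rightarrow> real) \<Rightarrow> real \<Rightarrow> real \<Rightarrow> 'a kernel" where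
  "splitting_kernel ABOBA U h \<gamma> =
     kernel_A (h/2) \<rhd> kernel_B U (h/2) \<rhd> kernel_O \<gamma> h \<rhd> kernel_B U (h/2) \<rhd> kernel_A (h/2)"
| "splitting_kernel AOBOA U h \<gamma> =
     kernel_A (h/2) \<rhd> kernel_O \<gamma> (h/2) \<rhd> kernel_B U h \<rhd> kernel_O \<gamma> (h/2) \<rhd> kernel_A (h/2)"
| "splitting_kernel BOAOB U h \<gamma> =
     kernel_B U (h/2) \<rhd> kernel_O \<gamma> (h/2) \<rhd> kernel_A h \<rhd> kernel_O \<gamma> (h/2) \<rhd> kernel_B U (h/2)"
| "splitting_kernel OABAO U h \<gamma> =
     kernel_O \<gamma> (h/2) \<rhd> kernel_A (h/2) \<rhd> kernel_B U h \<rhd> kernel_A (h/2) \<rhd> kernel_O \<gamma> (h/2)"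

text \<open>The law \<open>\<delta>\<^sub>z Q\<^sup>n\<close> of the chain with kernel \<open>Q\<close> after \<open>n\<close> steps from \<open>z\<close>.\<close>

definition law_at :: "'a::euclidean_space kernel \<Rightarrow> 'a \<times> 'a \<Rightarrow> nat \<Rightarrow> ('a \<times> 'a) measure" where
  "law_at Q z n = ((\<lambda>\<mu>. bind \<mu> Q) ^^ n) (return borel z)"

definition invariant_law :: "'a::euclidean_space kernel \<Rightarrow> ('a \<times> 'a) measure \<Rightarrow> bool" where
  "invariant_law Q \<mu> \<longleftrightarrow> \<mu> \<in> space (prob_algebra borel) \<and> bind \<mu> Q = \<mu>"

definition tv_dist :: "'a measure \<Rightarrow> 'a measure \<Rightarrow> real" where
  "tv_dist \<mu> \<nu> = (SUP A\<in>sets \<mu>. \<bar>measure \<mu> A - measure \<nu> A\<bar>)"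

definition couplings :: "'a measure \<Rightarrow> 'a measure \<Rightarrow> ('a \<times> 'a) measure set" where
  "couplings \<mu> \<nu> = {\<pi> \<in> space (prob_algebra (\<mu> \<Otimes>\<^sub>M \<nu>)). distr \<pi> \<mu> fst = \<mu> \<and> distr \<pi> \<nu> snd = \<nu>}"

definition ennreal_sqrt :: "ennreal \<Rightarrow> ennreal" where
  "ennreal_sqrt r = (if r = \<top> then \<top> else ennreal (sqrt (enn2real r)))"

definition W2 :: "'a::metric_space measure \<Rightarrow> 'a measure \<Rightarrow> ennreal" where
  "W2 \<mu> \<nu> = (INF \<pi>\<in>couplings \<mu> \<nu>. ennreal_sqrt (\<integral>\<^sup>+ (z, w). ennreal ((dist z w)\<^sup>2) \<partial>\<pi>))"

definition A_mat :: "real \<Rightarrow> real \<Rightarrow> real \<Rightarrow> complex mat" where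
  "A_mat l s \<beta> = mat_of_rows_list 2
     [[complex_of_real (1 + \<beta> - s * l), complex_of_real (- \<beta>)], [1, 0]]"

text \<open>The supremum is a maximum, since the spectral radius depends continuously on \<open>l\<close>.\<close>

definition rho_q :: "real \<Rightarrow> real \<Rightarrow> real \<Rightarrow> real" where
  "rho_q s \<beta> \<kappa> = (SUP l\<in>{1..\<kappa>}. spectral_radius (A_mat l s \<beta>))"

primrec s_param :: "splitting \<Rightarrow> real \<Rightarrow> real \<Rightarrow> real" where
  "s_param ABOBA h \<beta> = h\<^sup>2 / 2 * (1 + \<beta>)"
| "s_param OABAO h \<beta> = h\<^sup>2 / 2 * (1 + \<beta>)"
| "s_param AOBOA h \<beta> = sqrt \<beta> * h\<^sup>2"
| "s_param BOAOB h \<beta> = sqrt \<beta> * h\<^sup>2"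

primrec N_prefactor :: "splitting \<Rightarrow> real" where
  "N_prefactor ABOBA = 1 / 16"
| "N_prefactor AOBOA = 1 / 16"
| "N_prefactor BOAOB = 1 / 16"
| "N_prefactor OABAO = 1 / 32"

end

theory Submission
  imports Defs
begin

text \<open>
  Each of the four splittings, read at the moment when the position is the one at which the force is evaluated next,
  is a noisy heavy-ball recursion for the pair (current, previous) position, with momentum \<open>\<beta>\<close> and step
  parameter \<open>s\<close>: \<open>splitting_eq_pre_post\<close> cuts the step into a part before and a part after this moment,
  and \<open>post_pre_eq_heavy_ball\<close> identifies the two parts in the opposite order. Markov kernels do
  not increase total variation, so the distances between laws, and the invariant laws, can be studied for the
  heavy-ball chain. Its quality is decided by two mechanisms, as for the heavy-ball method in optimisation.

  Quadratic potentials. For the force \<open>l x\<close> two trajectories with the same noise differ by the iterates of a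
  companion matrix. Since two steps of noise blur every translation in total variation, and since the
  second moments stay bounded, the total variation distance of the two laws has the size of these iterates; along
  a suitable mode this is a power of the spectral radius (\<open>linear_chain_tv_rate\<close>,
  \<open>quadratic_tv_rate\<close>). The radius is maximal at an end point of the interval of stiffnesses
  (\<open>rho_q_attained\<close>). This is the first alternative whenever the maximal radius is at least \<open>q\<close>.

  Cycles. If the maximal radius is below \<open>q\<close>, the characteristic polynomial at stiffness one is positive at
  \<open>q\<close>, and this means that \<open>1 - \<beta>\<close> is small compared with \<open>s \<kappa>\<close>. Then there are points on the unit circle, the
  vertices of a regular polygon, that the noiseless heavy-ball recursion of some potential with Hessian between
  \<open>1\<close> and \<open>\<kappa>\<close> visits cyclically (\<open>cone_condition\<close>, \<open>cyclic_potential\<close>). The potential is built from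
  the projection onto a slightly turned smaller polygon: near a point of the cycle the projection is
  constantly the corresponding vertex, so the recursion is there an affine contraction and the cycle is attracting.
  This is the case in which a fast method on quadratics fails to converge for a nonquadratic convex function.
  Dilating the potential by \<open>R\<close> dilates the cycle and its basin but not the noise. By its Gaussian tails the noise
  leads out of the basin with a probability of order \<open>exp (- a R\<^sup>2)\<close> per step, so a chain started on the cycle
  follows it for an exponentially long time. The invariant law, on the other hand, gives the wells around two
  consecutive points of the cycle almost the same mass, hence at most about one half to each; this keeps
  the two laws apart (\<open>metastable_tv_lower\<close>).

  Existence and uniqueness of the invariant law and its second moment come from Harris' theorem for two steps of the
  chain (\<open>two_step_invariant_law\<close>): the drift is a contracting norm of the linear part
  (\<open>companion_contraction\<close>, \<open>heavy_ball_drift\<close>), and the common part is Lebesgue measure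
  on a ball, transported by the noise of the two steps (\<open>noisy_heavy_ball_minorised\<close>).\<close>

section \<open>Markov kernels, test functions and total variation\<close>

abbreviation borel_law :: "'z::topological_space measure \<Rightarrow> bool" where
  "borel_law \<mu> \<equiv> \<mu> \<in> space (prob_algebra borel)"

abbreviation markov_kernel :: "('y::topological_space \<Rightarrow> 'z::topological_space measure) \<Rightarrow> bool" where
  "markov_kernel K \<equiv> K \<in> borel \<rightarrow>\<^sub>M prob_algebra borel"

lemma borel_lawD:
  assumes "borel_law \<mu>"
  shows "prob_space \<mu>" and "sets \<mu> = sets borel" and "space \<mu> = UNIV"
  using assms sets_eq_imp_space_eq[of \<mu> borel] by (auto simp: space_prob_algebra)

lemma borel_lawI: "prob_space \<mu> \<Longrightarrow> sets \<mu> = sets borel \<Longrightarrow> borel_law \<mu>"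
  by (simp add: space_prob_algebra)

lemma borel_law_return: "borel_law (return borel z)"
  by (intro borel_lawI prob_space_return) auto

lemma markov_kernel_law: "markov_kernel K \<Longrightarrow> borel_law (K z)"
  by (erule measurable_space) simp

lemma markov_kernel_subprob:
  assumes "borel_law \<mu>" and "markov_kernel K"
  shows "K \<in> \<mu> \<rightarrow>\<^sub>M subprob_algebra borel"
  using measurable_prob_algebraD[OF assms(2)] borel_lawD(2)[OF assms(1)] measurable_cong_sets by blast

lemma borel_law_bind:
  assumes "borel_law \<mu>" and "markov_kernel K"
  shows "borel_law (bind \<mu> K)"
proof (rule borel_lawI)
  interpret prob_space \<mu> using assms(1) by (rule borel_lawD)
  note l = markov_kernel_law[OF assms(2)]
  have K: "K \<in> \<mu> \<rightarrow>\<^sub>M subprob_algebra borel"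
    using measurable_prob_algebraD[OF assms(2)] borel_lawD(2)[OF assms(1)] measurable_cong_sets by blast
  show "prob_space (bind \<mu> K)"
    by (rule prob_space_bind[OF _ K]) (simp add: borel_lawD[OF l])
  show "sets (bind \<mu> K) = sets borel"
    by (rule sets_bind) (auto simp: borel_lawD[OF l] not_empty)
qed

lemma borel_law_integrable:
  fixes \<phi> :: "'z::topological_space \<Rightarrow> real"
  assumes "borel_law \<mu>" and "\<phi> \<in> borel_measurable borel" and "\<And>x. \<bar>\<phi> x\<bar> \<le> B"
  shows "integrable \<mu> \<phi>"
proof -
  interpret prob_space \<mu> using assms(1) by (rule borel_lawD)
  show ?thesis
    by (rule integrable_const_bound[of _ B])
      (use assms in \<open>auto simp: borel_lawD(2) cong: measurable_cong_sets\<close>)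
qed

lemma borel_law_integral_diff_le:
  fixes \<phi> :: "'z::topological_space \<Rightarrow> real"
  assumes "borel_law \<mu>" and "\<phi> \<in> borel_measurable borel" and "\<psi> \<in> borel_measurable borel"
    and "\<And>x. \<bar>\<phi> x\<bar> \<le> B" and "\<And>x. \<bar>\<psi> x\<bar> \<le> B" and "\<And>x. \<bar>\<phi> x - \<psi> x\<bar> \<le> c"
  shows "\<bar>(\<integral>x. \<phi> x \<partial>\<mu>) - (\<integral>x. \<psi> x \<partial>\<mu>)\<bar> \<le> c"
proof -
  interpret prob_space \<mu> using assms(1) by (rule borel_lawD)
  note i = borel_law_integrable[OF assms(1,2,4)] borel_law_integrable[OF assms(1,3,5)]
  have "\<bar>(\<integral>x. \<phi> x \<partial>\<mu>) - (\<integral>x. \<psi> x \<partial>\<mu>)\<bar> = \<bar>\<integral>x. \<phi> x - \<psi> x \<partial>\<mu>\<bar>"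
    using i by simp
  also have "\<dots> \<le> (\<integral>x. \<bar>\<phi> x - \<psi> x\<bar> \<partial>\<mu>)" by (rule integral_abs_bound)
  also have "\<dots> \<le> (\<integral>x. c \<partial>\<mu>)" using i assms(6) by (intro integral_mono) auto
  finally show ?thesis by (simp add: prob_space)
qed

definition kernel_apply :: "('y \<Rightarrow> 'z measure) \<Rightarrow> ('z \<Rightarrow> real) \<Rightarrow> 'y \<Rightarrow> real" where
  "kernel_apply K \<phi> z = (\<integral>w. \<phi> w \<partial>K z)"

lemma kernel_apply_measurable [measurable]:
  assumes [measurable]: "markov_kernel K" "\<phi> \<in> borel_measurable borel"
  shows "kernel_apply K \<phi> \<in> borel_measurable borel"
  unfolding kernel_apply_def
  using integral_measurable_subprob_algebra[of \<phi> borel] measurable_prob_algebraD[of K borel borel]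
  by measurable

lemma kernel_apply_bounds:
  assumes "markov_kernel K" and "\<phi> \<in> borel_measurable borel" and "\<And>x. a \<le> \<phi> x" and "\<And>x. \<phi> x \<le> b"
  shows "a \<le> kernel_apply K \<phi> z" and "kernel_apply K \<phi> z \<le> b"
proof -
  note l = markov_kernel_law[OF assms(1), of z]
  interpret prob_space "K z" using l by (rule borel_lawD)
  have i: "integrable (K z) \<phi>"
    by (rule borel_law_integrable[OF l assms(2), of "max \<bar>a\<bar> \<bar>b\<bar>"])
      (use assms(3,4) in \<open>simp add: abs_le_iff le_max_iff_disj; smt (verit) assms(3,4)\<close>)
  have "(\<integral>w. a \<partial>K z) \<le> (\<integral>w. \<phi> w \<partial>K z)" using i assms(3) by (intro integral_mono) auto
  then show "a \<le> kernel_apply K \<phi> z" by (simp add: kernel_apply_def prob_space)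
  have "(\<integral>w. \<phi> w \<partial>K z) \<le> (\<integral>w. b \<partial>K z)" using i assms(4) by (intro integral_mono) auto
  then show "kernel_apply K \<phi> z \<le> b" by (simp add: kernel_apply_def prob_space)
qed

lemma integral_bind_kernel:
  fixes \<phi> :: "'z::topological_space \<Rightarrow> real"
  assumes "borel_law \<mu>" and "markov_kernel K" and "\<phi> \<in> borel_measurable borel" and "\<And>x. \<bar>\<phi> x\<bar> \<le> B"
  shows "(\<integral>w. \<phi> w \<partial>bind \<mu> K) = (\<integral>z. kernel_apply K \<phi> z \<partial>\<mu>)"
  unfolding kernel_apply_def
proof (rule integral_bind[where K=borel and B=B and B'=1])
  show "K \<in> \<mu> \<rightarrow>\<^sub>M subprob_algebra borel"
    using measurable_prob_algebraD[OF assms(2)] borel_lawD(2)[OF assms(1)] measurable_cong_sets by blast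
  show "finite_measure \<mu>" using borel_lawD(1)[OF assms(1)] by (simp add: prob_space.finite_measure)
  show "AE x in \<mu>. emeasure (K x) (space (K x)) \<le> ennreal 1"
    using borel_lawD(1)[OF markov_kernel_law[OF assms(2)]] by (simp add: prob_space.emeasure_space_1)
qed (use assms in auto)

lemma measure_eq_integral_indicator:
  assumes "borel_law \<mu>" "A \<in> sets borel"
  shows "measure \<mu> A = (\<integral>x. indicator A x \<partial>\<mu>)"
  using assms by (simp add: borel_lawD)

lemma nn_integral_bind_kernel:
  assumes "borel_law \<mu>" and "markov_kernel K" and "\<phi> \<in> borel_measurable borel"
  shows "(\<integral>\<^sup>+w. \<phi> w \<partial>bind \<mu> K) = (\<integral>\<^sup>+z. (\<integral>\<^sup>+w. \<phi> w \<partial>K z) \<partial>\<mu>)"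
  using assms(3)
  by (rule nn_integral_bind[OF _ markov_kernel_subprob[OF assms(1,2)]])

lemma nn_integral_kernel_measurable [measurable]:
  assumes "markov_kernel K" and "\<phi> \<in> borel_measurable borel"
  shows "(\<lambda>z. \<integral>\<^sup>+w. \<phi> w \<partial>K z) \<in> borel_measurable borel"
  using nn_integral_measurable_subprob_algebra[OF assms(2)] measurable_prob_algebraD[OF assms(1)]
  by (rule measurable_compose[rotated])

lemma markov_kernel_then [measurable]:
  assumes [measurable]: "markov_kernel K" "markov_kernel L"
  shows "markov_kernel (K \<rhd> L)"
  unfolding kernel_then_def
  by (rule measurable_bind_prob_space2[where N=borel]) measurable

lemma bind_kernel_assoc:
  assumes "borel_law \<mu>" and "markov_kernel K" and "markov_kernel L"
  shows "bind (bind \<mu> K) L = bind \<mu> (\<lambda>z. bind (K z) L)"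
  by (rule bind_assoc[OF markov_kernel_subprob[OF assms(1,2)] measurable_prob_algebraD[OF assms(3)]])

lemma bind_kernel_then:
  assumes "borel_law \<mu>" and "markov_kernel K" and "markov_kernel L"
  shows "bind \<mu> (K \<rhd> L) = bind (bind \<mu> K) L"
  unfolding kernel_then_def using bind_kernel_assoc[OF assms] by simp

lemma bind_return_kernel:
  assumes "markov_kernel K"
  shows "bind (return borel z) K = K z"
  by (rule bind_return[OF measurable_prob_algebraD[OF assms]]) simp

lemma tv_dist_ge:
  assumes "borel_law \<mu>" "borel_law \<nu>" "A \<in> sets borel"
  shows "\<bar>measure \<mu> A - measure \<nu> A\<bar> \<le> tv_dist \<mu> \<nu>"
  unfolding tv_dist_def
proof (rule cSUP_upper)
  interpret a: prob_space \<mu> using assms(1) by (rule borel_lawD)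
  interpret b: prob_space \<nu> using assms(2) by (rule borel_lawD)
  show "A \<in> sets \<mu>" using assms by (simp add: borel_lawD)
  have "\<bar>measure \<mu> A - measure \<nu> A\<bar> \<le> 1" for A
    using a.prob_le_1[of A] b.prob_le_1[of A] measure_nonneg[of \<mu> A] measure_nonneg[of \<nu> A] by linarith
  then show "bdd_above ((\<lambda>A. \<bar>measure \<mu> A - measure \<nu> A\<bar>) ` sets \<mu>)"
    by (auto intro!: bdd_aboveI[where M=1])
qed

lemma tv_dist_le:
  assumes "borel_law \<mu>" "\<And>A. A \<in> sets borel \<Longrightarrow> \<bar>measure \<mu> A - measure \<nu> A\<bar> \<le> c"
  shows "tv_dist \<mu> \<nu> \<le> c"
  unfolding tv_dist_def
  by (rule cSUP_least) (use assms borel_lawD(2)[OF assms(1)] in auto)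

lemma tv_dist_nonneg:
  assumes "borel_law \<mu>" "borel_law \<nu>"
  shows "0 \<le> tv_dist \<mu> \<nu>"
  using tv_dist_ge[OF assms, of "{}"] by simp

lemma floor_as_sum_of_indicators:
  fixes y :: real
  assumes "0 \<le> y" "y \<le> real n"
  shows "(\<Sum>k\<in>{1..n}. if real k \<le> y then 1 else 0 :: real) = real_of_int \<lfloor>y\<rfloor>"
proof -
  have "{k\<in>{1..n}. real k \<le> y} = {1..nat \<lfloor>y\<rfloor>}"
    using assms by (auto simp: le_nat_floor) linarith+
  then have "card {k\<in>{1..n}. real k \<le> y} = nat \<lfloor>y\<rfloor>" by simp
  then show ?thesis using assms by (simp add: sum.If_cases Int_def)
qed

text \<open>Rounding \<open>\<phi>\<close> down to multiples of \<open>1/n\<close> writes it as an average of indicators of its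
  superlevel sets, on each of which the two laws differ by at most their total variation.\<close>

lemma integral_diff_le_tv_dist:
  fixes \<phi> :: "'z::topological_space \<Rightarrow> real"
  assumes \<mu>: "borel_law \<mu>" and \<nu>: "borel_law \<nu>" and \<phi>: "\<phi> \<in> borel_measurable borel"
    and "\<And>x. 0 \<le> \<phi> x" and "\<And>x. \<phi> x \<le> 1"
  shows "\<bar>(\<integral>x. \<phi> x \<partial>\<mu>) - (\<integral>x. \<phi> x \<partial>\<nu>)\<bar> \<le> tv_dist \<mu> \<nu>"
proof (rule field_le_epsilon)
  fix e :: real assume "e > 0"
  obtain n :: nat where n: "2 / e < real n" using reals_Archimedean2 by blast
  then have n0: "n > 0" using \<open>e > 0\<close> by (cases n) (auto simp: field_simps)
  define A where "A k = {x. real k \<le> real n * \<phi> x}" for k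
  have A: "A k \<in> sets borel" for k unfolding A_def using \<phi> by measurable
  define \<psi> where "\<psi> x = (\<Sum>k\<in>{1..n}. indicator (A k) x) / real n" for x
  have \<psi>: "\<psi> x = real_of_int \<lfloor>real n * \<phi> x\<rfloor> / real n" for x
  proof -
    have "(\<Sum>k\<in>{1..n}. indicator (A k) x) = (\<Sum>k\<in>{1..n}. if real k \<le> real n * \<phi> x then 1 else 0 :: real)"
      by (intro sum.cong) (auto simp: A_def)
    also have "\<dots> = real_of_int \<lfloor>real n * \<phi> x\<rfloor>"
      by (rule floor_as_sum_of_indicators) (use assms n0 in \<open>auto simp: mult_left_le\<close>)
    finally show ?thesis by (simp add: \<psi>_def)
  qed
  have close: "\<bar>\<phi> x - \<psi> x\<bar> \<le> 1 / real n" for x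
  proof -
    have "\<bar>real n * \<phi> x - real_of_int \<lfloor>real n * \<phi> x\<rfloor>\<bar> \<le> 1" by linarith
    then have "\<bar>real n * \<phi> x - real_of_int \<lfloor>real n * \<phi> x\<rfloor>\<bar> / real n \<le> 1 / real n"
      by (intro divide_right_mono) auto
    moreover have "\<phi> x - \<psi> x = (real n * \<phi> x - real_of_int \<lfloor>real n * \<phi> x\<rfloor>) / real n"
      using n0 by (simp add: \<psi> field_simps)
    ultimately show ?thesis by simp
  qed
  have \<psi>m: "\<psi> \<in> borel_measurable borel" unfolding \<psi>_def using A by measurable
  have "1 / real n \<le> 1" using n0 by simp
  then have b: "\<bar>\<phi> x\<bar> \<le> 2" "\<bar>\<psi> x\<bar> \<le> 2" for x
    using assms(4,5)[of x] close[of x] by linarith+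
  have int: "(\<integral>x. \<psi> x \<partial>\<rho>) = (\<Sum>k\<in>{1..n}. measure \<rho> (A k)) / real n" if "borel_law \<rho>" for \<rho>
  proof -
    have "integrable \<rho> (indicator (A k) :: _ \<Rightarrow> real)" for k
      by (rule borel_law_integrable[OF that, of _ 1]) (use A in auto)
    then show ?thesis unfolding \<psi>_def by (simp add: measure_eq_integral_indicator[OF that A] integral_sum)
  qed
  have "\<bar>(\<integral>x. \<psi> x \<partial>\<mu>) - (\<integral>x. \<psi> x \<partial>\<nu>)\<bar> = \<bar>\<Sum>k\<in>{1..n}. measure \<mu> (A k) - measure \<nu> (A k)\<bar> / real n"
    by (simp add: int[OF \<mu>] int[OF \<nu>] sum_subtractf flip: diff_divide_distrib)
  also have "\<dots> \<le> (\<Sum>k\<in>{1..n}. tv_dist \<mu> \<nu>) / real n"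
    by (intro divide_right_mono order_trans[OF sum_abs] sum_mono tv_dist_ge \<mu> \<nu> A) auto
  also have "\<dots> = tv_dist \<mu> \<nu>" using n0 by simp
  finally have "\<bar>(\<integral>x. \<psi> x \<partial>\<mu>) - (\<integral>x. \<psi> x \<partial>\<nu>)\<bar> \<le> tv_dist \<mu> \<nu>" .
  moreover have "\<bar>(\<integral>x. \<phi> x \<partial>\<mu>) - (\<integral>x. \<psi> x \<partial>\<mu>)\<bar> \<le> 1 / real n"
    by (rule borel_law_integral_diff_le[OF \<mu> \<phi> \<psi>m b close])
  moreover have "\<bar>(\<integral>x. \<phi> x \<partial>\<nu>) - (\<integral>x. \<psi> x \<partial>\<nu>)\<bar> \<le> 1 / real n"
    by (rule borel_law_integral_diff_le[OF \<nu> \<phi> \<psi>m b close])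
  moreover have "2 / real n \<le> e" using n n0 \<open>e > 0\<close> by (simp add: field_simps)
  ultimately show "\<bar>(\<integral>x. \<phi> x \<partial>\<mu>) - (\<integral>x. \<phi> x \<partial>\<nu>)\<bar> \<le> tv_dist \<mu> \<nu> + e" by linarith
qed

lemma measure_bind_kernel:
  assumes "borel_law \<mu>" "markov_kernel K" "A \<in> sets borel"
  shows "measure (bind \<mu> K) A = (\<integral>z. kernel_apply K (indicator A) z \<partial>\<mu>)"
  using integral_bind_kernel[OF assms(1,2), of "indicator A" 1] assms
  by (simp add: measure_eq_integral_indicator[OF borel_law_bind[OF assms(1,2)]])

lemma tv_dist_bind_le:
  assumes "borel_law \<mu>" "borel_law \<nu>" "markov_kernel K"
  shows "tv_dist (bind \<mu> K) (bind \<nu> K) \<le> tv_dist \<mu> \<nu>"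
proof (rule tv_dist_le)
  fix A :: "'b set" assume A: "A \<in> sets borel"
  show "\<bar>measure (bind \<mu> K) A - measure (bind \<nu> K) A\<bar> \<le> tv_dist \<mu> \<nu>"
    unfolding measure_bind_kernel[OF assms(1,3) A] measure_bind_kernel[OF assms(2,3) A]
  proof (rule integral_diff_le_tv_dist)
    show "0 \<le> kernel_apply K (indicator A) x" "kernel_apply K (indicator A) x \<le> 1" for x
      by (rule kernel_apply_bounds[OF assms(3), where a=0 and b=1]; use A in \<open>auto simp: indicator_def\<close>)+
    show "kernel_apply K (indicator A) \<in> borel_measurable borel"
      using A assms(3) by measurable
  qed (use assms in auto)
qed (use assms borel_law_bind in blast)

definition iterate_kernel :: "('z \<Rightarrow> 'z measure) \<Rightarrow> 'z measure \<Rightarrow> nat \<Rightarrow> 'z measure" where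
  "iterate_kernel Q \<mu> n = ((\<lambda>\<mu>. bind \<mu> Q) ^^ n) \<mu>"

lemma iterate_kernel_0 [simp]: "iterate_kernel Q \<mu> 0 = \<mu>"
  and iterate_kernel_Suc [simp]: "iterate_kernel Q \<mu> (Suc n) = bind (iterate_kernel Q \<mu> n) Q"
  by (simp_all add: iterate_kernel_def)

lemma law_at_eq: "law_at Q z n = iterate_kernel Q (return borel z) n"
  by (simp add: law_at_def iterate_kernel_def)

lemma borel_law_iterate:
  assumes "borel_law \<mu>" "markov_kernel Q"
  shows "borel_law (iterate_kernel Q \<mu> n)"
  by (induction n) (use assms borel_law_bind in auto)

lemma iterate_invariant: "bind \<mu> Q = \<mu> \<Longrightarrow> iterate_kernel Q \<mu> n = \<mu>"
  by (induction n) auto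

text \<open>The step \<open>L \<rhd> K\<close> read from the moment between \<open>L\<close> and \<open>K\<close> is the step \<open>K \<rhd> L\<close>. This and the next lemma
  pass between a splitting and a chain that is easier to analyse.\<close>

lemma iterate_swap:
  assumes "borel_law \<mu>" "markov_kernel L" "markov_kernel K"
  shows "bind (iterate_kernel (L \<rhd> K) \<mu> n) L = iterate_kernel (K \<rhd> L) (bind \<mu> L) n"
proof (induction n)
  case (Suc n)
  let ?\<mu> = "iterate_kernel (L \<rhd> K) \<mu> n"
  have l: "borel_law ?\<mu>" using assms by (intro borel_law_iterate) measurable
  show ?case
    using assms l by (simp add: bind_kernel_then borel_law_bind flip: Suc.IH)
qed simp

lemma iterate_swap_Suc:
  assumes "borel_law \<mu>" "markov_kernel L" "markov_kernel K"
  shows "iterate_kernel (L \<rhd> K) \<mu> (Suc n) = bind (iterate_kernel (K \<rhd> L) (bind \<mu> L) n) K"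
proof -
  have "borel_law (iterate_kernel (L \<rhd> K) \<mu> n)" using assms by (intro borel_law_iterate) measurable
  then show ?thesis using assms by (simp add: bind_kernel_then flip: iterate_swap[OF assms])
qed

lemma integral_iterate_Suc:
  assumes "borel_law \<mu>" "markov_kernel Q" "\<phi> \<in> borel_measurable borel" "\<And>x. \<bar>\<phi> x\<bar> \<le> B"
  shows "(\<integral>w. \<phi> w \<partial>iterate_kernel Q \<mu> (Suc n)) = (\<integral>w. kernel_apply Q \<phi> w \<partial>iterate_kernel Q \<mu> n)"
  using integral_bind_kernel[OF borel_law_iterate[OF assms(1,2)] assms(2,3,4), of n] by simp

lemma kernel_apply_pow:
  fixes Q :: "'z::topological_space \<Rightarrow> 'z measure"
  assumes "markov_kernel Q" "\<phi> \<in> borel_measurable borel" "\<And>x. 0 \<le> \<phi> x" "\<And>x. \<phi> x \<le> 1"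
  shows "(kernel_apply Q ^^ n) \<phi> \<in> borel_measurable borel"
    and "0 \<le> (kernel_apply Q ^^ n) \<phi> x" and "(kernel_apply Q ^^ n) \<phi> x \<le> 1"
proof -
  have "(kernel_apply Q ^^ n) \<phi> \<in> borel_measurable borel
     \<and> (\<forall>x. 0 \<le> (kernel_apply Q ^^ n) \<phi> x \<and> (kernel_apply Q ^^ n) \<phi> x \<le> 1)"
  proof (induction n)
    case (Suc n)
    then show ?case
      using kernel_apply_bounds[OF assms(1), of "(kernel_apply Q ^^ n) \<phi>" 0 1]
        kernel_apply_measurable[OF assms(1), of "(kernel_apply Q ^^ n) \<phi>"] by auto
  qed (use assms in auto)
  then show "(kernel_apply Q ^^ n) \<phi> \<in> borel_measurable borel"
    and "0 \<le> (kernel_apply Q ^^ n) \<phi> x" and "(kernel_apply Q ^^ n) \<phi> x \<le> 1" by auto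
qed

lemma integral_iterate:
  fixes Q :: "'z::topological_space \<Rightarrow> 'z measure"
  assumes "borel_law \<mu>" "markov_kernel Q" "\<phi> \<in> borel_measurable borel"
    "\<And>x. 0 \<le> \<phi> x" "\<And>x. \<phi> x \<le> 1"
  shows "(\<integral>w. \<phi> w \<partial>iterate_kernel Q \<mu> (m + n)) = (\<integral>w. (kernel_apply Q ^^ n) \<phi> w \<partial>iterate_kernel Q \<mu> m)"
proof (induction n arbitrary: m)
  case (Suc n)
  have "(\<integral>w. \<phi> w \<partial>iterate_kernel Q \<mu> (m + Suc n)) = (\<integral>w. \<phi> w \<partial>iterate_kernel Q \<mu> (Suc m + n))" by simp
  also have "\<dots> = (\<integral>w. (kernel_apply Q ^^ n) \<phi> w \<partial>iterate_kernel Q \<mu> (Suc m))" by (rule Suc.IH)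
  also have "\<dots> = (\<integral>w. kernel_apply Q ((kernel_apply Q ^^ n) \<phi>) w \<partial>iterate_kernel Q \<mu> m)"
    by (rule integral_iterate_Suc[OF assms(1,2), of _ 1]) (use kernel_apply_pow[OF assms(2-5), of n] in auto)
  finally show ?case by simp
qed simp

section \<open>Existence and uniqueness of an invariant law\<close>

lemma integral_le_of_nn_integral:
  fixes V :: "'z \<Rightarrow> real"
  assumes "V \<in> borel_measurable M" "\<And>x. 0 \<le> V x" "(\<integral>\<^sup>+x. ennreal (V x) \<partial>M) \<le> ennreal D" "0 \<le> D"
  shows "integrable M V" and "(\<integral>x. V x \<partial>M) \<le> D"
proof -
  show i: "integrable M V" by (rule integrableI_bounded) (use assms in \<open>auto simp: le_less_trans\<close>)
  show "(\<integral>x. V x \<partial>M) \<le> D" using assms by (simp add: nn_integral_eq_integral[OF i])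
qed

text \<open>Removing the common part \<open>\<eta>\<close> leaves mass \<open>1 - a\<close>, on which \<open>f\<close> is controlled through \<open>V\<close> and its
  average \<open>D\<close>. The factor \<open>1 - a\<close> is where a common part of two laws is turned into contraction.\<close>

lemma minorised_average_bound:
  fixes P :: "'z::topological_space \<Rightarrow> 'z measure" and V :: "'z \<Rightarrow> real"
  assumes P: "borel_law (P z)" and V [measurable]: "V \<in> borel_measurable borel" and V0: "\<And>x. 0 \<le> V x"
    and drift: "(\<integral>\<^sup>+w. ennreal (V w) \<partial>P z) \<le> ennreal D" and D: "0 \<le> D"
    and \<eta>: "sets \<eta> = sets borel" "emeasure \<eta> UNIV = ennreal a" "0 \<le> a"
    and minor: "\<And>A. A \<in> sets borel \<Longrightarrow> emeasure \<eta> A \<le> emeasure (P z) A"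
    and f [measurable]: "f \<in> borel_measurable borel" and fB: "\<And>x. \<bar>f x\<bar> \<le> B"
    and fV: "\<And>x. \<bar>f x\<bar> \<le> c * (1 + b * V x)" and c: "0 \<le> c" and b: "0 \<le> b"
  shows "\<bar>(\<integral>x. f x \<partial>P z) - (\<integral>x. f x \<partial>\<eta>)\<bar> \<le> c * (1 - a + b * D)"
proof -
  interpret P: prob_space "P z" using P by (rule borel_lawD)
  have sP [measurable_cong]: "sets (P z) = sets borel" using P by (rule borel_lawD)
  note \<eta>(1) [measurable_cong]
  have sp: "space \<eta> = UNIV" using sets_eq_imp_space_eq[OF \<eta>(1)] by simp
  interpret \<eta>: finite_measure \<eta> by (rule finite_measureI) (simp add: sp \<eta>)
  have le: "\<eta> \<le> P z" using minor \<eta>(1) sP by (subst le_measure) auto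
  have nnle: "(\<integral>\<^sup>+x. g x \<partial>\<eta>) \<le> (\<integral>\<^sup>+x. g x \<partial>P z)" for g
    by (rule nn_integral_mono_measure) (use le \<eta>(1) sP in auto)
  have iV: "integrable (P z) V" and VD: "(\<integral>x. V x \<partial>P z) \<le> D"
    by (rule integral_le_of_nn_integral[OF _ V0 drift D]; measurable)+
  have iV\<eta>: "integrable \<eta> V"
    by (rule integrableI_bounded) (use drift nnle[of "\<lambda>w. ennreal (V w)"] V0 in \<open>auto simp: le_less_trans\<close>)
  have ifP: "integrable (P z) f" by (rule P.integrable_const_bound[of _ B]) (use fB in auto)
  have if\<eta>: "integrable \<eta> f" by (rule \<eta>.integrable_const_bound[of _ B]) (use fB in auto)
  have V\<eta>: "0 \<le> (\<integral>x. V x \<partial>\<eta>)" using V0 by simp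
  have m\<eta>: "measure \<eta> UNIV = a" using \<eta> by (simp add: measure_def)
  have key: "(\<integral>x. c * (1 + b * V x) + t * f x \<partial>\<eta>) \<le> (\<integral>x. c * (1 + b * V x) + t * f x \<partial>P z)"
    if "\<bar>t\<bar> = 1" for t
  proof -
    have nn: "0 \<le> c * (1 + b * V x) + t * f x" for x
      using fV[of x] that by (auto simp: abs_if split: if_splits)
    have i1: "integrable \<eta> (\<lambda>x. c * (1 + b * V x) + t * f x)"
      and i2: "integrable (P z) (\<lambda>x. c * (1 + b * V x) + t * f x)"
      using iV iV\<eta> ifP if\<eta> by auto
    have "ennreal (\<integral>x. c * (1 + b * V x) + t * f x \<partial>\<eta>) \<le> ennreal (\<integral>x. c * (1 + b * V x) + t * f x \<partial>P z)"
      using nnle[of "\<lambda>x. ennreal (c * (1 + b * V x) + t * f x)"]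
      by (simp add: nn_integral_eq_integral[OF i1] nn_integral_eq_integral[OF i2] nn)
    then show ?thesis using nn by (simp add: ennreal_le_iff)
  qed
  have e1: "(\<integral>x. c * (1 + b * V x) + t * f x \<partial>\<eta>) = c * (a + b * (\<integral>x. V x \<partial>\<eta>)) + t * (\<integral>x. f x \<partial>\<eta>)" for t
    using iV\<eta> if\<eta> by (simp add: m\<eta> sp algebra_simps)
  have e2: "(\<integral>x. c * (1 + b * V x) + t * f x \<partial>P z) = c * (1 + b * (\<integral>x. V x \<partial>P z)) + t * (\<integral>x. f x \<partial>P z)" for t
    using iV ifP borel_lawD(3)[OF P] P.prob_space by (simp add: algebra_simps)
  have "c * (1 + b * (\<integral>x. V x \<partial>P z)) - c * (a + b * (\<integral>x. V x \<partial>\<eta>)) \<le> c * (1 + b * D) - c * a"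
  proof -
    have "c * (1 + b * (\<integral>x. V x \<partial>P z)) \<le> c * (1 + b * D)"
      using VD b c by (intro mult_left_mono add_left_mono) auto
    moreover have "c * a \<le> c * (a + b * (\<integral>x. V x \<partial>\<eta>))"
      using V\<eta> b c by (intro mult_left_mono) auto
    ultimately show ?thesis by linarith
  qed
  moreover have "c * (1 - a + b * D) = c * (1 + b * D) - c * a" by (simp add: algebra_simps)
  ultimately show ?thesis using key[of 1] key[of "-1"] unfolding e1 e2 by (simp add: abs_le_iff)
qed

text \<open>An oscillation bound by \<open>c (2 + b V(x) + b V(y))\<close> is a bound \<open>c (1 + b V)\<close> on \<open>\<phi>\<close> itself
  once a suitable constant is subtracted.\<close>

lemma weighted_oscillation_recentre:
  fixes \<phi> :: "'z \<Rightarrow> real" and W :: "'z \<Rightarrow> real"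
  assumes "\<And>x y. \<bar>\<phi> x - \<phi> y\<bar> \<le> W x + W y"
  obtains k where "\<And>x. \<bar>\<phi> x - k\<bar> \<le> W x"
proof
  define k where "k = (SUP x. \<phi> x - W x)"
  fix x
  have le: "\<phi> y - W y \<le> \<phi> x + W x" for x y using assms[of y x] by (simp add: abs_le_iff)
  have bdd: "bdd_above (range (\<lambda>x. \<phi> x - W x))" by (rule bdd_aboveI2) (rule le)
  have "\<phi> x - W x \<le> k" unfolding k_def by (rule cSUP_upper[OF _ bdd]) simp
  moreover have "k \<le> \<phi> x + W x" unfolding k_def by (rule cSUP_least) (use le in auto)
  ultimately show "\<bar>\<phi> x - k\<bar> \<le> W x" by (simp add: abs_le_iff)
qed

text \<open>A moment bound that is at least the fixed point \<open>K / (1 - g)\<close> of \<open>M \<mapsto> g M + K\<close> is inherited by the next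
  law.\<close>

lemma drift_iterate_law:
  fixes V :: "'z::topological_space \<Rightarrow> real"
  assumes P: "markov_kernel P" and V [measurable]: "V \<in> borel_measurable borel"
    and V0: "\<And>x. 0 \<le> V x" and g: "0 \<le> g" "g < 1" and K: "0 \<le> K"
    and drift: "\<And>z. (\<integral>\<^sup>+w. ennreal (V w) \<partial>P z) \<le> ennreal (g * V z + K)"
    and \<mu>: "borel_law \<mu>" "(\<integral>\<^sup>+w. ennreal (V w) \<partial>\<mu>) \<le> ennreal M" and M: "K / (1 - g) \<le> M"
  shows "(\<integral>\<^sup>+w. ennreal (V w) \<partial>iterate_kernel P \<mu> n) \<le> ennreal M"
proof (induction n)
  case (Suc n)
  let ?\<mu> = "iterate_kernel P \<mu> n"
  have l: "borel_law ?\<mu>" by (rule borel_law_iterate[OF \<mu>(1) P])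
  interpret prob_space ?\<mu> using l by (rule borel_lawD)
  note borel_lawD(2)[OF l, measurable_cong]
  have "0 \<le> K / (1 - g)" using K g by simp
  then have M0: "0 \<le> M" using M by (rule order_trans)
  have "(\<integral>\<^sup>+w. ennreal (V w) \<partial>bind ?\<mu> P) = (\<integral>\<^sup>+z. (\<integral>\<^sup>+w. ennreal (V w) \<partial>P z) \<partial>?\<mu>)"
    by (rule nn_integral_bind_kernel[OF l P]) measurable
  also have "\<dots> \<le> (\<integral>\<^sup>+z. ennreal g * ennreal (V z) + ennreal K \<partial>?\<mu>)"
    using drift g K V0 by (intro nn_integral_mono) (auto simp: ennreal_mult' ennreal_plus)
  also have "\<dots> = ennreal g * (\<integral>\<^sup>+z. ennreal (V z) \<partial>?\<mu>) + ennreal K"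
    by (simp add: nn_integral_add nn_integral_cmult emeasure_space_1)
  also have "\<dots> \<le> ennreal g * ennreal M + ennreal K"
    using Suc.IH by (intro add_right_mono mult_left_mono) auto
  also have "\<dots> = ennreal (g * M + K)" using g K M0 by (simp add: ennreal_mult' ennreal_plus)
  also have "g * M + K \<le> M" using M g by (simp add: pos_divide_le_eq algebra_simps)
  finally show ?case by (simp add: ennreal_leI)
qed (use \<mu> in simp)

text \<open>The hypotheses of Harris' ergodic theorem: a drift towards the small values of \<open>V\<close>, and a part \<open>\<eta>\<close>
  common to the transition laws from all states below a level that is high enough for the drift to act
  strictly above it.\<close>

locale harris_kernel =
  fixes P :: "'z::topological_space \<Rightarrow> 'z measure" and V :: "'z \<Rightarrow> real" and g K a :: real and \<eta> :: "'z measure"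
  assumes P [measurable]: "markov_kernel P" and V [measurable]: "V \<in> borel_measurable borel"
    and V0: "\<And>x. 0 \<le> V x" and g: "0 \<le> g" "g < 1" and K: "0 < K"
    and drift: "\<And>z. (\<integral>\<^sup>+w. ennreal (V w) \<partial>P z) \<le> ennreal (g * V z + K)"
    and \<eta>: "sets \<eta> = sets borel" "emeasure \<eta> UNIV = ennreal a" "0 < a"
    and minor: "\<And>z A. V z \<le> 4 * K / (1 - g) \<Longrightarrow> A \<in> sets borel \<Longrightarrow> emeasure \<eta> A \<le> emeasure (P z) A"
begin

definition weight :: real where "weight = a / (2 * K)"

definition level :: real where "level = 4 * K / (1 - g)"

text \<open>The contraction factor: the first term arises when \<open>V(z) + V(w)\<close> is above \<open>level\<close>, the second from
  the common part, and the third from the drift below \<open>level\<close>.\<close>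

definition rate :: real where
  "rate = max ((2 + weight * ((1 + g) / 2) * level) / (2 + weight * level)) (max (1 - a / 2) g)"

lemma weight_pos: "0 < weight" and level_pos: "0 < level"
  using K g \<eta> by (auto simp: weight_def level_def)

lemma rate: "0 \<le> rate" "rate < 1"
proof -
  show "0 \<le> rate" using g by (simp add: rate_def)
  have "weight * ((1 + g) / 2) * level < weight * level"
    using weight_pos level_pos g by simp
  then show "rate < 1"
    using weight_pos level_pos g \<eta> by (simp add: rate_def add_pos_pos)
qed

text \<open>When \<open>V(z) + V(w)\<close> is large the drift contracts the weighted oscillation; when it is small,
  the part \<open>\<eta>\<close> common to \<open>P z\<close> and \<open>P w\<close> cancels, and the weight is chosen so small that the
  additive constant of the drift does not spoil the gain.\<close>

lemma contraction:
  assumes \<phi> [measurable]: "\<phi> \<in> borel_measurable borel" and \<phi>01: "\<And>x. 0 \<le> \<phi> x" "\<And>x. \<phi> x \<le> 1"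
    and osc: "\<And>x y. \<bar>\<phi> x - \<phi> y\<bar> \<le> c * (2 + weight * V x + weight * V y)" and c: "0 \<le> c"
  shows "\<bar>kernel_apply P \<phi> z - kernel_apply P \<phi> w\<bar> \<le> rate * c * (2 + weight * V z + weight * V w)"
proof -
  have osc': "\<bar>\<phi> x - \<phi> y\<bar> \<le> c * (1 + weight * V x) + c * (1 + weight * V y)" for x y
    using osc[of x y] by (simp add: algebra_simps)
  obtain k where k: "\<And>x. \<bar>\<phi> x - k\<bar> \<le> c * (1 + weight * V x)"
    using weighted_oscillation_recentre[of \<phi> "\<lambda>x. c * (1 + weight * V x)"] osc' by blast
  have kb: "\<bar>\<phi> x - k\<bar> \<le> 1 + \<bar>k\<bar>" for x using \<phi>01[of x] by linarith
  have shift: "kernel_apply P \<phi> y = (\<integral>x. \<phi> x - k \<partial>P y) + k" for y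
  proof -
    have l: "borel_law (P y)" using P by (rule markov_kernel_law)
    interpret prob_space "P y" using l by (rule borel_lawD)
    have "integrable (P y) \<phi>" by (rule borel_law_integrable[OF l, of _ 1]) (use \<phi>01 in \<open>auto simp: abs_le_iff intro: order_trans\<close>)
    then show ?thesis using borel_lawD(3)[OF l] prob_space by (simp add: kernel_apply_def)
  qed
  have D: "0 \<le> g * V y + K" for y using g K V0[of y] by simp
  let ?s = "V z + V w"
  have s0: "0 \<le> ?s" using V0[of z] V0[of w] by simp
  have bnd: "\<bar>kernel_apply P \<phi> z - kernel_apply P \<phi> w\<bar>
      \<le> c * (1 - a' + weight * (g * V z + K)) + c * (1 - a' + weight * (g * V w + K))"
    if "sets \<eta>' = sets borel" "emeasure \<eta>' UNIV = ennreal a'" "0 \<le> a'"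
      "\<And>A y. A \<in> sets borel \<Longrightarrow> y \<in> {z, w} \<Longrightarrow> emeasure \<eta>' A \<le> emeasure (P y) A" for \<eta>' a'
  proof -
    have "\<bar>(\<integral>x. \<phi> x - k \<partial>P y) - (\<integral>x. \<phi> x - k \<partial>\<eta>')\<bar> \<le> c * (1 - a' + weight * (g * V y + K))"
      if "y \<in> {z, w}" for y
      by (rule minorised_average_bound[OF markov_kernel_law[OF P] V V0 drift D _ _ _ _ _ kb k c])
        (use \<open>y \<in> {z, w}\<close> \<open>sets \<eta>' = sets borel\<close> \<open>emeasure \<eta>' UNIV = ennreal a'\<close> \<open>0 \<le> a'\<close>
          \<open>\<And>A y. A \<in> sets borel \<Longrightarrow> y \<in> {z, w} \<Longrightarrow> emeasure \<eta>' A \<le> emeasure (P y) A\<close> weight_pos in auto)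
    from this[of z] this[of w] show ?thesis unfolding shift by (simp add: abs_le_iff)
  qed
  show ?thesis
  proof (cases "level \<le> ?s")
    case True
    have "\<bar>kernel_apply P \<phi> z - kernel_apply P \<phi> w\<bar> \<le> c * (2 + weight * (g * ?s + 2 * K))"
      using bnd[of "null_measure borel" 0] by (simp add: algebra_simps)
    also have "\<dots> \<le> c * (rate * (2 + weight * ?s))"
    proof (intro mult_left_mono c)
      have "2 * K = (1 - g) / 2 * level" using g by (simp add: level_def field_simps)
      also have "\<dots> \<le> (1 - g) / 2 * ?s" using True g by (intro mult_left_mono) auto
      finally have "g * ?s + 2 * K \<le> (1 + g) / 2 * ?s" by (simp add: field_simps)
      then have "2 + weight * (g * ?s + 2 * K) \<le> 2 + weight * ((1 + g) / 2 * ?s)"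
        using weight_pos by (intro add_left_mono mult_left_mono) auto
      also have "\<dots> \<le> (2 + weight * ((1 + g) / 2) * level) / (2 + weight * level) * (2 + weight * ?s)"
      proof -
        have "0 \<le> weight * (1 - g) * (?s - level)" using weight_pos g True by simp
        then have "(2 + weight * ((1 + g) / 2 * ?s)) * (2 + weight * level)
            \<le> (2 + weight * ((1 + g) / 2) * level) * (2 + weight * ?s)"
          by (simp add: field_simps)
        then show ?thesis using weight_pos level_pos by (simp add: pos_le_divide_eq add_pos_pos)
      qed
      also have "\<dots> \<le> rate * (2 + weight * ?s)"
        using weight_pos s0 by (intro mult_right_mono) (auto simp: rate_def)
      finally show "2 + weight * (g * ?s + 2 * K) \<le> rate * (2 + weight * ?s)" .
    qed
    finally show ?thesis by (simp add: algebra_simps)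
  next
    case False
    then have "V z \<le> level" "V w \<le> level" using V0[of z] V0[of w] by auto
    then have "\<bar>kernel_apply P \<phi> z - kernel_apply P \<phi> w\<bar> \<le> c * (2 - 2 * a + weight * (g * ?s + 2 * K))"
      using bnd[of \<eta> a] \<eta> minor unfolding level_def by (force simp: algebra_simps)
    also have "\<dots> \<le> c * (rate * (2 + weight * ?s))"
    proof (intro mult_left_mono c)
      have "2 - 2 * a + weight * (g * ?s + 2 * K) = (1 - a / 2) * 2 + g * (weight * ?s)"
        using K by (simp add: weight_def field_simps)
      also have "\<dots> \<le> rate * 2 + rate * (weight * ?s)"
        using weight_pos s0 by (intro add_mono mult_right_mono) (auto simp: rate_def)
      finally show "2 - 2 * a + weight * (g * ?s + 2 * K) \<le> rate * (2 + weight * ?s)"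
        by (simp add: algebra_simps)
    qed
    finally show ?thesis by (simp add: algebra_simps)
  qed
qed

lemma contraction_iterate:
  assumes \<phi>: "\<phi> \<in> borel_measurable borel" and \<phi>01: "\<And>x. 0 \<le> \<phi> x" "\<And>x. \<phi> x \<le> 1"
  shows "\<bar>(kernel_apply P ^^ n) \<phi> z - (kernel_apply P ^^ n) \<phi> w\<bar>
           \<le> rate ^ n * (2 + weight * V z + weight * V w)"
proof (induction n arbitrary: z w)
  case 0
  have "\<bar>\<phi> z - \<phi> w\<bar> \<le> 1" using \<phi>01[of z] \<phi>01[of w] by linarith
  also have "1 \<le> 2 + weight * V z + weight * V w"
    using mult_nonneg_nonneg[of weight "V z"] mult_nonneg_nonneg[of weight "V w"] weight_pos V0 by force
  finally show ?case by simp
next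
  case (Suc n)
  have "\<bar>kernel_apply P ((kernel_apply P ^^ n) \<phi>) z - kernel_apply P ((kernel_apply P ^^ n) \<phi>) w\<bar>
      \<le> rate * rate ^ n * (2 + weight * V z + weight * V w)"
    by (rule contraction) (use kernel_apply_pow[OF P \<phi> \<phi>01] Suc.IH rate(1) in auto)
  then show ?case by simp
qed

lemma drift_iterate:
  "(\<integral>\<^sup>+w. ennreal (V w) \<partial>iterate_kernel P (return borel x) n) \<le> ennreal (V x + K / (1 - g))"
proof (rule drift_iterate_law[OF P V V0 g less_imp_le[OF K] drift borel_law_return])
  show "(\<integral>\<^sup>+w. ennreal (V w) \<partial>return borel x) \<le> ennreal (V x + K / (1 - g))"
    using K g V0 by (subst nn_integral_return) (auto intro!: ennreal_leI)
qed (use V0 in simp)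

text \<open>The contraction makes the laws of the chain a Cauchy sequence uniformly over Borel sets; the
  uniformity is what turns the setwise limit into a measure.\<close>

lemma law_cauchy:
  fixes x0 :: 'z
  defines "\<mu> \<equiv> iterate_kernel P (return borel x0)"
  assumes A: "A \<in> sets borel"
  shows "\<bar>measure (\<mu> (n + k)) A - measure (\<mu> n) A\<bar>
    \<le> rate ^ n * (2 + 2 * weight * (V x0 + K / (1 - g)))"
proof -
  let ?M = "V x0 + K / (1 - g)"
  have M: "V x0 \<le> ?M" "0 \<le> ?M" using K g V0[of x0] by auto
  define \<phi> where "\<phi> = (kernel_apply P ^^ n) (indicator A)"
  have ind: "(indicator A :: 'z \<Rightarrow> real) \<in> borel_measurable borel" "0 \<le> (indicator A x :: real)"
    "(indicator A x :: real) \<le> 1" for x using A by (auto simp: indicator_def)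
  note p = kernel_apply_pow[OF P ind, of n, folded \<phi>_def]
  note \<phi>m [measurable] = p(1)
  have l: "borel_law (\<mu> m)" for m unfolding \<mu>_def by (rule borel_law_iterate[OF borel_law_return P])
  interpret prob_space "\<mu> k" using l by (rule borel_lawD)
  note borel_lawD(2)[OF l, measurable_cong]
  have "measure (\<mu> (n + k)) A = (\<integral>x. indicator A x \<partial>\<mu> (k + n))"
    by (simp add: measure_eq_integral_indicator[OF l A] add.commute)
  also have "\<dots> = (\<integral>x. \<phi> x \<partial>\<mu> k)"
    unfolding \<mu>_def \<phi>_def by (rule integral_iterate[OF borel_law_return P ind])
  finally have 1: "measure (\<mu> (n + k)) A = (\<integral>x. \<phi> x \<partial>\<mu> k)" .
  have "measure (\<mu> n) A = (\<integral>x. indicator A x \<partial>iterate_kernel P (return borel x0) (0 + n))"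
    by (simp add: measure_eq_integral_indicator[OF l A] \<mu>_def[symmetric])
  also have "\<dots> = (\<integral>x. \<phi> x \<partial>return borel x0)"
    by (subst integral_iterate[OF borel_law_return P ind]) (simp add: \<phi>_def)
  also have "\<dots> = \<phi> x0" by (rule integral_return) auto
  finally have 2: "measure (\<mu> n) A = \<phi> x0" .
  have nV: "(\<integral>\<^sup>+w. ennreal (V w) \<partial>\<mu> k) \<le> ennreal ?M" unfolding \<mu>_def by (rule drift_iterate)
  have iV: "integrable (\<mu> k) V" and V\<mu>: "(\<integral>x. V x \<partial>\<mu> k) \<le> ?M"
    by (rule integral_le_of_nn_integral[OF _ V0 nV M(2)]; measurable)+
  have i\<phi>: "integrable (\<mu> k) \<phi>" by (rule borel_law_integrable[OF l \<phi>m, of 1]) (use p in \<open>auto simp: abs_le_iff intro: order_trans\<close>)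
  have "(\<integral>x. \<phi> x \<partial>\<mu> k) - \<phi> x0 = (\<integral>x. \<phi> x - \<phi> x0 \<partial>\<mu> k)"
    using i\<phi> prob_space borel_lawD(3)[OF l] by simp
  also have "\<bar>\<dots>\<bar> \<le> (\<integral>x. \<bar>\<phi> x - \<phi> x0\<bar> \<partial>\<mu> k)" by (rule integral_abs_bound)
  also have "\<dots> \<le> (\<integral>x. rate ^ n * (2 + weight * V x + weight * V x0) \<partial>\<mu> k)"
    using i\<phi> iV contraction_iterate[OF ind, of n] by (intro integral_mono) (auto simp: \<phi>_def)
  also have "\<dots> = rate ^ n * (2 + weight * (\<integral>x. V x \<partial>\<mu> k) + weight * V x0)"
    using iV prob_space borel_lawD(3)[OF l] by (simp add: algebra_simps)
  also have "\<dots> \<le> rate ^ n * (2 + weight * ?M + weight * ?M)"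
    using V\<mu> M rate(1) weight_pos by (intro mult_left_mono add_mono) auto
  finally show ?thesis unfolding 1 2 by (simp add: algebra_simps)
qed

theorem invariant_law_exists:
  obtains \<pi> where "borel_law \<pi>" "bind \<pi> P = \<pi>"
    "\<And>\<pi>'. borel_law \<pi>' \<Longrightarrow> bind \<pi>' P = \<pi>' \<Longrightarrow> \<pi>' = \<pi>"
    "(\<integral>\<^sup>+w. ennreal (V w) \<partial>\<pi>) \<le> ennreal (V x0 + K / (1 - g))"
proof -
  define \<mu> where "\<mu> = iterate_kernel P (return borel x0)"
  define D where "D = 2 + 2 * weight * (V x0 + K / (1 - g))"
  have l: "borel_law (\<mu> n)" for n unfolding \<mu>_def by (rule borel_law_iterate[OF borel_law_return P])
  have ps: "prob_space (\<mu> n)" for n using l by (rule borel_lawD)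
  have r0: "(\<lambda>n. rate ^ n * E) \<longlonglongrightarrow> 0" for E
    by (rule tendsto_mult_left_zero[OF LIMSEQ_realpow_zero[OF rate]])
  have cau: "\<bar>measure (\<mu> (n + k)) A - measure (\<mu> n) A\<bar> \<le> rate ^ n * D" if "A \<in> sets borel" for n k A
    using law_cauchy[OF that, of x0 n k] by (simp add: \<mu>_def D_def)
  define p where "p A = lim (\<lambda>n. measure (\<mu> n) A)" for A
  have lim: "(\<lambda>n. measure (\<mu> n) A) \<longlonglongrightarrow> p A" if A: "A \<in> sets borel" for A
  proof -
    have "Cauchy (\<lambda>n. measure (\<mu> n) A)"
    proof (rule metric_CauchyI)
      fix e :: real assume "e > 0"
      then obtain N where N: "rate ^ N * D < e / 2"
        using order_tendstoD(2)[OF r0, of "e / 2"] by (auto simp: eventually_sequentially)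
      have "dist (measure (\<mu> m) A) (measure (\<mu> n) A) < e" if "m \<ge> N" "n \<ge> N" for m n
        using cau[OF A, of N "m - N"] cau[OF A, of N "n - N"] that N by (simp add: dist_real_def)
      then show "\<exists>N. \<forall>m\<ge>N. \<forall>n\<ge>N. dist (measure (\<mu> m) A) (measure (\<mu> n) A) < e" by blast
    qed
    then show ?thesis unfolding p_def by (simp add: Cauchy_convergent convergent_LIMSEQ_iff[symmetric])
  qed
  have close: "\<bar>p A - measure (\<mu> n) A\<bar> \<le> rate ^ n * D" if A: "A \<in> sets borel" for A n
  proof (rule LIMSEQ_le_const2)
    show "(\<lambda>k. \<bar>measure (\<mu> (k + n)) A - measure (\<mu> n) A\<bar>) \<longlonglongrightarrow> \<bar>p A - measure (\<mu> n) A\<bar>"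
      using LIMSEQ_ignore_initial_segment[OF lim[OF A], of n] by (intro tendsto_intros)
  qed (use cau[OF A, of n] in \<open>auto simp: add.commute\<close>)
  have p0: "0 \<le> p A" if "A \<in> sets borel" for A by (rule LIMSEQ_le_const[OF lim[OF that]]) auto
  have pU: "p UNIV = 1"
  proof -
    have "measure (\<mu> n) UNIV = 1" for n using prob_space.prob_space[OF ps] borel_lawD(3)[OF l] by simp
    then show ?thesis using lim[of UNIV] by (simp add: LIMSEQ_unique)
  qed
  have padd: "p (A \<union> B) = p A + p B" if "A \<in> sets borel" "B \<in> sets borel" "A \<inter> B = {}" for A B
  proof (rule LIMSEQ_unique[OF lim])
    have "measure (\<mu> n) (A \<union> B) = measure (\<mu> n) A + measure (\<mu> n) B" for n
      by (rule finite_measure.finite_measure_Union) (use ps that borel_lawD(2)[OF l] in \<open>auto simp: prob_space.finite_measure\<close>)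
    then show "(\<lambda>n. measure (\<mu> n) (A \<union> B)) \<longlonglongrightarrow> p A + p B"
      using that by (auto intro!: tendsto_add lim)
  qed (use that in auto)
  define \<pi> where "\<pi> = measure_of UNIV (sets borel) (\<lambda>A. ennreal (p A))"
  have ca: "countably_additive (sets borel) (\<lambda>A. ennreal (p A))"
  proof (rule sets.empty_continuous_imp_countably_additive)
    have "p {} = 0" using padd[of "{}" "{}"] by simp
    then show "positive (sets borel) (\<lambda>A. ennreal (p A))" by (simp add: positive_def)
    show "additive (sets borel) (\<lambda>A. ennreal (p A))"
      by (auto simp: additive_def padd p0 ennreal_plus)
    show "\<forall>A\<in>sets borel. ennreal (p A) \<noteq> \<infinity>" by simp
    fix A :: "nat \<Rightarrow> 'z set" assume A: "range A \<subseteq> sets borel" "decseq A" "(\<Inter>i. A i) = {}"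
    then have Ai: "A i \<in> sets borel" for i by auto
    have "(\<lambda>i. p (A i)) \<longlonglongrightarrow> 0"
    proof (rule LIMSEQ_I)
      fix e :: real assume "e > 0"
      then obtain n where n: "rate ^ n * D < e / 2"
        using order_tendstoD(2)[OF r0, of "e / 2"] by (auto simp: eventually_sequentially)
      have "(\<lambda>i. measure (\<mu> n) (A i)) \<longlonglongrightarrow> measure (\<mu> n) (\<Inter>i. A i)"
        by (rule finite_measure.finite_Lim_measure_decseq)
          (use ps A borel_lawD(2)[OF l] in \<open>auto simp: prob_space.finite_measure\<close>)
      then have "\<forall>\<^sub>F i in sequentially. measure (\<mu> n) (A i) < e / 2"
        using A(3) \<open>e > 0\<close> by (intro order_tendstoD(2)[of _ 0]) auto
      then obtain N where N: "\<And>i. i \<ge> N \<Longrightarrow> measure (\<mu> n) (A i) < e / 2"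
        by (auto simp: eventually_sequentially)
      have "norm (p (A i) - 0) < e" if "i \<ge> N" for i
        using N[OF that] close[OF Ai, of i n] n p0[OF Ai, of i] by simp
      then show "\<exists>N. \<forall>i\<ge>N. norm (p (A i) - 0) < e" by blast
    qed
    then show "(\<lambda>i. ennreal (p (A i))) \<longlonglongrightarrow> 0" using tendsto_ennrealI[of _ 0] by simp
  qed
  have s\<pi>: "sets \<pi> = sets borel"
    unfolding \<pi>_def using sets.sets_measure_of_eq[of borel] by simp
  have e\<pi>: "emeasure \<pi> A = ennreal (p A)" if "A \<in> sets borel" for A
    unfolding \<pi>_def
  proof (rule emeasure_measure_of_sigma[OF _ _ ca that])
    show "sigma_algebra UNIV (sets borel)" using sets.sigma_algebra_axioms[of borel] by simp
    have "p {} = 0" using padd[of "{}" "{}"] by simp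
    then show "positive (sets borel) (\<lambda>A. ennreal (p A))" by (simp add: positive_def)
  qed
  have "space \<pi> = UNIV" using sets_eq_imp_space_eq[OF s\<pi>] by simp
  then have ps\<pi>: "prob_space \<pi>" by (intro prob_spaceI) (simp add: e\<pi> pU)
  have l\<pi>: "borel_law \<pi>" by (rule borel_lawI[OF ps\<pi> s\<pi>])
  have m\<pi>: "measure \<pi> A = p A" if "A \<in> sets borel" for A using e\<pi>[OF that] p0[OF that] by (simp add: measure_def)
  have tv: "tv_dist \<pi> (\<mu> n) \<le> rate ^ n * D" for n
    by (rule tv_dist_le[OF l\<pi>]) (use close m\<pi> in auto)
  have int_lim: "(\<lambda>n. \<integral>x. \<phi> x \<partial>\<mu> n) \<longlonglongrightarrow> (\<integral>x. \<phi> x \<partial>\<pi>)"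
    if "\<phi> \<in> borel_measurable borel" "\<And>x. 0 \<le> \<phi> x" "\<And>x. \<phi> x \<le> 1" for \<phi> :: "'z \<Rightarrow> real"
  proof -
    have "\<bar>(\<integral>x. \<phi> x \<partial>\<mu> n) - (\<integral>x. \<phi> x \<partial>\<pi>)\<bar> \<le> rate ^ n * D" for n
      using integral_diff_le_tv_dist[OF l\<pi> l that, of n] tv[of n] by (simp add: abs_minus_commute)
    then show ?thesis
      by (intro LIM_zero_cancel[of _ "\<integral>x. \<phi> x \<partial>\<pi>"] Lim_null_comparison[OF _ r0[of D]]) auto
  qed
  have ind: "(indicator A :: 'z \<Rightarrow> real) \<in> borel_measurable borel" "0 \<le> (indicator A x :: real)"
    "(indicator A x :: real) \<le> 1" if "A \<in> sets borel" for x A using that by (auto simp: indicator_def)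
  have inv: "bind \<pi> P = \<pi>"
  proof (rule measure_eqI)
    show "sets (bind \<pi> P) = sets \<pi>" using borel_lawD(2)[OF borel_law_bind[OF l\<pi> P]] s\<pi> by simp
    fix A assume "A \<in> sets (bind \<pi> P)"
    then have A: "A \<in> sets borel" using borel_lawD(2)[OF borel_law_bind[OF l\<pi> P]] by simp
    have "(\<lambda>n. \<integral>x. kernel_apply P (indicator A) x \<partial>\<mu> n) \<longlonglongrightarrow> (\<integral>x. kernel_apply P (indicator A) x \<partial>\<pi>)"
      by (rule int_lim) (use kernel_apply_pow[OF P ind[OF A], of 1] in auto)
    moreover have "(\<integral>x. kernel_apply P (indicator A) x \<partial>\<mu> n) = measure (\<mu> (Suc n)) A" for n
      using measure_bind_kernel[OF l P A, of n] by (simp add: \<mu>_def)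
    ultimately have "(\<integral>x. kernel_apply P (indicator A) x \<partial>\<pi>) = p A"
      using LIMSEQ_Suc[OF lim[OF A]] LIMSEQ_unique by auto
    then have "measure (bind \<pi> P) A = measure \<pi> A" using measure_bind_kernel[OF l\<pi> P A] m\<pi>[OF A] by simp
    then show "emeasure (bind \<pi> P) A = emeasure \<pi> A"
      using borel_lawD(1)[OF borel_law_bind[OF l\<pi> P]] ps\<pi>
      by (simp add: finite_measure.emeasure_eq_measure prob_space.finite_measure)
  qed
  have uniq: "\<pi>' = \<pi>" if l': "borel_law \<pi>'" and inv': "bind \<pi>' P = \<pi>'" for \<pi>'
  proof (rule measure_eqI)
    interpret \<pi>': prob_space \<pi>' using l' by (rule borel_lawD)
    note borel_lawD(2)[OF l', measurable_cong]
    show "sets \<pi>' = sets \<pi>" using borel_lawD(2)[OF l'] s\<pi> by simp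
    fix A assume "A \<in> sets \<pi>'"
    then have A: "A \<in> sets borel" using borel_lawD(2)[OF l'] by simp
    define \<phi> where "\<phi> n = (kernel_apply P ^^ n) (indicator A)" for n
    note pw = kernel_apply_pow[OF P ind[OF A], folded \<phi>_def]
    have x0: "\<phi> n x0 = measure (\<mu> n) A" for n
    proof -
      have "measure (\<mu> n) A = (\<integral>x. indicator A x \<partial>iterate_kernel P (return borel x0) (0 + n))"
        by (simp add: measure_eq_integral_indicator[OF l A] \<mu>_def[symmetric])
      also have "\<dots> = (\<integral>x. \<phi> n x \<partial>return borel x0)"
        by (subst integral_iterate[OF borel_law_return P ind[OF A]]) (simp add: \<phi>_def)
      also have "\<dots> = \<phi> n x0" by (rule integral_return) (use pw in auto)
      finally show ?thesis by simp
    qed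
    have pt: "(\<lambda>n. \<phi> n x) \<longlonglongrightarrow> p A" for x
    proof -
      have "(\<lambda>n. \<phi> n x - \<phi> n x0) \<longlonglongrightarrow> 0"
      proof (rule Lim_null_comparison)
        show "\<forall>\<^sub>F n in sequentially. norm (\<phi> n x - \<phi> n x0) \<le> rate ^ n * (2 + weight * V x + weight * V x0)"
          using contraction_iterate[OF ind[OF A]] by (auto simp: \<phi>_def)
        show "(\<lambda>n. rate ^ n * (2 + weight * V x + weight * V x0)) \<longlonglongrightarrow> 0"
          by (rule r0)
      qed
      then show ?thesis using tendsto_add[OF _ lim[OF A]] by (fastforce simp: x0)
    qed
    have "(\<lambda>n. \<integral>x. \<phi> n x \<partial>\<pi>') \<longlonglongrightarrow> (\<integral>x. p A \<partial>\<pi>')"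
      by (rule integral_dominated_convergence[where w="\<lambda>_. 1"]) (use pw pt in auto)
    moreover have "(\<integral>x. \<phi> n x \<partial>\<pi>') = measure \<pi>' A" for n
      using integral_iterate[OF l' P ind[OF A], of 0 n] iterate_invariant[OF inv', of "0 + n"]
      by (simp add: \<phi>_def measure_eq_integral_indicator[OF l' A])
    ultimately have "(\<lambda>n::nat. measure \<pi>' A) \<longlonglongrightarrow> p A" using \<pi>'.prob_space by simp
    then have "measure \<pi>' A = p A" by (simp add: LIMSEQ_const_iff)
    then show "emeasure \<pi>' A = emeasure \<pi> A" using m\<pi>[OF A] ps\<pi>
      by (simp add: finite_measure.emeasure_eq_measure prob_space.finite_measure \<pi>'.emeasure_eq_measure)
  qed
  have bound: "(\<integral>\<^sup>+w. ennreal (V w) \<partial>\<pi>) \<le> ennreal (V x0 + K / (1 - g))"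
  proof -
    let ?M = "V x0 + K / (1 - g)"
    have M0: "0 \<le> ?M" using V0[of x0] K g by simp
    note s\<pi> [measurable_cong]
    have trunc: "(\<integral>\<^sup>+w. ennreal (min (V w) (real m)) \<partial>\<pi>) \<le> ennreal ?M" for m :: nat
    proof (cases "m = 0")
      case True then show ?thesis using V0 by simp
    next
      case False
      define \<phi> where "\<phi> w = min (V w) (real m) / real m" for w
      have \<phi>: "\<phi> \<in> borel_measurable borel" "0 \<le> \<phi> x" "\<phi> x \<le> 1" for x
        using V0 False unfolding \<phi>_def by (auto simp: divide_le_eq)
      have i: "integrable \<pi> \<phi>" by (rule borel_law_integrable[OF l\<pi> \<phi>(1), of 1]) (use \<phi> in \<open>auto simp: abs_le_iff intro: order_trans\<close>)
      have "(\<integral>x. \<phi> x \<partial>\<pi>) \<le> ?M / real m"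
      proof (rule LIMSEQ_le_const2[OF int_lim[OF \<phi>]])
        have "(\<integral>x. \<phi> x \<partial>\<mu> n) \<le> ?M / real m" for n
        proof -
          note borel_lawD(2)[OF l, measurable_cong]
          have nV: "(\<integral>\<^sup>+w. ennreal (V w) \<partial>\<mu> n) \<le> ennreal ?M" unfolding \<mu>_def by (rule drift_iterate)
          have iV: "integrable (\<mu> n) V" "(\<integral>x. V x \<partial>\<mu> n) \<le> ?M"
            by (rule integral_le_of_nn_integral[OF _ V0 nV M0]; measurable)+
          have i': "integrable (\<mu> n) \<phi>" by (rule borel_law_integrable[OF l \<phi>(1), of 1]) (use \<phi> in \<open>auto simp: abs_le_iff intro: order_trans\<close>)
          have "(\<integral>x. \<phi> x \<partial>\<mu> n) \<le> (\<integral>x. V x / real m \<partial>\<mu> n)"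
            by (rule integral_mono[OF i']) (use iV(1) in \<open>auto simp: \<phi>_def divide_right_mono\<close>)
          also have "\<dots> \<le> ?M / real m"
            using iV(2) by (simp add: divide_right_mono)
          finally show ?thesis .
        qed
        then show "\<exists>N. \<forall>n\<ge>N. (\<integral>x. \<phi> x \<partial>\<mu> n) \<le> ?M / real m" by blast
      qed
      then have "real m * (\<integral>x. \<phi> x \<partial>\<pi>) \<le> ?M" using False by (simp add: field_simps)
      moreover have "(\<integral>\<^sup>+w. ennreal (min (V w) (real m)) \<partial>\<pi>) = (\<integral>\<^sup>+w. ennreal (real m * \<phi> w) \<partial>\<pi>)"
        using False by (simp add: \<phi>_def)
      moreover have "\<dots> = ennreal (real m * (\<integral>x. \<phi> x \<partial>\<pi>))"
        using i \<phi> by (subst nn_integral_eq_integral) auto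
      ultimately show ?thesis by (simp add: ennreal_leI)
    qed
    have sup: "ennreal (V w) = (SUP m. ennreal (min (V w) (real m)))" for w
    proof (rule antisym)
      obtain m :: nat where "V w \<le> real m" using real_arch_simple by blast
      then show "ennreal (V w) \<le> (SUP m. ennreal (min (V w) (real m)))"
        by (intro SUP_upper2[of m]) auto
    qed (auto intro!: SUP_least ennreal_leI)
    have "(\<integral>\<^sup>+w. ennreal (V w) \<partial>\<pi>) = (SUP m. \<integral>\<^sup>+w. ennreal (min (V w) (real m)) \<partial>\<pi>)"
      unfolding sup by (rule nn_integral_monotone_convergence_SUP) (auto simp: incseq_def le_fun_def intro!: ennreal_leI min.mono)
    also have "\<dots> \<le> ennreal ?M" by (rule SUP_least) (rule trunc)
    finally show ?thesis .
  qed
  show thesis by (rule that[OF l\<pi> inv uniq bound])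
qed

end

text \<open>When only two steps together are minorised, the theorem is applied to the two-step chain; its
  invariant law is invariant for one step as well, because one step maps it to another one.\<close>

theorem two_step_invariant_law:
  fixes Q :: "'z::topological_space \<Rightarrow> 'z measure" and V :: "'z \<Rightarrow> real"
  assumes Q [measurable]: "markov_kernel Q" and V [measurable]: "V \<in> borel_measurable borel"
    and V0: "\<And>x. 0 \<le> V x" and g: "0 \<le> g" "g < 1" and K: "0 < K"
    and drift: "\<And>z. (\<integral>\<^sup>+w. ennreal (V w) \<partial>Q z) \<le> ennreal (g * V z + K)"
    and minor: "\<And>r. \<exists>\<eta> a. sets \<eta> = sets borel \<and> emeasure \<eta> UNIV = ennreal a \<and> 0 < a \<and>
      (\<forall>z A. V z \<le> r \<longrightarrow> A \<in> sets borel \<longrightarrow> emeasure \<eta> A \<le> emeasure (bind (Q z) Q) A)"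
  obtains \<pi> where "borel_law \<pi>" "bind \<pi> Q = \<pi>"
    "\<And>\<pi>'. borel_law \<pi>' \<Longrightarrow> bind \<pi>' Q = \<pi>' \<Longrightarrow> \<pi>' = \<pi>"
    "(\<integral>\<^sup>+w. ennreal (V w) \<partial>\<pi>) \<le> ennreal (V x0 + K / (1 - g))"
proof -
  let ?P = "\<lambda>z. bind (Q z) Q" and ?K = "(1 + g) * K"
  have P: "markov_kernel ?P" by (rule measurable_bind_prob_space2[where N=borel]) measurable
  have g2: "0 \<le> g\<^sup>2" "g\<^sup>2 < 1" using g by (auto simp: power_less_one_iff)
  obtain \<eta> a where \<eta>: "sets \<eta> = sets borel" "emeasure \<eta> UNIV = ennreal a" "0 < a"
    "\<And>z A. V z \<le> 4 * ?K / (1 - g\<^sup>2) \<Longrightarrow> A \<in> sets borel \<Longrightarrow> emeasure \<eta> A \<le> emeasure (?P z) A"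
    using minor[of "4 * ?K / (1 - g\<^sup>2)"] by blast
  have drift2: "(\<integral>\<^sup>+w. ennreal (V w) \<partial>?P z) \<le> ennreal (g\<^sup>2 * V z + ?K)" for z
  proof -
    have l: "borel_law (Q z)" by (rule markov_kernel_law[OF Q])
    interpret prob_space "Q z" using l by (rule borel_lawD)
    note borel_lawD(2)[OF l, measurable_cong]
    have "(\<integral>\<^sup>+w. ennreal (V w) \<partial>?P z) = (\<integral>\<^sup>+y. (\<integral>\<^sup>+w. ennreal (V w) \<partial>Q y) \<partial>Q z)"
      by (rule nn_integral_bind_kernel[OF l Q]) measurable
    also have "\<dots> \<le> (\<integral>\<^sup>+y. ennreal g * ennreal (V y) + ennreal K \<partial>Q z)"
      using drift g K V0 by (intro nn_integral_mono) (auto simp: ennreal_mult' ennreal_plus)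
    also have "\<dots> = ennreal g * (\<integral>\<^sup>+y. ennreal (V y) \<partial>Q z) + ennreal K"
      by (simp add: nn_integral_add nn_integral_cmult emeasure_space_1)
    also have "\<dots> \<le> ennreal g * ennreal (g * V z + K) + ennreal K"
      using drift by (intro add_right_mono mult_left_mono) auto
    also have "\<dots> = ennreal (g * (g * V z + K) + K)"
      using g K V0 by (simp add: ennreal_mult' ennreal_plus)
    also have "g * (g * V z + K) + K = g\<^sup>2 * V z + ?K" by (simp add: algebra_simps power2_eq_square)
    finally show ?thesis .
  qed
  have eq: "?K / (1 - g\<^sup>2) = K / (1 - g)"
  proof -
    have "1 - g\<^sup>2 = (1 + g) * (1 - g)" by (simp add: algebra_simps power2_eq_square)
    moreover have "1 + g \<noteq> 0" using g by simp
    ultimately show ?thesis by simp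
  qed
  interpret harris_kernel ?P V "g\<^sup>2" ?K a \<eta>
    by unfold_locales (use P V0 g2 g K \<eta> drift2 in auto)
  obtain \<pi> where \<pi>: "borel_law \<pi>" "bind \<pi> ?P = \<pi>"
    "\<And>\<pi>'. borel_law \<pi>' \<Longrightarrow> bind \<pi>' ?P = \<pi>' \<Longrightarrow> \<pi>' = \<pi>"
    "(\<integral>\<^sup>+w. ennreal (V w) \<partial>\<pi>) \<le> ennreal (V x0 + ?K / (1 - g\<^sup>2))"
    using invariant_law_exists[of x0 thesis] by blast
  have two: "bind \<mu> ?P = bind (bind \<mu> Q) Q" if "borel_law \<mu>" for \<mu>
    using bind_kernel_assoc[OF that Q Q] by simp
  have inv: "bind \<pi> Q = \<pi>"
  proof (rule \<pi>(3))
    show l: "borel_law (bind \<pi> Q)" by (rule borel_law_bind[OF \<pi>(1) Q])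
    show "bind (bind \<pi> Q) ?P = bind \<pi> Q" using two[OF l] two[OF \<pi>(1)] \<pi>(2) by simp
  qed
  show thesis
  proof (rule that[OF \<pi>(1) inv])
    show "\<pi>' = \<pi>" if "borel_law \<pi>'" "bind \<pi>' Q = \<pi>'" for \<pi>'
      using \<pi>(3)[OF that(1)] two[OF that(1)] that by simp
    show "(\<integral>\<^sup>+w. ennreal (V w) \<partial>\<pi>) \<le> ennreal (V x0 + K / (1 - g))" using \<pi>(4) eq by simp
  qed
qed

section \<open>Gaussian noise\<close>

lemma std_gaussian_density:
  fixes x :: "'a::euclidean_space"
  shows "(\<Prod>b\<in>Basis. std_normal_density (x \<bullet> b)) = (1 / sqrt (2 * pi)) ^ DIM('a) * exp (- (norm x)\<^sup>2 / 2)"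
proof -
  have "(\<Prod>b\<in>Basis. std_normal_density (x \<bullet> b))
      = (\<Prod>b\<in>(Basis::'a set). 1 / sqrt (2 * pi)) * (\<Prod>b\<in>Basis. exp (- (x \<bullet> b)\<^sup>2 / 2))"
    by (subst prod.distrib[symmetric]) (simp add: std_normal_density_def)
  also have "(\<Prod>b\<in>Basis. exp (- (x \<bullet> b)\<^sup>2 / 2)) = exp (\<Sum>b\<in>Basis. - (x \<bullet> b)\<^sup>2 / 2)"
    by (simp add: exp_sum)
  also have "(\<Sum>b\<in>Basis. - (x \<bullet> b)\<^sup>2 / 2) = - (norm x)\<^sup>2 / 2"
    unfolding power2_norm_eq_inner
    by (subst euclidean_inner[of x x]) (simp add: sum_negf sum_divide_distrib power2_eq_square)
  finally show ?thesis by simp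
qed

lemma nn_integral_std_gaussian_prod:
  assumes "\<And>b. b \<in> Basis \<Longrightarrow> f b \<in> borel_measurable borel" "\<And>b x. 0 \<le> f b x"
  shows "(\<integral>\<^sup>+x. ennreal (\<Prod>b\<in>Basis. f b (x \<bullet> b)) \<partial>(std_gaussian :: 'a::euclidean_space measure))
    = (\<Prod>b\<in>(Basis::'a set). \<integral>\<^sup>+t. ennreal (std_normal_density t * f b t) \<partial>lborel)"
proof -
  have [measurable]: "(\<lambda>x::'a. f b (x \<bullet> b)) \<in> borel_measurable borel" if "b \<in> Basis" for b
    using assms(1)[OF that] by measurable
  have "(\<integral>\<^sup>+x. ennreal (\<Prod>b\<in>Basis. f b (x \<bullet> b)) \<partial>(std_gaussian :: 'a measure))
    = (\<integral>\<^sup>+x. ennreal (\<Prod>b\<in>Basis. std_normal_density (x \<bullet> b)) * ennreal (\<Prod>b\<in>Basis. f b (x \<bullet> b)) \<partial>(lborel :: 'a measure))"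
    unfolding std_gaussian_def by (rule nn_integral_density) (auto intro!: borel_measurable_prod)
  also have "\<dots> = (\<integral>\<^sup>+x. (\<Prod>b\<in>Basis. ennreal (std_normal_density (x \<bullet> b) * f b (x \<bullet> b))) \<partial>(lborel :: 'a measure))"
    by (intro nn_integral_cong)
      (simp add: assms(2) prod_ennreal prod.distrib prod_nonneg flip: ennreal_mult)
  also have "\<dots> = (\<Prod>b\<in>(Basis::'a set). \<integral>\<^sup>+t. ennreal (std_normal_density t * f b t) \<partial>lborel)"
    by (rule nn_integral_lborel_prod) (use assms(1) in \<open>auto intro!: measurable_compose[OF _ measurable_ennreal]\<close>)
  finally show ?thesis .
qed

lemma nn_integral_normal_density:
  assumes "0 < \<sigma>"
  shows "(\<integral>\<^sup>+t. ennreal (normal_density \<mu> \<sigma> t) \<partial>lborel) = 1"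
  using prob_space.emeasure_space_1[OF prob_space_normal_density[OF assms, of \<mu>]]
  by (simp add: emeasure_density)

lemma std_gaussian_law: "borel_law (std_gaussian :: 'a::euclidean_space measure)"
proof (rule borel_lawI)
  have "(\<integral>\<^sup>+x. 1 \<partial>(std_gaussian :: 'a measure)) = 1"
    using nn_integral_std_gaussian_prod[where f="\<lambda>_ _. 1" and 'a='a] nn_integral_normal_density[of 1 0] by simp
  then show "prob_space (std_gaussian :: 'a measure)" by (intro prob_spaceI) simp
qed (simp add: std_gaussian_def)

lemma sets_std_gaussian [simp, measurable_cong]: "sets std_gaussian = sets borel"
  and space_std_gaussian [simp]: "space std_gaussian = UNIV"
  by (simp_all add: std_gaussian_def)

lemma std_gaussian_exp_moment:
  "(\<integral>\<^sup>+x. ennreal (exp ((norm x)\<^sup>2 / 4)) \<partial>(std_gaussian :: 'a::euclidean_space measure)) = ennreal (sqrt 2 ^ DIM('a))"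
proof -
  have e: "exp ((norm x)\<^sup>2 / 4) = (\<Prod>b\<in>Basis. exp ((x \<bullet> b)\<^sup>2 / 4))" for x :: 'a
    unfolding power2_norm_eq_inner
    by (subst euclidean_inner[of x x]) (simp add: exp_sum[symmetric] sum_divide_distrib power2_eq_square)
  have d: "std_normal_density t * exp (t\<^sup>2 / 4) = sqrt 2 * normal_density 0 (sqrt 2) t" for t
    by (simp add: normal_density_def std_normal_density_def real_sqrt_mult field_simps flip: exp_add)
  have "(\<integral>\<^sup>+x. ennreal (exp ((norm x)\<^sup>2 / 4)) \<partial>(std_gaussian :: 'a measure))
      = (\<Prod>b\<in>(Basis::'a set). \<integral>\<^sup>+t. ennreal (std_normal_density t * exp (t\<^sup>2 / 4)) \<partial>lborel)"
    unfolding e by (rule nn_integral_std_gaussian_prod) auto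
  also have "\<dots> = (\<Prod>b\<in>(Basis::'a set). ennreal (sqrt 2))"
    unfolding d by (simp add: ennreal_mult' nn_integral_cmult nn_integral_normal_density)
  finally show ?thesis by (simp add: ennreal_power)
qed

lemma nn_integral_lborel_translate:
  fixes f :: "'a::euclidean_space \<Rightarrow> ennreal"
  assumes "f \<in> borel_measurable borel"
  shows "(\<integral>\<^sup>+x. f (c + x) \<partial>lborel) = (\<integral>\<^sup>+x. f x \<partial>lborel)"
proof -
  have "(\<integral>\<^sup>+x. f x \<partial>lborel) = (\<integral>\<^sup>+x. f x \<partial>distr lborel borel ((+) c))" by (simp add: lborel_distr_plus)
  also have "\<dots> = (\<integral>\<^sup>+x. f (c + x) \<partial>lborel)" using assms by (intro nn_integral_distr) auto
  finally show ?thesis by simp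
qed

lemma std_gaussian_shift_density:
  fixes c :: "'a::euclidean_space"
  assumes [measurable]: "f \<in> borel_measurable borel"
  shows "(\<integral>\<^sup>+x. f (c + x) \<partial>std_gaussian) = (\<integral>\<^sup>+x. ennreal (exp (x \<bullet> c - (norm c)\<^sup>2 / 2)) * f x \<partial>std_gaussian)"
proof -
  define k :: real where "k = (1 / sqrt (2 * pi)) ^ DIM('a)"
  have k: "0 \<le> k" by (simp add: k_def)
  have sg: "std_gaussian = density lborel (\<lambda>x::'a. ennreal (k * exp (- (norm x)\<^sup>2 / 2)))"
    by (simp add: std_gaussian_def std_gaussian_density k_def)
  have q: "k * exp (- (norm x)\<^sup>2 / 2) = k * exp (- (norm (c + x))\<^sup>2 / 2) * exp ((c + x) \<bullet> c - (norm c)\<^sup>2 / 2)" for x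
    by (simp add: power2_norm_eq_inner inner_add_left inner_add_right inner_commute flip: exp_add)
      (simp add: field_simps)
  have "(\<integral>\<^sup>+x. f (c + x) \<partial>std_gaussian) = (\<integral>\<^sup>+x. ennreal (k * exp (- (norm x)\<^sup>2 / 2)) * f (c + x) \<partial>lborel)"
    unfolding sg by (rule nn_integral_density) auto
  also have "\<dots> = (\<integral>\<^sup>+x. ennreal (k * exp (- (norm (c + x))\<^sup>2 / 2)) * (ennreal (exp ((c + x) \<bullet> c - (norm c)\<^sup>2 / 2)) * f (c + x)) \<partial>lborel)"
    by (intro nn_integral_cong, subst q) (simp add: ennreal_mult k mult.assoc)
  also have "\<dots> = (\<integral>\<^sup>+x. ennreal (k * exp (- (norm x)\<^sup>2 / 2)) * (ennreal (exp (x \<bullet> c - (norm c)\<^sup>2 / 2)) * f x) \<partial>lborel)"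
    by (rule nn_integral_lborel_translate) measurable
  also have "\<dots> = (\<integral>\<^sup>+x. ennreal (exp (x \<bullet> c - (norm c)\<^sup>2 / 2)) * f x \<partial>std_gaussian)"
    unfolding sg by (rule nn_integral_density[symmetric]) auto
  finally show ?thesis .
qed

text \<open>The chi-square divergence between a standard Gaussian and its translate by \<open>c\<close> is
  \<open>exp |c|\<^sup>2 - 1\<close>, and it dominates the square of their \<open>L\<^sup>1\<close> distance.\<close>

lemma std_gaussian_shift_tv:
  fixes c :: "'a::euclidean_space"
  assumes \<phi> [measurable]: "\<phi> \<in> borel_measurable borel" and \<phi>01: "\<And>x. 0 \<le> \<phi> x" "\<And>x. \<phi> x \<le> (1::real)"
  shows "\<bar>(\<integral>x. \<phi> (c + x) \<partial>std_gaussian) - (\<integral>x. \<phi> x \<partial>std_gaussian)\<bar> \<le> 2 * norm c"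
proof -
  interpret prob_space "std_gaussian :: 'a measure" using std_gaussian_law by (rule borel_lawD)
  define L where "L d x = exp (x \<bullet> d - (norm d)\<^sup>2 / 2)" for d x :: 'a
  have Lm [measurable]: "L d \<in> borel_measurable borel" for d unfolding L_def by measurable
  have L0: "0 \<le> L d x" for d x by (simp add: L_def)
  have L1: "(\<integral>\<^sup>+x. ennreal (L d x) \<partial>std_gaussian) = 1" for d
    using std_gaussian_shift_density[of "\<lambda>_. 1" d] emeasure_space_1 by (simp add: L_def)
  have iL: "integrable std_gaussian (L d)" for d
    by (rule integrableI_nonneg) (use L1 L0 in \<open>auto simp: \<close>)
  have EL: "(\<integral>x. L d x \<partial>std_gaussian) = 1" for d
    using L1[of d] L0 by (simp add: nn_integral_eq_integral[OF iL] flip: ennreal_1)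
  have sq: "(L c x)\<^sup>2 = exp ((norm c)\<^sup>2) * L (2 *\<^sub>R c) x" for x
    by (simp add: L_def power2_eq_square power_mult_distrib field_simps flip: exp_add)
  have iL2: "integrable std_gaussian (\<lambda>x. (L c x)\<^sup>2)" unfolding sq using iL by simp
  have EL2: "(\<integral>x. (L c x)\<^sup>2 \<partial>std_gaussian) = exp ((norm c)\<^sup>2)" unfolding sq using EL iL by simp
  have iX: "integrable std_gaussian (\<lambda>x. \<bar>L c x - 1\<bar>)" using iL by auto
  have sqX: "(\<bar>L c x - 1\<bar>)\<^sup>2 = (L c x)\<^sup>2 - 2 * L c x + 1" for x by (simp add: power2_diff)
  have iX2: "integrable std_gaussian (\<lambda>x. (\<bar>L c x - 1\<bar>)\<^sup>2)" unfolding sqX using iL iL2 by auto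
  have EX2: "(\<integral>x. (\<bar>L c x - 1\<bar>)\<^sup>2 \<partial>std_gaussian) = exp ((norm c)\<^sup>2) - 1"
    unfolding sqX using iL iL2 EL EL2 prob_space by simp
  have "(\<integral>x. \<bar>L c x - 1\<bar> \<partial>std_gaussian)\<^sup>2 \<le> exp ((norm c)\<^sup>2) - 1"
    using variance_eq[OF iX iX2] variance_positive[of "\<lambda>x. \<bar>L c x - 1\<bar>"] EX2 by simp
  then have X: "(\<integral>x. \<bar>L c x - 1\<bar> \<partial>std_gaussian) \<le> sqrt (exp ((norm c)\<^sup>2) - 1)"
    by (rule real_le_rsqrt)
  have i\<phi>: "integrable std_gaussian \<phi>" and i\<phi>c: "integrable std_gaussian (\<lambda>x. \<phi> (c + x))"
    by (rule integrable_const_bound[of _ 1]; use \<phi>01 in \<open>auto\<close>)+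
  have i\<phi>L: "integrable std_gaussian (\<lambda>x. L c x * \<phi> x)"
    by (rule Bochner_Integration.integrable_bound[OF iL[of c]])
      (use \<phi>01 L0 in \<open>auto simp: abs_mult mult_left_le\<close>)
  have "ennreal (\<integral>x. \<phi> (c + x) \<partial>std_gaussian) = (\<integral>\<^sup>+x. ennreal (\<phi> (c + x)) \<partial>std_gaussian)"
    using \<phi>01 by (simp add: nn_integral_eq_integral[OF i\<phi>c])
  also have "\<dots> = (\<integral>\<^sup>+x. ennreal (L c x * \<phi> x) \<partial>std_gaussian)"
    by (subst std_gaussian_shift_density) (use \<phi>01 in \<open>auto simp: L_def ennreal_mult\<close>)
  also have "\<dots> = ennreal (\<integral>x. L c x * \<phi> x \<partial>std_gaussian)"
    using \<phi>01 L0 by (simp add: nn_integral_eq_integral[OF i\<phi>L])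
  finally have eq: "(\<integral>x. \<phi> (c + x) \<partial>std_gaussian) = (\<integral>x. L c x * \<phi> x \<partial>std_gaussian)"
    using \<phi>01 L0 by (subst (asm) ennreal_inj) auto
  have "(\<integral>x. \<phi> (c + x) \<partial>std_gaussian) - (\<integral>x. \<phi> x \<partial>std_gaussian) = (\<integral>x. (L c x - 1) * \<phi> x \<partial>std_gaussian)"
    unfolding eq using i\<phi> i\<phi>L by (simp add: left_diff_distrib)
  also have "\<bar>\<dots>\<bar> \<le> (\<integral>x. \<bar>(L c x - 1) * \<phi> x\<bar> \<partial>std_gaussian)" by (rule integral_abs_bound)
  also have "\<dots> \<le> (\<integral>x. \<bar>L c x - 1\<bar> \<partial>std_gaussian)"
  proof (rule integral_mono[OF _ iX])
    show "integrable std_gaussian (\<lambda>x. \<bar>(L c x - 1) * \<phi> x\<bar>)" using i\<phi> i\<phi>L by (simp add: left_diff_distrib)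
    show "\<bar>(L c x - 1) * \<phi> x\<bar> \<le> \<bar>L c x - 1\<bar>" for x using \<phi>01 by (simp add: abs_mult mult_left_le)
  qed
  finally have 1: "\<bar>(\<integral>x. \<phi> (c + x) \<partial>std_gaussian) - (\<integral>x. \<phi> x \<partial>std_gaussian)\<bar> \<le> sqrt (exp ((norm c)\<^sup>2) - 1)"
    using X by linarith
  show ?thesis
  proof (cases "norm c \<le> 1")
    case True
    then have u: "(norm c)\<^sup>2 \<le> 1" by (simp add: power_le_one)
    have "exp ((norm c)\<^sup>2) \<le> 1 + (norm c)\<^sup>2 + ((norm c)\<^sup>2)\<^sup>2" by (rule exp_bound) (use u in auto)
    also have "((norm c)\<^sup>2)\<^sup>2 \<le> (norm c)\<^sup>2" using u by (simp add: power2_eq_square mult_left_le)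
    finally have "exp ((norm c)\<^sup>2) - 1 \<le> 2 * (norm c)\<^sup>2" by simp
    also have "\<dots> \<le> 4 * (norm c)\<^sup>2" by (intro mult_right_mono) auto
    finally have "exp ((norm c)\<^sup>2) - 1 \<le> (2 * norm c)\<^sup>2" by (simp add: power_mult_distrib)
    then have "sqrt (exp ((norm c)\<^sup>2) - 1) \<le> 2 * norm c" by (intro real_le_lsqrt) auto
    then show ?thesis using 1 by linarith
  next
    case False
    have "\<bar>(\<integral>x. \<phi> (c + x) \<partial>std_gaussian) - (\<integral>x. \<phi> x \<partial>std_gaussian)\<bar> \<le> 1"
    proof -
      have "0 \<le> (\<integral>x. \<phi> x \<partial>std_gaussian)" "0 \<le> (\<integral>x. \<phi> (c + x) \<partial>std_gaussian)"
        using \<phi>01 by (auto intro!: Bochner_Integration.integral_nonneg)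
      moreover have "(\<integral>x. \<phi> x \<partial>std_gaussian) \<le> 1" "(\<integral>x. \<phi> (c + x) \<partial>std_gaussian) \<le> 1"
        using \<phi>01 by (auto intro!: integral_le_const i\<phi> i\<phi>c)
      ultimately show ?thesis by linarith
    qed
    then show ?thesis using False by linarith
  qed
qed

lemma std_gaussian_lower:
  fixes A :: "'a::euclidean_space set"
  assumes [measurable]: "A \<in> sets borel" and "A \<subseteq> cball 0 r"
  shows "ennreal ((1 / sqrt (2 * pi)) ^ DIM('a) * exp (- r\<^sup>2 / 2)) * emeasure lborel A \<le> emeasure std_gaussian A"
proof -
  let ?c = "(1 / sqrt (2 * pi)) ^ DIM('a) * exp (- r\<^sup>2 / 2)"
  have "ennreal ?c * emeasure lborel A = (\<integral>\<^sup>+x. ennreal ?c * indicator A x \<partial>lborel)"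
    by (simp add: nn_integral_cmult_indicator)
  also have "\<dots> \<le> (\<integral>\<^sup>+x. ennreal ((1 / sqrt (2 * pi)) ^ DIM('a) * exp (- (norm x)\<^sup>2 / 2)) * indicator A x \<partial>lborel)"
  proof (intro nn_integral_mono)
    fix x :: 'a
    have "exp (- r\<^sup>2 / 2) \<le> exp (- (norm x)\<^sup>2 / 2)" if "x \<in> A"
      using that assms(2) by (auto simp: subset_iff intro!: power_mono)
    then show "ennreal ?c * indicator A x \<le> ennreal ((1 / sqrt (2 * pi)) ^ DIM('a) * exp (- (norm x)\<^sup>2 / 2)) * indicator A x"
      by (auto simp: indicator_def intro!: ennreal_leI mult_left_mono)
  qed
  also have "\<dots> = emeasure std_gaussian A"
    unfolding std_gaussian_def std_gaussian_density[symmetric] by (subst emeasure_density) auto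
  finally show ?thesis .
qed


lemma exp_moment_tail:
  fixes \<mu> :: "'a::euclidean_space measure"
  assumes \<mu>: "borel_law \<mu>" and c: "0 < c" "0 \<le> E" "(\<integral>\<^sup>+x. ennreal (exp (c * (norm x)\<^sup>2)) \<partial>\<mu>) \<le> ennreal E" and "0 \<le> r"
  shows "measure \<mu> {x. r < norm x} \<le> E * exp (- c * r\<^sup>2)"
proof -
  interpret prob_space \<mu> using \<mu> by (rule borel_lawD)
  note borel_lawD(2)[OF \<mu>, measurable_cong]
  let ?A = "{x::'a. r < norm x}"
  have "ennreal (exp (c * r\<^sup>2) * measure \<mu> ?A) = (\<integral>\<^sup>+x. ennreal (exp (c * r\<^sup>2)) * indicator ?A x \<partial>\<mu>)"
    by (simp add: nn_integral_cmult_indicator emeasure_eq_measure ennreal_mult)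
  also have "\<dots> \<le> (\<integral>\<^sup>+x. ennreal (exp (c * (norm x)\<^sup>2)) \<partial>\<mu>)"
    using c(1) \<open>0 \<le> r\<close> by (intro nn_integral_mono) (auto simp: indicator_def intro!: ennreal_leI power_mono)
  also have "\<dots> \<le> ennreal E" by (rule c(3))
  finally have "exp (c * r\<^sup>2) * measure \<mu> ?A \<le> E" using c(2) by (simp add: ennreal_le_iff)
  then show ?thesis by (simp add: exp_minus field_simps)
qed

text \<open>A scheme with one velocity refreshment per step is driven by a Gaussian vector, one with two by a sum of
  two independent Gaussian vectors. Both share these properties: \<open>exp_moment\<close> bounds
  the probability of leaving a metastable set, \<open>lower\<close> yields a common part of the transition laws, and
  \<open>shift\<close> makes the kernels smoothing in total variation.\<close>

locale smooth_noise =
  fixes \<nu> :: "'a::euclidean_space measure"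
  assumes law: "borel_law \<nu>"
    and exp_moment: "\<exists>c>0. \<exists>E\<ge>0. (\<integral>\<^sup>+x. ennreal (exp (c * (norm x)\<^sup>2)) \<partial>\<nu>) \<le> ennreal E"
    and lower: "\<And>r. \<exists>k>0. \<forall>A\<in>sets borel. A \<subseteq> cball 0 r \<longrightarrow> ennreal k * emeasure lborel A \<le> emeasure \<nu> A"
    and shift: "\<exists>C\<ge>0. \<forall>\<phi> c. \<phi> \<in> borel_measurable borel \<longrightarrow> (\<forall>x. 0 \<le> \<phi> x \<and> \<phi> x \<le> (1::real)) \<longrightarrow>
      \<bar>(\<integral>x. \<phi> (c + x) \<partial>\<nu>) - (\<integral>x. \<phi> x \<partial>\<nu>)\<bar> \<le> C * norm c"
begin

lemma sets_noise [simp, measurable_cong]: "sets \<nu> = sets borel"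
  using law by (rule borel_lawD)

lemma space_noise [simp]: "space \<nu> = UNIV"
  using law by (rule borel_lawD)

sublocale prob_space \<nu>
  using law by (rule borel_lawD)

lemma tail: "\<exists>c>0. \<exists>C\<ge>0. \<forall>r\<ge>0. measure \<nu> {x. r < norm x} \<le> C * exp (- c * r\<^sup>2)"
  using exp_moment exp_moment_tail[OF law] by blast

lemma second_moment: "\<exists>M\<ge>0. (\<integral>\<^sup>+x. ennreal ((norm x)\<^sup>2) \<partial>\<nu>) \<le> ennreal M"
proof -
  obtain c E where c: "c > 0" "E \<ge> 0" "(\<integral>\<^sup>+x. ennreal (exp (c * (norm x)\<^sup>2)) \<partial>\<nu>) \<le> ennreal E"
    using exp_moment by blast
  have "(norm x)\<^sup>2 \<le> (1 / c) * exp (c * (norm x)\<^sup>2)" for x :: 'a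
  proof -
    have "c * (norm x)\<^sup>2 \<le> exp (c * (norm x)\<^sup>2)" using exp_ge_add_one_self[of "c * (norm x)\<^sup>2"] by linarith
    then show ?thesis using c(1) by (simp add: field_simps)
  qed
  then have "(\<integral>\<^sup>+x. ennreal ((norm x)\<^sup>2) \<partial>\<nu>) \<le> (\<integral>\<^sup>+x. ennreal (1 / c) * ennreal (exp (c * (norm x)\<^sup>2)) \<partial>\<nu>)"
    using c(1) by (intro nn_integral_mono) (auto simp flip: ennreal_mult intro!: ennreal_leI)
  also have "\<dots> = ennreal (1 / c) * (\<integral>\<^sup>+x. ennreal (exp (c * (norm x)\<^sup>2)) \<partial>\<nu>)"
    by (rule nn_integral_cmult) measurable
  also have "\<dots> \<le> ennreal (1 / c) * ennreal E" using c by (intro mult_left_mono) auto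
  also have "\<dots> = ennreal (E / c)" using c by (simp add: ennreal_mult'[symmetric])
  finally show ?thesis using c by (intro exI[of _ "E / c"]) auto
qed

end

text \<open>The law of \<open>a \<xi> + b \<xi>'\<close> for independent standard Gaussian vectors, disintegrated over the first
  one so that the estimates below can be made conditionally on it.\<close>

definition gauss_mix :: "real \<Rightarrow> real \<Rightarrow> 'a::euclidean_space measure" where
  "gauss_mix a b = bind std_gaussian (\<lambda>\<xi>. distr std_gaussian borel (\<lambda>\<xi>'. a *\<^sub>R \<xi> + b *\<^sub>R \<xi>'))"

lemma std_gaussian_kernel [measurable]:
  assumes [measurable]: "(\<lambda>(x, y). f x y) \<in> borel \<Otimes>\<^sub>M borel \<rightarrow>\<^sub>M borel"
  shows "markov_kernel (\<lambda>x. distr std_gaussian borel (f x))"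
proof (rule measurable_distr_prob_space2[where M=borel])
  show "(\<lambda>x. std_gaussian) \<in> borel \<rightarrow>\<^sub>M prob_algebra borel"
    using std_gaussian_law by (rule measurable_const)
qed measurable

lemma gauss_mix_kernel:
  "markov_kernel (\<lambda>\<xi>::'a::euclidean_space. distr std_gaussian borel (\<lambda>\<xi>'. a *\<^sub>R \<xi> + b *\<^sub>R \<xi>'))"
  by measurable

lemma gauss_mix_law: "borel_law (gauss_mix a b)"
  unfolding gauss_mix_def by (rule borel_law_bind[OF std_gaussian_law gauss_mix_kernel])

lemma nn_integral_gauss_mix:
  assumes [measurable]: "f \<in> borel_measurable borel"
  shows "(\<integral>\<^sup>+x. f x \<partial>gauss_mix a b) = (\<integral>\<^sup>+\<xi>. (\<integral>\<^sup>+\<xi>'. f (a *\<^sub>R \<xi> + b *\<^sub>R \<xi>') \<partial>std_gaussian) \<partial>std_gaussian)"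
  unfolding gauss_mix_def
  by (subst nn_integral_bind_kernel[OF std_gaussian_law gauss_mix_kernel assms])
    (intro nn_integral_cong nn_integral_distr; measurable)

lemma integral_gauss_mix:
  assumes [measurable]: "f \<in> borel_measurable borel" and "\<And>x. \<bar>f x\<bar> \<le> (B::real)"
  shows "(\<integral>x. f x \<partial>gauss_mix a b) = (\<integral>\<xi>. (\<integral>\<xi>'. f (a *\<^sub>R \<xi> + b *\<^sub>R \<xi>') \<partial>std_gaussian) \<partial>std_gaussian)"
  unfolding gauss_mix_def
  by (subst integral_bind_kernel[OF std_gaussian_law gauss_mix_kernel assms])
    (unfold kernel_apply_def, intro Bochner_Integration.integral_cong refl integral_distr; measurable)

lemma emeasure_lborel_affine_preimage:
  fixes A :: "'a::euclidean_space set"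
  assumes [measurable]: "A \<in> sets borel" and "b > 0"
  shows "ennreal (b ^ DIM('a)) * emeasure lborel {x. t + b *\<^sub>R x \<in> A} = emeasure lborel A"
proof -
  have "emeasure lborel A = emeasure (density (distr lborel borel (\<lambda>x. t + b *\<^sub>R x)) (\<lambda>_. ennreal (\<bar>b\<bar> ^ DIM('a)))) A"
    using lborel_affine[of b t] assms by simp
  also have "\<dots> = ennreal (b ^ DIM('a)) * emeasure (distr lborel borel (\<lambda>x. t + b *\<^sub>R x)) A"
    using assms by (simp add: emeasure_density_const)
  also have "emeasure (distr lborel borel (\<lambda>x. t + b *\<^sub>R x)) A = emeasure lborel {x. t + b *\<^sub>R x \<in> A}"
    using assms by (subst emeasure_distr) (auto simp: vimage_def)
  finally show ?thesis by simp
qed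

lemma emeasure_lborel_cball_pos: "0 < r \<Longrightarrow> 0 < emeasure lborel (cball (x::'a::euclidean_space) r)"
  by (simp add: emeasure_cball)

text \<open>Given \<open>\<xi>\<close>, the vector \<open>b \<xi>'\<close> alone already dominates Lebesgue measure on balls and blurs
  translations; averaging over \<open>\<xi>\<close>, restricted to the unit ball for the lower bound, keeps both.\<close>

lemma smooth_noise_gauss_mix:
  fixes a b :: real
  assumes b: "b > 0"
  shows "smooth_noise (gauss_mix a b :: 'a::euclidean_space measure)"
proof
  let ?\<nu> = "gauss_mix a b :: 'a measure"
  interpret G: prob_space "std_gaussian :: 'a measure" using std_gaussian_law by (rule borel_lawD)
  show "borel_law ?\<nu>" by (rule gauss_mix_law)
  show "\<exists>c>0. \<exists>E\<ge>0. (\<integral>\<^sup>+x. ennreal (exp (c * (norm x)\<^sup>2)) \<partial>?\<nu>) \<le> ennreal E"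
  proof (intro exI conjI)
    define c where "c = 1 / (8 * (a\<^sup>2 + b\<^sup>2))"
    have ab: "0 < a\<^sup>2 + b\<^sup>2" using b by (simp add: add_nonneg_pos)
    show "c > 0" using ab by (simp add: c_def)
    show "0 \<le> (sqrt 2 ^ DIM('a)) * (sqrt 2 ^ DIM('a))" by simp
    have e: "exp (c * (norm (a *\<^sub>R \<xi> + b *\<^sub>R \<xi>'))\<^sup>2) \<le> exp ((norm \<xi>)\<^sup>2 / 4) * exp ((norm \<xi>')\<^sup>2 / 4)" for \<xi> \<xi>' :: 'a
    proof -
      have "norm (a *\<^sub>R \<xi> + b *\<^sub>R \<xi>') \<le> \<bar>a\<bar> * norm \<xi> + \<bar>b\<bar> * norm \<xi>'"
        using norm_triangle_ineq[of "a *\<^sub>R \<xi>" "b *\<^sub>R \<xi>'"] by simp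
      then have "(norm (a *\<^sub>R \<xi> + b *\<^sub>R \<xi>'))\<^sup>2 \<le> (\<bar>a\<bar> * norm \<xi> + \<bar>b\<bar> * norm \<xi>')\<^sup>2" by (intro power_mono) auto
      also have "\<dots> \<le> 2 * (\<bar>a\<bar> * norm \<xi>)\<^sup>2 + 2 * (\<bar>b\<bar> * norm \<xi>')\<^sup>2"
        using sum_squares_bound[of "\<bar>a\<bar> * norm \<xi>" "\<bar>b\<bar> * norm \<xi>'"] by (simp add: power2_sum)
      also have "\<dots> \<le> 2 * (a\<^sup>2 + b\<^sup>2) * (norm \<xi>)\<^sup>2 + 2 * (a\<^sup>2 + b\<^sup>2) * (norm \<xi>')\<^sup>2"
        by (simp add: power_mult_distrib algebra_simps)
      finally have "c * (norm (a *\<^sub>R \<xi> + b *\<^sub>R \<xi>'))\<^sup>2 \<le> (norm \<xi>)\<^sup>2 / 4 + (norm \<xi>')\<^sup>2 / 4"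
        using ab by (simp add: c_def field_simps)
      then show ?thesis by (simp flip: exp_add)
    qed
    have "(\<integral>\<^sup>+x. ennreal (exp (c * (norm x)\<^sup>2)) \<partial>?\<nu>)
        \<le> (\<integral>\<^sup>+\<xi>. (\<integral>\<^sup>+\<xi>'. ennreal (exp ((norm (\<xi>::'a))\<^sup>2 / 4)) * ennreal (exp ((norm (\<xi>'::'a))\<^sup>2 / 4)) \<partial>std_gaussian) \<partial>std_gaussian)"
      by (subst nn_integral_gauss_mix) (auto intro!: nn_integral_mono ennreal_leI e simp flip: ennreal_mult)
    also have "\<dots> = ennreal ((sqrt 2 ^ DIM('a)) * (sqrt 2 ^ DIM('a)))"
      by (simp add: nn_integral_cmult nn_integral_multc std_gaussian_exp_moment ennreal_mult)
    finally show "(\<integral>\<^sup>+x. ennreal (exp (c * (norm x)\<^sup>2)) \<partial>?\<nu>) \<le> ennreal ((sqrt 2 ^ DIM('a)) * (sqrt 2 ^ DIM('a)))" .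
  qed
  show "\<exists>k>0. \<forall>A\<in>sets borel. A \<subseteq> cball 0 r \<longrightarrow> ennreal k * emeasure lborel A \<le> emeasure ?\<nu> A" for r
  proof -
    define r' where "r' = (r + \<bar>a\<bar>) / b"
    define k1 where "k1 = (1 / sqrt (2 * pi)) ^ DIM('a) * exp (- r'\<^sup>2 / 2)"
    define k2 where "k2 = measure std_gaussian (cball (0::'a) 1)"
    define d where "d = b ^ DIM('a)"
    have k1: "0 < k1" by (simp add: k1_def)
    have d: "0 < d" using b by (simp add: d_def)
    have k2e: "emeasure std_gaussian (cball (0::'a) 1) = ennreal k2" by (simp add: k2_def G.emeasure_eq_measure)
    have "0 < ennreal ((1 / sqrt (2 * pi)) ^ DIM('a) * exp (- 1\<^sup>2 / 2)) * emeasure lborel (cball (0::'a) 1)"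
      using emeasure_lborel_cball_pos[of 1 "0::'a"] by (simp add: ennreal_zero_less_mult_iff)
    also have "\<dots> \<le> emeasure std_gaussian (cball (0::'a) 1)" by (rule std_gaussian_lower) auto
    finally have k2: "0 < k2" unfolding k2e by simp
    have "ennreal (k1 / d * k2) * emeasure lborel A \<le> emeasure ?\<nu> A"
      if [measurable]: "A \<in> sets borel" and Ar: "A \<subseteq> cball 0 r" for A
    proof -
      have "ennreal (k1 / d * k2) * emeasure lborel A = (\<integral>\<^sup>+\<xi>. ennreal (k1 / d) * emeasure lborel A * indicator (cball (0::'a) 1) \<xi> \<partial>std_gaussian)"
      proof -
        have "(\<integral>\<^sup>+\<xi>. ennreal (k1 / d) * emeasure lborel A * indicator (cball (0::'a) 1) \<xi> \<partial>std_gaussian)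
            = ennreal (k1 / d) * emeasure lborel A * ennreal k2"
          by (subst nn_integral_cmult_indicator) (auto simp: k2e)
        moreover have "ennreal (k1 / d * k2) = ennreal (k1 / d) * ennreal k2"
          using k1 k2 d by (intro ennreal_mult) auto
        ultimately show ?thesis by (simp add: mult_ac)
      qed
      also have "\<dots> \<le> (\<integral>\<^sup>+\<xi>. (\<integral>\<^sup>+\<xi>'. indicator A (a *\<^sub>R \<xi> + b *\<^sub>R \<xi>') \<partial>std_gaussian) \<partial>std_gaussian)"
      proof (rule nn_integral_mono)
        fix \<xi> :: 'a
        let ?B = "{x. a *\<^sub>R \<xi> + b *\<^sub>R x \<in> A}"
        have B [measurable]: "?B \<in> sets borel" by measurable
        show "ennreal (k1 / d) * emeasure lborel A * indicator (cball 0 1) \<xi> \<le> (\<integral>\<^sup>+\<xi>'. indicator A (a *\<^sub>R \<xi> + b *\<^sub>R \<xi>') \<partial>std_gaussian)"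
        proof (cases "\<xi> \<in> cball 0 1")
          case True
          have "?B \<subseteq> cball 0 r'"
          proof
            fix x assume "x \<in> ?B"
            then have "norm (a *\<^sub>R \<xi> + b *\<^sub>R x) \<le> r" using Ar by auto
            moreover have "norm (b *\<^sub>R x) \<le> norm (a *\<^sub>R \<xi> + b *\<^sub>R x) + norm (a *\<^sub>R \<xi>)"
              using norm_triangle_ineq4[of "a *\<^sub>R \<xi> + b *\<^sub>R x" "a *\<^sub>R \<xi>"] by simp
            moreover have "norm (a *\<^sub>R \<xi>) \<le> \<bar>a\<bar>" using True by (simp add: mult_left_le)
            ultimately have "b * norm x \<le> r + \<bar>a\<bar>" using b by simp
            then show "x \<in> cball 0 r'" using b by (simp add: r'_def field_simps)
          qed
          then have "ennreal k1 * emeasure lborel ?B \<le> emeasure std_gaussian ?B"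
            unfolding k1_def by (intro std_gaussian_lower) auto
          moreover have "ennreal (k1 / d) * emeasure lborel A = ennreal k1 * emeasure lborel ?B"
          proof -
            have "ennreal (k1 / d) * emeasure lborel A = (ennreal (k1 / d) * ennreal d) * emeasure lborel ?B"
              using emeasure_lborel_affine_preimage[OF \<open>A \<in> sets borel\<close> b, of "a *\<^sub>R \<xi>"] by (simp add: d_def mult.assoc)
            then show ?thesis using k1 d by (simp flip: ennreal_mult)
          qed
          moreover have "(\<integral>\<^sup>+\<xi>'. indicator A (a *\<^sub>R \<xi> + b *\<^sub>R \<xi>') \<partial>std_gaussian) = emeasure std_gaussian ?B"
          proof -
            have "(\<lambda>\<xi>'. indicator A (a *\<^sub>R \<xi> + b *\<^sub>R \<xi>') :: ennreal) = indicator ?B"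
              by (auto simp: indicator_def fun_eq_iff)
            then show ?thesis by simp
          qed
          ultimately show ?thesis using True by simp
        qed simp
      qed
      also have "\<dots> = emeasure ?\<nu> A"
      proof -
        have "A \<in> sets ?\<nu>" using borel_lawD(2)[OF gauss_mix_law] \<open>A \<in> sets borel\<close> by blast
        then show ?thesis using nn_integral_gauss_mix[of "indicator A" a b] by (simp add: nn_integral_indicator)
      qed
      finally show ?thesis .
    qed
    moreover have "k1 / d * k2 > 0" using k1 k2 d by simp
    ultimately show ?thesis by blast
  qed
  show "\<exists>C\<ge>0. \<forall>\<phi> c. \<phi> \<in> borel_measurable borel \<longrightarrow> (\<forall>x. 0 \<le> \<phi> x \<and> \<phi> x \<le> (1::real)) \<longrightarrow>
      \<bar>(\<integral>x. \<phi> (c + x) \<partial>?\<nu>) - (\<integral>x. \<phi> x \<partial>?\<nu>)\<bar> \<le> C * norm c"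
  proof (intro exI[of _ "2 / b"] conjI allI impI)
    fix \<phi> :: "'a \<Rightarrow> real" and c :: 'a
    assume \<phi> [measurable]: "\<phi> \<in> borel_measurable borel" and \<phi>01: "\<forall>x. 0 \<le> \<phi> x \<and> \<phi> x \<le> 1"
    have ab: "\<bar>\<phi> x\<bar> \<le> 1" for x using \<phi>01[rule_format, of x] by linarith
    have K: "\<bar>(\<integral>\<xi>'. \<psi> (a *\<^sub>R \<xi> + b *\<^sub>R \<xi>') \<partial>(std_gaussian :: 'a measure))\<bar> \<le> 1"
      "(\<lambda>\<xi>. \<integral>\<xi>'. \<psi> (a *\<^sub>R \<xi> + b *\<^sub>R \<xi>') \<partial>(std_gaussian :: 'a measure)) \<in> borel_measurable borel"
      if [measurable]: "\<psi> \<in> borel_measurable borel" and "\<And>x. \<bar>\<psi> x\<bar> \<le> (1::real)" for \<psi> \<xi>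
    proof -
      have "kernel_apply (\<lambda>\<xi>::'a. distr std_gaussian borel (\<lambda>\<xi>'. a *\<^sub>R \<xi> + b *\<^sub>R \<xi>')) \<psi> = (\<lambda>\<xi>. \<integral>\<xi>'. \<psi> (a *\<^sub>R \<xi> + b *\<^sub>R \<xi>') \<partial>(std_gaussian :: 'a measure))"
        unfolding kernel_apply_def by (intro ext integral_distr) measurable
      then show "(\<lambda>\<xi>. \<integral>\<xi>'. \<psi> (a *\<^sub>R \<xi> + b *\<^sub>R \<xi>') \<partial>(std_gaussian :: 'a measure)) \<in> borel_measurable borel"
        and "\<bar>(\<integral>\<xi>'. \<psi> (a *\<^sub>R \<xi> + b *\<^sub>R \<xi>') \<partial>(std_gaussian :: 'a measure))\<bar> \<le> 1"
        using kernel_apply_measurable[OF gauss_mix_kernel that(1), of a b]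
          kernel_apply_bounds[OF gauss_mix_kernel that(1), of "-1" 1 a b \<xi>] that(2)
        by (auto simp: abs_le_iff fun_eq_iff minus_le_iff)
    qed
    have "\<bar>(\<integral>\<xi>. (\<integral>\<xi>'. \<phi> (c + (a *\<^sub>R \<xi> + b *\<^sub>R \<xi>')) \<partial>(std_gaussian :: 'a measure)) \<partial>(std_gaussian :: 'a measure))
        - (\<integral>\<xi>. (\<integral>\<xi>'. \<phi> (a *\<^sub>R \<xi> + b *\<^sub>R \<xi>') \<partial>(std_gaussian :: 'a measure)) \<partial>(std_gaussian :: 'a measure))\<bar> \<le> 2 / b * norm c"
    proof (rule borel_law_integral_diff_le[OF std_gaussian_law, where B=1])
      fix \<xi> :: 'a
      have "\<bar>(\<integral>x. \<phi> (a *\<^sub>R \<xi> + b *\<^sub>R ((1 / b) *\<^sub>R c + x)) \<partial>(std_gaussian :: 'a measure)) - (\<integral>x. \<phi> (a *\<^sub>R \<xi> + b *\<^sub>R x) \<partial>(std_gaussian :: 'a measure))\<bar>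
          \<le> 2 * norm ((1 / b) *\<^sub>R c)"
        by (rule std_gaussian_shift_tv[where \<phi>="\<lambda>x. \<phi> (a *\<^sub>R \<xi> + b *\<^sub>R x)"]) (use \<phi>01 in auto)
      moreover have "a *\<^sub>R \<xi> + b *\<^sub>R ((1 / b) *\<^sub>R c + x) = c + (a *\<^sub>R \<xi> + b *\<^sub>R x)" for x
        using b by (simp add: algebra_simps)
      ultimately show "\<bar>(\<integral>\<xi>'. \<phi> (c + (a *\<^sub>R \<xi> + b *\<^sub>R \<xi>')) \<partial>std_gaussian) - (\<integral>\<xi>'. \<phi> (a *\<^sub>R \<xi> + b *\<^sub>R \<xi>') \<partial>std_gaussian)\<bar> \<le> 2 / b * norm c"
        using b by simp
    qed (use K[of \<phi>] K[of "\<lambda>x. \<phi> (c + x)"] ab in auto)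
    then show "\<bar>(\<integral>x. \<phi> (c + x) \<partial>?\<nu>) - (\<integral>x. \<phi> x \<partial>?\<nu>)\<bar> \<le> 2 / b * norm c"
      using integral_gauss_mix[OF \<phi> ab, of a b] integral_gauss_mix[of "\<lambda>x. \<phi> (c + x)" 1 a b] ab by simp
  qed (use b in auto)
qed

section \<open>The noisy heavy-ball chain\<close>

text \<open>All four splittings share this skeleton: after a change of variables their positions at a suitable
  moment of the step follow a heavy-ball recursion for the pair (current, previous) position, driven by
  noise that enters both components with fixed weights.\<close>

definition heavy_ball :: "real \<Rightarrow> real \<Rightarrow> ('a::euclidean_space \<Rightarrow> 'a) \<Rightarrow> 'a \<times> 'a \<Rightarrow> 'a \<times> 'a" where
  "heavy_ball \<beta> s G z = ((1 + \<beta>) *\<^sub>R fst z - \<beta> *\<^sub>R snd z - s *\<^sub>R G (fst z), fst z)"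

definition noisy_heavy_ball ::
    "real \<Rightarrow> real \<Rightarrow> ('a::euclidean_space \<Rightarrow> 'a) \<Rightarrow> real \<Rightarrow> real \<Rightarrow> 'a measure \<Rightarrow> 'a kernel" where
  "noisy_heavy_ball \<beta> s G e f \<nu> = (\<lambda>z. distr \<nu> borel (\<lambda>N. heavy_ball \<beta> s G z + (e *\<^sub>R N, f *\<^sub>R N)))"

lemma borel_measurable_Pair_iff:
  fixes f :: "'x \<Rightarrow> 'a::second_countable_topology" and g :: "'x \<Rightarrow> 'b::second_countable_topology"
  assumes [measurable]: "f \<in> M \<rightarrow>\<^sub>M borel" "g \<in> M \<rightarrow>\<^sub>M borel"
  shows "(\<lambda>x. (f x, g x)) \<in> M \<rightarrow>\<^sub>M borel"
  unfolding borel_prod[symmetric] by measurable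

lemma borel_measurable_fst_snd [measurable]:
  "fst \<in> (borel :: ('a::second_countable_topology \<times> 'b::second_countable_topology) measure) \<rightarrow>\<^sub>M borel"
  "snd \<in> (borel :: ('a::second_countable_topology \<times> 'b::second_countable_topology) measure) \<rightarrow>\<^sub>M borel"
  unfolding borel_prod[symmetric] by measurable

lemma heavy_ball_measurable [measurable]:
  assumes [measurable]: "G \<in> borel_measurable borel"
  shows "heavy_ball \<beta> s G \<in> borel_measurable borel"
  unfolding heavy_ball_def by (rule borel_measurable_Pair_iff) measurable

lemma noise_direction_measurable [measurable]:
  "(\<lambda>N::'a::euclidean_space. (e *\<^sub>R N, f *\<^sub>R N)) \<in> borel_measurable borel"
  by (rule borel_measurable_Pair_iff) measurable

lemma noise_kernel:
  assumes "borel_law \<nu>" and [measurable]: "(\<lambda>(z, N). F z N) \<in> borel \<Otimes>\<^sub>M borel \<rightarrow>\<^sub>M borel"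
  shows "markov_kernel (\<lambda>z. distr \<nu> borel (F z))"
proof (rule measurable_distr_prob_space2[where M=borel])
  show "(\<lambda>x. \<nu>) \<in> borel \<rightarrow>\<^sub>M prob_algebra borel"
    using assms(1) by (rule measurable_const)
qed measurable

lemma noisy_heavy_ball_kernel:
  assumes "borel_law \<nu>" and [measurable]: "G \<in> borel_measurable borel"
  shows "markov_kernel (noisy_heavy_ball \<beta> s G e f \<nu>)"
  unfolding noisy_heavy_ball_def
  by (rule noise_kernel[OF assms(1)]) measurable

lemma nn_integral_noise_kernel:
  assumes "borel_law \<nu>" and [measurable]: "h \<in> borel \<rightarrow>\<^sub>M borel" "\<phi> \<in> borel_measurable borel"
  shows "(\<integral>\<^sup>+w. \<phi> w \<partial>distr \<nu> borel h) = (\<integral>\<^sup>+N. \<phi> (h N) \<partial>\<nu>)"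
  using assms borel_lawD(2)[OF assms(1)] by (intro nn_integral_distr) (auto cong: measurable_cong_sets)

lemma nn_integral_noisy_heavy_ball:
  assumes "borel_law \<nu>" and [measurable]: "G \<in> borel_measurable borel" "\<phi> \<in> borel_measurable borel"
  shows "(\<integral>\<^sup>+w. \<phi> w \<partial>noisy_heavy_ball \<beta> s G e f \<nu> z)
    = (\<integral>\<^sup>+N. \<phi> (heavy_ball \<beta> s G z + (e *\<^sub>R N, f *\<^sub>R N)) \<partial>\<nu>)"
  unfolding noisy_heavy_ball_def by (rule nn_integral_noise_kernel[OF assms(1)]) measurable

subsection \<open>A contracting norm\<close>

lemma quadratic_form_lower:
  fixes a b :: "'a::real_inner"
  assumes "0 < x" "0 < w" "y\<^sup>2 < x * w"
  shows "(x * w - y\<^sup>2) / (x + w) * ((norm a)\<^sup>2 + (norm b)\<^sup>2)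
    \<le> x * (norm a)\<^sup>2 - 2 * y * (a \<bullet> b) + w * (norm b)\<^sup>2"
proof -
  define d where "d = (x * w - y\<^sup>2) / (x + w)"
  define x' w' where "x' = x - d" and "w' = w - d"
  have d: "d * (x + w) = x * w - y\<^sup>2" using assms by (simp add: d_def)
  have "x' * (x + w) = x\<^sup>2 + y\<^sup>2" "w' * (x + w) = w\<^sup>2 + y\<^sup>2"
    using d by (simp_all add: x'_def w'_def algebra_simps power2_eq_square)
  then have nn: "0 \<le> x'" "0 \<le> w'"
    using assms by (metis add_pos_pos sum_power2_ge_zero zero_le_mult_iff not_less order_less_imp_le)+
  have "x' * w' = y\<^sup>2 + d\<^sup>2"
    using d by (simp add: x'_def w'_def algebra_simps power2_eq_square)
  then have "y\<^sup>2 \<le> x' * w'" by simp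
  then have y: "\<bar>y\<bar> \<le> sqrt x' * sqrt w'"
    by (metis real_sqrt_abs real_sqrt_le_iff real_sqrt_mult)
  have "2 * y * (a \<bullet> b) \<le> 2 * (\<bar>y\<bar> * \<bar>a \<bullet> b\<bar>)" by (simp flip: abs_mult)
  also have "\<dots> \<le> 2 * ((sqrt x' * sqrt w') * (norm a * norm b))"
    using y Cauchy_Schwarz_ineq2[of a b] nn by (intro mult_left_mono mult_mono) auto
  also have "\<dots> = 2 * (sqrt x' * norm a) * (sqrt w' * norm b)" by simp
  also have "\<dots> \<le> (sqrt x' * norm a)\<^sup>2 + (sqrt w' * norm b)\<^sup>2" by (rule sum_squares_bound)
  also have "\<dots> = x' * (norm a)\<^sup>2 + w' * (norm b)\<^sup>2" using nn by (simp add: power_mult_distrib)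
  finally show ?thesis unfolding d_def[symmetric] by (simp add: x'_def w'_def algebra_simps)
qed

lemma norm_Pair_power2: "(norm z)\<^sup>2 = (norm (fst z))\<^sup>2 + (norm (snd z))\<^sup>2"
  for z :: "'a::real_inner \<times> 'b::real_inner"
  by (simp add: norm_prod_def)

text \<open>With \<open>c = T / (1 + \<beta>)\<close>, the form \<open>|a|\<^sup>2 - 2 c \<langle>a, b\<rangle> + |b|\<^sup>2\<close> decreases by
  \<open>(1 - \<beta>\<^sup>2) |b - c a|\<^sup>2\<close> along the recursion; lowering the coefficient of \<open>|b|\<^sup>2\<close> slightly
  makes the decrease strict in every direction.\<close>

lemma companion_contraction:
  fixes \<beta> T :: real
  assumes \<beta>: "0 < \<beta>" "\<beta> < 1" and T: "\<bar>T\<bar> < 1 + \<beta>"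
  obtains J :: "'a::euclidean_space \<times> 'a \<Rightarrow> 'a \<times> 'a" and r m k :: real
  where "bounded_linear J" "0 < r" "r < 1" "0 < m" "0 < k"
    "\<And>z. m * norm z \<le> norm (J z)" "\<And>z. norm (J z) \<le> k * norm z"
    "\<And>a b. norm (J (T *\<^sub>R a - \<beta> *\<^sub>R b, a)) \<le> r * norm (J (a, b))"
proof -
  define c where "c = T / (1 + \<beta>)"
  have Tc: "T = c * (1 + \<beta>)" using \<beta> by (simp add: c_def)
  have "\<bar>c\<bar> < 1" using T \<beta> by (simp add: c_def abs_divide)
  then have c2: "c\<^sup>2 < 1" by (simp add: abs_square_less_1)
  define E where "E = 1 - \<beta>\<^sup>2"
  have E: "0 < E" "E < 1" using \<beta> by (auto simp: E_def power_less_one_iff)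
  define \<delta> where "\<delta> = (1 - c\<^sup>2) * E / 2"
  have \<delta>: "0 < \<delta>" using c2 E by (simp add: \<delta>_def)
  have "(1 - c\<^sup>2) * E \<le> 1 - c\<^sup>2" using c2 E by (simp add: mult_left_le)
  then have \<delta>1: "\<delta> < 1 - c\<^sup>2" using c2 \<delta> unfolding \<delta>_def by linarith
  have "(1 - c\<^sup>2) * E \<le> E" using E by (simp add: mult_left_le_one_le)
  then have \<delta>E: "\<delta> < E" using E \<delta> unfolding \<delta>_def by linarith
  define q where "q = 1 - \<delta>"
  have q: "0 < q" "c\<^sup>2 < q" using \<delta>1 E \<delta>E by (auto simp: q_def)
  define u where "u = 1 - c\<^sup>2 / q"
  have u: "0 < u" using q by (simp add: u_def)
  define J where "J z = (sqrt u *\<^sub>R fst z, sqrt q *\<^sub>R (snd z - (c / q) *\<^sub>R fst z))" for z :: "'a \<times> 'a"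
  have bl: "bounded_linear J"
    unfolding J_def by (intro bounded_linear_Pair bounded_linear_intros)
  have J2: "(norm (J z))\<^sup>2 = (norm (fst z))\<^sup>2 - 2 * c * (fst z \<bullet> snd z) + q * (norm (snd z))\<^sup>2" for z
  proof -
    have "(norm (snd z - (c / q) *\<^sub>R fst z))\<^sup>2 = (norm (snd z))\<^sup>2 - 2 * (c / q) * (fst z \<bullet> snd z) + (c / q)\<^sup>2 * (norm (fst z))\<^sup>2"
      unfolding power2_norm_eq_inner by (simp add: inner_diff inner_commute power2_eq_square algebra_simps)
    then show ?thesis
      using u q by (simp add: norm_Pair_power2 J_def power_mult_distrib u_def)
        (simp add: field_simps power2_eq_square)
  qed
  define m2 where "m2 = (1 * q - c\<^sup>2) / (1 + q)"
  have m2: "0 < m2" using q by (simp add: m2_def)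
  have low: "m2 * (norm z)\<^sup>2 \<le> (norm (J z))\<^sup>2" for z
    unfolding J2 norm_Pair_power2[of z] m2_def
    using quadratic_form_lower[of 1 q c "fst z" "snd z"] q by simp
  obtain k0 where k0: "\<And>z. norm (J z) \<le> norm z * k0" "k0 > 0" using bounded_linear.pos_bounded[OF bl] by blast
  define \<epsilon> where "\<epsilon> = ((\<delta> + c\<^sup>2 * E) * (E - \<delta>) - (c * E)\<^sup>2) / ((\<delta> + c\<^sup>2 * E) + (E - \<delta>))"
  have det: "(\<delta> + c\<^sup>2 * E) * (E - \<delta>) - (c * E)\<^sup>2 = \<delta>\<^sup>2"
    by (simp add: \<delta>_def power2_eq_square field_simps)
  have pos: "0 < \<delta> + c\<^sup>2 * E" "0 < E - \<delta>" using \<delta> E \<delta>E by (auto simp: add_pos_nonneg)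
  have \<epsilon>: "0 < \<epsilon>" unfolding \<epsilon>_def det using \<delta> pos by simp
  define \<theta> where "\<theta> = min (\<epsilon> / k0\<^sup>2) (1 / 2)"
  have \<theta>: "0 < \<theta>" "\<theta> < 1" using \<epsilon> k0 by (auto simp: \<theta>_def)
  have dec: "(norm (J (T *\<^sub>R a - \<beta> *\<^sub>R b, a)))\<^sup>2 \<le> (1 - \<theta>) * (norm (J (a, b)))\<^sup>2" for a b
  proof -
    have "(norm (J (a, b)))\<^sup>2 - (norm (J (T *\<^sub>R a - \<beta> *\<^sub>R b, a)))\<^sup>2
        = (\<delta> + c\<^sup>2 * E) * (norm a)\<^sup>2 - 2 * (c * E) * (a \<bullet> b) + (E - \<delta>) * (norm b)\<^sup>2"
      unfolding J2[of "(a, b)", unfolded fst_conv snd_conv]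
        J2[of "(T *\<^sub>R a - \<beta> *\<^sub>R b, a)", unfolded fst_conv snd_conv]
      unfolding power2_norm_eq_inner Tc q_def E_def
      by (simp add: inner_diff inner_commute power2_eq_square algebra_simps)
    also have "\<dots> \<ge> \<epsilon> * ((norm a)\<^sup>2 + (norm b)\<^sup>2)"
    proof -
      have "0 < \<delta>\<^sup>2" using \<delta> by simp
      then have "(c * E)\<^sup>2 < (\<delta> + c\<^sup>2 * E) * (E - \<delta>)" using det by linarith
      then show ?thesis unfolding \<epsilon>_def by (rule quadratic_form_lower[OF pos])
    qed
    finally have "\<epsilon> * (norm (a, b))\<^sup>2 \<le> (norm (J (a, b)))\<^sup>2 - (norm (J (T *\<^sub>R a - \<beta> *\<^sub>R b, a)))\<^sup>2"
      by (simp add: norm_Pair_power2)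
    moreover have "\<theta> * (norm (J (a, b)))\<^sup>2 \<le> \<epsilon> * (norm (a, b))\<^sup>2"
    proof -
      have "(norm (J (a, b)))\<^sup>2 \<le> (norm (a, b) * k0)\<^sup>2" by (intro power_mono k0) auto
      then have "\<theta> * (norm (J (a, b)))\<^sup>2 \<le> (\<epsilon> / k0\<^sup>2) * (norm (a, b) * k0)\<^sup>2"
        using \<theta> \<epsilon> k0 by (intro mult_mono) (auto simp: \<theta>_def)
      then show ?thesis using k0(2) by (simp add: power_mult_distrib)
    qed
    ultimately show ?thesis by (simp add: algebra_simps)
  qed
  show thesis
  proof (rule that[OF bl])
    show "0 < sqrt (1 - \<theta>)" "sqrt (1 - \<theta>) < 1" using \<theta> by auto
    show "0 < sqrt m2" "0 < k0" using m2 k0 by auto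
    show "sqrt m2 * norm z \<le> norm (J z)" for z
      by (rule power2_le_imp_le) (use low[of z] m2 in \<open>auto simp: power_mult_distrib\<close>)
    show "norm (J z) \<le> k0 * norm z" for z using k0(1)[of z] by (simp add: mult.commute)
    show "norm (J (T *\<^sub>R a - \<beta> *\<^sub>R b, a)) \<le> sqrt (1 - \<theta>) * norm (J (a, b))" for a b
      by (rule power2_le_imp_le) (use dec[of a b] \<theta> in \<open>auto simp: power_mult_distrib\<close>)
  qed
qed

text \<open>For a bounded perturbation of a linear force the squared contracting norm satisfies a drift
  inequality whose additive constant depends on the bound \<open>B\<close> of the perturbation only through
  \<open>1 + B\<^sup>2\<close>; this gives moments of the correct order after dilation of the potential.\<close>

lemma heavy_ball_drift:
  fixes J :: "'a::euclidean_space \<times> 'a \<Rightarrow> 'a \<times> 'a"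
  assumes \<nu>: "smooth_noise \<nu>" and J: "bounded_linear J" and r: "0 < r" "r < 1" and k: "0 < k"
    and Jk: "\<And>z. norm (J z) \<le> k * norm z"
    and Jr: "\<And>a b. norm (J ((1 + \<beta> - s * l) *\<^sub>R a - \<beta> *\<^sub>R b, a)) \<le> r * norm (J (a, b))"
    and s: "0 \<le> s"
  obtains D where "0 < D" "\<And>G g B z. G \<in> borel_measurable borel \<Longrightarrow> 0 \<le> B \<Longrightarrow>
      (\<And>x. G x = l *\<^sub>R x + g x) \<Longrightarrow> (\<And>x. norm (g x) \<le> B) \<Longrightarrow>
      (\<integral>\<^sup>+w. ennreal ((norm (J w))\<^sup>2) \<partial>noisy_heavy_ball \<beta> s G e f \<nu> z) \<le> ennreal (r * (norm (J z))\<^sup>2 + D * (1 + B\<^sup>2))"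
proof -
  interpret smooth_noise \<nu> by (rule \<nu>)
  obtain M where M: "M \<ge> 0" "(\<integral>\<^sup>+x. ennreal ((norm x)\<^sup>2) \<partial>\<nu>) \<le> ennreal M" using second_moment by blast
  define p where "p = k * s"
  define t where "t = k * (\<bar>e\<bar> + \<bar>f\<bar>)"
  have pt: "0 \<le> p" "0 \<le> t" using k s by (auto simp: p_def t_def)
  define D where "D = (2 * p\<^sup>2 + 2 * t\<^sup>2 * M + 1) / (1 - r)"
  have D0: "0 < D" unfolding D_def using r M by (intro divide_pos_pos add_nonneg_pos) auto
  show thesis
  proof (rule that[OF D0])
    fix G g :: "'a \<Rightarrow> 'a" and B and z :: "'a \<times> 'a"
    assume Gm [measurable]: "G \<in> borel_measurable borel" and B: "0 \<le> B"
      and G: "\<And>x. G x = l *\<^sub>R x + g x" and g: "\<And>x. norm (g x) \<le> B"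
    have Jm [measurable]: "J \<in> borel_measurable borel"
      using linear_continuous_on[OF J] by (rule borel_measurable_continuous_onI)
    have pt_bound: "(norm (J (heavy_ball \<beta> s G z + (e *\<^sub>R N, f *\<^sub>R N))))\<^sup>2
       \<le> (r * (norm (J z))\<^sup>2 + 2 * p\<^sup>2 * B\<^sup>2 / (1 - r)) + 2 * t\<^sup>2 / (1 - r) * (norm N)\<^sup>2" for N
    proof -
      have split: "heavy_ball \<beta> s G z + (e *\<^sub>R N, f *\<^sub>R N)
          = ((1 + \<beta> - s * l) *\<^sub>R fst z - \<beta> *\<^sub>R snd z, fst z) + ((- s) *\<^sub>R g (fst z), 0) + (e *\<^sub>R N, f *\<^sub>R N)"
        by (simp add: heavy_ball_def G algebra_simps)
      have n1: "norm (J ((- s) *\<^sub>R g (fst z), 0)) \<le> p * B"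
      proof -
        have "norm (((- s) *\<^sub>R g (fst z), 0) :: 'a \<times> 'a) \<le> s * B"
          using g[of "fst z"] s by (simp add: norm_Pair mult_left_mono)
        then have "k * norm (((- s) *\<^sub>R g (fst z), 0) :: 'a \<times> 'a) \<le> k * (s * B)" using k by (intro mult_left_mono) auto
        then show ?thesis using Jk[of "((- s) *\<^sub>R g (fst z), 0)"] by (simp add: p_def mult.assoc)
      qed
      have n2: "norm (J (e *\<^sub>R N, f *\<^sub>R N)) \<le> t * norm N"
      proof -
        have "norm (e *\<^sub>R N, f *\<^sub>R N) \<le> (\<bar>e\<bar> + \<bar>f\<bar>) * norm N"
          using norm_Pair_le[of "e *\<^sub>R N" "f *\<^sub>R N"] by (simp add: algebra_simps)
        then have "k * norm (e *\<^sub>R N, f *\<^sub>R N) \<le> k * ((\<bar>e\<bar> + \<bar>f\<bar>) * norm N)" using k by (intro mult_left_mono) auto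
        then show ?thesis using Jk[of "(e *\<^sub>R N, f *\<^sub>R N)"] by (simp add: t_def mult.assoc)
      qed
      define x where "x = norm (J z)"
      define X where "X = p * B + t * norm N"
      have "norm (J (heavy_ball \<beta> s G z + (e *\<^sub>R N, f *\<^sub>R N)))
         \<le> norm (J ((1 + \<beta> - s * l) *\<^sub>R fst z - \<beta> *\<^sub>R snd z, fst z)) + norm (J ((- s) *\<^sub>R g (fst z), 0)) + norm (J (e *\<^sub>R N, f *\<^sub>R N))"
        unfolding split linear_add[OF bounded_linear.linear[OF J]]
        by (intro order_trans[OF norm_triangle_ineq] add_mono order_refl norm_triangle_ineq)
      also have "\<dots> \<le> r * x + X"
        using Jr[of "fst z" "snd z"] n1 n2 by (simp add: x_def X_def)
      finally have "(norm (J (heavy_ball \<beta> s G z + (e *\<^sub>R N, f *\<^sub>R N))))\<^sup>2 \<le> (r * x + X)\<^sup>2" by (intro power_mono) auto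
      also have "\<dots> \<le> r * x\<^sup>2 + X\<^sup>2 / (1 - r)"
      proof -
        have "0 \<le> r * ((1 - r) * x - X)\<^sup>2 / (1 - r)" using r by simp
        also have "r * ((1 - r) * x - X)\<^sup>2 / (1 - r) = r * x\<^sup>2 + X\<^sup>2 / (1 - r) - (r * x + X)\<^sup>2"
          using r by (simp add: field_simps power2_eq_square)
        finally show ?thesis by simp
      qed
      also have "X\<^sup>2 \<le> 2 * (p * B)\<^sup>2 + 2 * (t * norm N)\<^sup>2"
        using sum_squares_bound[of "p * B" "t * norm N"] unfolding X_def power2_sum by linarith
      also have "\<dots> = 2 * p\<^sup>2 * B\<^sup>2 + 2 * t\<^sup>2 * (norm N)\<^sup>2" by (simp add: power_mult_distrib)
      finally show ?thesis using r by (simp add: x_def add_divide_distrib divide_right_mono)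
    qed
    have "(\<integral>\<^sup>+w. ennreal ((norm (J w))\<^sup>2) \<partial>noisy_heavy_ball \<beta> s G e f \<nu> z)
        = (\<integral>\<^sup>+N. ennreal ((norm (J (heavy_ball \<beta> s G z + (e *\<^sub>R N, f *\<^sub>R N))))\<^sup>2) \<partial>\<nu>)"
      by (rule nn_integral_noisy_heavy_ball[OF law Gm]) measurable
    also have "\<dots> \<le> (\<integral>\<^sup>+N. ennreal (r * (norm (J z))\<^sup>2 + 2 * p\<^sup>2 * B\<^sup>2 / (1 - r)) + ennreal (2 * t\<^sup>2 / (1 - r)) * ennreal ((norm N)\<^sup>2) \<partial>\<nu>)"
      using pt_bound r by (intro nn_integral_mono) (simp flip: ennreal_plus ennreal_mult add: ennreal_leI)
    also have "\<dots> = ennreal (r * (norm (J z))\<^sup>2 + 2 * p\<^sup>2 * B\<^sup>2 / (1 - r)) + ennreal (2 * t\<^sup>2 / (1 - r)) * (\<integral>\<^sup>+N. ennreal ((norm N)\<^sup>2) \<partial>\<nu>)"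
      by (simp add: nn_integral_add nn_integral_cmult emeasure_space_1[simplified])
    also have "\<dots> \<le> ennreal (r * (norm (J z))\<^sup>2 + 2 * p\<^sup>2 * B\<^sup>2 / (1 - r)) + ennreal (2 * t\<^sup>2 / (1 - r)) * ennreal M"
      using M by (intro add_left_mono mult_left_mono) auto
    also have "\<dots> = ennreal ((r * (norm (J z))\<^sup>2 + 2 * p\<^sup>2 * B\<^sup>2 / (1 - r)) + 2 * t\<^sup>2 / (1 - r) * M)"
      using r M by (simp flip: ennreal_plus ennreal_mult)
    also have "\<dots> \<le> ennreal (r * (norm (J z))\<^sup>2 + D * (1 + B\<^sup>2))"
    proof (rule ennreal_leI)
      have "2 * p\<^sup>2 * B\<^sup>2 + 2 * t\<^sup>2 * M \<le> (2 * p\<^sup>2 + 2 * t\<^sup>2 * M + 1) * (1 + B\<^sup>2)"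
        using M by (simp add: algebra_simps)
      then have "(2 * p\<^sup>2 * B\<^sup>2 + 2 * t\<^sup>2 * M) / (1 - r) \<le> (2 * p\<^sup>2 + 2 * t\<^sup>2 * M + 1) * (1 + B\<^sup>2) / (1 - r)"
        using r by (intro divide_right_mono) auto
      moreover have "2 * p\<^sup>2 * B\<^sup>2 / (1 - r) + 2 * t\<^sup>2 / (1 - r) * M = (2 * p\<^sup>2 * B\<^sup>2 + 2 * t\<^sup>2 * M) / (1 - r)"
        by (simp add: add_divide_distrib)
      moreover have "(2 * p\<^sup>2 + 2 * t\<^sup>2 * M + 1) * (1 + B\<^sup>2) / (1 - r) = D * (1 + B\<^sup>2)" by (simp add: D_def)
      ultimately show "(r * (norm (J z))\<^sup>2 + 2 * p\<^sup>2 * B\<^sup>2 / (1 - r)) + 2 * t\<^sup>2 / (1 - r) * M \<le> r * (norm (J z))\<^sup>2 + D * (1 + B\<^sup>2)"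
        by linarith
    qed
    finally show "(\<integral>\<^sup>+w. ennreal ((norm (J w))\<^sup>2) \<partial>noisy_heavy_ball \<beta> s G e f \<nu> z) \<le> ennreal (r * (norm (J z))\<^sup>2 + D * (1 + B\<^sup>2))" .
  qed
qed

subsection \<open>Two steps of the chain have a common part\<close>

lemma cball_borel [measurable]: "cball (x::'a::metric_space) r \<in> sets borel"
  by (rule borel_closed) simp

text \<open>The Jacobian is bounded on the compact ball, so a set covered by the image of the ball is at most a
  fixed factor larger than the part of the ball that covers it.\<close>

lemma differentiable_image_measure_bound:
  fixes \<Phi> :: "real^2 \<Rightarrow> real^2"
  assumes deriv: "\<And>x. (\<Phi> has_derivative \<Phi>' x) (at x)"
    and cont: "\<And>v. continuous_on UNIV (\<lambda>x. \<Phi>' x v)"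
  obtains B where "0 < B" "\<And>A. A \<in> sets borel \<Longrightarrow> A \<subseteq> \<Phi> ` cball 0 \<rho> \<Longrightarrow>
    emeasure lborel A \<le> ennreal B * emeasure lborel {x \<in> cball 0 \<rho>. \<Phi> x \<in> A}"
proof -
  have "continuous_on UNIV (\<lambda>x. Determinants.det (matrix (\<Phi>' x)))"
    unfolding Determinants.det_def matrix_def
    by (intro continuous_intros) (auto intro!: continuous_intros cont)
  then have dc: "continuous_on S (\<lambda>x. \<bar>Determinants.det (matrix (\<Phi>' x))\<bar>)" for S
    by (intro continuous_intros) (auto intro: continuous_on_subset)
  have "bounded ((\<lambda>x. \<bar>Determinants.det (matrix (\<Phi>' x))\<bar>) ` cball 0 \<rho>)"
    by (intro compact_imp_bounded compact_continuous_image dc) auto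
  then obtain B0 where B0: "\<And>x. x \<in> cball 0 \<rho> \<Longrightarrow> \<bar>Determinants.det (matrix (\<Phi>' x))\<bar> \<le> B0"
    unfolding bounded_iff by fastforce
  define B where "B = max B0 1"
  have contPhi: "continuous_on S \<Phi>" for S
    using deriv by (meson continuous_at_imp_continuous_on has_derivative_continuous)
  have "emeasure lborel A \<le> ennreal B * emeasure lborel {x \<in> cball 0 \<rho>. \<Phi> x \<in> A}"
    if A [measurable]: "A \<in> sets borel" and sub: "A \<subseteq> \<Phi> ` cball 0 \<rho>" for A
  proof -
    let ?S = "{x \<in> cball 0 \<rho>. \<Phi> x \<in> A}"
    have [measurable]: "\<Phi> \<in> borel_measurable borel"
      using contPhi by (rule borel_measurable_continuous_onI)
    have S [measurable]: "?S \<in> sets borel" by measurable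
    have fin: "emeasure lborel ?S < \<infinity>"
      using emeasure_lborel_cball_finite[of "0::real^2" \<rho>]
      by (rule le_less_trans[rotated]) (auto intro!: emeasure_mono)
    have lm: "?S \<in> lmeasurable" using S fin by (intro fmeasurableI) auto
    obtain u v where uv: "cball (0::real^2) \<rho> \<subseteq> cbox u v"
      using bounded_subset_cbox_symmetric[OF bounded_cball] by blast
    have ab: "(\<lambda>x. \<bar>Determinants.det (matrix (\<Phi>' x))\<bar>) absolutely_integrable_on ?S"
    proof (rule set_integrable_subset)
      show "(\<lambda>x. \<bar>Determinants.det (matrix (\<Phi>' x))\<bar>) absolutely_integrable_on cbox u v"
        by (rule absolutely_integrable_continuous[OF dc])
      show "?S \<subseteq> cbox u v" using uv by auto
      show "?S \<in> sets lebesgue" using S by auto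
    qed
    have im: "\<Phi> ` ?S = A" using sub by auto
    have "measure lebesgue (\<Phi> ` ?S) \<le> B * measure lebesgue ?S"
    proof (rule measure_bounded_differentiable_image[OF lm])
      show "(\<Phi> has_derivative \<Phi>' x) (at x within ?S)" for x
        using deriv[of x] by (rule has_derivative_at_withinI)
      show "(\<lambda>x. \<bar>Determinants.det (matrix (\<Phi>' x))\<bar>) integrable_on ?S"
        using ab by (rule set_lebesgue_integral_eq_integral(1))
      show "\<bar>Determinants.det (matrix (\<Phi>' x))\<bar> \<le> B" if "x \<in> ?S" for x using B0[of x] that by (auto simp: B_def)
    qed
    then have le: "measure lborel A \<le> B * measure lborel ?S"
      unfolding im using A S by simp
    have "compact (\<Phi> ` cball 0 \<rho>)" by (intro compact_continuous_image contPhi) auto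
    then have finA: "emeasure lborel A < \<infinity>"
      using emeasure_compact_finite emeasure_mono[OF sub] by (metis borel_compact le_less_trans sets_lborel)
    show ?thesis
      using le fin finA by (simp add: emeasure_eq_ennreal_measure B_def flip: ennreal_mult)
  qed
  moreover have "0 < B" by (simp add: B_def)
  ultimately show thesis using that by blast
qed

text \<open>A preimage of \<open>u\<close> is a fixed point of the contraction \<open>x \<mapsto> (u + H x) / \<omega>\<close>.\<close>

lemma lipschitz_perturbation_surjective:
  fixes H :: "'a::euclidean_space \<Rightarrow> 'a"
  assumes L: "0 \<le> L" "L < \<omega>" and H: "\<And>x y. norm (H x - H y) \<le> L * norm (x - y)"
    and \<rho>: "(R + norm (H 0)) / (\<omega> - L) \<le> \<rho>"
  shows "cball 0 R \<subseteq> (\<lambda>x. \<omega> *\<^sub>R x - H x) ` cball 0 \<rho>"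
proof
  fix u :: 'a assume u: "u \<in> cball 0 R"
  have \<omega>: "0 < \<omega>" using L by simp
  have "\<exists>!x. (1 / \<omega>) *\<^sub>R (u + H x) = x"
  proof (rule banach_fix_type[of "L / \<omega>"])
    show "\<forall>x y. dist ((1 / \<omega>) *\<^sub>R (u + H x)) ((1 / \<omega>) *\<^sub>R (u + H y)) \<le> L / \<omega> * dist x y"
    proof (intro allI)
      fix x y
      have "dist ((1 / \<omega>) *\<^sub>R (u + H x)) ((1 / \<omega>) *\<^sub>R (u + H y)) = (1 / \<omega>) * norm (H x - H y)"
        using \<omega> by (simp add: dist_norm flip: scaleR_diff_right)
      also have "\<dots> \<le> (1 / \<omega>) * (L * norm (x - y))" using H \<omega> by (intro mult_left_mono) auto
      finally show "dist ((1 / \<omega>) *\<^sub>R (u + H x)) ((1 / \<omega>) *\<^sub>R (u + H y)) \<le> L / \<omega> * dist x y"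
        by (simp add: dist_norm)
    qed
  qed (use L \<omega> in auto)
  then obtain x where x: "(1 / \<omega>) *\<^sub>R (u + H x) = x" by blast
  have "\<omega> *\<^sub>R ((1 / \<omega>) *\<^sub>R (u + H x)) = u + H x" using \<omega> by simp
  then have eq: "\<omega> *\<^sub>R x = u + H x" unfolding x .
  have "\<omega> * norm x = norm (\<omega> *\<^sub>R x)" using \<omega> by simp
  also have "\<dots> = norm (u + H x)" unfolding eq ..
  also have "\<dots> \<le> norm u + (norm (H x - H 0) + norm (H 0))"
    using norm_triangle_ineq[of u "H x"] norm_triangle_sub[of "H x" "H 0"] by linarith
  also have "\<dots> \<le> R + (L * norm x + norm (H 0))" using H[of x 0] u by auto
  finally have "(\<omega> - L) * norm x \<le> R + norm (H 0)" by (simp add: algebra_simps)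
  then have "norm x \<le> (R + norm (H 0)) / (\<omega> - L)" using L by (simp add: pos_le_divide_eq mult.commute)
  then have "norm x \<le> \<rho>" using \<rho> by linarith
  then show "u \<in> (\<lambda>x. \<omega> *\<^sub>R x - H x) ` cball 0 \<rho>" using eq by (auto intro!: image_eqI[of _ _ x])
qed

lemma (in smooth_noise) lower_nn_integral:
  obtains k where "0 < k" "\<And>\<phi>. \<phi> \<in> borel_measurable borel \<Longrightarrow>
    ennreal k * (\<integral>\<^sup>+x. \<phi> x * indicator (cball 0 r) x \<partial>lborel) \<le> (\<integral>\<^sup>+x. \<phi> x \<partial>\<nu>)"
proof -
  obtain k where k: "0 < k" "\<And>A. A \<in> sets borel \<Longrightarrow> A \<subseteq> cball 0 r \<Longrightarrow> ennreal k * emeasure lborel A \<le> emeasure \<nu> A"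
    using lower[of r] by blast
  let ?m = "density lborel (\<lambda>x. ennreal k * indicator (cball 0 r) x) :: 'a measure"
  have le: "?m \<le> \<nu>"
  proof (subst le_measure)
    show "\<forall>A\<in>sets ?m. emeasure ?m A \<le> emeasure \<nu> A"
    proof
      fix A :: "'a set" assume "A \<in> sets ?m"
      then have A [measurable]: "A \<in> sets borel" by simp
      have "emeasure ?m A = (\<integral>\<^sup>+x. ennreal k * indicator (A \<inter> cball 0 r) x \<partial>lborel)"
        by (subst emeasure_density) (auto intro!: nn_integral_cong simp: indicator_def)
      also have "\<dots> = ennreal k * emeasure lborel (A \<inter> cball 0 r)" by (rule nn_integral_cmult_indicator) auto
      also have "\<dots> \<le> emeasure \<nu> (A \<inter> cball 0 r)" by (rule k(2)) auto
      also have "\<dots> \<le> emeasure \<nu> A" by (rule emeasure_mono) auto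
      finally show "emeasure ?m A \<le> emeasure \<nu> A" .
    qed
  qed simp
  show thesis
  proof (rule that[OF k(1)])
    fix \<phi> :: "'a \<Rightarrow> ennreal" assume [measurable]: "\<phi> \<in> borel_measurable borel"
    have "ennreal k * (\<integral>\<^sup>+x. \<phi> x * indicator (cball 0 r) x \<partial>lborel) = (\<integral>\<^sup>+x. ennreal k * indicator (cball 0 r) x * \<phi> x \<partial>lborel)"
    proof -
      have "(\<lambda>x. \<phi> x * indicator (cball 0 r) x) \<in> borel_measurable borel" by measurable
      then show ?thesis by (subst nn_integral_cmult[symmetric]) (auto intro!: nn_integral_cong simp: mult_ac)
    qed
    also have "\<dots> = (\<integral>\<^sup>+x. \<phi> x \<partial>?m)" by (rule nn_integral_density[symmetric]) auto
    also have "\<dots> \<le> (\<integral>\<^sup>+x. \<phi> x \<partial>\<nu>)" by (rule nn_integral_mono_measure[OF _ le]) simp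
    finally show "ennreal k * (\<integral>\<^sup>+x. \<phi> x * indicator (cball 0 r) x \<partial>lborel) \<le> (\<integral>\<^sup>+x. \<phi> x \<partial>\<nu>)" .
  qed
qed

lemma nn_integral_lborel_scale:
  fixes f :: "'a::euclidean_space \<Rightarrow> ennreal"
  assumes [measurable]: "f \<in> borel_measurable borel" and "0 < e"
  shows "(\<integral>\<^sup>+x. f x \<partial>lborel) = ennreal (e ^ DIM('a)) * (\<integral>\<^sup>+x. f (t + e *\<^sub>R x) \<partial>lborel)"
proof -
  have "(\<integral>\<^sup>+x. f x \<partial>lborel) = (\<integral>\<^sup>+x. f x \<partial>density (distr lborel borel (\<lambda>x. t + e *\<^sub>R x)) (\<lambda>_. ennreal (\<bar>e\<bar> ^ DIM('a))))"
    using lborel_affine[of e t] assms by simp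
  also have "\<dots> = ennreal (e ^ DIM('a)) * (\<integral>\<^sup>+x. f x \<partial>distr lborel borel (\<lambda>x. t + e *\<^sub>R x))"
    using assms(2) by (subst nn_integral_density) (auto simp: nn_integral_cmult)
  also have "(\<integral>\<^sup>+x. f x \<partial>distr lborel borel (\<lambda>x. t + e *\<^sub>R x)) = (\<integral>\<^sup>+x. f (t + e *\<^sub>R x) \<partial>lborel)"
    by (rule nn_integral_distr) auto
  finally show ?thesis .
qed

text \<open>A Gaussian-like law dominates Lebesgue measure on a ball, also after an affine change of variable
  whose offset stays in a bounded set.\<close>

lemma (in smooth_noise) lower_affine:
  assumes e: "0 < e"
  obtains k where "0 < k" "\<And>\<phi> t. \<phi> \<in> borel_measurable borel \<Longrightarrow> norm t \<le> m \<Longrightarrow>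
    ennreal k * (\<integral>\<^sup>+x. \<phi> x * indicator (cball 0 \<rho>) x \<partial>lborel) \<le> (\<integral>\<^sup>+N. \<phi> (t + e *\<^sub>R N) \<partial>\<nu>)"
proof -
  obtain k where k: "0 < k" "\<And>\<phi>. \<phi> \<in> borel_measurable borel \<Longrightarrow>
    ennreal k * (\<integral>\<^sup>+x. \<phi> x * indicator (cball 0 ((\<rho> + m) / e)) x \<partial>lborel) \<le> (\<integral>\<^sup>+x. \<phi> x \<partial>\<nu>)"
    using lower_nn_integral[of "(\<rho> + m) / e" thesis] by blast
  let ?d = "e ^ DIM('a)"
  show thesis
  proof (rule that)
    show "0 < k / ?d" using k e by simp
    fix \<phi> :: "'a \<Rightarrow> ennreal" and t :: 'a
    assume \<phi> [measurable]: "\<phi> \<in> borel_measurable borel" and t: "norm t \<le> m"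
    have "(\<integral>\<^sup>+x. \<phi> x * indicator (cball 0 \<rho>) x \<partial>lborel)
        = ennreal ?d * (\<integral>\<^sup>+x. \<phi> (t + e *\<^sub>R x) * indicator (cball 0 \<rho>) (t + e *\<^sub>R x) \<partial>lborel)"
      by (rule nn_integral_lborel_scale[OF _ e]) measurable
    also have "\<dots> \<le> ennreal ?d * (\<integral>\<^sup>+x. \<phi> (t + e *\<^sub>R x) * indicator (cball 0 ((\<rho> + m) / e)) x \<partial>lborel)"
    proof (rule mult_left_mono[OF nn_integral_mono])
      fix x :: 'a
      have "norm x \<le> (\<rho> + m) / e" if "norm (t + e *\<^sub>R x) \<le> \<rho>"
      proof -
        have "e * norm x \<le> norm (t + e *\<^sub>R x) + norm t"
          using norm_triangle_ineq4[of "t + e *\<^sub>R x" t] e by simp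
        then show ?thesis using that t e by (simp add: field_simps)
      qed
      then show "\<phi> (t + e *\<^sub>R x) * indicator (cball 0 \<rho>) (t + e *\<^sub>R x) \<le> \<phi> (t + e *\<^sub>R x) * indicator (cball 0 ((\<rho> + m) / e)) x"
        by (auto simp: indicator_def)
    qed auto
    finally have "ennreal (k / ?d) * (\<integral>\<^sup>+x. \<phi> x * indicator (cball 0 \<rho>) x \<partial>lborel)
        \<le> ennreal (k / ?d) * (ennreal ?d * (\<integral>\<^sup>+x. \<phi> (t + e *\<^sub>R x) * indicator (cball 0 ((\<rho> + m) / e)) x \<partial>lborel))"
      by (rule mult_left_mono) auto
    also have "\<dots> = ennreal k * (\<integral>\<^sup>+x. \<phi> (t + e *\<^sub>R x) * indicator (cball 0 ((\<rho> + m) / e)) x \<partial>lborel)"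
      using k e by (simp flip: mult.assoc ennreal_mult)
    also have "\<dots> \<le> (\<integral>\<^sup>+N. \<phi> (t + e *\<^sub>R N) \<partial>\<nu>)" by (rule k(2)) measurable
    finally show "ennreal (k / ?d) * (\<integral>\<^sup>+x. \<phi> x * indicator (cball 0 \<rho>) x \<partial>lborel) \<le> (\<integral>\<^sup>+N. \<phi> (t + e *\<^sub>R N) \<partial>\<nu>)" .
  qed
qed

text \<open>Two steps of the chain draw two noise vectors. The second one places the new position \<open>t\<close>, and
  eliminating it leaves the other component as an affine function of \<open>t\<close> plus \<open>\<Phi>\<close> of the
  intermediate position. The map \<open>\<Phi>\<close> is a small Lipschitz perturbation of a multiple of the
  identity, so its image covers a ball and it cannot compress Lebesgue measure there.\<close>

lemma noisy_heavy_ball_minorised: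
  fixes G :: "real^2 \<Rightarrow> real^2"
  assumes \<nu>: "smooth_noise \<nu>" and e: "0 < e" and \<phi>: "0 \<le> \<phi>" and s: "0 \<le> s" and \<beta>: "0 \<le> \<beta>" and \<kappa>: "0 \<le> \<kappa>"
    and deriv: "\<And>x. (G has_derivative G' x) (at x)" and cont: "\<And>v. continuous_on UNIV (\<lambda>x. G' x v)"
    and lip: "\<And>x y. norm (G x - G y) \<le> \<kappa> * norm (x - y)"
    and small: "\<phi> * s * \<kappa> < (1 + \<phi>) * (1 + \<beta> * \<phi>)"
  defines "S \<equiv> noisy_heavy_ball \<beta> s G e (- \<phi> * e) \<nu>"
  shows "\<exists>\<eta> a. sets \<eta> = sets borel \<and> emeasure \<eta> UNIV = ennreal a \<and> 0 < a \<and>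
    (\<forall>z A. norm z \<le> r \<longrightarrow> A \<in> sets borel \<longrightarrow> emeasure \<eta> A \<le> emeasure (bind (S z) S) A)"
proof -
  interpret smooth_noise \<nu> by (rule \<nu>)
  have "continuous_on UNIV G"
    using deriv by (meson continuous_at_imp_continuous_on has_derivative_continuous)
  then have Gm [measurable]: "G \<in> borel_measurable borel" by (rule borel_measurable_continuous_onI)
  have Sk: "markov_kernel S" unfolding S_def by (rule noisy_heavy_ball_kernel[OF law Gm])
  define \<omega> where "\<omega> = (1 + \<phi>) * (1 + \<beta> * \<phi>)"
  define H where "H x = (\<phi> * s) *\<^sub>R G x" for x
  define \<Phi> where "\<Phi> x = \<omega> *\<^sub>R x - H x" for x
  define L where "L = \<phi> * s * \<kappa>"
  have L: "0 \<le> L" "L < \<omega>" using \<phi> s \<kappa> small by (auto simp: L_def \<omega>_def)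
  have Hlip: "norm (H x - H y) \<le> L * norm (x - y)" for x y
  proof -
    have "norm (H x - H y) = \<phi> * s * norm (G x - G y)"
      using \<phi> s by (simp add: H_def flip: scaleR_diff_right)
    also have "\<dots> \<le> \<phi> * s * (\<kappa> * norm (x - y))" using \<phi> s lip by (intro mult_left_mono) auto
    finally show ?thesis by (simp add: L_def mult.assoc)
  qed
  have Gb: "norm (G x) \<le> norm (G 0) + \<kappa> * norm x" for x
    using lip[of x 0] norm_triangle_sub[of "G x" "G 0"] by simp
  (* Uniform bounds over the starting ball: m1 for the noiseless image, m2 for the offset cz, \<rho> for a ball whose
     image under \<Phi> covers a translated unit ball, m3 and m4 for the components b x and F x of the second step. *)
  define r0 where "r0 = max r 0"
  define m1 where "m1 = (1 + \<beta>) * r0 + \<beta> * r0 + s * (norm (G 0) + \<kappa> * r0)"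
  define m2 where "m2 = \<phi> * \<beta> * (r0 + \<phi> * m1)"
  define \<rho> where "\<rho> = (1 + m2 + norm (H 0)) / (\<omega> - L)"
  define m3 where "m3 = r0 + \<phi> * (\<rho> + m1)"
  define m4 where "m4 = (1 + \<beta>) * \<rho> + \<beta> * m3 + s * (norm (G 0) + \<kappa> * \<rho>)"
  have step_bound: "norm ((1 + \<beta>) *\<^sub>R x - \<beta> *\<^sub>R y - s *\<^sub>R G x) \<le> (1 + \<beta>) * p + \<beta> * q + s * (norm (G 0) + \<kappa> * p)"
    if "norm x \<le> p" "norm y \<le> q" for x y p q
  proof -
    have "norm ((1 + \<beta>) *\<^sub>R x - \<beta> *\<^sub>R y - s *\<^sub>R G x) \<le> (1 + \<beta>) * norm x + \<beta> * norm y + s * norm (G x)"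
      using norm_triangle_ineq4[of "(1 + \<beta>) *\<^sub>R x - \<beta> *\<^sub>R y" "s *\<^sub>R G x"] norm_triangle_ineq4[of "(1 + \<beta>) *\<^sub>R x" "\<beta> *\<^sub>R y"] \<beta> s
      by simp
    also have "s * norm (G x) \<le> s * (norm (G 0) + \<kappa> * p)"
      using Gb[of x] mult_left_mono[OF that(1) \<kappa>] s by (intro mult_left_mono) linarith+
    finally show ?thesis using mult_left_mono[OF that(1), of "1 + \<beta>"] mult_left_mono[OF that(2) \<beta>] \<beta> by linarith
  qed
  have \<Phi>deriv: "(\<Phi> has_derivative (\<lambda>v. \<omega> *\<^sub>R v - (\<phi> * s) *\<^sub>R G' x v)) (at x)" for x
    unfolding \<Phi>_def H_def by (intro derivative_intros deriv)
  have \<Phi>cont: "continuous_on UNIV (\<lambda>x. \<omega> *\<^sub>R v - (\<phi> * s) *\<^sub>R G' x v)" for v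
    by (intro continuous_intros cont)
  have \<Phi>m [measurable]: "\<Phi> \<in> borel_measurable borel" unfolding \<Phi>_def H_def by measurable
  obtain B where B: "0 < B" "\<And>A. A \<in> sets borel \<Longrightarrow> A \<subseteq> \<Phi> ` cball 0 \<rho> \<Longrightarrow>
    emeasure lborel A \<le> ennreal B * emeasure lborel {x \<in> cball 0 \<rho>. \<Phi> x \<in> A}"
    using differentiable_image_measure_bound[OF \<Phi>deriv \<Phi>cont, of \<rho> thesis] by blast
  have surj: "cball 0 (1 + m2) \<subseteq> \<Phi> ` cball 0 \<rho>"
    unfolding \<Phi>_def by (rule lipschitz_perturbation_surjective[OF L Hlip]) (simp add: \<rho>_def)
  obtain k1 where k1: "0 < k1" "\<And>g t. g \<in> borel_measurable borel \<Longrightarrow> norm t \<le> m1 \<Longrightarrow>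
    ennreal k1 * (\<integral>\<^sup>+x. g x * indicator (cball 0 \<rho>) x \<partial>lborel) \<le> (\<integral>\<^sup>+N. g (t + e *\<^sub>R N) \<partial>\<nu>)"
    using lower_affine[OF e, of m1 \<rho> thesis] by blast
  obtain k2 where k2: "0 < k2" "\<And>g t. g \<in> borel_measurable borel \<Longrightarrow> norm t \<le> m4 \<Longrightarrow>
    ennreal k2 * (\<integral>\<^sup>+x. g x * indicator (cball 0 1) x \<partial>lborel) \<le> (\<integral>\<^sup>+N. g (t + e *\<^sub>R N) \<partial>\<nu>)"
    using lower_affine[OF e, of m4 1 thesis] by blast
  define k where "k = k1 * k2 / B"
  have k: "0 < k" using k1 k2 B by (simp add: k_def)
  let ?c = "cball (0 :: real^2) 1"
  define h where "h w = (fst w, snd w - \<phi> *\<^sub>R fst w)" for w :: "(real^2) \<times> (real^2)"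
  have hm [measurable]: "h \<in> borel_measurable borel" unfolding h_def by (rule borel_measurable_Pair_iff) measurable
  define \<eta> where "\<eta> = distr (density lborel (\<lambda>w. ennreal k * indicator (?c \<times> ?c) w)) borel h"
  have cc [measurable]: "?c \<times> ?c \<in> sets borel"
    by (rule borel_closed) (intro closed_Times closed_cball)
  have \<eta>: "emeasure \<eta> A = ennreal k * (\<integral>\<^sup>+t. (\<integral>\<^sup>+u. indicator ?c t * indicator ?c u * indicator A (t, u - \<phi> *\<^sub>R t) \<partial>lborel) \<partial>lborel)"
    if [measurable]: "A \<in> sets borel" for A
  proof -
    have "emeasure \<eta> A = (\<integral>\<^sup>+w. indicator A (h w) \<partial>density lborel (\<lambda>w. ennreal k * indicator (?c \<times> ?c) w))"
      unfolding \<eta>_def by (subst nn_integral_indicator[symmetric], simp, subst nn_integral_distr) auto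
    also have "\<dots> = (\<integral>\<^sup>+w. ennreal k * (indicator (?c \<times> ?c) w * indicator A (h w)) \<partial>lborel)"
      by (subst nn_integral_density) (auto simp: mult.assoc)
    also have "\<dots> = ennreal k * (\<integral>\<^sup>+w. indicator (?c \<times> ?c) w * indicator A (h w) \<partial>lborel)"
      by (rule nn_integral_cmult) measurable
    also have "(\<integral>\<^sup>+w. indicator (?c \<times> ?c) w * indicator A (h w) \<partial>lborel) = (\<integral>\<^sup>+w. indicator (?c \<times> ?c) w * indicator A (h w) \<partial>(lborel \<Otimes>\<^sub>M lborel))"
      by (simp add: lborel_prod)
    also have "\<dots> = (\<integral>\<^sup>+t. (\<integral>\<^sup>+u. indicator (?c \<times> ?c) (t, u) * indicator A (h (t, u)) \<partial>lborel) \<partial>lborel)"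
      by (rule lborel.nn_integral_fst[symmetric]) (simp add: lborel_prod)
    finally show ?thesis by (simp add: h_def indicator_times)
  qed
  define v where "v = measure lborel ?c"
  have v: "emeasure lborel ?c = ennreal v" "0 < v"
    using emeasure_lborel_cball_pos[of 1 "0::real^2"] emeasure_lborel_cball_finite[of "0::real^2" 1]
    by (auto simp: v_def emeasure_eq_ennreal_measure)
  have mass: "emeasure \<eta> UNIV = ennreal (k * (v * v))"
  proof -
    have "emeasure \<eta> UNIV = ennreal k * (\<integral>\<^sup>+t. indicator ?c t * emeasure lborel ?c \<partial>lborel)"
      by (simp add: \<eta> nn_integral_cmult)
    also have "\<dots> = ennreal k * (ennreal v * ennreal v)" by (simp add: nn_integral_multc v)
    finally show ?thesis using k v by (simp add: ennreal_mult)
  qed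
  have "emeasure \<eta> A \<le> emeasure (bind (S z) S) A" if z: "norm z \<le> r" and A [measurable]: "A \<in> sets borel" for z A
  proof -
    define a0 where "a0 = fst z"
    have zn: "norm (fst z) \<le> r0" "norm (snd z) \<le> r0"
      using z norm_fst_le[of "fst z" "snd z"] norm_snd_le[of "snd z" "fst z"] by (auto simp: r0_def)
    define Az where "Az = fst (heavy_ball \<beta> s G z)"
    have Az: "norm Az \<le> m1" using step_bound[OF zn] by (simp add: Az_def heavy_ball_def m1_def)
    define b where "b x = a0 - \<phi> *\<^sub>R (x - Az)" for x
    define F where "F x = (1 + \<beta>) *\<^sub>R x - \<beta> *\<^sub>R b x - s *\<^sub>R G x" for x
    define cz where "cz = - (\<phi> * \<beta>) *\<^sub>R (a0 + \<phi> *\<^sub>R Az)"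
    have [measurable]: "F \<in> borel_measurable borel" unfolding F_def b_def by measurable
    have cz: "norm cz \<le> m2"
    proof -
      have "norm (a0 + \<phi> *\<^sub>R Az) \<le> r0 + \<phi> * m1"
        using norm_triangle_ineq[of a0 "\<phi> *\<^sub>R Az"] zn(1) mult_left_mono[OF Az \<phi>] \<phi> by (simp add: a0_def)
      then show ?thesis using \<phi> \<beta> by (simp add: cz_def m2_def mult_left_mono)
    qed
    have Fb: "norm (F x) \<le> m4" if "norm x \<le> \<rho>" for x
    proof -
      have "norm (b x) \<le> norm a0 + \<phi> * norm (x - Az)"
        using norm_triangle_ineq4[of a0 "\<phi> *\<^sub>R (x - Az)"] \<phi> by (simp add: b_def)
      also have "norm (x - Az) \<le> \<rho> + m1" using norm_triangle_ineq4[of x Az] that Az by linarith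
      finally have "norm (b x) \<le> m3" using zn(1) \<phi> by (simp add: a0_def m3_def mult_left_mono)
      from step_bound[OF that this] show ?thesis by (simp add: F_def m4_def)
    qed
    define \<psi> where "\<psi> x t = (indicator A (t, x - \<phi> *\<^sub>R (t - F x)) :: ennreal)" for x t
    have \<psi>m: "(\<lambda>w. \<psi> (fst w) (snd w)) \<in> borel_measurable borel"
      unfolding \<psi>_def
      by (rule measurable_compose[OF borel_measurable_Pair_iff borel_measurable_indicator[OF A]]) measurable
    have \<psi>m2 [measurable]: "(\<lambda>(x, t). \<psi> x t) \<in> borel_measurable (borel \<Otimes>\<^sub>M borel)"
      using \<psi>m by (simp add: borel_prod case_prod_unfold)
    define g where "g x = (\<integral>\<^sup>+N. \<psi> x (F x + e *\<^sub>R N) \<partial>\<nu>)" for x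
    have gm [measurable]: "g \<in> borel_measurable borel" unfolding g_def by measurable
    have form: "emeasure (bind (S z) S) A = (\<integral>\<^sup>+N. g (Az + e *\<^sub>R N) \<partial>\<nu>)"
    proof -
      have "emeasure (bind (S z) S) A = (\<integral>\<^sup>+w. emeasure (S w) A \<partial>S z)"
        by (rule emeasure_bind_prob_algebra[OF markov_kernel_law[OF Sk] Sk A])
      also have "\<dots> = (\<integral>\<^sup>+w. (\<integral>\<^sup>+y. indicator A y \<partial>S w) \<partial>S z)"
        using borel_lawD(2)[OF markov_kernel_law[OF Sk]] A by simp
      also have "\<dots> = (\<integral>\<^sup>+w. (\<integral>\<^sup>+N. indicator A (heavy_ball \<beta> s G w + (e *\<^sub>R N, (- \<phi> * e) *\<^sub>R N)) \<partial>\<nu>) \<partial>S z)"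
        unfolding S_def by (subst nn_integral_noisy_heavy_ball[OF law Gm, of "indicator A"]) auto
      also have "\<dots> = (\<integral>\<^sup>+N1. (\<integral>\<^sup>+N. indicator A (heavy_ball \<beta> s G (heavy_ball \<beta> s G z + (e *\<^sub>R N1, (- \<phi> * e) *\<^sub>R N1)) + (e *\<^sub>R N, (- \<phi> * e) *\<^sub>R N)) \<partial>\<nu>) \<partial>\<nu>)"
        unfolding S_def by (rule nn_integral_noisy_heavy_ball[OF law Gm]) measurable
      also have "\<dots> = (\<integral>\<^sup>+N1. g (Az + e *\<^sub>R N1) \<partial>\<nu>)"
        unfolding g_def \<psi>_def
        by (intro nn_integral_cong arg_cong[where f="indicator A"])
          (simp add: heavy_ball_def F_def b_def Az_def a0_def algebra_simps)
      finally show ?thesis .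
    qed
    have At: "ennreal (1 / B) * (\<integral>\<^sup>+u. indicator ?c t * indicator ?c u * indicator A (t, u - \<phi> *\<^sub>R t) \<partial>lborel)
        \<le> (\<integral>\<^sup>+x. \<psi> x t * indicator ?c t * indicator (cball 0 \<rho>) x \<partial>lborel)" for t
    proof -
      define At where "At = {u. norm (u + cz) \<le> 1 \<and> (t, (u + cz) - \<phi> *\<^sub>R t) \<in> A}"
      have pm: "(\<lambda>u. (t, (u + cz) - \<phi> *\<^sub>R t)) \<in> borel_measurable borel" by (rule borel_measurable_Pair_iff) measurable
      have [measurable]: "{u. (t, (u + cz) - \<phi> *\<^sub>R t) \<in> A} \<in> sets borel"
        using measurable_sets[OF pm A] by (simp add: vimage_def)
      have Atm [measurable]: "At \<in> sets borel"
      proof -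
        have "At = {u. norm (u + cz) \<le> 1} \<inter> {u. (t, (u + cz) - \<phi> *\<^sub>R t) \<in> A}" by (auto simp: At_def)
        then show ?thesis by simp
      qed
      have "At \<subseteq> cball 0 (1 + m2)"
      proof
        fix u assume "u \<in> At"
        then have "norm (u + cz) \<le> 1" by (simp add: At_def)
        then show "u \<in> cball 0 (1 + m2)" using norm_triangle_ineq4[of "u + cz" cz] cz by simp
      qed
      then have sub: "At \<subseteq> \<Phi> ` cball 0 \<rho>" using surj by blast
      have key: "x - \<phi> *\<^sub>R (t - F x) = (\<Phi> x + cz) - \<phi> *\<^sub>R t" for x
        by (simp add: F_def b_def \<Phi>_def H_def \<omega>_def cz_def algebra_simps)
      have "(\<integral>\<^sup>+u. indicator ?c u * indicator A (t, u - \<phi> *\<^sub>R t) \<partial>lborel) = (\<integral>\<^sup>+u. indicator ?c (cz + u) * indicator A (t, (cz + u) - \<phi> *\<^sub>R t) \<partial>lborel)"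
      proof (rule nn_integral_lborel_translate[symmetric])
        have "(\<lambda>u. (t, u - \<phi> *\<^sub>R t)) \<in> borel_measurable borel" by (rule borel_measurable_Pair_iff) measurable
        from measurable_compose[OF this borel_measurable_indicator[OF A]]
        show "(\<lambda>u. indicator ?c u * indicator A (t, u - \<phi> *\<^sub>R t) :: ennreal) \<in> borel_measurable borel" by measurable
      qed
      also have "\<dots> = (\<integral>\<^sup>+u. indicator At u \<partial>lborel)"
        by (intro nn_integral_cong) (auto simp: At_def indicator_def add.commute)
      also have "\<dots> = emeasure lborel At" by simp
      also have "\<dots> \<le> ennreal B * emeasure lborel {x \<in> cball 0 \<rho>. \<Phi> x \<in> At}" by (rule B(2)[OF Atm sub])
      finally have 1: "(\<integral>\<^sup>+u. indicator ?c u * indicator A (t, u - \<phi> *\<^sub>R t) \<partial>lborel) \<le> ennreal B * emeasure lborel {x \<in> cball 0 \<rho>. \<Phi> x \<in> At}" .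
      have "ennreal (1 / B) * (\<integral>\<^sup>+u. indicator ?c u * indicator A (t, u - \<phi> *\<^sub>R t) \<partial>lborel)
          \<le> ennreal (1 / B) * (ennreal B * emeasure lborel {x \<in> cball 0 \<rho>. \<Phi> x \<in> At})"
        by (rule mult_left_mono[OF 1]) simp
      also have "\<dots> = emeasure lborel {x \<in> cball 0 \<rho>. \<Phi> x \<in> At}"
        using B(1) by (simp flip: mult.assoc ennreal_mult)
      also have "\<dots> = (\<integral>\<^sup>+x. indicator {x \<in> cball 0 \<rho>. \<Phi> x \<in> At} x \<partial>lborel)" by simp
      also have "\<dots> \<le> (\<integral>\<^sup>+x. \<psi> x t * indicator (cball 0 \<rho>) x \<partial>lborel)"
        by (intro nn_integral_mono) (auto simp: indicator_def At_def \<psi>_def key)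
      finally show ?thesis by (cases "t \<in> ?c") auto
    qed
    have "emeasure \<eta> A = ennreal (k1 * k2) * (ennreal (1 / B) * (\<integral>\<^sup>+t. (\<integral>\<^sup>+u. indicator ?c t * indicator ?c u * indicator A (t, u - \<phi> *\<^sub>R t) \<partial>lborel) \<partial>lborel))"
      using k1 k2 B by (simp add: \<eta> k_def flip: mult.assoc ennreal_mult)
    also have "\<dots> \<le> ennreal (k1 * k2) * (\<integral>\<^sup>+t. ennreal (1 / B) * (\<integral>\<^sup>+u. indicator ?c t * indicator ?c u * indicator A (t, u - \<phi> *\<^sub>R t) \<partial>lborel) \<partial>lborel)"
    proof -
      have [measurable]: "(\<lambda>w. indicator A (h w) :: ennreal) \<in> borel_measurable (borel \<Otimes>\<^sub>M borel)"
        unfolding borel_prod by measurable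
      have "(\<lambda>(t, u). indicator ?c t * indicator ?c u * indicator A (h (t, u)) :: ennreal) \<in> borel_measurable (borel \<Otimes>\<^sub>M lborel)"
        by measurable
      then have "(\<lambda>t. \<integral>\<^sup>+u. indicator ?c t * indicator ?c u * indicator A (h (t, u)) \<partial>lborel) \<in> borel_measurable borel"
        by (rule lborel.borel_measurable_nn_integral)
      then show ?thesis by (subst nn_integral_cmult) (auto simp: h_def)
    qed
    also have "\<dots> \<le> ennreal (k1 * k2) * (\<integral>\<^sup>+t. (\<integral>\<^sup>+x. \<psi> x t * indicator ?c t * indicator (cball 0 \<rho>) x \<partial>lborel) \<partial>lborel)"
      by (intro mult_left_mono nn_integral_mono At) auto
    also have "\<dots> = ennreal (k1 * k2) * (\<integral>\<^sup>+x. (\<integral>\<^sup>+t. \<psi> x t * indicator ?c t * indicator (cball 0 \<rho>) x \<partial>lborel) \<partial>lborel)"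
    proof (subst lborel_pair.Fubini')
      show "(\<lambda>(x, t). \<psi> x t * indicator ?c t * indicator (cball 0 \<rho>) x) \<in> borel_measurable (lborel \<Otimes>\<^sub>M lborel)"
        by measurable
    qed simp
    also have "\<dots> = ennreal k1 * (\<integral>\<^sup>+x. ennreal k2 * (\<integral>\<^sup>+t. \<psi> x t * indicator ?c t \<partial>lborel) * indicator (cball 0 \<rho>) x \<partial>lborel)"
    proof -
      have 1: "(\<integral>\<^sup>+t. \<psi> x t * indicator ?c t * indicator (cball 0 \<rho>) x \<partial>lborel) = (\<integral>\<^sup>+t. \<psi> x t * indicator ?c t \<partial>lborel) * indicator (cball 0 \<rho>) x" for x
        by (rule nn_integral_multc) measurable
      show ?thesis unfolding 1 using k1(1) k2(1)
        by (subst mult.assoc, subst nn_integral_cmult) (auto simp: ennreal_mult mult.assoc)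
    qed
    also have "\<dots> \<le> ennreal k1 * (\<integral>\<^sup>+x. g x * indicator (cball 0 \<rho>) x \<partial>lborel)"
    proof (rule mult_left_mono[OF nn_integral_mono])
      fix x
      have "ennreal k2 * (\<integral>\<^sup>+t. \<psi> x t * indicator ?c t \<partial>lborel) \<le> g x" if "norm x \<le> \<rho>"
        unfolding g_def by (rule k2(2)[OF _ Fb[OF that]]) measurable
      then show "ennreal k2 * (\<integral>\<^sup>+t. \<psi> x t * indicator ?c t \<partial>lborel) * indicator (cball 0 \<rho>) x \<le> g x * indicator (cball 0 \<rho>) x"
        by (auto simp: indicator_def)
    qed auto
    also have "\<dots> \<le> (\<integral>\<^sup>+N. g (Az + e *\<^sub>R N) \<partial>\<nu>)" by (rule k1(2)[OF gm Az])
    finally show ?thesis using form by simp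
  qed
  moreover have "sets \<eta> = sets borel" by (simp add: \<eta>_def)
  moreover have "0 < k * (v * v)" using k v by simp
  ultimately show ?thesis using mass by blast
qed

section \<open>Smooth functions and mollification\<close>

lemma C_k_SucI:
  assumes "\<And>x. (f has_derivative f' x) (at x)" and "\<And>b. b \<in> Basis \<Longrightarrow> C_k k (\<lambda>x. f' x b)"
  shows "C_k (Suc k) f"
proof -
  have "frechet_derivative f (at x) = f' x" for x
    using frechet_derivative_at[OF assms(1)[of x]] by simp
  then show ?thesis using assms by (auto simp: differentiable_def)
qed

lemma C_k_SucD:
  assumes "C_k (Suc k) f"
  shows "(f has_derivative frechet_derivative f (at x)) (at x)"
    and "b \<in> Basis \<Longrightarrow> C_k k (\<lambda>x. frechet_derivative f (at x) b)"
  using assms by (auto simp: frechet_derivative_works)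

lemma C_k_lower: "C_k (Suc k) f \<Longrightarrow> C_k k f"
proof (induction k arbitrary: f)
  case 0
  then show ?case
    by (auto intro!: differentiable_imp_continuous_on simp: differentiable_on_def differentiable_at_withinI)
qed (auto simp: C_k.simps(2))

lemma C_k_continuous: "C_k k f \<Longrightarrow> continuous_on UNIV f"
  by (induction k) (auto dest: C_k_lower simp del: C_k.simps(2))

lemma C_k_const: "C_k k (\<lambda>x. c)"
proof (induction k arbitrary: c)
  case (Suc k)
  show ?case by (rule C_k_SucI[of _ "\<lambda>_ _. 0"]) (use Suc in auto)
qed simp

lemma C_k_inner: "C_k k (\<lambda>x. x \<bullet> c)"
proof (cases k)
  case 0
  then show ?thesis by (auto intro!: continuous_intros)
next
  case (Suc j)
  show ?thesis unfolding Suc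
    by (rule C_k_SucI[of _ "\<lambda>_ h. h \<bullet> c"]) (auto intro!: C_k_const derivative_eq_intros)
qed

lemma C_k_add: "C_k k f \<Longrightarrow> C_k k g \<Longrightarrow> C_k k (\<lambda>x. f x + g x)"
proof (induction k arbitrary: f g)
  case 0
  then show ?case by (auto intro: continuous_intros)
next
  case (Suc k)
  show ?case
    by (rule C_k_SucI[of _ "\<lambda>x h. frechet_derivative f (at x) h + frechet_derivative g (at x) h"])
      (auto intro!: has_derivative_add Suc.IH C_k_SucD[OF Suc.prems(1)] C_k_SucD[OF Suc.prems(2)])
qed

lemma C_k_mult: "C_k k f \<Longrightarrow> C_k k g \<Longrightarrow> C_k k (\<lambda>x. f x * g x)"
proof (induction k arbitrary: f g)
  case 0
  then show ?case by (auto intro: continuous_intros)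
next
  case (Suc k)
  show ?case
    by (rule C_k_SucI[of _ "\<lambda>x h. f x * frechet_derivative g (at x) h + frechet_derivative f (at x) h * g x"])
      (auto intro!: has_derivative_mult C_k_add Suc.IH C_k_SucD[OF Suc.prems(1)] C_k_SucD[OF Suc.prems(2)]
        C_k_lower[OF Suc.prems(1)] C_k_lower[OF Suc.prems(2)] simp del: C_k.simps)
qed

lemma C_k_rescale: "C_k k f \<Longrightarrow> C_k k (\<lambda>x. c * f (a *\<^sub>R x))"
proof (induction k arbitrary: f c)
  case 0
  then show ?case by (auto intro!: continuous_intros continuous_on_compose2[of UNIV f])
next
  case (Suc k)
  show ?case
  proof (rule C_k_SucI[of _ "\<lambda>x h. c * frechet_derivative f (at (a *\<^sub>R x)) (a *\<^sub>R h)"])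
    fix x
    show "((\<lambda>x. c * f (a *\<^sub>R x)) has_derivative (\<lambda>h. c * frechet_derivative f (at (a *\<^sub>R x)) (a *\<^sub>R h))) (at x)"
      by (intro has_derivative_mult_right has_derivative_compose[OF _ C_k_SucD(1)[OF Suc.prems], of "\<lambda>x. a *\<^sub>R x" "\<lambda>x. a *\<^sub>R x"])
        (auto intro!: derivative_eq_intros)
  next
    fix b :: 'a assume b: "b \<in> Basis"
    have "frechet_derivative f (at y) (a *\<^sub>R b) = a * frechet_derivative f (at y) b" for y
      using linear_scale[OF has_derivative_linear[OF C_k_SucD(1)[OF Suc.prems]]] by simp
    then show "C_k k (\<lambda>x. c * frechet_derivative f (at (a *\<^sub>R x)) (a *\<^sub>R b))"
      using Suc.IH[OF C_k_SucD(2)[OF Suc.prems b], of "c * a"] by (simp add: mult.assoc)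
  qed
qed

text \<open>The hypothesis lists all successive derivatives \<open>e j\<close> of one function, so that the induction can move
  along the list.\<close>

lemma C_k_compose_real:
  assumes e: "\<And>j t. (e j has_real_derivative e (Suc j) t) (at t)" and g: "\<And>k. C_k k g"
  shows "C_k k (\<lambda>x. e j (g x))"
proof (induction k arbitrary: j)
  case 0
  have "continuous_on UNIV (e j)" using e by (meson DERIV_isCont continuous_at_imp_continuous_on)
  then show ?case using C_k_continuous[OF g[of 0]] by (auto intro: continuous_on_compose2)
next
  case (Suc k)
  show ?case
  proof (rule C_k_SucI[of _ "\<lambda>x h. e (Suc j) (g x) * frechet_derivative g (at x) h"])
    fix x
    show "((\<lambda>x. e j (g x)) has_derivative (\<lambda>h. e (Suc j) (g x) * frechet_derivative g (at x) h)) (at x)"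
      using has_derivative_compose[OF C_k_SucD(1)[OF g[of "Suc k"]] e[unfolded has_field_derivative_def]] .
  qed (auto intro!: C_k_mult Suc.IH C_k_SucD(2)[OF g] simp del: C_k.simps)
qed

subsection \<open>A bump function\<close>

text \<open>The derivatives of \<open>exp (-1/t)\<close> have the form \<open>P\<^sub>j (1/t) exp (-1/t)\<close>.\<close>

primrec flat_poly :: "nat \<Rightarrow> real poly" where
  "flat_poly 0 = 1"
| "flat_poly (Suc j) = [:0, 0, 1:] * (flat_poly j - pderiv (flat_poly j))"

definition flat_exp :: "nat \<Rightarrow> real \<Rightarrow> real" where
  "flat_exp j t = (if t \<le> 0 then 0 else poly (flat_poly j) (1 / t) * exp (- (1 / t)))"

lemma poly_times_exp_tendsto_0: "((\<lambda>u. poly p u * exp (- u)) \<longlongrightarrow> (0::real)) at_top"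
proof -
  have "((\<lambda>u. \<Sum>i\<le>degree p. coeff p i * (u ^ i / exp u)) \<longlongrightarrow> (\<Sum>i\<le>degree p. coeff p i * 0)) at_top"
    by (intro tendsto_intros tendsto_power_div_exp_0)
  then show ?thesis by (simp add: poly_altdef exp_minus field_simps sum_divide_distrib)
qed

lemma flat_exp_deriv: "(flat_exp j has_real_derivative flat_exp (Suc j) t) (at t)"
proof -
  consider "t < 0" | "t = 0" | "t > 0" by linarith
  then show ?thesis
  proof cases
    case 1
    have "((\<lambda>_. 0) has_real_derivative 0) (at t)" by simp
    then have "(flat_exp j has_real_derivative 0) (at t)"
      by (rule has_field_derivative_transform_within_open[of _ _ _ "{..<0}"]) (use 1 in \<open>auto simp: flat_exp_def\<close>)
    then show ?thesis using 1 by (simp add: flat_exp_def)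
  next
    case 2
    have "((\<lambda>y. (flat_exp j y - flat_exp j 0) / (y - 0)) \<longlongrightarrow> 0) (at 0)"
    proof (rule filterlim_split_at)
      show "((\<lambda>y. (flat_exp j y - flat_exp j 0) / (y - 0)) \<longlongrightarrow> 0) (at_left 0)"
        by (rule tendsto_eventually) (auto simp: eventually_at_left_field flat_exp_def intro!: exI[of _ "-1"])
      have "((\<lambda>y. poly (pCons 0 (flat_poly j)) (inverse y) * exp (- inverse y)) \<longlongrightarrow> 0) (at_right 0)"
        by (rule filterlim_compose[OF poly_times_exp_tendsto_0 filterlim_inverse_at_top_right])
      then show "((\<lambda>y. (flat_exp j y - flat_exp j 0) / (y - 0)) \<longlongrightarrow> 0) (at_right 0)"
        by (rule Lim_transform_eventually)
          (auto simp: eventually_at_right_field flat_exp_def inverse_eq_divide intro!: exI[of _ 1])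
    qed
    then show ?thesis using 2 by (simp add: has_field_derivative_iff flat_exp_def)
  next
    case 3
    have "((\<lambda>t. poly (flat_poly j) (1 / t) * exp (- (1 / t))) has_real_derivative
        poly (flat_poly (Suc j)) (1 / t) * exp (- (1 / t))) (at t)"
      using 3 by (auto intro!: derivative_eq_intros poly_DERIV[THEN DERIV_chain2] simp: field_simps power2_eq_square)
    then have "(flat_exp j has_real_derivative poly (flat_poly (Suc j)) (1 / t) * exp (- (1 / t))) (at t)"
      by (rule has_field_derivative_transform_within_open[of _ _ _ "{0<..}"]) (use 3 in \<open>auto simp: flat_exp_def\<close>)
    then show ?thesis using 3 by (simp add: flat_exp_def)
  qed
qed

lemma C_k_norm_square: "C_k k (\<lambda>x::'a::euclidean_space. x \<bullet> x)"
proof (cases k)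
  case 0
  then show ?thesis by (auto intro!: continuous_intros)
next
  case (Suc j)
  show ?thesis unfolding Suc
  proof (rule C_k_SucI[of _ "\<lambda>x h. 2 * inner x h"])
    show "((\<lambda>x. x \<bullet> x) has_derivative (\<lambda>h. 2 * (x \<bullet> h))) (at x)" for x :: 'a
      by (auto intro!: derivative_eq_intros simp: inner_commute)
  qed (auto intro!: C_k_mult C_k_const C_k_inner simp del: C_k.simps)
qed

lemma bump_exists:
  assumes "0 < \<rho>"
  obtains \<psi> :: "'a::euclidean_space \<Rightarrow> real" where "\<And>k. C_k k \<psi>" "\<And>x. 0 \<le> \<psi> x" "\<And>x. \<rho> \<le> norm x \<Longrightarrow> \<psi> x = 0" "0 < \<psi> 0"
proof
  define g :: "'a \<Rightarrow> real" where "g x = \<rho>\<^sup>2 + (- 1) * (x \<bullet> x)" for x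
  define \<psi> where "\<psi> x = flat_exp 0 (g x)" for x :: 'a
  have g: "C_k k g" for k unfolding g_def by (intro C_k_add C_k_const C_k_mult C_k_norm_square)
  show "C_k k \<psi>" for k unfolding \<psi>_def by (rule C_k_compose_real[where e=flat_exp and g=g, OF flat_exp_deriv g])
  show "0 \<le> \<psi> x" for x by (simp add: \<psi>_def flat_exp_def)
  show "\<psi> x = 0" if "\<rho> \<le> norm x" for x
  proof -
    have "\<rho>\<^sup>2 \<le> (norm x)\<^sup>2" using that assms by (intro power_mono) auto
    then show ?thesis by (simp add: \<psi>_def flat_exp_def g_def power2_norm_eq_inner)
  qed
  show "0 < \<psi> 0" using assms by (simp add: \<psi>_def flat_exp_def g_def)
qed

subsection \<open>Convolution with a bump function\<close>

text \<open>The Leibniz rule asks for a derivative that is continuous as a bounded linear map; in finite dimension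
  this follows from the continuity of the partial derivatives.\<close>

lemma has_derivative_integral_cbox:
  fixes f :: "'a::euclidean_space \<Rightarrow> 'a \<Rightarrow> real"
  assumes deriv: "\<And>x t. ((\<lambda>x. f x t) has_derivative D x t) (at x)"
    and f: "continuous_on UNIV (\<lambda>(x, t). f x t)"
    and D: "\<And>b. b \<in> Basis \<Longrightarrow> continuous_on UNIV (\<lambda>(x, t). D x t b)"
  shows "((\<lambda>x. integral (cbox u v) (f x)) has_derivative (\<lambda>h. integral (cbox u v) (\<lambda>t. D x0 t h))) (at x0)"
proof -
  define F where "F x t = Blinfun (D x t)" for x t
  have F: "blinfun_apply (F x t) = D x t" for x t
    unfolding F_def by (rule bounded_linear_Blinfun_apply) (rule has_derivative_bounded_linear[OF deriv])
  have Fc: "continuous_on UNIV (\<lambda>(x, t). F x t)"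
    unfolding case_prod_unfold
    by (rule continuous_on_blinfun_componentwise) (use D in \<open>auto simp: F case_prod_unfold\<close>)
  have "((\<lambda>x. integral (cbox u v) (f x)) has_derivative blinfun_apply (integral (cbox u v) (F x0))) (at x0 within UNIV)"
  proof (rule leibniz_rule)
    show "f x integrable_on cbox u v" for x
    proof (rule integrable_continuous)
      have "continuous_on (cbox u v) (\<lambda>t. (\<lambda>(x, t). f x t) (x, t))"
        by (rule continuous_on_compose2[OF f]) (auto intro!: continuous_intros)
      then show "continuous_on (cbox u v) (f x)" by simp
    qed
    show "continuous_on (UNIV \<times> cbox u v) (\<lambda>(x, t). F x t)"
      using Fc by (rule continuous_on_subset) auto
  qed (auto simp: F deriv)
  moreover have "blinfun_apply (integral (cbox u v) (F x0)) = (\<lambda>h. integral (cbox u v) (\<lambda>t. D x0 t h))"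
  proof (rule ext)
    fix h
    have "continuous_on (cbox u v) (\<lambda>t. (\<lambda>(x, t). F x t) (x0, t))"
      by (rule continuous_on_compose2[OF Fc]) (auto intro!: continuous_intros)
    then have "F x0 integrable_on cbox u v" by (intro integrable_continuous) simp
    from integral_linear[OF this, of "\<lambda>L. blinfun_apply L h"]
    show "blinfun_apply (integral (cbox u v) (F x0)) h = integral (cbox u v) (\<lambda>t. D x0 t h)"
      by (simp add: o_def F blinfun.bounded_linear_left)
  qed
  ultimately show ?thesis by simp
qed

lemma derivative_outside_support:
  fixes \<psi> :: "'a::euclidean_space \<Rightarrow> real"
  assumes s: "\<And>x. \<rho> < norm x \<Longrightarrow> \<psi> x = 0" and x: "\<rho> < norm x"
  shows "frechet_derivative \<psi> (at x) h = 0"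
proof -
  have "(\<psi> has_derivative (\<lambda>_. 0)) (at x)"
  proof (rule has_derivative_transform_within_open[of "\<lambda>_. 0" _ _ _ "{x. \<rho> < norm x}"])
    show "open {x::'a. \<rho> < norm x}" by (intro open_Collect_less continuous_intros)
  qed (use s x in auto)
  from frechet_derivative_at[OF this] show ?thesis by metis
qed

lemma convolution_has_derivative:
  fixes q \<psi> :: "'a::euclidean_space \<Rightarrow> real"
  assumes q: "continuous_on UNIV q" and \<psi>: "\<And>j. C_k j \<psi>" and s: "\<And>x. \<rho> < norm x \<Longrightarrow> \<psi> x = 0"
  shows "((\<lambda>x. integral UNIV (\<lambda>y. q y * \<psi> (x - y))) has_derivative
      (\<lambda>h. integral UNIV (\<lambda>y. q y * frechet_derivative \<psi> (at (x0 - y)) h))) (at x0)"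
proof -
  have s': "frechet_derivative \<psi> (at x) h = 0" if "\<rho> < norm x" for x h
    using derivative_outside_support[OF s that] .
  have loc: "\<exists>u v. \<forall>x\<in>ball x0 1. \<forall>\<psi>. (\<forall>x. \<rho> < norm x \<longrightarrow> \<psi> x = (0::real)) \<longrightarrow>
      integral UNIV (\<lambda>y. q y * \<psi> (x - y)) = integral (cbox u v) (\<lambda>y. q y * \<psi> (x - y))" 
  proof -
    obtain a where a: "cball x0 (\<bar>\<rho>\<bar> + 1) \<subseteq> cbox (- a) (a::'a)"
      using bounded_subset_cbox_symmetric[OF bounded_cball] by blast
    have "integral UNIV (\<lambda>y. q y * \<psi> (x - y)) = integral (cbox (- a) a) (\<lambda>y. q y * \<psi> (x - y))"
      if x: "x \<in> ball x0 1" and s: "\<forall>x. \<rho> < norm x \<longrightarrow> \<psi> x = (0::real)" for x \<psi>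
    proof -
      have "q y * \<psi> (x - y) = 0" if "y \<notin> cbox (- a) a" for y
      proof -
        have "\<bar>\<rho>\<bar> + 1 < dist x0 y" using a that by (meson mem_cball not_less subsetD)
        moreover have "dist x0 y \<le> dist x0 x + dist x y" by (rule dist_triangle)
        ultimately have "\<rho> < norm (x - y)" using x by (simp add: dist_norm)
        then show ?thesis using s by simp
      qed
      then have "(\<lambda>y. if y \<in> cbox (- a) a then q y * \<psi> (x - y) else 0) = (\<lambda>y. q y * \<psi> (x - y))" by auto
      then show ?thesis using integral_restrict_UNIV[of "cbox (- a) a" "\<lambda>y. q y * \<psi> (x - y)"] by simp
    qed
    then show ?thesis by blast
  qed
  obtain u v where uv: "\<And>x \<psi>. x \<in> ball x0 1 \<Longrightarrow> (\<forall>x. \<rho> < norm x \<longrightarrow> \<psi> x = (0::real)) \<Longrightarrow>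
      integral UNIV (\<lambda>y. q y * \<psi> (x - y)) = integral (cbox u v) (\<lambda>y. q y * \<psi> (x - y))"
      using loc by blast
    have qc: "continuous_on UNIV (\<lambda>w. q (snd w))" for w :: "'a \<times> 'a"
      by (rule continuous_on_compose2[OF q]) (auto intro!: continuous_intros)
    have "((\<lambda>x. integral (cbox u v) (\<lambda>y. q y * \<psi> (x - y))) has_derivative
        (\<lambda>h. integral (cbox u v) (\<lambda>y. q y * frechet_derivative \<psi> (at (x0 - y)) h))) (at x0)"
    proof (rule has_derivative_integral_cbox)
      fix x t
      show "((\<lambda>x. q t * \<psi> (x - t)) has_derivative (\<lambda>h. q t * frechet_derivative \<psi> (at (x - t)) h)) (at x)"
        by (intro has_derivative_mult_right has_derivative_compose[OF _ C_k_SucD(1)[OF \<psi>[of "Suc 0"]], of "\<lambda>x. x - t" "\<lambda>x. x"])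
          (auto intro!: derivative_eq_intros)
    next
      show "continuous_on UNIV (\<lambda>(x, t). q t * \<psi> (x - t))"
        unfolding case_prod_unfold
        by (intro continuous_on_mult qc continuous_on_compose2[OF C_k_continuous[OF \<psi>[of 0]]]) (auto intro!: continuous_intros)
      fix b :: 'a assume "b \<in> Basis"
      then show "continuous_on UNIV (\<lambda>(x, t). q t * frechet_derivative \<psi> (at (x - t)) b)"
        unfolding case_prod_unfold
        by (intro continuous_on_mult qc continuous_on_compose2[OF C_k_continuous[OF C_k_SucD(2)[OF \<psi>[of "Suc 0"]]]])
          (auto intro!: continuous_intros)
    qed
    then have "((\<lambda>x. integral UNIV (\<lambda>y. q y * \<psi> (x - y))) has_derivative
        (\<lambda>h. integral (cbox u v) (\<lambda>y. q y * frechet_derivative \<psi> (at (x0 - y)) h))) (at x0)"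
      by (rule has_derivative_transform_within_open[of _ _ _ _ "ball x0 1"]) (use uv[of _ \<psi>] s in auto)
    moreover have "integral (cbox u v) (\<lambda>y. q y * frechet_derivative \<psi> (at (x0 - y)) h)
        = integral UNIV (\<lambda>y. q y * frechet_derivative \<psi> (at (x0 - y)) h)" for h
      using uv[of x0 "\<lambda>x. frechet_derivative \<psi> (at x) h"] s' by simp
    ultimately show ?thesis by simp
qed

text \<open>Each derivative of the convolution falls on the smooth compactly supported factor \<open>\<psi>\<close>, while \<open>q\<close> need
  only be continuous.\<close>

lemma C_k_convolution:
  fixes q \<psi> :: "'a::euclidean_space \<Rightarrow> real"
  assumes q: "continuous_on UNIV q" and \<psi>: "\<And>j. C_k j \<psi>" and supp: "\<And>x. \<rho> < norm x \<Longrightarrow> \<psi> x = 0"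
  shows "C_k k (\<lambda>x. integral UNIV (\<lambda>y. q y * \<psi> (x - y)))"
  using \<psi> supp
proof (induction k arbitrary: \<psi>)
  case 0
  have "continuous (at x0) (\<lambda>x. integral UNIV (\<lambda>y. q y * \<psi> (x - y)))" for x0
    using convolution_has_derivative[OF q 0] by (rule has_derivative_continuous)
  then show ?case by (simp add: continuous_at_imp_continuous_on)
next
  case (Suc k)
  show ?case
  proof (rule C_k_SucI[OF convolution_has_derivative[OF q Suc.prems]])
    fix b :: 'a assume b: "b \<in> Basis"
    show "C_k k (\<lambda>x. integral UNIV (\<lambda>y. q y * frechet_derivative \<psi> (at (x - y)) b))"
      by (rule Suc.IH) (use C_k_SucD(2)[OF Suc.prems(1) b] derivative_outside_support[OF Suc.prems(2)] in auto)
  qed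
qed

text \<open>Averaging the translates of \<open>q\<close> with a bump of radius \<open>\<rho>\<close> averages the translates of its gradient \<open>p\<close>.
  Lipschitz, monotonicity and size bounds survive, and so does the value of \<open>p\<close> where \<open>p\<close> is constant on a
  ball large enough to contain the translates.\<close>

lemma mollification:
  fixes q :: "'a::euclidean_space \<Rightarrow> real" and p :: "'a \<Rightarrow> 'a"
  assumes q: "\<And>x. GDERIV q x :> p x" and lip: "\<And>x y. norm (p x - p y) \<le> norm (x - y)"
    and mono: "\<And>x y. 0 \<le> inner (p x - p y) (x - y)" and B: "\<And>x. norm (p x) \<le> B" and \<rho>: "0 < \<rho>"
  obtains Q P where "\<And>k. C_k k Q" "\<And>x. GDERIV Q x :> P x" "\<And>x y. norm (P x - P y) \<le> norm (x - y)"
    "\<And>x y. 0 \<le> inner (P x - P y) (x - y)" "\<And>x. norm (P x) \<le> B"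
    "\<And>c v x. (\<And>y. dist c y \<le> 2 * \<rho> \<Longrightarrow> p y = v) \<Longrightarrow> dist c x \<le> \<rho> \<Longrightarrow> P x = v"
proof -
  obtain \<psi> :: "'a \<Rightarrow> real" where \<psi>: "\<And>k. C_k k \<psi>" "\<And>x. 0 \<le> \<psi> x" "\<And>x. \<rho> \<le> norm x \<Longrightarrow> \<psi> x = 0" "0 < \<psi> 0"
    using bump_exists[OF \<rho>] by blast
  obtain a where a: "cball 0 \<rho> \<subseteq> cbox (- a) (a::'a)"
    using bounded_subset_cbox_symmetric[OF bounded_cball] by blast
  define c where "c = integral (cbox (- a) a) \<psi>"
  have \<psi>c: "continuous_on S \<psi>" for S using C_k_continuous[OF \<psi>(1)] continuous_on_subset by blast
  have \<psi>i: "\<psi> integrable_on cbox (- a) a" by (rule integrable_continuous[OF \<psi>c])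
  have ne: "box (- a) a \<noteq> {}"
  proof
    assume e: "box (- a) a = {}"
    have "0 < measure lborel (cball (0::'a) \<rho>)" using emeasure_lborel_cball_pos[OF \<rho>, of "0::'a"] emeasure_lborel_cball_finite[of "0::'a" \<rho>]
      by (simp add: measure_def enn2real_positive_iff)
    moreover have "measure lborel (cball (0::'a) \<rho>) \<le> measure lborel (cbox (- a) a)"
      by (rule measure_mono_fmeasurable[OF a]) auto
    moreover have "measure lborel (cbox (- a) a) = 0" using e by (simp add: content_eq_0_interior)
    ultimately show False by linarith
  qed
  have "c \<noteq> 0"
  proof
    assume "c = 0"
    then have "(\<psi> has_integral 0) (cbox (- a) a)" using integrable_integral[OF \<psi>i] by (simp add: c_def)
    moreover have "0 \<in> cbox (- a) a" using a \<rho> by auto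
    ultimately have "\<psi> 0 = 0" using has_integral_0_cbox_imp_0[OF \<psi>c _ _ ne] \<psi>(2) by blast
    then show False using \<psi>(4) by simp
  qed
  moreover have "0 \<le> c" unfolding c_def by (rule integral_nonneg[OF \<psi>i]) (use \<psi> in auto)
  ultimately have c: "0 < c" by simp
  define \<eta> where "\<eta> x = (1 / c) * \<psi> (1 *\<^sub>R x)" for x
  have \<eta>C: "C_k k \<eta>" for k unfolding \<eta>_def by (rule C_k_rescale[OF \<psi>(1)])
  have \<eta>0: "0 \<le> \<eta> x" for x using \<psi>(2) c by (simp add: \<eta>_def)
  have \<eta>s: "\<eta> x = 0" if "\<rho> < norm x" for x using \<psi>(3)[of x] that by (simp add: \<eta>_def)
  have \<eta>c: "continuous_on S \<eta>" for S using C_k_continuous[OF \<eta>C] continuous_on_subset by blast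
  have \<eta>1: "integral (cbox (- a) a) \<eta> = 1"
  proof -
    have "\<eta> = (\<lambda>x. (1 / c) * \<psi> x)" by (simp add: \<eta>_def fun_eq_iff)
    then have "integral (cbox (- a) a) \<eta> = (1 / c) * c" by (simp only: integral_mult_right c_def[symmetric])
    then show ?thesis using c by simp
  qed
  have \<eta>i: "\<eta> integrable_on cbox (- a) a" by (rule integrable_continuous[OF \<eta>c])
  have "continuous (at x) q" for x using q[of x] unfolding gderiv_def by (rule has_derivative_continuous)
  then have qc: "continuous_on UNIV q" by (simp add: continuous_at_imp_continuous_on)
  have "1-lipschitz_on UNIV p" by (rule lipschitz_onI) (use lip in \<open>auto simp: dist_norm\<close>)
  then have pc: "continuous_on UNIV p" by (rule lipschitz_on_continuous_on)
  define Q where "Q x = integral UNIV (\<lambda>y. q y * \<eta> (x - y))" for x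
  have Qeq: "Q x = integral (cbox (- a) a) (\<lambda>t. q (x - t) * \<eta> t)" for x
  proof -
    let ?f = "\<lambda>y. q y * \<eta> (x - y)"
    have z: "?f y = 0" if "y \<notin> cbox (x - a) (x + a)" for y
    proof -
      have "x - y \<notin> cbox (- a) a" using that by (auto simp: mem_box inner_diff_left inner_add_left) force+
      then have "x - y \<notin> cball 0 \<rho>" using a by blast
      then show ?thesis using \<eta>s[of "x - y"] by simp
    qed
    have "(\<lambda>y. if y \<in> cbox (x - a) (x + a) then ?f y else 0) = ?f" using z by auto
    then have 1: "Q x = integral (cbox (x - a) (x + a)) ?f"
      unfolding Q_def using integral_restrict_UNIV[of "cbox (x - a) (x + a)" ?f] by simp
    have "?f integrable_on cbox (x - a) (x + a)"
      by (intro integrable_continuous continuous_on_mult continuous_on_subset[OF qc] continuous_on_compose2[OF \<eta>c[of UNIV]])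
        (auto intro!: continuous_intros)
    then have "(?f has_integral Q x) (cbox (x - a) (x + a))" unfolding 1 by (rule integrable_integral)
    from has_integral_affinity[OF this, of "-1" x]
    have "((\<lambda>t. q (x - t) * \<eta> t) has_integral Q x) ((\<lambda>t. - t + x) ` cbox (x - a) (x + a))"
      by (simp add: algebra_simps)
    moreover have "(\<lambda>t. - t + x) ` cbox (x - a) (x + a) = cbox (- a) a"
    proof -
      have "(\<lambda>t. (-1) *\<^sub>R t + x) ` cbox (x - a) (x + a) = (if cbox (x - a) (x + a) = {} then {} else cbox (- a) a)"
        by (subst image_affinity_cbox) simp
      moreover have "cbox (x - a) (x + a) \<noteq> {}"
      proof -
        have "(0::'a) \<in> cbox (- a) a" using a \<rho> by auto
        then have "x \<in> cbox (x - a) (x + a)" by (auto simp: mem_box inner_diff_left inner_add_left)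
        then show ?thesis by blast
      qed
      ultimately show ?thesis by simp
    qed
    ultimately show ?thesis by (simp add: integral_unique)
  qed
  define P where "P x = integral (cbox (- a) a) (\<lambda>t. \<eta> t *\<^sub>R p (x - t))" for x
  have pcx: "continuous_on S (\<lambda>t. p (x - t))" for S x
    by (rule continuous_on_compose2[OF pc]) (auto intro!: continuous_intros)
  have Pi: "(\<lambda>t. \<eta> t *\<^sub>R p (x - t)) integrable_on cbox (- a) a" for x
    by (intro integrable_continuous continuous_on_scaleR \<eta>c pcx)
  have Pinner: "integral (cbox (- a) a) (\<lambda>t. inner h (p (x - t)) * \<eta> t) = inner h (P x)" for h x
    using integral_linear[OF Pi[of x] bounded_linear_inner_right[of h]]
    by (simp add: P_def o_def mult.commute)
  have Qd: "GDERIV Q x0 :> P x0" for x0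
  proof -
    have "((\<lambda>x. integral (cbox (- a) a) (\<lambda>t. q (x - t) * \<eta> t)) has_derivative
        (\<lambda>h. integral (cbox (- a) a) (\<lambda>t. inner h (p (x0 - t)) * \<eta> t))) (at x0)"
    proof (rule has_derivative_integral_cbox)
      fix x t
      have "((\<lambda>x. q (x - t)) has_derivative (\<lambda>h. inner h (p (x - t)))) (at x)"
        by (rule has_derivative_compose[OF _ q[unfolded gderiv_def], of "\<lambda>x. x - t" "\<lambda>x. x"]) (auto intro!: derivative_eq_intros)
      then show "((\<lambda>x. q (x - t) * \<eta> t) has_derivative (\<lambda>h. inner h (p (x - t)) * \<eta> t)) (at x)"
        by (rule has_derivative_mult_left)
    next
      have e: "continuous_on UNIV (\<lambda>w. \<eta> (snd w))" for w :: "'a \<times> 'a"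
        by (rule continuous_on_compose2[OF \<eta>c[of UNIV]]) (auto intro!: continuous_intros)
      show "continuous_on UNIV (\<lambda>(x, t). q (x - t) * \<eta> t)"
        unfolding case_prod_unfold
        by (intro continuous_on_mult e continuous_on_compose2[OF qc]) (auto intro!: continuous_intros)
      fix b :: 'a
      show "continuous_on UNIV (\<lambda>(x, t). inner b (p (x - t)) * \<eta> t)"
        unfolding case_prod_unfold
        by (intro continuous_on_mult e continuous_on_inner continuous_on_const continuous_on_compose2[OF pc])
          (auto intro!: continuous_intros)
    qed
    then show ?thesis unfolding gderiv_def Pinner by (simp add: Qeq[abs_def])
  qed
  have Pdiff: "P x - P y = integral (cbox (- a) a) (\<lambda>t. \<eta> t *\<^sub>R (p (x - t) - p (y - t)))" for x y
    unfolding P_def using integral_diff[OF Pi[of x] Pi[of y]] by (simp add: scaleR_diff_right)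
  have Pdi: "(\<lambda>t. \<eta> t *\<^sub>R (p (x - t) - p (y - t))) integrable_on cbox (- a) a" for x y
    using integrable_diff[OF Pi[of x] Pi[of y]] by (simp add: scaleR_diff_right)
  show thesis
  proof (rule that[of Q P])
    show "C_k k Q" for k unfolding Q_def by (rule C_k_convolution[OF qc \<eta>C \<eta>s])
    show "GDERIV Q x :> P x" for x by (rule Qd)
    show "norm (P x - P y) \<le> norm (x - y)" for x y
    proof -
      have "norm (P x - P y) \<le> integral (cbox (- a) a) (\<lambda>t. \<eta> t * norm (x - y))"
        unfolding Pdiff
      proof (rule integral_norm_bound_integral[OF Pdi])
        show "(\<lambda>t. \<eta> t * norm (x - y)) integrable_on cbox (- a) a" by (rule integrable_on_mult_left[OF \<eta>i])
        show "norm (\<eta> t *\<^sub>R (p (x - t) - p (y - t))) \<le> \<eta> t * norm (x - y)" for t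
          using lip[of "x - t" "y - t"] \<eta>0[of t] by (simp add: mult_left_mono)
      qed
      then show ?thesis using \<eta>1 by simp
    qed
    show "norm (P x) \<le> B" for x
    proof -
      have "norm (P x) \<le> integral (cbox (- a) a) (\<lambda>t. \<eta> t * B)"
        unfolding P_def
      proof (rule integral_norm_bound_integral[OF Pi])
        show "(\<lambda>t. \<eta> t * B) integrable_on cbox (- a) a" by (rule integrable_on_mult_left[OF \<eta>i])
        show "norm (\<eta> t *\<^sub>R p (x - t)) \<le> \<eta> t * B" for t
          using B[of "x - t"] \<eta>0[of t] by (simp add: mult_left_mono)
      qed
      then show ?thesis using \<eta>1 by simp
    qed
    show "0 \<le> inner (P x - P y) (x - y)" for x y
    proof -
      have "inner (x - y) (P x - P y) = integral (cbox (- a) a) (\<lambda>t. \<eta> t * inner (x - y) (p (x - t) - p (y - t)))"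
        unfolding Pdiff using integral_linear[OF Pdi bounded_linear_inner_right[of "x - y"], of x y] by (simp add: o_def)
      also have "0 \<le> \<dots>"
      proof (rule integral_nonneg)
        show "(\<lambda>t. \<eta> t * inner (x - y) (p (x - t) - p (y - t))) integrable_on cbox (- a) a"
          by (intro integrable_continuous continuous_on_mult continuous_on_inner continuous_on_diff continuous_on_const \<eta>c pcx)
        show "0 \<le> \<eta> t * inner (x - y) (p (x - t) - p (y - t))" for t
          using \<eta>0[of t] mono[of "x - t" "y - t"] by (simp add: inner_commute)
      qed
      finally show ?thesis by (simp add: inner_commute)
    qed
    show "P x = v" if pv: "\<And>y. dist c' y \<le> 2 * \<rho> \<Longrightarrow> p y = v" and x: "dist c' x \<le> \<rho>" for c' v x
    proof -
      have "\<eta> t *\<^sub>R p (x - t) = \<eta> t *\<^sub>R v" for t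
      proof (cases "\<rho> < norm t")
        case False
        have "dist c' (x - t) \<le> dist c' x + dist x (x - t)" by (rule dist_triangle)
        then have "dist c' (x - t) \<le> 2 * \<rho>" using x False by (simp add: dist_norm)
        then show ?thesis using pv by simp
      qed (simp add: \<eta>s)
      then have "P x = integral (cbox (- a) a) (\<lambda>t. \<eta> t *\<^sub>R v)" by (simp only: P_def)
      also have "\<dots> = integral (cbox (- a) a) \<eta> *\<^sub>R v"
        using integral_linear[OF \<eta>i bounded_linear_scaleR_left[of v]] by (simp add: o_def)
      finally show ?thesis using \<eta>1 by simp
    qed
  qed
qed

subsection \<open>Membership in the class of potentials\<close>

lemma grad_eqI:
  assumes "GDERIV U x :> g"
  shows "grad U x = g"
  unfolding grad_def
proof (rule the_equality)
  fix g' assume "GDERIV U x :> g'"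
  then have "(\<lambda>h. inner h g') = (\<lambda>h. inner h g)"
    using assms unfolding gderiv_def by (rule has_derivative_unique)
  then show "g' = g" by (metis vector_eq_ldot)
qed (rule assms)

lemma smooth_gradient:
  fixes U :: "'a::euclidean_space \<Rightarrow> real"
  assumes C: "\<And>k. C_k k U" and G: "\<And>x. GDERIV U x :> G x"
  shows "\<exists>G'. (\<forall>x. (G has_derivative G' x) (at x)) \<and> (\<forall>v. continuous_on UNIV (\<lambda>x. G' x v))"
proof -
  define d where "d b x = frechet_derivative U (at x) b" for b x
  have dG: "d b x = inner b (G x)" for b x
    unfolding d_def using frechet_derivative_at[OF G[of x, unfolded gderiv_def]] by metis
  have d1: "C_k 1 (d b)" if "b \<in> Basis" for b
    unfolding d_def using C_k_SucD(2)[OF C[of "Suc 1"] that] by simp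
  define G' where "G' x h = (\<Sum>b\<in>Basis. frechet_derivative (d b) (at x) h *\<^sub>R b)" for x h
  have dd: "(d b has_derivative frechet_derivative (d b) (at x)) (at x)" if "b \<in> Basis" for b x
    using C_k_SucD(1)[of 0 "d b" x] d1[OF that] by (simp only: One_nat_def)
  have Geq: "G = (\<lambda>x. \<Sum>b\<in>Basis. d b x *\<^sub>R b)"
  proof (rule ext)
    fix x
    have "(\<Sum>b\<in>Basis. d b x *\<^sub>R b) = (\<Sum>b\<in>Basis. inner (G x) b *\<^sub>R b)"
      by (intro sum.cong refl) (simp add: dG inner_commute)
    then show "G x = (\<Sum>b\<in>Basis. d b x *\<^sub>R b)" by (simp add: euclidean_representation)
  qed
  show ?thesis
  proof (intro exI[of _ G'] conjI allI)
    show "(G has_derivative G' x) (at x)" for x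
      unfolding Geq G'_def by (intro has_derivative_sum has_derivative_scaleR_left dd)
    show "continuous_on UNIV (\<lambda>x. G' x v)" for v
    proof -
      have "frechet_derivative (d b) (at x) v = (\<Sum>c\<in>Basis. inner v c * frechet_derivative (d b) (at x) c)"
        if b: "b \<in> Basis" for b x
      proof -
        note l = has_derivative_linear[OF dd[OF b, of x]]
        have "frechet_derivative (d b) (at x) (\<Sum>c\<in>Basis. inner v c *\<^sub>R c) = (\<Sum>c\<in>Basis. inner v c * frechet_derivative (d b) (at x) c)"
          by (simp add: linear_sum[OF l] linear_scale[OF l])
        then show ?thesis by (simp add: euclidean_representation)
      qed
      moreover have "continuous_on UNIV (\<lambda>x. \<Sum>b\<in>Basis. (\<Sum>c\<in>Basis. inner v c * frechet_derivative (d b) (at x) c) *\<^sub>R b)"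
      proof (intro continuous_intros)
        fix b c :: 'a assume bc: "b \<in> Basis" "c \<in> Basis"
        have "C_k 0 (\<lambda>x. frechet_derivative (d b) (at x) c)"
          using C_k_SucD(2)[of 0 "d b" c] d1[OF bc(1)] bc(2) by (simp only: One_nat_def)
        then show "continuous_on UNIV (\<lambda>x. frechet_derivative (d b) (at x) c)" by simp
      qed
      ultimately show ?thesis unfolding G'_def by simp
    qed
  qed
qed

text \<open>The difference quotients of the gradient along a line through \<open>x\<close> are squeezed by the two monotonicity
  inequalities, and they converge to the Hessian form.\<close>

lemma potentialsI:
  fixes U :: "'a::euclidean_space \<Rightarrow> real"
  assumes C: "\<And>k. C_k k U" and G: "\<And>x. GDERIV U x :> G x"
    and lo: "\<And>x y. (norm (x - y))\<^sup>2 \<le> inner (G x - G y) (x - y)"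
    and hi: "\<And>x y. inner (G x - G y) (x - y) \<le> \<kappa> * (norm (x - y))\<^sup>2"
  shows "U \<in> potentials \<kappa>"
proof -
  obtain G' where G': "\<And>x. (G has_derivative G' x) (at x)"
    using smooth_gradient[OF C G] by blast
  have gG: "grad U = G" using grad_eqI[OF G] by auto
  have H: "hessian U x = G' x" for x
    unfolding hessian_def gG using frechet_derivative_at[OF G'] by metis
  have "(norm u)\<^sup>2 \<le> inner u (G' x u) \<and> inner u (G' x u) \<le> \<kappa> * (norm u)\<^sup>2" for x u
  proof -
    have "((\<lambda>t. x + t *\<^sub>R u) has_derivative (\<lambda>t. t *\<^sub>R u)) (at 0)" by (auto intro!: derivative_eq_intros)
    from has_derivative_compose[OF this, of G "G' x"] G'[of x]
    have "((\<lambda>t. G (x + t *\<^sub>R u)) has_derivative (\<lambda>t. G' x (t *\<^sub>R u))) (at 0)" by simp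
    from has_derivative_inner_left[OF this, of u]
    have "((\<lambda>t. inner (G (x + t *\<^sub>R u)) u) has_real_derivative inner (G' x u) u) (at 0)"
      using linear_scale[OF has_derivative_linear[OF G'[of x]]]
      by (simp add: has_field_derivative_def mult_commute_abs)
    then have l: "((\<lambda>t. (inner (G (x + t *\<^sub>R u)) u - inner (G x) u) / t) \<longlongrightarrow> inner (G' x u) u) (at 0)"
      by (simp add: has_field_derivative_iff)
    have "(norm u)\<^sup>2 \<le> (inner (G (x + t *\<^sub>R u)) u - inner (G x) u) / t
        \<and> (inner (G (x + t *\<^sub>R u)) u - inner (G x) u) / t \<le> \<kappa> * (norm u)\<^sup>2" if t: "t \<noteq> 0" for t
    proof -
      let ?D = "inner (G (x + t *\<^sub>R u)) u - inner (G x) u"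
      have i: "inner (G (x + t *\<^sub>R u) - G x) ((x + t *\<^sub>R u) - x) = t * ?D" by (simp add: inner_diff_left algebra_simps)
      have "t\<^sup>2 * (norm u)\<^sup>2 \<le> t * ?D" "t * ?D \<le> \<kappa> * (t\<^sup>2 * (norm u)\<^sup>2)"
        using lo[of "x + t *\<^sub>R u" x] hi[of "x + t *\<^sub>R u" x] unfolding i by (simp_all add: power_mult_distrib)
      moreover have "t * ?D = t\<^sup>2 * (?D / t)" using t by (simp add: power2_eq_square)
      ultimately have "t\<^sup>2 * (norm u)\<^sup>2 \<le> t\<^sup>2 * (?D / t)" "t\<^sup>2 * (?D / t) \<le> t\<^sup>2 * (\<kappa> * (norm u)\<^sup>2)"
        by (simp_all only: mult_ac)
      moreover have "0 < t\<^sup>2" using t by simp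
      ultimately show ?thesis by (simp only: mult_le_cancel_left_pos)
    qed
    then have "(norm u)\<^sup>2 \<le> inner (G' x u) u" "inner (G' x u) u \<le> \<kappa> * (norm u)\<^sup>2"
      by (auto intro!: tendsto_lowerbound[OF l] tendsto_upperbound[OF l] simp: eventually_at_filter)
    then show ?thesis by (simp add: inner_commute)
  qed
  then show ?thesis
    using C by (simp add: potentials_def C_infinity_def loewner_le_def H power2_norm_eq_inner)
qed

lemma dilate_gderiv:
  assumes "\<And>x. GDERIV U x :> G x" and "R \<noteq> 0"
  shows "GDERIV (dilate R U) x :> R *\<^sub>R G (x /\<^sub>R R)"
proof -
  have "((\<lambda>x. U (x /\<^sub>R R)) has_derivative (\<lambda>h. inner (h /\<^sub>R R) (G (x /\<^sub>R R)))) (at x)"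
    by (rule has_derivative_compose[OF _ assms(1)[unfolded gderiv_def], of "\<lambda>x. x /\<^sub>R R" "\<lambda>h. h /\<^sub>R R"])
      (auto intro!: derivative_eq_intros)
  from has_derivative_mult_right[OF this, of "R\<^sup>2"] show ?thesis
    using assms(2) unfolding gderiv_def dilate_def by (simp add: power2_eq_square field_simps)
qed

text \<open>Dilation multiplies the gradient by \<open>R\<close> and its argument by \<open>1 / R\<close>, so it leaves the Hessian bounds
  unchanged.\<close>

lemma dilate_potentials:
  fixes U :: "'a::euclidean_space \<Rightarrow> real"
  assumes C: "\<And>k. C_k k U" and G: "\<And>x. GDERIV U x :> G x"
    and lo: "\<And>x y. (norm (x - y))\<^sup>2 \<le> inner (G x - G y) (x - y)"
    and hi: "\<And>x y. inner (G x - G y) (x - y) \<le> \<kappa> * (norm (x - y))\<^sup>2"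
    and R: "0 < R"
  shows "dilate R U \<in> potentials \<kappa>" and "grad (dilate R U) = (\<lambda>x. R *\<^sub>R G (x /\<^sub>R R))"
proof -
  note D = dilate_gderiv[OF G, of R]
  show "grad (dilate R U) = (\<lambda>x. R *\<^sub>R G (x /\<^sub>R R))" using grad_eqI[OF D] R by auto
  have i: "inner (R *\<^sub>R G (x /\<^sub>R R) - R *\<^sub>R G (y /\<^sub>R R)) (x - y) = R\<^sup>2 * inner (G (x /\<^sub>R R) - G (y /\<^sub>R R)) (x /\<^sub>R R - y /\<^sub>R R)" for x y
    using R by (simp add: power2_eq_square flip: scaleR_diff_right)
  have n: "(norm (x - y))\<^sup>2 = R\<^sup>2 * (norm (x /\<^sub>R R - y /\<^sub>R R))\<^sup>2" for x y :: 'a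
  proof -
    have "norm (x /\<^sub>R R - y /\<^sub>R R) = norm (x - y) / R"
      using R by (simp add: divide_inverse_commute flip: scaleR_diff_right)
    then show ?thesis using R by (simp add: power_divide)
  qed
  show "dilate R U \<in> potentials \<kappa>"
  proof (rule potentialsI[of _ "\<lambda>x. R *\<^sub>R G (x /\<^sub>R R)"])
    show "C_k k (dilate R U)" for k unfolding dilate_def by (rule C_k_rescale[OF C])
    show "GDERIV (dilate R U) x :> R *\<^sub>R G (x /\<^sub>R R)" for x by (rule D) (use R in simp)
    show "(norm (x - y))\<^sup>2 \<le> inner (R *\<^sub>R G (x /\<^sub>R R) - R *\<^sub>R G (y /\<^sub>R R)) (x - y)" for x y
      unfolding i n[of x y] by (rule mult_left_mono[OF lo]) simp
    show "inner (R *\<^sub>R G (x /\<^sub>R R) - R *\<^sub>R G (y /\<^sub>R R)) (x - y) \<le> \<kappa> * (norm (x - y))\<^sup>2" for x y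
      unfolding i n[of x y] using mult_left_mono[OF hi[of "x /\<^sub>R R" "y /\<^sub>R R"], of "R\<^sup>2"] by (simp add: mult_ac)
  qed
qed

subsection \<open>Projection onto a convex set\<close>

text \<open>Half the difference between \<open>|x|\<^sup>2\<close> and the squared distance to \<open>K\<close> is the supremum over
  \<open>p\<close> in \<open>K\<close> of \<open>\<langle>x, p\<rangle> - |p|\<^sup>2 / 2\<close>, attained at the projection; comparing the suprema at two
  points brackets the increment and yields the gradient.\<close>

lemma projection_potential:
  fixes K :: "'a::euclidean_space set"
  assumes K: "convex K" "closed K" "K \<noteq> {}"
  defines "p \<equiv> closest_point K"
  obtains q where "\<And>x. GDERIV q x :> p x" "\<And>x y. norm (p x - p y) \<le> norm (x - y)"
    "\<And>x y. 0 \<le> inner (p x - p y) (x - y)" "\<And>x. p x \<in> K"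
proof
  define q where "q x = ((norm x)\<^sup>2 - (norm (x - p x))\<^sup>2) / 2" for x
  have q: "q x = inner x (p x) - (norm (p x))\<^sup>2 / 2" for x
    unfolding q_def power2_norm_eq_inner by (simp add: inner_diff_left inner_diff_right inner_commute field_simps)
  show pK: "p x \<in> K" for x unfolding p_def using closest_point_exists[OF K(2,3)] by blast
  show lip: "norm (p x - p y) \<le> norm (x - y)" for x y
    using closest_point_lipschitz[OF K, of x y] by (simp add: p_def dist_norm)
  have qlow: "q y + inner (x - y) (p y) \<le> q x" for x y
  proof -
    have "dist x (p x) \<le> dist x (p y)" unfolding p_def by (rule closest_point_le[OF K(2)]) (use pK in \<open>simp add: p_def\<close>)
    then have "(norm (x - p x))\<^sup>2 \<le> (norm (x - p y))\<^sup>2" by (simp add: dist_norm power_mono)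
    then show ?thesis unfolding q[of y] q_def[of x] power2_norm_eq_inner
      by (simp add: inner_diff_left inner_diff_right inner_commute field_simps)
  qed
  show "0 \<le> inner (p x - p y) (x - y)" for x y
    using qlow[of x y] qlow[of y x] by (simp add: inner_diff_left inner_diff_right inner_commute algebra_simps)
  have bracket: "norm (q y - q x - inner (y - x) (p x)) \<le> norm (y - x) * norm (y - x)" for x y
  proof -
    have "q y - q x - inner (y - x) (p x) \<le> inner (y - x) (p y - p x)"
      using qlow[of y x] by (simp add: inner_diff_left inner_diff_right algebra_simps)
    also have "\<dots> \<le> norm (y - x) * norm (p y - p x)" by (rule norm_cauchy_schwarz)
    also have "\<dots> \<le> norm (y - x) * norm (y - x)" by (intro mult_left_mono lip) auto
    finally show ?thesis using qlow[of x y] by (simp add: abs_le_iff)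
  qed
  show "GDERIV q x :> p x" for x
    unfolding gderiv_def has_derivative_iff_norm
  proof (intro conjI bounded_linear_inner_left)
    show "((\<lambda>y. norm (q y - q x - inner (y - x) (p x)) / norm (y - x)) \<longlongrightarrow> 0) (at x)"
    proof (rule tendsto_sandwich[of "\<lambda>_. 0" _ _ "\<lambda>y. norm (y - x)"])
      show "((\<lambda>y. norm (y - x)) \<longlongrightarrow> 0) (at x)"
        by (auto intro!: tendsto_eq_intros)
      show "\<forall>\<^sub>F y in at x. norm (q y - q x - inner (y - x) (p x)) / norm (y - x) \<le> norm (y - x)"
        using bracket by (auto simp: eventually_at_filter divide_le_eq)
    qed auto
  qed
qed

section \<open>A potential with an attracting heavy-ball cycle\<close>

definition unit_at :: "real \<Rightarrow> real^2" where
  "unit_at t = vector [cos t, sin t]"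

definition normal_at :: "real \<Rightarrow> real^2" where
  "normal_at t = vector [- sin t, cos t]"

lemma inner_vec2: "inner x y = x $ 1 * y $ 1 + x $ 2 * y $ 2" for x y :: "real^2"
  by (simp add: inner_vec_def sum_2)

lemma inner_unit_normal:
  "inner (unit_at a) (unit_at b) = cos (b - a)" "inner (unit_at a) (normal_at b) = - sin (b - a)"
  "inner (normal_at a) (unit_at b) = sin (b - a)" "inner (normal_at a) (normal_at b) = cos (b - a)"
  by (simp_all add: inner_vec2 unit_at_def normal_at_def cos_diff sin_diff algebra_simps)

lemma norm_unit_at: "norm (unit_at t) = 1"
  by (simp add: norm_eq_sqrt_inner inner_unit_normal)

lemma norm_normal_at: "norm (normal_at t) = 1"
  by (simp add: norm_eq_sqrt_inner inner_unit_normal)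

lemma unit_at_add: "unit_at (a + b) = cos b *\<^sub>R unit_at a + sin b *\<^sub>R normal_at a"
  by (simp add: Finite_Cartesian_Product.vec_eq_iff forall_2 unit_at_def normal_at_def cos_add sin_add algebra_simps)

lemma unit_at_period: "unit_at (t + 2 * pi * of_int n) = unit_at t"
  and normal_at_period: "normal_at (t + 2 * pi * of_int n) = normal_at t"
  by (simp_all add: unit_at_def normal_at_def cos_add sin_add)

text \<open>The vertices \<open>p\<^sub>k = X u\<^sub>k - y n\<^sub>k\<close> form a regular polygon turned slightly backwards with respect
  to the cycle points \<open>u\<^sub>k\<close>. The hypothesis \<open>cone\<close> says that each \<open>u\<^sub>k\<close> lies in the interior of the
  normal cone of its vertex \<open>p\<^sub>k\<close>, so that the projection is constant near \<open>u\<^sub>k\<close>.\<close>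

lemma polygon_projection_locally_constant:
  fixes K :: nat and X y :: real
  defines "\<theta> \<equiv> 2 * pi / real K"
  defines "p \<equiv> \<lambda>k::int. X *\<^sub>R unit_at (of_int k * \<theta>) - y *\<^sub>R normal_at (of_int k * \<theta>)"
  assumes K: "2 \<le> K" and y: "0 \<le> y"
    and cone: "y * cos (pi / real K) < (X - X\<^sup>2 - y\<^sup>2) * sin (pi / real K)"
  obtains \<rho> where "0 < \<rho>"
    "\<And>k x. dist (unit_at (of_int k * \<theta>)) x \<le> \<rho> \<Longrightarrow> closest_point (convex hull (p ` {0..<int K})) x = p k"
proof -
  define A where "A = X - X\<^sup>2 - y\<^sup>2"
  define v where "v m = A * (1 - cos (of_int m * \<theta>)) - y * sin (of_int m * \<theta>)" for m :: int
  have \<theta>K: "\<theta> * real K = 2 * pi" using K by (simp add: \<theta>_def)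
  have red: "of_int m * \<theta> = of_int (m mod int K) * \<theta> + 2 * pi * of_int (m div int K)" for m
  proof -
    have "(of_int m :: real) = of_int (m mod int K) + real K * of_int (m div int K)"
      by (metis add.commute mod_mult_div_eq of_int_add of_int_mult of_int_of_nat_eq)
    then have "of_int m * \<theta> = of_int (m mod int K) * \<theta> + (\<theta> * real K) * of_int (m div int K)"
      by (simp add: algebra_simps)
    then show ?thesis by (simp add: \<theta>K)
  qed
  have p_mod: "p m = p (m mod int K)" for m
    unfolding p_def by (subst (1 2) red) (simp add: unit_at_period normal_at_period)
  have v_mod: "v m = v (m mod int K)" for m
    unfolding v_def by (subst (1 2) red) (simp add: cos_add sin_add)
  have sK: "0 < sin (pi / real K)" using K by (intro sin_gt_zero) (auto simp: field_simps)
  have cK: "0 \<le> cos (pi / real K)" 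
  proof (rule cos_ge_zero)
    have "0 \<le> pi / real K" by simp
    then show "- (pi / 2) \<le> pi / real K" using pi_ge_zero by linarith
    show "pi / real K \<le> pi / 2" using K by (simp add: field_simps)
  qed
  have A0: "0 < A"
  proof -
    have "0 \<le> y * cos (pi / real K)" using y cK by simp
    then have "0 < A * sin (pi / real K)" using cone by (simp add: A_def)
    then show ?thesis using sK by (simp add: zero_less_mult_iff)
  qed
  have v_pos: "0 < v m" if m: "m \<in> {1..<int K}" for m
  proof -
    define \<psi> where "\<psi> = of_int m * (pi / real K)"
    have lo: "pi / real K \<le> \<psi>" 
      using m mult_right_mono[of 1 "of_int m" "pi / real K"] by (simp add: \<psi>_def)
    have hi: "\<psi> \<le> pi - pi / real K"
    proof -
      have "of_int m + 1 \<le> real K" using m by auto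
      then have "(of_int m + 1) * (pi / real K) \<le> real K * (pi / real K)" by (intro mult_right_mono) auto
      moreover have "(of_int m + 1) * (pi / real K) = \<psi> + pi / real K" by (simp add: \<psi>_def distrib_right add_divide_distrib)
      moreover have "real K * (pi / real K) = pi" using K by simp
      ultimately show ?thesis by linarith
    qed
    have p0: "0 < pi / real K" using K by simp
    have h: "pi / real K \<le> pi / 2" using K by (simp add: field_simps)
    have s: "sin (pi / real K) \<le> sin \<psi>"
    proof (cases "\<psi> \<le> pi / 2")
      case True
      show ?thesis by (rule sin_monotone_2pi_le) (use lo True p0 in auto)
    next
      case False
      have "sin (pi / real K) \<le> sin (pi - \<psi>)" by (rule sin_monotone_2pi_le) (use hi False p0 in auto)
      then show ?thesis by simp
    qed
    have c: "cos \<psi> \<le> cos (pi / real K)" by (rule cos_monotone_0_pi_le) (use lo hi p0 in auto)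
    have "y * cos \<psi> \<le> y * cos (pi / real K)" using c y by (rule mult_left_mono)
    also have "\<dots> < A * sin (pi / real K)" using cone by (simp add: A_def)
    also have "\<dots> \<le> A * sin \<psi>" using s A0 by simp
    finally have d: "0 < A * sin \<psi> - y * cos \<psi>" by simp
    have tw: "of_int m * \<theta> = 2 * \<psi>" by (simp add: \<theta>_def \<psi>_def)
    have "v m = 2 * sin \<psi> * (A * sin \<psi> - y * cos \<psi>)"
      unfolding v_def tw sin_double cos_double_sin by (simp add: algebra_simps power2_eq_square)
    then show ?thesis using d s sK by simp
  qed
  define d where "d = Min (v ` {1..<int K})"
  have fin: "finite (v ` {1..<int K})" "v ` {1..<int K} \<noteq> {}" using K by auto
  have d0: "0 < d" unfolding d_def using fin v_pos by (subst Min_gr_iff) auto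
  have d_le: "d \<le> v m" if "m mod int K \<noteq> 0" for m
  proof -
    have "0 \<le> m mod int K" "m mod int K < int K" using K by simp_all
    then have "m mod int K \<in> {1..<int K}" using that by simp
    then show ?thesis unfolding v_mod[of m] d_def using fin by (intro Min_le) auto
  qed
  have ip: "inner (unit_at (of_int k * \<theta>) - p k) (p j - p k) = - v (j - k)" for j k
    unfolding p_def v_def A_def
    by (simp add: inner_diff_left inner_diff_right inner_unit_normal left_diff_distrib[symmetric] of_int_diff[symmetric] del: of_int_diff)
      (simp add: sin_minus cos_minus algebra_simps power2_eq_square sin_diff cos_diff)
  define M where "M = 2 * (\<bar>X\<bar> + y) + 1"
  have pM: "norm (p j - p k) \<le> M" for j k
  proof -
    have "norm (p j) \<le> \<bar>X\<bar> + y" for j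
      unfolding p_def using norm_triangle_ineq4[of "X *\<^sub>R unit_at (of_int j * \<theta>)" "y *\<^sub>R normal_at (of_int j * \<theta>)"] y
      by (simp add: norm_unit_at norm_normal_at)
    from this[of j] this[of k] show ?thesis using norm_triangle_ineq4[of "p j" "p k"] by (simp add: M_def)
  qed
  have M: "0 < M" using y by (simp add: M_def)
  show thesis
  proof (rule that[of "d / M"])
    show "0 < d / M" using d0 M by simp
    fix k x assume x: "dist (unit_at (of_int k * \<theta>)) x \<le> d / M"
    let ?H = "convex hull (p ` {0..<int K})"
    have half: "?H \<subseteq> {q. inner (x - p k) q \<le> inner (x - p k) (p k)}"
    proof (rule hull_minimal)
      show "convex {q. inner (x - p k) q \<le> inner (x - p k) (p k)}" by (rule convex_halfspace_le)
      show "p ` {0..<int K} \<subseteq> {q. inner (x - p k) q \<le> inner (x - p k) (p k)}"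
      proof safe
        fix j assume "j \<in> {0..<int K}"
        show "inner (x - p k) (p j) \<le> inner (x - p k) (p k)"
        proof (cases "(j - k) mod int K = 0")
          case True
          then have "j mod int K = k mod int K" by (simp add: mod_eq_dvd_iff dvd_eq_mod_eq_0)
          then have "p j = p k" using p_mod[of j] p_mod[of k] by simp
          then show ?thesis by simp
        next
          case False
          have "inner (x - p k) (p j - p k) = inner (unit_at (of_int k * \<theta>) - p k) (p j - p k) + inner (x - unit_at (of_int k * \<theta>)) (p j - p k)"
            by (simp add: inner_diff_left)
          also have "\<dots> \<le> - d + (d / M) * M"
          proof (rule add_mono)
            show "inner (unit_at (of_int k * \<theta>) - p k) (p j - p k) \<le> - d" using ip d_le[OF False] by simp
            have "inner (x - unit_at (of_int k * \<theta>)) (p j - p k) \<le> norm (x - unit_at (of_int k * \<theta>)) * norm (p j - p k)"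
              by (rule norm_cauchy_schwarz)
            also have "\<dots> \<le> (d / M) * M" using x pM d0 M by (intro mult_mono) (auto simp: dist_norm norm_minus_commute)
            finally show "inner (x - unit_at (of_int k * \<theta>)) (p j - p k) \<le> (d / M) * M" .
          qed
          finally show ?thesis using M by (simp add: inner_diff_right)
        qed
      qed
    qed
    have pk: "p k \<in> ?H"
    proof -
      have "k mod int K \<in> {0..<int K}" using K by simp
      then show ?thesis unfolding p_mod[of k] by (intro hull_inc imageI)
    qed
    have "p k = closest_point ?H x"
    proof (rule closest_point_unique)
      show "closed ?H" by (intro compact_imp_closed finite_imp_compact_convex_hull) simp
      show "\<forall>z\<in>?H. dist x (p k) \<le> dist x z"
      proof
        fix z assume "z \<in> ?H"
        then have "inner (x - p k) (z - p k) \<le> 0" using half by (auto simp: inner_diff_right)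
        moreover have "(norm (x - z))\<^sup>2 = (norm (x - p k))\<^sup>2 - 2 * inner (x - p k) (z - p k) + (norm (z - p k))\<^sup>2"
          unfolding power2_norm_eq_inner by (simp add: inner_diff_left inner_diff_right inner_commute)
        ultimately have "(norm (x - p k))\<^sup>2 \<le> (norm (x - z))\<^sup>2" using zero_le_power2[of "norm (z - p k)"] by linarith
        then show "dist x (p k) \<le> dist x z" by (simp add: dist_norm)
      qed
    qed (use pk in auto)
    then show "closest_point ?H x = p k" by simp
  qed
qed

text \<open>The potential is \<open>|x|\<^sup>2 / 2 + (\<kappa> - 1) Q\<close>, where the gradient of \<open>Q\<close> is a mollified projection onto the
  polygon with vertices \<open>p\<^sub>k\<close>; a projection is monotone and nonexpansive, hence the Hessian bounds \<open>1\<close> and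
  \<open>\<kappa>\<close>. At the cycle point \<open>u\<^sub>k\<close> the force is \<open>u\<^sub>k + (\<kappa> - 1) p\<^sub>k\<close>. The equations for \<open>X\<close> and \<open>y\<close> are the
  radial and the tangential component of the requirement that the heavy-ball recursion send
  \<open>(u\<^sub>k, u\<^sub>k\<^sub>-\<^sub>1)\<close> to \<open>u\<^sub>k\<^sub>+\<^sub>1\<close>. The force is linear up to a constant near each \<open>u\<^sub>k\<close>, which makes the cycle
  attracting. The index \<open>k\<close> runs over all integers, with period \<open>K\<close>.\<close>

theorem cyclic_potential:
  fixes K :: nat and \<beta> s \<kappa> X y :: real
  assumes K: "2 \<le> K" and \<kappa>: "1 < \<kappa>" and s: "0 < s" and \<beta>: "\<beta> \<le> 1"
    and X: "s * (\<kappa> - 1) * X = (1 + \<beta>) * (1 - cos (2 * pi / real K)) - s"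
    and y: "s * (\<kappa> - 1) * y = (1 - \<beta>) * sin (2 * pi / real K)" and y0: "0 \<le> y"
    and cone: "y * cos (pi / real K) < (X - X\<^sup>2 - y\<^sup>2) * sin (pi / real K)"
  obtains U :: "real^2 \<Rightarrow> real" and G g :: "real^2 \<Rightarrow> real^2" and c :: "int \<Rightarrow> real^2" and \<rho> B d :: real
  where "\<And>k. C_k k U" "\<And>x. GDERIV U x :> G x"
    "\<And>x y. (norm (x - y))\<^sup>2 \<le> inner (G x - G y) (x - y)"
    "\<And>x y. inner (G x - G y) (x - y) \<le> \<kappa> * (norm (x - y))\<^sup>2"
    "\<And>x y. norm (G x - G y) \<le> \<kappa> * norm (x - y)"
    "\<And>x. G x = x + g x" "\<And>x. norm (g x) \<le> B" "0 \<le> B"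
    "\<And>k. c (k + 1) = (1 + \<beta>) *\<^sub>R c k - \<beta> *\<^sub>R c (k - 1) - s *\<^sub>R G (c k)"
    "0 < \<rho>" "\<And>k x. dist (c k) x \<le> \<rho> \<Longrightarrow> g x = g (c k)"
    "\<And>k. norm (c k) = 1" "0 < d" "\<And>k. dist (c k) (c (k + 1)) = d"
proof -
  define \<theta> where "\<theta> = 2 * pi / real K"
  define p where "p k = X *\<^sub>R unit_at (of_int k * \<theta>) - y *\<^sub>R normal_at (of_int k * \<theta>)" for k :: int
  define c where "c k = unit_at (of_int k * \<theta>)" for k :: int
  let ?H = "convex hull (p ` {0..<int K})"
  obtain \<rho> where \<rho>: "0 < \<rho>" "\<And>k x. dist (c k) x \<le> \<rho> \<Longrightarrow> closest_point ?H x = p k"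
    unfolding c_def p_def \<theta>_def by (rule polygon_projection_locally_constant[OF K y0 cone]) blast
  have cl: "closed ?H" by (intro compact_imp_closed finite_imp_compact_convex_hull) simp
  have ne: "?H \<noteq> {}" using K by simp
  obtain q where q: "\<And>x. GDERIV q x :> closest_point ?H x"
    "\<And>x y. norm (closest_point ?H x - closest_point ?H y) \<le> norm (x - y)"
    "\<And>x y. 0 \<le> inner (closest_point ?H x - closest_point ?H y) (x - y)" "\<And>x. closest_point ?H x \<in> ?H"
    by (rule projection_potential[OF convex_convex_hull cl ne]) blast
  have "bounded ?H" by (intro compact_imp_bounded finite_imp_compact_convex_hull) simp
  then obtain B0 where B0: "\<And>x. x \<in> ?H \<Longrightarrow> norm x \<le> B0" by (auto simp: bounded_iff)
  have B00: "0 \<le> B0" using B0[OF q(4)[of 0]] norm_ge_zero order_trans by blast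
  have r2: "0 < \<rho> / 2" using \<rho> by simp
  obtain Q P where QP: "\<And>k. C_k k Q" "\<And>x. GDERIV Q x :> P x" "\<And>x y. norm (P x - P y) \<le> norm (x - y)"
    "\<And>x y. 0 \<le> inner (P x - P y) (x - y)" "\<And>x. norm (P x) \<le> B0"
    "\<And>c v x. (\<And>y. dist c y \<le> 2 * (\<rho> / 2) \<Longrightarrow> closest_point ?H y = v) \<Longrightarrow> dist c x \<le> \<rho> / 2 \<Longrightarrow> P x = v"
    by (rule mollification[OF q(1-3) B0[OF q(4)] r2]) blast
  have Pc: "P x = p k" if "dist (c k) x \<le> \<rho> / 2" for k x
    by (rule QP(6)[OF _ that]) (use \<rho>(2) in auto)
  define U where "U x = (1 / 2) * (inner x x) + (\<kappa> - 1) * Q x" for x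
  define g where "g x = (\<kappa> - 1) *\<^sub>R P x" for x
  define G where "G x = x + g x" for x
  have gdiff: "g x - g y = (\<kappa> - 1) *\<^sub>R (P x - P y)" for x y by (simp add: g_def scaleR_diff_right)
  have iG: "inner (G x - G y) (x - y) = (norm (x - y))\<^sup>2 + (\<kappa> - 1) * inner (P x - P y) (x - y)" for x y
  proof -
    have "G x - G y = (x - y) + (\<kappa> - 1) *\<^sub>R (P x - P y)" using gdiff[of x y] by (simp add: G_def algebra_simps)
    then show ?thesis by (simp add: inner_add_left power2_norm_eq_inner)
  qed
  have step: "c (k + 1) = cos \<theta> *\<^sub>R c k + sin \<theta> *\<^sub>R normal_at (of_int k * \<theta>)"
    "c (k - 1) = cos \<theta> *\<^sub>R c k - sin \<theta> *\<^sub>R normal_at (of_int k * \<theta>)" for k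
    using unit_at_add[of "of_int k * \<theta>" \<theta>] unit_at_add[of "of_int k * \<theta>" "- \<theta>"]
    by (simp_all add: c_def algebra_simps)
  have gc: "g (c k) = (\<kappa> - 1) *\<^sub>R p k" for k using Pc[of k "c k"] \<rho> by (simp add: g_def)
  show thesis
  proof (rule that[of U G g B0' c "\<rho> / 2" "norm (unit_at \<theta> - unit_at 0)" for B0'])
    show "C_k k U" for k unfolding U_def
      by (intro C_k_add C_k_mult C_k_const C_k_norm_square QP(1))
    show "GDERIV U x :> G x" for x
    proof -
      have "((\<lambda>x. inner x x) has_derivative (\<lambda>h. 2 * inner h x)) (at x)"
        by (auto intro!: derivative_eq_intros simp: inner_commute)
      from has_derivative_add[OF has_derivative_mult_right[OF this, of "1/2"] has_derivative_mult_right[OF QP(2)[unfolded gderiv_def], of "\<kappa> - 1"]]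
      show ?thesis by (simp add: gderiv_def U_def[abs_def] G_def g_def inner_add_right)
    qed
    show "(norm (x - y))\<^sup>2 \<le> inner (G x - G y) (x - y)" for x y
      unfolding iG using QP(4)[of x y] \<kappa> by simp
    show "inner (G x - G y) (x - y) \<le> \<kappa> * (norm (x - y))\<^sup>2" for x y
    proof -
      have "inner (P x - P y) (x - y) \<le> norm (P x - P y) * norm (x - y)" by (rule norm_cauchy_schwarz)
      also have "\<dots> \<le> norm (x - y) * norm (x - y)" by (intro mult_right_mono QP(3)) auto
      finally have "(\<kappa> - 1) * inner (P x - P y) (x - y) \<le> (\<kappa> - 1) * (norm (x - y))\<^sup>2"
        using \<kappa> by (intro mult_left_mono) (auto simp: power2_eq_square)
      then show ?thesis unfolding iG by (simp add: algebra_simps)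
    qed
    show "norm (G x - G y) \<le> \<kappa> * norm (x - y)" for x y
    proof -
      have "G x - G y = (x - y) + (g x - g y)" by (simp add: G_def)
      also have "norm \<dots> \<le> norm (x - y) + norm (g x - g y)" by (rule norm_triangle_ineq)
      also have "norm (g x - g y) \<le> (\<kappa> - 1) * norm (x - y)"
        unfolding gdiff using QP(3)[of x y] \<kappa> by (simp add: mult_left_mono)
      finally show ?thesis by (simp add: algebra_simps)
    qed
    show "G x = x + g x" for x by (simp add: G_def)
    show "norm (g x) \<le> (\<kappa> - 1) * B0" for x using QP(5)[of x] \<kappa> by (simp add: g_def mult_left_mono)
    show "0 \<le> (\<kappa> - 1) * B0" using B00 \<kappa> by simp
    show "0 < \<rho> / 2" by (rule r2)
    show "g x = g (c k)" if "dist (c k) x \<le> \<rho> / 2" for k x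
      unfolding gc by (simp add: g_def Pc[OF that])
    show "norm (c k) = 1" for k by (simp add: c_def norm_unit_at)
    show "c (k + 1) = (1 + \<beta>) *\<^sub>R c k - \<beta> *\<^sub>R c (k - 1) - s *\<^sub>R G (c k)" for k
    proof -
      have "s *\<^sub>R G (c k) = s *\<^sub>R c k + (s * (\<kappa> - 1) * X) *\<^sub>R c k - (s * (\<kappa> - 1) * y) *\<^sub>R normal_at (of_int k * \<theta>)"
      proof -
      have "s *\<^sub>R G (c k) = s *\<^sub>R (c k + (\<kappa> - 1) *\<^sub>R p k)" by (simp add: G_def gc)
      then show ?thesis by (simp add: p_def c_def algebra_simps)
    qed
      also have "\<dots> = ((1 + \<beta>) * (1 - cos \<theta>)) *\<^sub>R c k - ((1 - \<beta>) * sin \<theta>) *\<^sub>R normal_at (of_int k * \<theta>)"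
        unfolding X y \<theta>_def[symmetric] by (simp add: algebra_simps)
      finally show ?thesis unfolding step by (simp add: algebra_simps)
    qed
    show "dist (c k) (c (k + 1)) = norm (unit_at \<theta> - unit_at 0)" for k
    proof -
      have n: "(norm (unit_at a - unit_at b))\<^sup>2 = 2 - 2 * cos (a - b)" for a b
        unfolding power2_norm_eq_inner
        by (simp add: inner_diff_left inner_diff_right inner_unit_normal cos_diff mult.commute)
      have e: "of_int k * \<theta> - of_int (k + 1) * \<theta> = - \<theta>" by (simp add: algebra_simps)
      have "(norm (c k - c (k + 1)))\<^sup>2 = (norm (unit_at \<theta> - unit_at 0))\<^sup>2"
        unfolding c_def n e by simp
      then have "norm (c k - c (k + 1)) = norm (unit_at \<theta> - unit_at 0)" by (rule power2_eq_imp_eq) auto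
      then show ?thesis by (simp add: dist_norm)
    qed
    show "0 < norm (unit_at \<theta> - unit_at 0)"
    proof -
      have "\<theta> \<le> pi" "0 < \<theta>" using K by (auto simp: \<theta>_def field_simps)
      then have "cos \<theta> < cos 0" by (intro cos_monotone_0_pi) auto
      then have "unit_at \<theta> $ 1 \<noteq> unit_at 0 $ 1" by (simp add: unit_at_def)
      then have "unit_at \<theta> \<noteq> unit_at 0" by metis
      then show ?thesis by simp
    qed
  qed
qed

text \<open>Halving the angle divides \<open>1 - cos\<close> by at most four, and the end points of the window have the ratio
  \<open>17 / 4\<close>, so some dyadic angle hits it.\<close>

lemma dyadic_angle_in_window:
  fixes t :: real
  assumes t: "0 < t" "t < 2"
  obtains K :: nat where "4 \<le> K" "t / 5 \<le> 1 - cos (2 * pi / real K)" "1 - cos (2 * pi / real K) \<le> 17 / 20 * t"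
proof -
  define w where "w n = 1 - cos (2 * pi / 2 ^ n)" for n :: nat
  have w2: "w n = 2 * (sin (pi / 2 ^ n))\<^sup>2" for n
    using cos_double_sin[of "pi / 2 ^ n"] by (simp add: w_def)
  have half: "w n \<le> 4 * w (Suc n)" for n
  proof -
    have "sin (pi / 2 ^ n) = 2 * sin (pi / 2 ^ Suc n) * cos (pi / 2 ^ Suc n)"
      using sin_double[of "pi / 2 ^ Suc n"] by simp
    then have "(sin (pi / 2 ^ n))\<^sup>2 = 4 * (sin (pi / 2 ^ Suc n))\<^sup>2 * (cos (pi / 2 ^ Suc n))\<^sup>2"
      by (simp add: power_mult_distrib)
    also have "\<dots> \<le> 4 * (sin (pi / 2 ^ Suc n))\<^sup>2 * 1"
      by (intro mult_left_mono) (auto simp: abs_square_le_1)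
    finally show ?thesis by (simp add: w2)
  qed
  have "(\<lambda>n. w n) \<longlonglongrightarrow> 1 - cos 0"
  proof -
    have "(\<lambda>n. 2 * pi * (1 / 2) ^ n) \<longlonglongrightarrow> 2 * pi * 0" by (intro tendsto_intros LIMSEQ_realpow_zero) auto
    then have "(\<lambda>n. 2 * pi / 2 ^ n) \<longlonglongrightarrow> 0" by (simp add: power_one_over)
    then show ?thesis unfolding w_def by (intro tendsto_intros)
  qed
  then have "\<forall>\<^sub>F n in sequentially. w n < 17 / 20 * t" by (rule order_tendstoD(2)) (use t in simp)
  then obtain N where N: "\<And>n. n \<ge> N \<Longrightarrow> w n < 17 / 20 * t" by (auto simp: eventually_sequentially)
  define n where "n = (LEAST n. 2 \<le> n \<and> w n \<le> 17 / 20 * t)"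
  have n: "2 \<le> n" "w n \<le> 17 / 20 * t"
    unfolding n_def using LeastI[of "\<lambda>n. 2 \<le> n \<and> w n \<le> 17 / 20 * t" "max N 2"] N[of "max N 2"] by auto
  have lo: "t / 5 \<le> w n"
  proof (cases "n = 2")
    case True
    have "w 2 = 1" by (simp add: w_def)
    then show ?thesis using True t by simp
  next
    case False
    then obtain m where m: "n = Suc m" "2 \<le> m" using n(1) by (cases n) auto
    have "\<not> (2 \<le> m \<and> w m \<le> 17 / 20 * t)" using not_less_Least[of m "\<lambda>n. 2 \<le> n \<and> w n \<le> 17 / 20 * t"] m by (simp add: n_def)
    then have "17 / 20 * t < w m" using m by simp
    also have "\<dots> \<le> 4 * w n" using half m by simp
    finally show ?thesis using t by simp
  qed
  show thesis
  proof (rule that[of "2 ^ n"])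
    show "4 \<le> (2::nat) ^ n" using power_increasing[OF n(1), of "2::nat"] by simp
  qed (use n lo in \<open>auto simp: w_def\<close>)
qed

text \<open>By \<open>lo\<close> the friction \<open>1 - \<beta>\<close> is small compared with \<open>s \<kappa>\<close>, hence so is the backward turn \<open>y\<close> of the
  polygon. The radial coordinate \<open>X\<close> then satisfies the cone condition on a whole window
  around \<open>1/2\<close>, wide enough for some dyadic number of vertices.\<close>

lemma cone_condition:
  fixes \<beta> s \<kappa> C :: real
  assumes \<beta>: "0 < \<beta>" "\<beta> < 1" and s: "0 < s" and \<kappa>: "54 \<le> \<kappa>" and C: "27 \<le> C"
    and up: "s * \<kappa> < 2 * (1 + \<beta>)" and lo: "C * (1 - \<beta>) < s * \<kappa>"
  obtains K :: nat and X y :: real where "2 \<le> K" "0 \<le> y"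
    "s * (\<kappa> - 1) * X = (1 + \<beta>) * (1 - cos (2 * pi / real K)) - s"
    "s * (\<kappa> - 1) * y = (1 - \<beta>) * sin (2 * pi / real K)"
    "y * cos (pi / real K) < (X - X\<^sup>2 - y\<^sup>2) * sin (pi / real K)"
proof -
  define t where "t = s * \<kappa> / (1 + \<beta>)"
  have t: "0 < t" "t < 2" using up s \<kappa> \<beta> by (auto simp: t_def field_simps)
  obtain K :: nat where K: "4 \<le> K" "t / 5 \<le> 1 - cos (2 * pi / real K)" "1 - cos (2 * pi / real K) \<le> 17 / 20 * t"
    using dyadic_angle_in_window[OF t] by blast
  define w where "w = 1 - cos (2 * pi / real K)"
  define D where "D = s * (\<kappa> - 1)"
  have D: "0 < D" using s \<kappa> by (simp add: D_def)
  have tb: "(1 + \<beta>) * t = s * \<kappa>" using \<beta> by (simp add: t_def)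
  define X where "X = ((1 + \<beta>) * w - s) / D"
  define y where "y = (1 - \<beta>) * sin (2 * pi / real K) / D"
  define S where "S = sin (pi / real K)"
  define Co where "Co = cos (pi / real K)"
  have S: "0 < S" unfolding S_def using K by (intro sin_gt_zero) (auto simp: field_simps)
  have wS: "w = 2 * S\<^sup>2" using cos_double_sin[of "pi / real K"] by (simp add: w_def S_def)
  have sC: "S\<^sup>2 + Co\<^sup>2 = 1" by (simp add: S_def Co_def)
  have Co0: "0 \<le> Co" unfolding Co_def 
  proof (rule cos_ge_zero)
    have "0 \<le> pi / real K" by simp
    then show "- (pi / 2) \<le> pi / real K" using pi_ge_zero by linarith
    show "pi / real K \<le> pi / 2" using K by (simp add: field_simps)
  qed
  have s2: "sin (2 * pi / real K) = 2 * S * Co" using sin_double[of "pi / real K"] by (simp add: S_def Co_def)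
  define \<epsilon> where "\<epsilon> = (1 - \<beta>) / D"
  have \<epsilon>0: "0 < \<epsilon>" using \<beta> D by (simp add: \<epsilon>_def)
  have \<epsilon>1: "\<epsilon> \<le> 2 / 53"
  proof -
    have "27 * (1 - \<beta>) \<le> C * (1 - \<beta>)" using C \<beta> by (intro mult_right_mono) auto
    then have 1: "27 * (1 - \<beta>) \<le> s * \<kappa>" using lo by linarith
    have "53 * (s * \<kappa>) \<le> 54 * D" using mult_left_mono[OF \<kappa>, of s] s by (simp add: D_def algebra_simps)
    then have "53 * (1 - \<beta>) \<le> 2 * D" using 1 by linarith
    then show ?thesis using D by (simp add: \<epsilon>_def field_simps)
  qed
  have y\<epsilon>: "y = \<epsilon> * (2 * S * Co)" by (simp add: y_def \<epsilon>_def s2)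
  (* The window for the angle puts X between 1/10 and 9/10, where X - X^2 is at least 9/100; the correction by y is smaller. *)
  have Xhi: "X \<le> 9 / 10"
  proof -
    have "(1 + \<beta>) * w \<le> (1 + \<beta>) * (17 / 20 * t)" using K \<beta> by (intro mult_left_mono) (auto simp: w_def)
    then have "(1 + \<beta>) * w \<le> 17 / 20 * (s * \<kappa>)" using tb by simp
    moreover have "54 * s \<le> s * \<kappa>" using mult_left_mono[OF \<kappa>, of s] s by simp
    moreover have "D = s * \<kappa> - s" by (simp add: D_def algebra_simps)
    ultimately have "(1 + \<beta>) * w - s \<le> 9 / 10 * D" using s by linarith
    then show ?thesis using D by (simp add: X_def field_simps)
  qed
  have Xlo: "1 / 10 \<le> X"
  proof -
    have "(1 + \<beta>) * (t / 5) \<le> (1 + \<beta>) * w" using K \<beta> by (intro mult_left_mono) (auto simp: w_def)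
    then have "(s * \<kappa>) / 5 \<le> (1 + \<beta>) * w" using tb by simp
    moreover have "54 * s \<le> s * \<kappa>" using mult_left_mono[OF \<kappa>, of s] s by simp
    moreover have "D = s * \<kappa> - s" by (simp add: D_def algebra_simps)
    ultimately have "1 / 10 * D \<le> (1 + \<beta>) * w - s" using s by linarith
    then show ?thesis using D by (simp add: X_def field_simps)
  qed
  have XX: "9 / 100 \<le> X - X\<^sup>2"
  proof -
    have "0 \<le> (X - 1 / 10) * (9 / 10 - X)" using Xlo Xhi by (intro mult_nonneg_nonneg) auto
    moreover have "(X - 1 / 10) * (9 / 10 - X) = (X - X\<^sup>2) - 9 / 100" by (simp add: power2_eq_square field_simps)
    ultimately show ?thesis by linarith
  qed
  have y2: "y\<^sup>2 \<le> \<epsilon>\<^sup>2"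
  proof -
    have "(sin (2 * pi / real K))\<^sup>2 \<le> 1" by (simp add: abs_square_le_1)
    then have "\<epsilon>\<^sup>2 * (2 * S * Co)\<^sup>2 \<le> \<epsilon>\<^sup>2 * 1" unfolding s2 by (intro mult_left_mono) auto
    then show ?thesis by (simp add: y\<epsilon> power_mult_distrib)
  qed
  have e2: "\<epsilon>\<^sup>2 \<le> (2 / 53)\<^sup>2" using \<epsilon>0 \<epsilon>1 by (intro power_mono) auto
  have cone: "y * Co < (X - X\<^sup>2 - y\<^sup>2) * S"
  proof -
    have "2 * \<epsilon> * Co\<^sup>2 \<le> 2 * \<epsilon> * 1" using \<epsilon>0 sC zero_le_power2[of S] by (intro mult_left_mono) (linarith+)
    also have "\<dots> < X - X\<^sup>2 - y\<^sup>2" using XX y2 e2 \<epsilon>1 by (simp add: power2_eq_square)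
    finally have "2 * \<epsilon> * Co\<^sup>2 * S < (X - X\<^sup>2 - y\<^sup>2) * S" using S by (rule mult_strict_right_mono)
    then show ?thesis by (simp add: y\<epsilon> power2_eq_square mult_ac)
  qed
  show thesis
  proof (rule that[of K y X])
    show "2 \<le> K" using K by simp
    show "0 \<le> y" using \<epsilon>0 S Co0 by (simp add: y\<epsilon>)
    show "s * (\<kappa> - 1) * X = (1 + \<beta>) * (1 - cos (2 * pi / real K)) - s" using D unfolding X_def D_def[symmetric] w_def[symmetric] by simp
    show "s * (\<kappa> - 1) * y = (1 - \<beta>) * sin (2 * pi / real K)" using D unfolding y_def D_def[symmetric] by simp
    show "y * cos (pi / real K) < (X - X\<^sup>2 - y\<^sup>2) * sin (pi / real K)" using cone by (simp add: S_def Co_def)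
  qed
qed

section \<open>Reduction of the splittings to the noisy heavy-ball chain\<close>

text \<open>Kernels are compared through their action on nonnegative test functions, for which composition
  of kernels is composition of operators.\<close>

definition kernel_nn :: "('y \<Rightarrow> 'z measure) \<Rightarrow> ('z \<Rightarrow> ennreal) \<Rightarrow> 'y \<Rightarrow> ennreal" where
  "kernel_nn K \<phi> z = (\<integral>\<^sup>+w. \<phi> w \<partial>K z)"

lemma kernel_nn_measurable:
  assumes "markov_kernel K" and "\<phi> \<in> borel_measurable borel"
  shows "kernel_nn K \<phi> \<in> borel_measurable borel"
  using nn_integral_kernel_measurable[OF assms] by (simp add: kernel_nn_def[abs_def])

lemma kernel_nn_then:
  assumes "markov_kernel K" "markov_kernel L" "\<phi> \<in> borel_measurable borel"
  shows "kernel_nn (K \<rhd> L) \<phi> = kernel_nn K (kernel_nn L \<phi>)"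
  unfolding kernel_nn_def[abs_def] kernel_then_def
  using nn_integral_bind_kernel[OF markov_kernel_law[OF assms(1)] assms(2,3)] by auto

lemma kernel_eqI:
  assumes K: "markov_kernel K" and L: "markov_kernel L"
    and eq: "\<And>\<phi> z. \<phi> \<in> borel_measurable borel \<Longrightarrow> kernel_nn K \<phi> z = kernel_nn L \<phi> z"
  shows "K = L"
proof
  fix z
  note s = borel_lawD(2)[OF markov_kernel_law[OF K]] borel_lawD(2)[OF markov_kernel_law[OF L]]
  show "K z = L z"
  proof (rule measure_eqI)
    fix A assume "A \<in> sets (K z)"
    then have A: "A \<in> sets borel" using s by simp
    then show "emeasure (K z) A = emeasure (L z) A"
      using eq[of "indicator A" z] s by (simp add: kernel_nn_def)
  qed (use s in simp)
qed

lemma return_kernel: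
  assumes "f \<in> borel_measurable borel"
  shows "markov_kernel (\<lambda>z. return borel (f z))"
  by (rule measurable_compose[OF assms measurable_return_prob_space])

lemma kernel_nn_return:
  assumes "\<phi> \<in> borel_measurable borel"
  shows "kernel_nn (\<lambda>z. return borel (f z)) \<phi> z = \<phi> (f z)"
  unfolding kernel_nn_def by (rule nn_integral_return) (use assms in auto)

lemma split_fst_snd: "(\<lambda>(x, y). f x y) = (\<lambda>z. f (fst z) (snd z))"
  by auto

lemma kernel_A_markov: "markov_kernel (kernel_A t)"
  unfolding kernel_A_def split_fst_snd by (intro return_kernel borel_measurable_Pair_iff) measurable

lemma kernel_nn_A:
  "\<phi> \<in> borel_measurable borel \<Longrightarrow> kernel_nn (kernel_A t) \<phi> z = \<phi> (fst z + t *\<^sub>R snd z, snd z)"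
  unfolding kernel_A_def split_fst_snd by (rule kernel_nn_return)

lemma kernel_B_markov:
  assumes [measurable]: "grad U \<in> borel_measurable borel"
  shows "markov_kernel (kernel_B U t)"
  unfolding kernel_B_def split_fst_snd by (intro return_kernel borel_measurable_Pair_iff) measurable

lemma kernel_nn_B:
  "\<phi> \<in> borel_measurable borel \<Longrightarrow> kernel_nn (kernel_B U t) \<phi> z = \<phi> (fst z, snd z - t *\<^sub>R grad U (fst z))"
  unfolding kernel_B_def split_fst_snd by (rule kernel_nn_return)

lemma kernel_O_eq: "kernel_O \<gamma> t = (\<lambda>z. distr std_gaussian borel
    (\<lambda>\<xi>. (fst z, exp (- \<gamma> * t) *\<^sub>R snd z + sqrt (1 - exp (- 2 * \<gamma> * t)) *\<^sub>R \<xi>)))"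
  by (auto simp: kernel_O_def)

lemma kernel_O_markov: "markov_kernel (kernel_O \<gamma> t :: 'a::euclidean_space kernel)"
proof -
  have "(\<lambda>(z, \<xi>). (fst z, exp (- \<gamma> * t) *\<^sub>R snd z + sqrt (1 - exp (- 2 * \<gamma> * t)) *\<^sub>R \<xi>))
    \<in> (borel :: ('a \<times> 'a) measure) \<Otimes>\<^sub>M (borel :: 'a measure) \<rightarrow>\<^sub>M borel"
    unfolding case_prod_unfold by (intro borel_measurable_Pair_iff) measurable
  then show ?thesis unfolding kernel_O_eq by (rule noise_kernel[OF std_gaussian_law])
qed

lemma kernel_nn_O:
  "\<phi> \<in> borel_measurable borel \<Longrightarrow> kernel_nn (kernel_O \<gamma> t) \<phi> z
    = (\<integral>\<^sup>+\<xi>. \<phi> (fst z, exp (- \<gamma> * t) *\<^sub>R snd z + sqrt (1 - exp (- 2 * \<gamma> * t)) *\<^sub>R \<xi>) \<partial>std_gaussian)"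
  unfolding kernel_nn_def kernel_O_eq
  by (rule nn_integral_noise_kernel[OF std_gaussian_law]) (intro borel_measurable_Pair_iff; measurable)

text \<open>The change of variables \<open>(y, v) \<mapsto> (y, y - r v)\<close>: with \<open>r\<close> the right multiple of the step size,
  the second component is the previous position, up to noise in the case of OABAO.\<close>

definition shear :: "real \<Rightarrow> 'a::euclidean_space kernel" where
  "shear r = (\<lambda>z. return borel (fst z, fst z - r *\<^sub>R snd z))"

definition unshear :: "real \<Rightarrow> 'a::euclidean_space kernel" where
  "unshear r = (\<lambda>z. return borel (fst z, (1 / r) *\<^sub>R (fst z - snd z)))"

lemma shear_markov: "markov_kernel (shear r)" and unshear_markov: "markov_kernel (unshear r)"
  unfolding shear_def unshear_def by (intro return_kernel borel_measurable_Pair_iff; measurable)+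

lemma kernel_nn_shear:
  "\<phi> \<in> borel_measurable borel \<Longrightarrow> kernel_nn (shear r) \<phi> z = \<phi> (fst z, fst z - r *\<^sub>R snd z)"
  unfolding shear_def by (rule kernel_nn_return)

lemma kernel_nn_unshear:
  "\<phi> \<in> borel_measurable borel \<Longrightarrow> kernel_nn (unshear r) \<phi> z = \<phi> (fst z, (1 / r) *\<^sub>R (fst z - snd z))"
  unfolding unshear_def by (rule kernel_nn_return)

text \<open>The step is cut at the moment when the position is the one at which the force is evaluated next. There the
  velocity is replaced by a previous position: \<open>pre_kernel\<close> leads from the beginning of the step to this
  moment, and \<open>post_kernel\<close> from there to the end. In three of the schemes the position moves between two
  force evaluations with the current velocity for the whole time \<open>h\<close>. In OABAO it moves for half of
  this time with the velocity before the refreshment, which is \<open>1 / \<beta>\<close> times the current one up to noise;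
  hence the different length.\<close>

primrec shear_length :: "splitting \<Rightarrow> real \<Rightarrow> real \<Rightarrow> real" where
  "shear_length ABOBA h \<beta> = h"
| "shear_length AOBOA h \<beta> = h"
| "shear_length BOAOB h \<beta> = h"
| "shear_length OABAO h \<beta> = h / 2 * (1 + \<beta>) / \<beta>"

primrec pre_kernel :: "splitting \<Rightarrow> ('a::euclidean_space \<Rightarrow> real) \<Rightarrow> real \<Rightarrow> real \<Rightarrow> 'a kernel" where
  "pre_kernel ABOBA U h \<gamma> = kernel_A (h/2) \<rhd> shear h"
| "pre_kernel AOBOA U h \<gamma> = kernel_A (h/2) \<rhd> shear h"
| "pre_kernel BOAOB U h \<gamma> = kernel_B U (h/2) \<rhd> kernel_O \<gamma> (h/2) \<rhd> kernel_A h \<rhd> shear h"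
| "pre_kernel OABAO U h \<gamma> =
     kernel_O \<gamma> (h/2) \<rhd> kernel_A (h/2) \<rhd> shear (shear_length OABAO h (exp (- \<gamma> * h)))"

primrec post_kernel :: "splitting \<Rightarrow> ('a::euclidean_space \<Rightarrow> real) \<Rightarrow> real \<Rightarrow> real \<Rightarrow> 'a kernel" where
  "post_kernel ABOBA U h \<gamma> =
     unshear h \<rhd> kernel_B U (h/2) \<rhd> kernel_O \<gamma> h \<rhd> kernel_B U (h/2) \<rhd> kernel_A (h/2)"
| "post_kernel AOBOA U h \<gamma> =
     unshear h \<rhd> kernel_O \<gamma> (h/2) \<rhd> kernel_B U h \<rhd> kernel_O \<gamma> (h/2) \<rhd> kernel_A (h/2)"
| "post_kernel BOAOB U h \<gamma> = unshear h \<rhd> kernel_O \<gamma> (h/2) \<rhd> kernel_B U (h/2)"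
| "post_kernel OABAO U h \<gamma> = unshear (shear_length OABAO h (exp (- \<gamma> * h))) \<rhd>
     kernel_B U h \<rhd> kernel_A (h/2) \<rhd> kernel_O \<gamma> (h/2)"

primrec noise_gain :: "splitting \<Rightarrow> real \<Rightarrow> real" where
  "noise_gain ABOBA h = h"
| "noise_gain AOBOA h = h"
| "noise_gain BOAOB h = h"
| "noise_gain OABAO h = h / 2"

text \<open>In OABAO the current velocity determines the previous position only up to the noise of the refreshment, so
  the second component is the previous position minus \<open>1 / \<beta>\<close> times the noise that enters the new one.\<close>

primrec noise_memory :: "splitting \<Rightarrow> real \<Rightarrow> real" where
  "noise_memory ABOBA \<beta> = 0"
| "noise_memory AOBOA \<beta> = 0"
| "noise_memory BOAOB \<beta> = 0"
| "noise_memory OABAO \<beta> = 1 / \<beta>"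

primrec step_noise :: "splitting \<Rightarrow> real \<Rightarrow> 'a::euclidean_space measure" where
  "step_noise ABOBA \<beta> = gauss_mix 0 (sqrt (1 - \<beta>\<^sup>2))"
| "step_noise AOBOA \<beta> = gauss_mix (sqrt \<beta> * sqrt (1 - \<beta>)) (sqrt (1 - \<beta>))"
| "step_noise BOAOB \<beta> = gauss_mix (sqrt \<beta> * sqrt (1 - \<beta>)) (sqrt (1 - \<beta>))"
| "step_noise OABAO \<beta> = gauss_mix (sqrt \<beta> * sqrt (1 - \<beta>)) (sqrt (1 - \<beta>))"

primrec pre_map :: "splitting \<Rightarrow> ('a::euclidean_space \<Rightarrow> 'a) \<Rightarrow> real \<Rightarrow> real \<Rightarrow> 'a \<times> 'a \<Rightarrow> 'a \<times> 'a" where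
  "pre_map ABOBA G h \<beta> z = (fst z + (h/2) *\<^sub>R snd z, fst z - (h/2) *\<^sub>R snd z)"
| "pre_map AOBOA G h \<beta> z = (fst z + (h/2) *\<^sub>R snd z, fst z - (h/2) *\<^sub>R snd z)"
| "pre_map BOAOB G h \<beta> z = (fst z + (h * sqrt \<beta>) *\<^sub>R (snd z - (h/2) *\<^sub>R G (fst z)), fst z)"
| "pre_map OABAO G h \<beta> z =
     (fst z + (h/2 * sqrt \<beta>) *\<^sub>R snd z, fst z - (h / (2 * \<beta>) * sqrt \<beta>) *\<^sub>R snd z)"

primrec pre_gain :: "splitting \<Rightarrow> real \<Rightarrow> real \<Rightarrow> real \<times> real" where
  "pre_gain ABOBA h \<beta> = (0, 0)"
| "pre_gain AOBOA h \<beta> = (0, 0)"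
| "pre_gain BOAOB h \<beta> = (h * sqrt (1 - \<beta>), 0)"
| "pre_gain OABAO h \<beta> = (h / 2 * sqrt (1 - \<beta>), - (h / (2 * \<beta>)) * sqrt (1 - \<beta>))"

lemmas basic_markov = kernel_A_markov kernel_B_markov kernel_O_markov shear_markov unshear_markov

lemmas basic_nn = kernel_nn_A kernel_nn_B kernel_nn_O kernel_nn_shear kernel_nn_unshear

lemma emeasure_std_gaussian_UNIV [simp]: "emeasure std_gaussian UNIV = 1"
  using prob_space.emeasure_space_1[OF borel_lawD(1)[OF std_gaussian_law]] by simp

lemma pre_map_measurable:
  assumes [measurable]: "G \<in> borel_measurable borel"
  shows "pre_map S G h \<beta> \<in> borel_measurable borel"
proof -
  have "(\<lambda>z. pre_map S G h \<beta> z) \<in> borel_measurable borel"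
  proof (cases S)
    case ABOBA
    show ?thesis unfolding ABOBA pre_map.simps by (rule borel_measurable_Pair_iff) measurable
  next
    case AOBOA
    show ?thesis unfolding AOBOA pre_map.simps by (rule borel_measurable_Pair_iff) measurable
  next
    case BOAOB
    show ?thesis unfolding BOAOB pre_map.simps by (rule borel_measurable_Pair_iff) measurable
  next
    case OABAO
    show ?thesis unfolding OABAO pre_map.simps by (rule borel_measurable_Pair_iff) measurable
  qed
  then show ?thesis by simp
qed

lemma shear_identity:
  fixes a b g :: "'a::real_vector"
  assumes \<beta>: "\<beta> \<noteq> 0" and r0: "r \<noteq> 0" and r: "r = h / 2 * (1 + \<beta>) / \<beta>"
  defines "u \<equiv> (1 / r) *\<^sub>R (a - b) - h *\<^sub>R g"
  shows "a + (h / 2) *\<^sub>R u + (h / 2) *\<^sub>R (\<beta> *\<^sub>R u + N)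
      = (1 + \<beta>) *\<^sub>R a - \<beta> *\<^sub>R b - (h\<^sup>2 / 2 * (1 + \<beta>)) *\<^sub>R g + (h / 2) *\<^sub>R N"
    and "a + (h / 2) *\<^sub>R u + (h / 2) *\<^sub>R (\<beta> *\<^sub>R u + N) - r *\<^sub>R (\<beta> *\<^sub>R u + N) = a - (h / (2 * \<beta>)) *\<^sub>R N"
proof -
  have br: "h / 2 + h / 2 * \<beta> = \<beta> * r" using \<beta> by (simp add: r field_simps)
  have "a + (h / 2) *\<^sub>R u + (h / 2) *\<^sub>R (\<beta> *\<^sub>R u + N) = a + (h / 2 + h / 2 * \<beta>) *\<^sub>R u + (h / 2) *\<^sub>R N"
    by (simp add: scaleR_add_right scaleR_add_left)
  then have 1: "a + (h / 2) *\<^sub>R u + (h / 2) *\<^sub>R (\<beta> *\<^sub>R u + N) = a + (\<beta> * r) *\<^sub>R u + (h / 2) *\<^sub>R N"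
    unfolding br .
  have "r *\<^sub>R u = (a - b) - (r * h) *\<^sub>R g" using r0 by (simp add: u_def scaleR_diff_right)
  then have "(\<beta> * r) *\<^sub>R u = \<beta> *\<^sub>R (a - b) - (\<beta> * r * h) *\<^sub>R g"
    by (metis mult.assoc scaleR_diff_right scaleR_scaleR)
  moreover have "\<beta> * r * h = h\<^sup>2 / 2 * (1 + \<beta>)" unfolding br[symmetric] by (simp add: power2_eq_square algebra_simps)
  ultimately show "a + (h / 2) *\<^sub>R u + (h / 2) *\<^sub>R (\<beta> *\<^sub>R u + N)
      = (1 + \<beta>) *\<^sub>R a - \<beta> *\<^sub>R b - (h\<^sup>2 / 2 * (1 + \<beta>)) *\<^sub>R g + (h / 2) *\<^sub>R N"
    unfolding 1 by (simp add: scaleR_add_left scaleR_diff_right)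
  have "h / 2 - r = - (h / (2 * \<beta>))" using \<beta> by (simp add: r field_simps)
  then have "(h / 2) *\<^sub>R N - r *\<^sub>R N = - (h / (2 * \<beta>)) *\<^sub>R N" by (metis scaleR_diff_left)
  moreover have "a + (\<beta> * r) *\<^sub>R u + (h / 2) *\<^sub>R N - r *\<^sub>R (\<beta> *\<^sub>R u + N) = a + ((h / 2) *\<^sub>R N - r *\<^sub>R N)"
    by (simp add: scaleR_add_right mult.commute)
  ultimately show "a + (h / 2) *\<^sub>R u + (h / 2) *\<^sub>R (\<beta> *\<^sub>R u + N) - r *\<^sub>R (\<beta> *\<^sub>R u + N) = a - (h / (2 * \<beta>)) *\<^sub>R N"
    unfolding 1 by simp
qed

context
  fixes U :: "'a::euclidean_space \<Rightarrow> real" and h \<gamma> \<beta> :: real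
  assumes G: "grad U \<in> borel_measurable borel" and h: "0 < h" and \<gamma>: "0 < \<gamma>" and \<beta>: "\<beta> = exp (- \<gamma> * h)"
begin

lemma beta_bounds: "0 < \<beta>" "\<beta> < 1"
  using h \<gamma> by (auto simp: \<beta>)

lemma half_step_factor: "exp (- \<gamma> * (h/2)) = sqrt \<beta>"
proof -
  have "exp (- \<gamma> * (h/2)) ^ 2 = \<beta>" by (simp add: \<beta> power2_eq_square flip: exp_add)
  then show ?thesis by (metis exp_ge_zero real_sqrt_unique)
qed

lemma half_step_noise: "exp (- 2 * \<gamma> * (h/2)) = \<beta>"
  by (simp add: \<beta>)

lemma full_step_noise: "exp (- 2 * \<gamma> * h) = \<beta>\<^sup>2"
  by (simp add: \<beta> power2_eq_square flip: exp_add)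

lemma step_factors:
  "exp (- (\<gamma> * h)) = \<beta>" "exp (- (\<gamma> * h / 2)) = sqrt \<beta>" "exp (- (2 * \<gamma> * h)) = \<beta>\<^sup>2"
  using half_step_factor half_step_noise full_step_noise by (simp_all add: \<beta>)

lemma then_markov: "markov_kernel K \<Longrightarrow> markov_kernel L \<Longrightarrow> markov_kernel (K \<rhd> L)"
  for K L :: "'a kernel"
  by (rule markov_kernel_then)

lemma pre_kernel_markov: "markov_kernel (pre_kernel S U h \<gamma>)"
  by (cases S) (simp_all add: then_markov basic_markov G)

lemma post_kernel_markov: "markov_kernel (post_kernel S U h \<gamma>)"
  by (cases S) (simp_all add: then_markov basic_markov G)

lemma splitting_markov: "markov_kernel (splitting_kernel S U h \<gamma>)"
  by (cases S) (simp_all add: then_markov basic_markov G)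

lemmas evaluate = kernel_nn_then then_markov basic_markov G kernel_nn_measurable basic_nn

theorem splitting_eq_pre_post: "splitting_kernel S U h \<gamma> = pre_kernel S U h \<gamma> \<rhd> post_kernel S U h \<gamma>"
proof (rule kernel_eqI)
  fix \<phi> :: "'a \<times> 'a \<Rightarrow> ennreal" and z
  assume \<phi>: "\<phi> \<in> borel_measurable borel"
  have "shear_length OABAO h \<beta> \<noteq> 0" using h beta_bounds by simp
  then show "kernel_nn (splitting_kernel S U h \<gamma>) \<phi> z = kernel_nn (pre_kernel S U h \<gamma> \<rhd> post_kernel S U h \<gamma>) \<phi> z"
    using h \<phi> by (cases S) (simp_all add: evaluate step_factors del: shear_length.simps)
qed (auto intro: splitting_markov then_markov pre_kernel_markov post_kernel_markov)

text \<open>Between two force evaluations the four schemes move the position by a damped velocity plus Gaussian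
  noise; written in terms of the current and the previous position this is one step of the noisy heavy-ball
  chain, with the step parameter \<open>s_param\<close>.\<close>

theorem post_pre_eq_heavy_ball:
  "post_kernel S U h \<gamma> \<rhd> pre_kernel S U h \<gamma> = noisy_heavy_ball \<beta> (s_param S h \<beta>) (grad U)
     (noise_gain S h) (- noise_memory S \<beta> * noise_gain S h) (step_noise S \<beta>)"
proof (rule kernel_eqI)
  have l: "borel_law (step_noise S \<beta> :: 'a measure)" by (cases S) (simp_all add: gauss_mix_law)
  show "markov_kernel (noisy_heavy_ball \<beta> (s_param S h \<beta>) (grad U)
     (noise_gain S h) (- noise_memory S \<beta> * noise_gain S h) (step_noise S \<beta>))"
    by (rule noisy_heavy_ball_kernel[OF l G])
  fix \<phi> :: "'a \<times> 'a \<Rightarrow> ennreal" and z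
  assume \<phi> [measurable]: "\<phi> \<in> borel_measurable borel"
  have b0: "\<beta> \<noteq> 0" "h \<noteq> 0" "1 + \<beta> \<noteq> 0" "0 \<le> \<beta>" using h beta_bounds by auto
  have hb: "h + \<beta> * h \<noteq> 0" "h * 2 + \<beta> * (h * 2) \<noteq> 0" "\<beta> * (h * 2) + \<beta> * (\<beta> * (h * 2)) \<noteq> 0"
    using h beta_bounds by (simp_all add: add_pos_pos less_imp_neq[symmetric])
  have sq: "sqrt \<beta> * (sqrt \<beta> * x) = \<beta> * x" for x using b0 by (simp flip: mult.assoc)
  have R: "kernel_nn (noisy_heavy_ball \<beta> (s_param S h \<beta>) (grad U)
     (noise_gain S h) (- noise_memory S \<beta> * noise_gain S h) (step_noise S \<beta>)) \<phi> z
    = (\<integral>\<^sup>+N. \<phi> (heavy_ball \<beta> (s_param S h \<beta>) (grad U) z + (noise_gain S h *\<^sub>R N, (- noise_memory S \<beta> * noise_gain S h) *\<^sub>R N)) \<partial>step_noise S \<beta>)"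
    unfolding kernel_nn_def by (rule nn_integral_noisy_heavy_ball[OF l G \<phi>])
  note mix = nn_integral_gauss_mix[of "\<lambda>N. \<phi> (heavy_ball \<beta> (s_param S h \<beta>) (grad U) z + (noise_gain S h *\<^sub>R N, (- noise_memory S \<beta> * noise_gain S h) *\<^sub>R N))"]
  show "kernel_nn (post_kernel S U h \<gamma> \<rhd> pre_kernel S U h \<gamma>) \<phi> z = kernel_nn (noisy_heavy_ball \<beta> (s_param S h \<beta>) (grad U)
     (noise_gain S h) (- noise_memory S \<beta> * noise_gain S h) (step_noise S \<beta>)) \<phi> z"
  proof (cases S)
    case ABOBA
    show ?thesis
      unfolding R using mix \<phi> unfolding ABOBA
      apply (simp add: evaluate step_factors)
      apply (intro nn_integral_cong arg_cong[where f=\<phi>])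
      apply (simp add: heavy_ball_def euclidean_eq_iff[where 'a='a] inner_simps b0 power2_eq_square)
      apply (simp add: field_simps b0 hb sq)
      done
  next
    case AOBOA
    show ?thesis
      unfolding R using mix \<phi> unfolding AOBOA
      apply (simp add: evaluate step_factors)
      apply (intro nn_integral_cong arg_cong[where f=\<phi>])
      apply (simp add: heavy_ball_def euclidean_eq_iff[where 'a='a] inner_simps b0 power2_eq_square)
      apply (simp add: field_simps b0 hb sq)
      done
  next
    case BOAOB
    show ?thesis
      unfolding R using mix \<phi> unfolding BOAOB
      apply (simp add: evaluate step_factors)
      apply (intro nn_integral_cong arg_cong[where f=\<phi>])
      apply (simp add: heavy_ball_def euclidean_eq_iff[where 'a='a] inner_simps b0 power2_eq_square)
      apply (simp add: field_simps b0 hb sq)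
      done
  next
    case OABAO
    define r where "r = shear_length OABAO h \<beta>"
    have r: "r = h / 2 * (1 + \<beta>) / \<beta>" by (simp add: r_def)
    have r0: "r \<noteq> 0" using b0 by (simp add: r)
    define u where "u = (1 / r) *\<^sub>R (fst z - snd z) - h *\<^sub>R grad U (fst z)"
    define v where "v \<xi> \<xi>' = sqrt \<beta> *\<^sub>R (sqrt \<beta> *\<^sub>R u + sqrt (1 - \<beta>) *\<^sub>R \<xi>) + sqrt (1 - \<beta>) *\<^sub>R \<xi>'" for \<xi> \<xi>' :: 'a
    have eval: "kernel_nn (post_kernel S U h \<gamma> \<rhd> pre_kernel S U h \<gamma>) \<phi> z = (\<integral>\<^sup>+\<xi>. (\<integral>\<^sup>+\<xi>'.
        \<phi> (fst z + (h / 2) *\<^sub>R u + (h / 2) *\<^sub>R v \<xi> \<xi>', fst z + (h / 2) *\<^sub>R u + (h / 2) *\<^sub>R v \<xi> \<xi>' - r *\<^sub>R v \<xi> \<xi>') \<partial>std_gaussian) \<partial>std_gaussian)"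
      unfolding OABAO u_def v_def r_def using \<phi> by (simp add: evaluate step_factors del: shear_length.simps)
    have vN: "v \<xi> \<xi>' = \<beta> *\<^sub>R u + ((sqrt \<beta> * sqrt (1 - \<beta>)) *\<^sub>R \<xi> + sqrt (1 - \<beta>) *\<^sub>R \<xi>')" for \<xi> \<xi>'
      using b0 by (simp add: v_def scaleR_add_right)
    note id = shear_identity[OF b0(1) r0 r, of "fst z" "snd z" "grad U (fst z)", folded u_def]
    have arg: "(fst z + (h / 2) *\<^sub>R u + (h / 2) *\<^sub>R v \<xi> \<xi>', fst z + (h / 2) *\<^sub>R u + (h / 2) *\<^sub>R v \<xi> \<xi>' - r *\<^sub>R v \<xi> \<xi>')
        = heavy_ball \<beta> (s_param S h \<beta>) (grad U) z + (noise_gain S h *\<^sub>R ((sqrt \<beta> * sqrt (1 - \<beta>)) *\<^sub>R \<xi> + sqrt (1 - \<beta>) *\<^sub>R \<xi>'),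
            (- noise_memory S \<beta> * noise_gain S h) *\<^sub>R ((sqrt \<beta> * sqrt (1 - \<beta>)) *\<^sub>R \<xi> + sqrt (1 - \<beta>) *\<^sub>R \<xi>'))" for \<xi> \<xi>'
      unfolding vN unfolding id(2) unfolding id(1) unfolding OABAO heavy_ball_def by (simp add: scaleR_add_right mult.commute)
    have "(\<lambda>N. \<phi> (heavy_ball \<beta> (s_param S h \<beta>) (grad U) z + (noise_gain S h *\<^sub>R N, (- noise_memory S \<beta> * noise_gain S h) *\<^sub>R N))) \<in> borel_measurable borel"
      by measurable
    from mix[OF this, of "sqrt \<beta> * sqrt (1 - \<beta>)" "sqrt (1 - \<beta>)"] show ?thesis
      unfolding eval R arg using OABAO by simp
  qed
qed (auto intro: then_markov pre_kernel_markov post_kernel_markov)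

text \<open>The part of the step before the skeleton is an affine image of one Gaussian vector (of none, for the
  schemes that start with a position update).\<close>

lemma affine_noise_kernel:
  assumes [measurable]: "f \<in> borel_measurable borel"
  shows "markov_kernel (\<lambda>z. distr std_gaussian borel (\<lambda>\<xi>::'a. f z + (e *\<^sub>R \<xi>, e' *\<^sub>R \<xi>)) :: ('a \<times> 'a) measure)"
  by (rule noise_kernel[OF std_gaussian_law]) measurable

theorem pre_kernel_affine:
  "pre_kernel S U h \<gamma> = (\<lambda>z. distr std_gaussian borel
     (\<lambda>\<xi>. pre_map S (grad U) h \<beta> z + (fst (pre_gain S h \<beta>) *\<^sub>R \<xi>, snd (pre_gain S h \<beta>) *\<^sub>R \<xi>)))"
    (is "_ = ?R")
proof (rule kernel_eqI)
  show "markov_kernel ?R" by (rule affine_noise_kernel[OF pre_map_measurable[OF G]])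
  fix \<phi> :: "'a \<times> 'a \<Rightarrow> ennreal" and z
  assume \<phi> [measurable]: "\<phi> \<in> borel_measurable borel"
  have b0: "\<beta> \<noteq> 0" "h \<noteq> 0" "1 + \<beta> \<noteq> 0" "0 \<le> \<beta>" using h beta_bounds by auto
  have sq: "sqrt \<beta> * (sqrt \<beta> * x) = \<beta> * x" for x using b0 by (simp flip: mult.assoc)
  have R: "kernel_nn ?R \<phi> z = (\<integral>\<^sup>+\<xi>. \<phi> (pre_map S (grad U) h \<beta> z + (fst (pre_gain S h \<beta>) *\<^sub>R \<xi>, snd (pre_gain S h \<beta>) *\<^sub>R \<xi>)) \<partial>std_gaussian)"
    unfolding kernel_nn_def by (rule nn_integral_noise_kernel[OF std_gaussian_law _ \<phi>]) measurable
  show "kernel_nn (pre_kernel S U h \<gamma>) \<phi> z = kernel_nn ?R \<phi> z"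
    unfolding R using \<phi>
    by (cases S; simp add: evaluate step_factors;
        (intro nn_integral_cong)?; intro arg_cong[where f=\<phi>];
        simp add: euclidean_eq_iff[where 'a='a] inner_simps b0; simp add: field_simps b0 sq)
qed (rule pre_kernel_markov)

end

text \<open>Every state of the skeleton is the noiseless image of an initial state of comparable size, so the skeleton
  can be started close to a prescribed point.\<close>

lemma pre_map_surj:
  assumes h: "0 < h" and \<beta>: "0 < \<beta>"
  obtains C where "0 < C" "\<And>(G::'a::euclidean_space \<Rightarrow> 'a) a b. \<exists>z. pre_map S G h \<beta> z = (a, b) \<and> norm z \<le> C * (norm a + norm b + norm (G b))"
proof (cases "S = OABAO")
  case True
  define k where "k = h / 2 * sqrt \<beta> + h / (2 * \<beta>) * sqrt \<beta>"
  have k: "0 < k" using h \<beta> by (simp add: k_def add_pos_pos)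
  show thesis
  proof (rule that[of "1 + (1 + h / 2 * sqrt \<beta>) / k"])
    show "0 < 1 + (1 + h / 2 * sqrt \<beta>) / k" using k h \<beta> by (simp add: add_pos_nonneg)
    fix G :: "'a \<Rightarrow> 'a" and a b :: 'a
    define v where "v = (1 / k) *\<^sub>R (a - b)"
    have kv: "k *\<^sub>R v = a - b" using k by (simp add: v_def)
    have "(h / (2 * \<beta>) * sqrt \<beta>) *\<^sub>R v + (h / 2 * sqrt \<beta>) *\<^sub>R v = a - b"
      unfolding kv[symmetric] k_def by (simp only: scaleR_left.add add.commute)
    then have "pre_map S G h \<beta> (a - (h / 2 * sqrt \<beta>) *\<^sub>R v, v) = (a, b)"
      unfolding True by (simp add: algebra_simps)
    moreover have "norm (a - (h / 2 * sqrt \<beta>) *\<^sub>R v, v) \<le> (1 + (1 + h / 2 * sqrt \<beta>) / k) * (norm a + norm b + norm (G b))"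
    proof -
      have nv: "norm v \<le> (norm a + norm b) / k" using k norm_triangle_ineq4[of a b] by (simp add: v_def divide_right_mono)
      have "norm (a - (h / 2 * sqrt \<beta>) *\<^sub>R v, v) \<le> norm a + (1 + h / 2 * sqrt \<beta>) * norm v"
        using norm_Pair_le[of "a - (h / 2 * sqrt \<beta>) *\<^sub>R v" v] norm_triangle_ineq4[of a "(h / 2 * sqrt \<beta>) *\<^sub>R v"] h \<beta> by (simp add: algebra_simps)
      also have "\<dots> \<le> norm a + (1 + h / 2 * sqrt \<beta>) * ((norm a + norm b) / k)"
        using nv h \<beta> by (intro add_left_mono mult_left_mono) auto
      also have "\<dots> = norm a + (1 + h / 2 * sqrt \<beta>) / k * (norm a + norm b)" by simp
      also have "\<dots> \<le> (norm a + norm b + norm (G b)) + (1 + h / 2 * sqrt \<beta>) / k * (norm a + norm b + norm (G b))"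
      proof -
        have "(1 + h / 2 * sqrt \<beta>) / k * (norm a + norm b) \<le> (1 + h / 2 * sqrt \<beta>) / k * (norm a + norm b + norm (G b))"
          using h \<beta> k by (intro mult_left_mono) auto
        then show ?thesis using norm_ge_zero[of b] norm_ge_zero[of "G b"] by linarith
      qed
      finally show ?thesis by (simp add: distrib_right)
    qed
    ultimately show "\<exists>z. pre_map S G h \<beta> z = (a, b) \<and> norm z \<le> (1 + (1 + h / 2 * sqrt \<beta>) / k) * (norm a + norm b + norm (G b))" by blast
  qed
next
  case notOABAO: False
  show thesis
  proof (cases "S = BOAOB")
    case True
    define k where "k = h * sqrt \<beta>"
    have k: "0 < k" using h \<beta> by (simp add: k_def)
    show thesis
    proof (rule that[of "1 + 1 / k + h / 2"])
      show "0 < 1 + 1 / k + h / 2" using k h by (simp add: add_pos_pos)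
      fix G :: "'a \<Rightarrow> 'a" and a b :: 'a
      define v where "v = (1 / k) *\<^sub>R (a - b) + (h / 2) *\<^sub>R G b"
      have "pre_map S G h \<beta> (b, v) = (a, b)"
        unfolding True using h \<beta> by (simp add: v_def k_def)
      moreover have "norm (b, v) \<le> (1 + 1 / k + h / 2) * (norm a + norm b + norm (G b))"
      proof -
        have "norm ((1 / k) *\<^sub>R (a - b)) \<le> 1 / k * (norm a + norm b)"
          using k norm_triangle_ineq4[of a b] by (simp add: divide_right_mono)
        then have "norm v \<le> 1 / k * (norm a + norm b) + h / 2 * norm (G b)"
          using norm_triangle_ineq[of "(1 / k) *\<^sub>R (a - b)" "(h / 2) *\<^sub>R G b"] h by (simp add: v_def)
        then have "norm (b, v) \<le> norm b + (1 / k * (norm a + norm b) + h / 2 * norm (G b))"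
          using norm_Pair_le[of b v] by linarith
        also have "\<dots> \<le> (norm a + norm b + norm (G b)) + (1 / k * (norm a + norm b + norm (G b)) + h / 2 * (norm a + norm b + norm (G b)))"
          using h k mult_left_mono[of "norm a + norm b" "norm a + norm b + norm (G b)" "1 / k"]
            mult_left_mono[of "norm (G b)" "norm a + norm b + norm (G b)" "h / 2"] by (simp add: add_mono)
        finally show ?thesis by (simp add: distrib_right)
      qed
      ultimately show "\<exists>z. pre_map S G h \<beta> z = (a, b) \<and> norm z \<le> (1 + 1 / k + h / 2) * (norm a + norm b + norm (G b))" by blast
    qed
  next
    case False
    then have S: "S = ABOBA \<or> S = AOBOA" using notOABAO by (cases S) auto
    show thesis
    proof (rule that[of "1 + 1 / h"])
      show "0 < 1 + 1 / h" using h by (simp add: add_pos_pos)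
      fix G :: "'a \<Rightarrow> 'a" and a b :: 'a
      define z where "z = ((1 / 2) *\<^sub>R (a + b), (1 / h) *\<^sub>R (a - b))"
      have "pre_map S G h \<beta> z = (a, b)"
        using S h by (auto simp: z_def euclidean_eq_iff[where 'a='a] inner_simps field_simps)
      moreover have "norm z \<le> (1 + 1 / h) * (norm a + norm b + norm (G b))"
      proof -
        have "norm ((1 / 2) *\<^sub>R (a + b)) = norm (a + b) / 2" by simp
        then have "norm ((1 / 2) *\<^sub>R (a + b)) \<le> norm a + norm b"
          using norm_triangle_ineq[of a b] norm_ge_zero[of a] norm_ge_zero[of b] by linarith
        moreover have "norm ((1 / h) *\<^sub>R (a - b)) \<le> 1 / h * (norm a + norm b)"
          using h norm_triangle_ineq4[of a b] by (simp add: divide_right_mono)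
        ultimately have "norm z \<le> (norm a + norm b) + 1 / h * (norm a + norm b)"
          unfolding z_def using norm_Pair_le[of "(1 / 2) *\<^sub>R (a + b)" "(1 / h) *\<^sub>R (a - b)"] by linarith
        also have "\<dots> \<le> (norm a + norm b + norm (G b)) + 1 / h * (norm a + norm b + norm (G b))"
          using h mult_left_mono[of "norm a + norm b" "norm a + norm b + norm (G b)" "1 / h"] by (simp add: add_mono)
        finally show ?thesis by (simp add: distrib_right)
      qed
      ultimately show "\<exists>z. pre_map S G h \<beta> z = (a, b) \<and> norm z \<le> (1 + 1 / h) * (norm a + norm b + norm (G b))" by blast
    qed
  qed
qed

lemma pre_map_linear:
  "pre_map S (\<lambda>x. l *\<^sub>R x) h \<beta> (z + w) = pre_map S (\<lambda>x. l *\<^sub>R x) h \<beta> z + pre_map S (\<lambda>x. l *\<^sub>R x) h \<beta> w"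
  by (cases S) (simp_all add: algebra_simps)

subsection \<open>Second moments\<close>

text \<open>With the constant \<open>b\<close> on both sides the property composes. For a potential dilated by \<open>R\<close> it will be
  used with \<open>b = (1 + R)\<^sup>2\<close>, and the point is that \<open>C\<close> does not depend on \<open>R\<close>.\<close>

definition quadratic_growth :: "real \<Rightarrow> real \<Rightarrow> 'a::euclidean_space kernel \<Rightarrow> bool" where
  "quadratic_growth C b K \<longleftrightarrow> markov_kernel K \<and> 0 < C \<and>
     (\<forall>z. kernel_nn K (\<lambda>w. ennreal (b + (norm w)\<^sup>2)) z \<le> ennreal (C * (b + (norm z)\<^sup>2)))"

lemma quadratic_growth_then:
  fixes K L :: "'a::euclidean_space kernel"
  assumes "quadratic_growth C b K" and "quadratic_growth D b L" and b: "0 \<le> b"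
  shows "quadratic_growth (D * C) b (K \<rhd> L)"
  unfolding quadratic_growth_def
proof (intro conjI allI)
  have K: "markov_kernel K" "0 < C" "\<And>z. kernel_nn K (\<lambda>w. ennreal (b + (norm w)\<^sup>2)) z \<le> ennreal (C * (b + (norm z)\<^sup>2))"
    and L: "markov_kernel L" "0 < D" "\<And>z. kernel_nn L (\<lambda>w. ennreal (b + (norm w)\<^sup>2)) z \<le> ennreal (D * (b + (norm z)\<^sup>2))"
    using assms by (auto simp: quadratic_growth_def)
  note borel_lawD(2)[OF markov_kernel_law[OF K(1)], measurable_cong]
  show "markov_kernel (K \<rhd> L)" by (rule markov_kernel_then[OF K(1) L(1)])
  show "0 < D * C" using K L by simp
  fix z
  have "kernel_nn (K \<rhd> L) (\<lambda>w. ennreal (b + (norm w)\<^sup>2)) z = kernel_nn K (kernel_nn L (\<lambda>w. ennreal (b + (norm w)\<^sup>2))) z"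
    by (subst kernel_nn_then[OF K(1) L(1)]) auto
  also have "\<dots> \<le> kernel_nn K (\<lambda>w. ennreal D * ennreal (b + (norm w)\<^sup>2)) z"
    unfolding kernel_nn_def[of K]
  proof (rule nn_integral_mono)
    fix w
    have "kernel_nn L (\<lambda>w. ennreal (b + (norm w)\<^sup>2)) w \<le> ennreal (D * (b + (norm w)\<^sup>2))" by (rule L(3))
    also have "\<dots> = ennreal D * ennreal (b + (norm w)\<^sup>2)" using L(2) b by (intro ennreal_mult) auto
    finally show "kernel_nn L (\<lambda>w. ennreal (b + (norm w)\<^sup>2)) w \<le> ennreal D * ennreal (b + (norm w)\<^sup>2)" .
  qed
  also have "\<dots> = ennreal D * kernel_nn K (\<lambda>w. ennreal (b + (norm w)\<^sup>2)) z"
    unfolding kernel_nn_def[of K] by (rule nn_integral_cmult) measurable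
  also have "\<dots> \<le> ennreal D * ennreal (C * (b + (norm z)\<^sup>2))" by (rule mult_left_mono[OF K(3)]) simp
  also have "\<dots> = ennreal (D * C * (b + (norm z)\<^sup>2))" using L(2) by (simp add: ennreal_mult' mult.assoc)
  finally show "kernel_nn (K \<rhd> L) (\<lambda>w. ennreal (b + (norm w)\<^sup>2)) z \<le> ennreal (D * C * (b + (norm z)\<^sup>2))" .
qed

lemma norm_add_square: "(norm (x + y))\<^sup>2 \<le> 2 * (norm x)\<^sup>2 + 2 * (norm y)\<^sup>2" for x y :: "'a::real_normed_vector"
proof -
  have "(norm (x + y))\<^sup>2 \<le> (norm x + norm y)\<^sup>2" by (intro power_mono norm_triangle_ineq) auto
  then show ?thesis using sum_squares_bound[of "norm x" "norm y"] unfolding power2_sum by linarith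
qed

lemma quadratic_growth_A: "0 \<le> b \<Longrightarrow> quadratic_growth (2 + 2 * t\<^sup>2) b (kernel_A t :: 'a::euclidean_space kernel)"
  unfolding quadratic_growth_def
proof (intro conjI allI kernel_A_markov)
  assume b: "0 \<le> b"
  show "0 < 2 + 2 * t\<^sup>2" by (simp add: add_pos_nonneg)
  fix z :: "'a \<times> 'a"
  have "(norm (fst z + t *\<^sub>R snd z))\<^sup>2 \<le> 2 * (norm (fst z))\<^sup>2 + 2 * (t\<^sup>2 * (norm (snd z))\<^sup>2)"
    using norm_add_square[of "fst z" "t *\<^sub>R snd z"] by (simp add: power_mult_distrib)
  moreover have "0 \<le> t\<^sup>2 * (norm (fst z))\<^sup>2" "0 \<le> t\<^sup>2 * b" using b by auto
  moreover have "(norm (fst z + t *\<^sub>R snd z, snd z))\<^sup>2 = (norm (fst z + t *\<^sub>R snd z))\<^sup>2 + (norm (snd z))\<^sup>2"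
    by (simp add: norm_Pair_power2)
  moreover have "(2 + 2 * t\<^sup>2) * (b + (norm z)\<^sup>2) = 2 * b + 2 * (t\<^sup>2 * b) + 2 * (norm (fst z))\<^sup>2 + 2 * (norm (snd z))\<^sup>2 + 2 * (t\<^sup>2 * (norm (fst z))\<^sup>2) + 2 * (t\<^sup>2 * (norm (snd z))\<^sup>2)"
    unfolding norm_Pair_power2[of z] by (simp add: algebra_simps)
  moreover have "0 \<le> (norm (snd z))\<^sup>2" by simp
  ultimately have "b + (norm (fst z + t *\<^sub>R snd z, snd z))\<^sup>2 \<le> (2 + 2 * t\<^sup>2) * (b + (norm z)\<^sup>2)" using b by linarith
  then show "kernel_nn (kernel_A t) (\<lambda>w. ennreal (b + (norm w)\<^sup>2)) z \<le> ennreal ((2 + 2 * t\<^sup>2) * (b + (norm z)\<^sup>2))"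
    by (subst kernel_nn_A) (auto intro!: ennreal_leI)
qed

lemma quadratic_growth_unshear: "0 \<le> b \<Longrightarrow> quadratic_growth (1 + 2 * (1 / r)\<^sup>2) b (unshear r :: 'a::euclidean_space kernel)"
  unfolding quadratic_growth_def
proof (intro conjI allI unshear_markov)
  assume b: "0 \<le> b"
  show "0 < 1 + 2 * (1 / r)\<^sup>2" by (simp add: add_pos_nonneg)
  fix z :: "'a \<times> 'a"
  define k where "k = (1 / r)\<^sup>2"
  have "(norm (fst z - snd z))\<^sup>2 \<le> 2 * (norm (fst z))\<^sup>2 + 2 * (norm (snd z))\<^sup>2"
    using norm_add_square[of "fst z" "- snd z"] by simp
  then have "k * (norm (fst z - snd z))\<^sup>2 \<le> k * (2 * (norm (fst z))\<^sup>2 + 2 * (norm (snd z))\<^sup>2)"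
    by (rule mult_left_mono) (simp add: k_def)
  moreover have "(norm (fst z, (1 / r) *\<^sub>R (fst z - snd z)))\<^sup>2 = (norm (fst z))\<^sup>2 + k * (norm (fst z - snd z))\<^sup>2"
    by (simp add: norm_Pair_power2 k_def power_divide)
  moreover have "(1 + 2 * k) * (b + (norm z)\<^sup>2) = b + 2 * (k * b) + (norm (fst z))\<^sup>2 + (norm (snd z))\<^sup>2 + k * (2 * (norm (fst z))\<^sup>2 + 2 * (norm (snd z))\<^sup>2)"
    unfolding norm_Pair_power2[of z] by (simp add: algebra_simps)
  moreover have "0 \<le> k * b" "0 \<le> (norm (snd z))\<^sup>2" using b by (auto simp: k_def)
  ultimately have "b + (norm (fst z, (1 / r) *\<^sub>R (fst z - snd z)))\<^sup>2 \<le> (1 + 2 * k) * (b + (norm z)\<^sup>2)" by linarith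
  then show "kernel_nn (unshear r) (\<lambda>w. ennreal (b + (norm w)\<^sup>2)) z \<le> ennreal ((1 + 2 * (1 / r)\<^sup>2) * (b + (norm z)\<^sup>2))"
    unfolding k_def[symmetric] by (subst kernel_nn_unshear) (auto intro!: ennreal_leI)
qed

lemma quadratic_growth_B:
  fixes U :: "'a::euclidean_space \<Rightarrow> real"
  assumes b: "0 \<le> b" and m: "grad U \<in> borel_measurable borel" and g: "\<And>x. norm (grad U x) \<le> norm x + B * sqrt b"
  shows "quadratic_growth (2 + 4 * t\<^sup>2 + 4 * (t * B)\<^sup>2) b (kernel_B U t)"
  unfolding quadratic_growth_def
proof (intro conjI allI kernel_B_markov m)
  show "0 < 2 + 4 * t\<^sup>2 + 4 * (t * B)\<^sup>2" by (simp add: add_pos_nonneg)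
  fix z :: "'a \<times> 'a"
  have "(norm (grad U (fst z)))\<^sup>2 \<le> (norm (fst z) + B * sqrt b)\<^sup>2" using g by (intro power_mono) auto
  also have "\<dots> \<le> 2 * (norm (fst z))\<^sup>2 + 2 * (B * sqrt b)\<^sup>2"
    using sum_squares_bound[of "norm (fst z)" "B * sqrt b"] unfolding power2_sum by linarith
  also have "(B * sqrt b)\<^sup>2 = B\<^sup>2 * b" using b by (simp add: power_mult_distrib)
  finally have "t\<^sup>2 * (norm (grad U (fst z)))\<^sup>2 \<le> t\<^sup>2 * (2 * (norm (fst z))\<^sup>2 + 2 * (B\<^sup>2 * b))" by (rule mult_left_mono) simp
  moreover have "(norm (snd z - t *\<^sub>R grad U (fst z)))\<^sup>2 \<le> 2 * (norm (snd z))\<^sup>2 + 2 * (t\<^sup>2 * (norm (grad U (fst z)))\<^sup>2)"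
    using norm_add_square[of "snd z" "- t *\<^sub>R grad U (fst z)"] by (simp add: power_mult_distrib)
  moreover have "(norm (fst z, snd z - t *\<^sub>R grad U (fst z)))\<^sup>2 = (norm (fst z))\<^sup>2 + (norm (snd z - t *\<^sub>R grad U (fst z)))\<^sup>2"
    by (simp add: norm_Pair_power2)
  moreover have "t\<^sup>2 * (2 * (norm (fst z))\<^sup>2 + 2 * (B\<^sup>2 * b)) = 2 * (t\<^sup>2 * (norm (fst z))\<^sup>2) + 2 * ((t * B)\<^sup>2 * b)"
    by (simp add: algebra_simps power_mult_distrib)
  moreover have "(2 + 4 * t\<^sup>2 + 4 * (t * B)\<^sup>2) * (b + (norm z)\<^sup>2)
    = 2 * b + 2 * (norm (fst z))\<^sup>2 + 2 * (norm (snd z))\<^sup>2 + 4 * (t\<^sup>2 * b) + 4 * (t\<^sup>2 * (norm (fst z))\<^sup>2) + 4 * (t\<^sup>2 * (norm (snd z))\<^sup>2) + 4 * ((t * B)\<^sup>2 * b) + 4 * ((t * B)\<^sup>2 * (norm z)\<^sup>2)"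
    unfolding norm_Pair_power2[of z] by (simp add: algebra_simps)
  moreover have "0 \<le> t\<^sup>2 * b" "0 \<le> t\<^sup>2 * (norm (snd z))\<^sup>2" "0 \<le> (t * B)\<^sup>2 * (norm z)\<^sup>2" "0 \<le> (norm (fst z))\<^sup>2"
    using b by auto
  ultimately have "b + (norm (fst z, snd z - t *\<^sub>R grad U (fst z)))\<^sup>2 \<le> (2 + 4 * t\<^sup>2 + 4 * (t * B)\<^sup>2) * (b + (norm z)\<^sup>2)" using b by linarith
  then show "kernel_nn (kernel_B U t) (\<lambda>w. ennreal (b + (norm w)\<^sup>2)) z \<le> ennreal ((2 + 4 * t\<^sup>2 + 4 * (t * B)\<^sup>2) * (b + (norm z)\<^sup>2))"
    by (subst kernel_nn_B) (auto intro!: ennreal_leI)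
qed

lemma std_gaussian_second_moment:
  obtains M where "0 \<le> M" "(\<integral>\<^sup>+x. ennreal ((norm x)\<^sup>2) \<partial>(std_gaussian :: 'a::euclidean_space measure)) \<le> ennreal M"
proof
  show "0 \<le> 4 * sqrt 2 ^ DIM('a)" by simp
  have "(\<integral>\<^sup>+x. ennreal ((norm x)\<^sup>2) \<partial>(std_gaussian :: 'a measure)) \<le> (\<integral>\<^sup>+x. ennreal 4 * ennreal (exp ((norm x)\<^sup>2 / 4)) \<partial>(std_gaussian :: 'a measure))"
  proof (rule nn_integral_mono)
    fix x :: 'a
    have "(norm x)\<^sup>2 \<le> 4 * exp ((norm x)\<^sup>2 / 4)" using exp_ge_add_one_self[of "(norm x)\<^sup>2 / 4"] by linarith
    then show "ennreal ((norm x)\<^sup>2) \<le> ennreal 4 * ennreal (exp ((norm x)\<^sup>2 / 4))" by (subst ennreal_mult[symmetric]) (auto intro!: ennreal_leI)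
  qed
  also have "\<dots> = ennreal 4 * ennreal (sqrt 2 ^ DIM('a))"
    by (subst nn_integral_cmult) (auto simp: std_gaussian_exp_moment)
  also have "\<dots> = ennreal (4 * sqrt 2 ^ DIM('a))" by (rule ennreal_mult[symmetric]) auto
  finally show "(\<integral>\<^sup>+x. ennreal ((norm x)\<^sup>2) \<partial>(std_gaussian :: 'a measure)) \<le> ennreal (4 * sqrt 2 ^ DIM('a))" .
qed

lemma quadratic_growth_O:
  obtains C where "\<And>b. 1 \<le> b \<Longrightarrow> quadratic_growth C b (kernel_O \<gamma> t :: 'a::euclidean_space kernel)"
proof -
  obtain M where M: "0 \<le> M" "(\<integral>\<^sup>+x. ennreal ((norm x)\<^sup>2) \<partial>(std_gaussian :: 'a measure)) \<le> ennreal M"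
    using std_gaussian_second_moment by blast
  define c where "c = exp (- \<gamma> * t)"
  define d where "d = sqrt (1 - exp (- 2 * \<gamma> * t))"
  have "quadratic_growth (1 + 2 * c\<^sup>2 + 2 * d\<^sup>2 * M) b (kernel_O \<gamma> t :: 'a kernel)" if b: "1 \<le> b" for b
    unfolding quadratic_growth_def
  proof (intro conjI allI kernel_O_markov)
    have dM: "0 \<le> d\<^sup>2 * M" using M by simp
    show "0 < 1 + 2 * c\<^sup>2 + 2 * d\<^sup>2 * M" using dM zero_le_power2[of c] by linarith
    fix z :: "'a \<times> 'a"
    let ?A = "b + (norm (fst z))\<^sup>2 + 2 * (c\<^sup>2 * (norm (snd z))\<^sup>2)"
    have A0: "0 \<le> ?A" using b by simp
    have "kernel_nn (kernel_O \<gamma> t) (\<lambda>w. ennreal (b + (norm w)\<^sup>2)) z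
        = (\<integral>\<^sup>+\<xi>. ennreal (b + (norm (fst z, c *\<^sub>R snd z + d *\<^sub>R \<xi>))\<^sup>2) \<partial>std_gaussian)"
      unfolding c_def d_def by (rule kernel_nn_O) measurable
    also have "\<dots> \<le> (\<integral>\<^sup>+\<xi>. ennreal ?A + ennreal (2 * d\<^sup>2) * ennreal ((norm \<xi>)\<^sup>2) \<partial>(std_gaussian :: 'a measure))"
    proof (rule nn_integral_mono)
      fix \<xi> :: 'a
      have "(norm (c *\<^sub>R snd z + d *\<^sub>R \<xi>))\<^sup>2 \<le> 2 * (c\<^sup>2 * (norm (snd z))\<^sup>2) + 2 * d\<^sup>2 * (norm \<xi>)\<^sup>2"
        using norm_add_square[of "c *\<^sub>R snd z" "d *\<^sub>R \<xi>"] by (simp add: power_mult_distrib)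
      then have "b + (norm (fst z, c *\<^sub>R snd z + d *\<^sub>R \<xi>))\<^sup>2 \<le> ?A + 2 * d\<^sup>2 * (norm \<xi>)\<^sup>2" by (simp add: norm_Pair_power2)
      then show "ennreal (b + (norm (fst z, c *\<^sub>R snd z + d *\<^sub>R \<xi>))\<^sup>2) \<le> ennreal ?A + ennreal (2 * d\<^sup>2) * ennreal ((norm \<xi>)\<^sup>2)"
      proof -
        have "ennreal (2 * d\<^sup>2) * ennreal ((norm \<xi>)\<^sup>2) = ennreal (2 * d\<^sup>2 * (norm \<xi>)\<^sup>2)"
          by (rule ennreal_mult[symmetric]) auto
        moreover have "ennreal ?A + ennreal (2 * d\<^sup>2 * (norm \<xi>)\<^sup>2) = ennreal (?A + 2 * d\<^sup>2 * (norm \<xi>)\<^sup>2)"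
          by (rule ennreal_plus[symmetric]) (use A0 in auto)
        ultimately show ?thesis
          using \<open>b + (norm (fst z, c *\<^sub>R snd z + d *\<^sub>R \<xi>))\<^sup>2 \<le> ?A + 2 * d\<^sup>2 * (norm \<xi>)\<^sup>2\<close> by (simp only: ennreal_leI)
      qed
    qed
    also have "\<dots> = ennreal ?A + ennreal (2 * d\<^sup>2) * (\<integral>\<^sup>+\<xi>. ennreal ((norm \<xi>)\<^sup>2) \<partial>(std_gaussian :: 'a measure))"
      by (subst nn_integral_add) (auto simp: nn_integral_cmult)
    also have "\<dots> \<le> ennreal ?A + ennreal (2 * d\<^sup>2) * ennreal M" by (intro add_left_mono mult_left_mono M) auto
    also have "\<dots> = ennreal (?A + 2 * d\<^sup>2 * M)"
      using A0 M by (subst ennreal_mult[symmetric], simp, simp, subst ennreal_plus[symmetric]) auto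
    also have "\<dots> \<le> ennreal ((1 + 2 * c\<^sup>2 + 2 * d\<^sup>2 * M) * (b + (norm z)\<^sup>2))"
    proof (rule ennreal_leI)
      have "2 * (d\<^sup>2 * M) * 1 \<le> 2 * (d\<^sup>2 * M) * (b + (norm z)\<^sup>2)" using dM b by (intro mult_left_mono) (auto simp: add_increasing2)
      moreover have "(1 + 2 * c\<^sup>2 + 2 * d\<^sup>2 * M) * (b + (norm z)\<^sup>2) = b + (norm (fst z))\<^sup>2 + (norm (snd z))\<^sup>2 + 2 * (c\<^sup>2 * b) + 2 * (c\<^sup>2 * (norm (fst z))\<^sup>2) + 2 * (c\<^sup>2 * (norm (snd z))\<^sup>2) + 2 * (d\<^sup>2 * M) * (b + (norm z)\<^sup>2)"
        unfolding norm_Pair_power2[of z] by (simp add: algebra_simps)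
      moreover have "0 \<le> c\<^sup>2 * b" "0 \<le> c\<^sup>2 * (norm (fst z))\<^sup>2" "0 \<le> (norm (snd z))\<^sup>2" using b by auto
      ultimately show "?A + 2 * d\<^sup>2 * M \<le> (1 + 2 * c\<^sup>2 + 2 * d\<^sup>2 * M) * (b + (norm z)\<^sup>2)" by linarith
    qed
    finally show "kernel_nn (kernel_O \<gamma> t) (\<lambda>w. ennreal (b + (norm w)\<^sup>2)) z \<le> ennreal ((1 + 2 * c\<^sup>2 + 2 * d\<^sup>2 * M) * (b + (norm z)\<^sup>2))" .
  qed
  then show thesis by (rule that)
qed

lemma post_kernel_growth:
  obtains C where "0 < C" "\<And>(U :: 'a::euclidean_space \<Rightarrow> real) b. 1 \<le> b \<Longrightarrow> grad U \<in> borel_measurable borel \<Longrightarrow>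
    (\<And>x. norm (grad U x) \<le> norm x + B * sqrt b) \<Longrightarrow> quadratic_growth C b (post_kernel S U h \<gamma>)"
proof -
  obtain C1 where C1: "\<And>b. 1 \<le> b \<Longrightarrow> quadratic_growth C1 b (kernel_O \<gamma> h :: 'a kernel)"
    using quadratic_growth_O by blast
  obtain C2 where C2: "\<And>b. 1 \<le> b \<Longrightarrow> quadratic_growth C2 b (kernel_O \<gamma> (h/2) :: 'a kernel)"
    using quadratic_growth_O by blast
  have "\<exists>C. \<forall>(U :: 'a \<Rightarrow> real) b. 1 \<le> b \<longrightarrow> grad U \<in> borel_measurable borel \<longrightarrow>
    (\<forall>x. norm (grad U x) \<le> norm x + B * sqrt b) \<longrightarrow> quadratic_growth C b (post_kernel S U h \<gamma>)"
    by (cases S; simp only: post_kernel.simps; intro exI allI impI;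
        (rule quadratic_growth_then quadratic_growth_A quadratic_growth_B[where B=B] quadratic_growth_unshear C1 C2 | simp)+)
  then obtain C where C: "\<And>(U :: 'a \<Rightarrow> real) b. 1 \<le> b \<Longrightarrow> grad U \<in> borel_measurable borel \<Longrightarrow>
    (\<And>x. norm (grad U x) \<le> norm x + B * sqrt b) \<Longrightarrow> quadratic_growth C b (post_kernel S U h \<gamma>)" by blast
  show thesis
  proof (rule that[of "max C 1"])
    fix U :: "'a \<Rightarrow> real" and b
    assume a: "1 \<le> b" "grad U \<in> borel_measurable borel" "\<And>x. norm (grad U x) \<le> norm x + B * sqrt b"
    from C[OF a] show "quadratic_growth (max C 1) b (post_kernel S U h \<gamma>)"
      unfolding quadratic_growth_def
    proof (elim conjE, intro conjI allI)
      fix z assume "\<forall>z. kernel_nn (post_kernel S U h \<gamma>) (\<lambda>w. ennreal (b + (norm w)\<^sup>2)) z \<le> ennreal (C * (b + (norm z)\<^sup>2))"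
      then have "kernel_nn (post_kernel S U h \<gamma>) (\<lambda>w. ennreal (b + (norm w)\<^sup>2)) z \<le> ennreal (C * (b + (norm z)\<^sup>2))" by blast
      also have "\<dots> \<le> ennreal (max C 1 * (b + (norm z)\<^sup>2))" using a(1) by (intro ennreal_leI mult_right_mono) auto
      finally show "kernel_nn (post_kernel S U h \<gamma>) (\<lambda>w. ennreal (b + (norm w)\<^sup>2)) z \<le> ennreal (max C 1 * (b + (norm z)\<^sup>2))" .
    qed auto
  qed simp
qed

section \<open>Quadratic potentials\<close>

subsection \<open>The companion map and its spectral radius\<close>

text \<open>The heavy-ball map of the linear force \<open>x \<mapsto> l x\<close>, with trace \<open>T = 1 + \<beta> - s l\<close> and determinant \<open>\<beta>\<close> in each
  coordinate; \<open>companion_radius\<close> is the larger modulus of the roots of \<open>x\<^sup>2 - T x + \<beta>\<close>.\<close>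

definition companion :: "real \<Rightarrow> real \<Rightarrow> 'a::real_vector \<times> 'a \<Rightarrow> 'a \<times> 'a" where
  "companion T \<beta> z = (T *\<^sub>R fst z - \<beta> *\<^sub>R snd z, fst z)"

definition companion_radius :: "real \<Rightarrow> real \<Rightarrow> real" where
  "companion_radius T \<beta> = (if 4 * \<beta> \<le> T\<^sup>2 then (\<bar>T\<bar> + sqrt (T\<^sup>2 - 4 * \<beta>)) / 2 else sqrt \<beta>)"

lemma companion_linear: "linear (companion T \<beta>)"
  by (rule linearI) (simp_all add: companion_def algebra_simps)

lemma companion_radius_ge: "0 < \<beta> \<Longrightarrow> sqrt \<beta> \<le> companion_radius T \<beta>"
proof (cases "4 * \<beta> \<le> T\<^sup>2")
  case True
  assume "0 < \<beta>"
  define q where "q = sqrt (T\<^sup>2 - 4 * \<beta>)"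
  have "(2 * sqrt \<beta>)\<^sup>2 \<le> \<bar>T\<bar>\<^sup>2" using True \<open>0 < \<beta>\<close> by (simp add: power_mult_distrib)
  then have "2 * sqrt \<beta> \<le> \<bar>T\<bar>" by (rule power2_le_imp_le) simp
  moreover have "0 \<le> q" using True by (simp add: q_def)
  moreover have "companion_radius T \<beta> = (\<bar>T\<bar> + q) / 2" using True by (simp add: companion_radius_def q_def)
  ultimately show ?thesis by argo
qed (simp add: companion_radius_def)

lemma companion_radius_pos: "0 < \<beta> \<Longrightarrow> 0 < companion_radius T \<beta>"
  using companion_radius_ge[of \<beta> T] real_sqrt_gt_zero[of \<beta>] by linarith

lemma companion_radius_mono:
  assumes "0 < \<beta>" "\<bar>T\<bar> \<le> \<bar>T'\<bar>"
  shows "companion_radius T \<beta> \<le> companion_radius T' \<beta>"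
proof (cases "4 * \<beta> \<le> T\<^sup>2")
  case True
  have le: "T\<^sup>2 \<le> T'\<^sup>2" using assms(2) by (rule abs_le_square_iff[THEN iffD1])
  then have sq: "sqrt (T\<^sup>2 - 4 * \<beta>) \<le> sqrt (T'\<^sup>2 - 4 * \<beta>)" by simp
  have eq: "companion_radius T \<beta> = (\<bar>T\<bar> + sqrt (T\<^sup>2 - 4 * \<beta>)) / 2"
    "companion_radius T' \<beta> = (\<bar>T'\<bar> + sqrt (T'\<^sup>2 - 4 * \<beta>)) / 2"
    using True le by (simp_all add: companion_radius_def)
  show ?thesis unfolding eq by (intro divide_right_mono add_mono sq assms(2)) simp
next
  case False
  then have "companion_radius T \<beta> = sqrt \<beta>" by (simp add: companion_radius_def)
  then show ?thesis using companion_radius_ge[OF assms(1), of T'] by simp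
qed

text \<open>The largest modulus of a root is in particular an upper bound for the real roots.\<close>

lemma characteristic_positive:
  assumes \<beta>: "0 < \<beta>" and q: "companion_radius T \<beta> < q"
  shows "0 < q\<^sup>2 - T * q + \<beta>"
proof (cases "4 * \<beta> \<le> T\<^sup>2")
  case True
  define w where "w = sqrt (T\<^sup>2 - 4 * \<beta>)"
  have w: "0 \<le> w" "w\<^sup>2 = T\<^sup>2 - 4 * \<beta>" using True by (simp_all add: w_def)
  have q0: "0 < q" using companion_radius_pos[OF \<beta>, of T] q by linarith
  have "companion_radius T \<beta> = (\<bar>T\<bar> + w) / 2" using True by (simp add: companion_radius_def w_def)
  then have "w < 2 * q - \<bar>T\<bar>" using q by argo
  then have "w\<^sup>2 < (2 * q - \<bar>T\<bar>)\<^sup>2" using w(1) by (intro power_strict_mono) auto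
  moreover have "(2 * q - \<bar>T\<bar>)\<^sup>2 = 4 * (q\<^sup>2 - \<bar>T\<bar> * q) + T\<^sup>2" by (simp add: power2_eq_square algebra_simps)
  ultimately have "0 < 4 * (q\<^sup>2 - \<bar>T\<bar> * q + \<beta>)" unfolding w(2) distrib_left by argo
  then have "0 < q\<^sup>2 - \<bar>T\<bar> * q + \<beta>" by (simp only: zero_less_mult_iff) argo
  moreover have "T * q \<le> \<bar>T\<bar> * q" using q0 by (intro mult_right_mono) auto
  ultimately show ?thesis by linarith
next
  case False
  have "q\<^sup>2 - T * q + \<beta> = (q - T / 2)\<^sup>2 + (\<beta> - T\<^sup>2 / 4)" by (simp add: power2_eq_square field_simps)
  moreover have "0 < \<beta> - T\<^sup>2 / 4" using False by simp
  ultimately show ?thesis using zero_le_power2[of "q - T / 2"] by linarith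
qed

lemma eigenvalue_A_mat:
  "eigenvalue (A_mat l s \<beta>) k \<longleftrightarrow> k\<^sup>2 - complex_of_real (1 + \<beta> - s * l) * k + complex_of_real \<beta> = 0"
proof -
  let ?T = "complex_of_real (1 + \<beta> - s * l)" and ?A = "A_mat l s \<beta>"
  have A: "?A \<in> carrier_mat 2 2"
    unfolding A_mat_def mat_of_rows_list_def by (rule carrier_matI) simp_all
  have Av: "?A *\<^sub>v v = Matrix.vec 2 (\<lambda>i. if i = 0 then ?T * vec_index v 0 - complex_of_real \<beta> * vec_index v 1 else vec_index v 0)"
    if v: "v \<in> carrier_vec 2" for v
  proof (rule eq_vecI)
    fix i assume "i < dim_vec (Matrix.vec 2 (\<lambda>i. if i = 0 then ?T * vec_index v 0 - complex_of_real \<beta> * vec_index v 1 else vec_index v 0))"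
    then have i: "i < 2" by simp
    have d: "dim_vec v = 2" using v by simp
    have "vec_index (?A *\<^sub>v v) i = (\<Sum>j\<in>{0..<2}. ?A $$ (i, j) * vec_index v j)"
      using A i d by (simp add: mult_mat_vec_def scalar_prod_def)
    also have "{0..<2} = {0, 1::nat}" by auto
    finally show "vec_index (?A *\<^sub>v v) i = vec_index (Matrix.vec 2 (\<lambda>i. if i = 0 then ?T * vec_index v 0 - complex_of_real \<beta> * vec_index v 1 else vec_index v 0)) i"
      using i by (auto simp: A_mat_def mat_of_rows_list_def less_2_cases_iff)
  qed (use A in simp)
  show ?thesis
  proof
    assume "eigenvalue ?A k"
    then obtain v where v: "v \<in> carrier_vec 2" "v \<noteq> 0\<^sub>v 2" "?A *\<^sub>v v = k \<cdot>\<^sub>v v"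
      using A by (auto simp: eigenvalue_def eigenvector_def)
    have "vec_index (?A *\<^sub>v v) 0 = k * vec_index v 0" "vec_index (?A *\<^sub>v v) 1 = k * vec_index v 1" using v by auto
    then have e: "?T * vec_index v 0 - complex_of_real \<beta> * vec_index v 1 = k * vec_index v 0" "vec_index v 0 = k * vec_index v 1"
      unfolding Av[OF v(1)] by simp_all
    have "vec_index v 1 \<noteq> 0"
    proof
      assume 0: "vec_index v 1 = 0"
      have "v = 0\<^sub>v 2"
        by (rule eq_vecI) (use 0 e(2) v(1) in \<open>auto simp: less_2_cases_iff\<close>)
      then show False using v by simp
    qed
    moreover have "(k\<^sup>2 - ?T * k + complex_of_real \<beta>) * vec_index v 1 = 0"
      using e(1) unfolding e(2) by (simp add: algebra_simps power2_eq_square)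
    ultimately show "k\<^sup>2 - ?T * k + complex_of_real \<beta> = 0" by simp
  next
    assume k: "k\<^sup>2 - ?T * k + complex_of_real \<beta> = 0"
    define v where "v = Matrix.vec 2 (\<lambda>i. if i = 0 then k else 1)"
    have v: "v \<in> carrier_vec 2" by (simp add: v_def)
    have "vec_index v 1 \<noteq> vec_index (0\<^sub>v 2 :: complex vec) 1" by (simp add: v_def)
    then have "v \<noteq> 0\<^sub>v 2" by metis
    moreover have "?A *\<^sub>v v = k \<cdot>\<^sub>v v"
      unfolding Av[OF v]
    proof (rule eq_vecI)
      have "?T * k - complex_of_real \<beta> = k * k" using k by (simp add: algebra_simps power2_eq_square)
      then show "vec_index (Matrix.vec 2 (\<lambda>i. if i = 0 then ?T * vec_index v 0 - complex_of_real \<beta> * vec_index v 1 else vec_index v 0)) i = vec_index (k \<cdot>\<^sub>v v) i"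
        if "i < dim_vec (k \<cdot>\<^sub>v v)" for i
        using that by (auto simp: v_def less_2_cases_iff)
    qed (simp add: v_def)
    ultimately show "eigenvalue ?A k"
      using v A by (auto simp: eigenvalue_def eigenvector_def)
  qed
qed

lemma spectral_radius_A_mat:
  assumes \<beta>: "0 < \<beta>"
  shows "spectral_radius (A_mat l s \<beta>) = companion_radius (1 + \<beta> - s * l) \<beta>"
proof -
  define T where "T = 1 + \<beta> - s * l"
  have A: "A_mat l s \<beta> \<in> carrier_mat 2 2"
    unfolding A_mat_def mat_of_rows_list_def by (rule carrier_matI) simp_all
  note ev = eigenvalue_A_mat[of l s \<beta>, folded T_def]
  have fin: "finite (spectrum (A_mat l s \<beta>))" by (rule card_finite_spectrum(1)[OF A])
  have ne: "spectrum (A_mat l s \<beta>) \<noteq> {}" by (rule spectrum_non_empty[OF A]) simp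
  have "Max (norm ` spectrum (A_mat l s \<beta>)) = companion_radius T \<beta>"
  proof (rule Max_eqI)
    show "finite (norm ` spectrum (A_mat l s \<beta>))" using fin by simp
  next
    fix y assume "y \<in> norm ` spectrum (A_mat l s \<beta>)"
    then obtain k where k: "y = norm k" "k\<^sup>2 - complex_of_real T * k + complex_of_real \<beta> = 0"
      by (auto simp: spectrum_def ev)
    define a b where "a = Re k" and "b = Im k"
    have re: "a\<^sup>2 - b\<^sup>2 - T * a + \<beta> = 0" and im: "2 * a * b - T * b = 0"
      using k(2) by (simp_all add: complex_eq_iff a_def b_def power2_eq_square)
    have n: "(norm k)\<^sup>2 = a\<^sup>2 + b\<^sup>2" by (simp add: cmod_power2 a_def b_def)
    show "y \<le> companion_radius T \<beta>"
    proof (cases "b = 0")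
      case True
      then have q: "(2 * a - T)\<^sup>2 = T\<^sup>2 - 4 * \<beta>" using re by (simp add: power2_eq_square algebra_simps)
      then have T4: "4 * \<beta> \<le> T\<^sup>2" using zero_le_power2[of "2 * a - T"] by linarith
      have "\<bar>2 * a - T\<bar> = sqrt (T\<^sup>2 - 4 * \<beta>)" using q by (metis real_sqrt_abs)
      then have "2 * \<bar>a\<bar> \<le> \<bar>T\<bar> + sqrt (T\<^sup>2 - 4 * \<beta>)" by linarith
      moreover have "norm k = \<bar>a\<bar>" using True by (simp add: cmod_def a_def b_def)
      ultimately show ?thesis using T4 k(1) by (simp add: companion_radius_def)
    next
      case False
      then have "T = 2 * a" using im by simp
      then have "a\<^sup>2 + b\<^sup>2 = \<beta>" using re by (simp add: power2_eq_square)
      then have "norm k = sqrt \<beta>" using n by (metis norm_ge_zero real_sqrt_unique)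
      then show ?thesis using companion_radius_ge[OF \<beta>, of T] k(1) by simp
    qed
  next
    show "companion_radius T \<beta> \<in> norm ` spectrum (A_mat l s \<beta>)"
    proof (cases "4 * \<beta> \<le> T\<^sup>2")
      case True
      define q where "q = sqrt (T\<^sup>2 - 4 * \<beta>)"
      have q2: "q\<^sup>2 = T\<^sup>2 - 4 * \<beta>" using True by (simp add: q_def)
      have q0: "0 \<le> q" using True by (simp add: q_def)
      define r where "r = (if 0 \<le> T then (T + q) / 2 else (T - q) / 2)"
      have "r\<^sup>2 - T * r + \<beta> = 0" using q2 by (auto simp: r_def power2_eq_square field_simps)
      then have "(complex_of_real r)\<^sup>2 - complex_of_real T * complex_of_real r + complex_of_real \<beta> = 0"
        by (metis of_real_0 of_real_add of_real_diff of_real_mult of_real_power)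
      moreover have "companion_radius T \<beta> = (\<bar>T\<bar> + q) / 2" using True by (simp add: companion_radius_def q_def)
      then have "norm (complex_of_real r) = companion_radius T \<beta>"
        unfolding norm_of_real using q0 by (cases "0 \<le> T") (simp_all add: r_def abs_if field_simps)
      ultimately show ?thesis by (intro image_eqI[of _ _ "complex_of_real r"]) (auto simp: spectrum_def ev)
    next
      case False
      define k where "k = Complex (T / 2) (sqrt (\<beta> - T\<^sup>2 / 4))"
      have p: "0 \<le> \<beta> - T\<^sup>2 / 4" using False by simp
      have "k\<^sup>2 - complex_of_real T * k + complex_of_real \<beta> = 0"
        using p by (simp add: k_def complex_eq_iff power2_eq_square)
      moreover have "norm k = companion_radius T \<beta>"
        using p False by (simp add: k_def cmod_def companion_radius_def power_divide)
      ultimately show ?thesis by (intro image_eqI[of _ _ k]) (auto simp: spectrum_def ev)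
    qed
  qed
  then show ?thesis by (simp add: spectral_radius_def T_def)
qed

text \<open>The trace \<open>1 + \<beta> - s l\<close> is affine in \<open>l\<close> and the radius increases with its modulus, so the
  supremum over \<open>l\<close> is attained at an end point.\<close>

lemma rho_q_attained:
  assumes \<beta>: "0 < \<beta>" and s: "0 \<le> s" and \<kappa>: "1 \<le> \<kappa>"
  obtains l where "l \<in> {1..\<kappa>}" "rho_q s \<beta> \<kappa> = companion_radius (1 + \<beta> - s * l) \<beta>"
proof -
  let ?T = "\<lambda>l. 1 + \<beta> - s * l"
  define l where "l = (if \<bar>?T \<kappa>\<bar> \<le> \<bar>?T 1\<bar> then 1 else \<kappa>)"
  have l: "l \<in> {1..\<kappa>}" using \<kappa> by (simp add: l_def)
  have le: "companion_radius (?T x) \<beta> \<le> companion_radius (?T l) \<beta>" if x: "x \<in> {1..\<kappa>}" for x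
  proof (rule companion_radius_mono[OF \<beta>])
    have "?T \<kappa> \<le> ?T x" "?T x \<le> ?T 1" using x mult_left_mono[of x \<kappa> s] mult_left_mono[of 1 x s] s by auto
    then show "\<bar>?T x\<bar> \<le> \<bar>?T l\<bar>" by (auto simp: l_def)
  qed
  have "rho_q s \<beta> \<kappa> = companion_radius (?T l) \<beta>"
    unfolding rho_q_def spectral_radius_A_mat[OF \<beta>]
    by (rule cSup_eq_maximum) (use l le in auto)
  then show thesis using that l by blast
qed

lemma rho_q_ge:
  assumes \<beta>: "0 < \<beta>" and s: "0 \<le> s" and \<kappa>: "1 \<le> \<kappa>" and l: "l \<in> {1..\<kappa>}"
  shows "companion_radius (1 + \<beta> - s * l) \<beta> \<le> rho_q s \<beta> \<kappa>"
  unfolding rho_q_def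
proof (rule cSUP_upper2[OF _ l])
  show "bdd_above ((\<lambda>l. spectral_radius (A_mat l s \<beta>)) ` {1..\<kappa>})"
  proof (rule bdd_aboveI2)
    fix x assume "x \<in> {1..\<kappa>}"
    then have "1 \<le> x" "x \<le> \<kappa>" by auto
    then have "s * x \<le> s * \<kappa>" "0 \<le> s * x" using s by (auto intro: mult_left_mono)
    then have "\<bar>1 + \<beta> - s * x\<bar> \<le> \<bar>1 + \<beta> + s * \<kappa>\<bar>" using \<beta> by linarith
    then show "spectral_radius (A_mat x s \<beta>) \<le> companion_radius (1 + \<beta> + s * \<kappa>) \<beta>"
      unfolding spectral_radius_A_mat[OF \<beta>] by (rule companion_radius_mono[OF \<beta>])
  qed
qed (simp add: spectral_radius_A_mat[OF \<beta>])

text \<open>A mode along which the companion map acts exactly at its spectral radius: an eigenvector when the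
  eigenvalues are real; otherwise any vector, because the map then multiplies the form
  \<open>|a|\<^sup>2 - T \<langle>a, b\<rangle> + \<beta> |b|\<^sup>2\<close> by \<open>\<beta>\<close>.\<close>

lemma companion_mode:
  fixes T \<beta> :: real
  assumes \<beta>: "0 < \<beta>"
  obtains w :: "'a::euclidean_space \<times> 'a" and c C :: real where "0 < c" "0 < C"
    "\<And>n. c * companion_radius T \<beta> ^ n \<le> norm ((companion T \<beta> ^^ n) w)"
    "\<And>n. norm ((companion T \<beta> ^^ n) w) \<le> C * companion_radius T \<beta> ^ n"
proof -
  obtain u :: 'a where u: "u \<in> Basis" using nonempty_Basis by blast
  then have u1: "norm u = 1" by simp
  show thesis
  proof (cases "4 * \<beta> \<le> T\<^sup>2")
    case True
    define q where "q = sqrt (T\<^sup>2 - 4 * \<beta>)"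
    have q2: "q\<^sup>2 = T\<^sup>2 - 4 * \<beta>" using True by (simp add: q_def)
    have q0: "0 \<le> q" using True by (simp add: q_def)
    define r where "r = (if 0 \<le> T then (T + q) / 2 else (T - q) / 2)"
    have rr: "T * r - \<beta> = r * r" using q2 by (auto simp: r_def power2_eq_square field_simps)
    have "companion_radius T \<beta> = (\<bar>T\<bar> + q) / 2" using True by (simp add: companion_radius_def q_def)
    then have ra: "\<bar>r\<bar> = companion_radius T \<beta>" using q0 by (cases "0 \<le> T") (simp_all add: r_def abs_if field_simps)
    define w where "w = (r *\<^sub>R u, u)"
    have step: "companion T \<beta> w = r *\<^sub>R w"
    proof -
      have "(T * r) *\<^sub>R u - \<beta> *\<^sub>R u = (r * r) *\<^sub>R u" by (simp add: rr flip: scaleR_diff_left)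
      then show ?thesis by (simp add: companion_def w_def)
    qed
    have "(companion T \<beta> ^^ n) w = r ^ n *\<^sub>R w" for n
      by (induction n) (simp_all add: linear_scale[OF companion_linear] step mult.commute)
    then have nw: "norm ((companion T \<beta> ^^ n) w) = norm w * companion_radius T \<beta> ^ n" for n
      by (simp add: ra[symmetric] power_abs)
    have "w \<noteq> 0" using u1 by (auto simp: w_def zero_prod_def)
    then have "0 < norm w" by simp
    then show thesis using that[of "norm w" "norm w" w] nw by simp
  next
    case False
    define V where "V z = (norm (fst z))\<^sup>2 - 2 * (T / 2) * inner (fst z) (snd z) + \<beta> * (norm (snd z))\<^sup>2" for z :: "'a \<times> 'a"
    have VM: "V (companion T \<beta> z) = \<beta> * V z" for z
      unfolding V_def companion_def power2_norm_eq_inner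
      by (simp add: inner_diff_left inner_diff_right inner_commute power2_eq_square algebra_simps)
    have Vn: "V ((companion T \<beta> ^^ n) z) = \<beta> ^ n * V z" for n z
      by (induction n) (simp_all add: VM)
    define m where "m = (1 * \<beta> - (T / 2)\<^sup>2) / (1 + \<beta>)"
    have pd: "(T / 2)\<^sup>2 < 1 * \<beta>" using False by (simp add: power_divide)
    have m: "0 < m" using pd \<beta> by (simp add: m_def)
    have low: "m * (norm z)\<^sup>2 \<le> V z" for z
      unfolding V_def norm_Pair_power2[of z] m_def using quadratic_form_lower[OF _ \<beta> pd, of "fst z" "snd z"] by simp
    define k where "k = 1 + \<bar>T\<bar> + \<beta>"
    have k: "0 < k" using \<beta> by (simp add: k_def add_nonneg_pos)
    have up: "V z \<le> k * (norm z)\<^sup>2" for z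
    proof -
      have a: "norm (fst z) \<le> norm z" "norm (snd z) \<le> norm z"
        using norm_fst_le[of "fst z" "snd z"] norm_snd_le[of "snd z" "fst z"] by simp_all
      have "\<bar>inner (fst z) (snd z)\<bar> \<le> norm (fst z) * norm (snd z)" by (rule Cauchy_Schwarz_ineq2)
      also have "\<dots> \<le> norm z * norm z" using a by (intro mult_mono) auto
      finally have "\<bar>T\<bar> * \<bar>inner (fst z) (snd z)\<bar> \<le> \<bar>T\<bar> * (norm z)\<^sup>2" by (simp add: mult_left_mono power2_eq_square)
      then have "- (T * inner (fst z) (snd z)) \<le> \<bar>T\<bar> * (norm z)\<^sup>2" by (simp flip: abs_mult)
      moreover have "(norm (fst z))\<^sup>2 \<le> (norm z)\<^sup>2" "\<beta> * (norm (snd z))\<^sup>2 \<le> \<beta> * (norm z)\<^sup>2"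
        using a \<beta> by (auto intro: power_mono)
      moreover have "V z = (norm (fst z))\<^sup>2 - T * inner (fst z) (snd z) + \<beta> * (norm (snd z))\<^sup>2" by (simp add: V_def)
      moreover have "k * (norm z)\<^sup>2 = (norm z)\<^sup>2 + \<bar>T\<bar> * (norm z)\<^sup>2 + \<beta> * (norm z)\<^sup>2" by (simp add: k_def algebra_simps)
      ultimately show ?thesis by linarith
    qed
    define w where "w = (0::'a, u)"
    have Vw: "V w = \<beta>" using u1 by (simp add: V_def w_def)
    have rad: "companion_radius T \<beta> = sqrt \<beta>" using False by (simp add: companion_radius_def)
    have sn: "(sqrt \<beta> ^ n)\<^sup>2 = \<beta> ^ n" for n using \<beta> real_sqrt_pow2[of \<beta>] power_mult[of "sqrt \<beta>" 2 n] power_mult[of "sqrt \<beta>" n 2] by (simp add: mult.commute)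
    show thesis
    proof (rule that[of "sqrt (\<beta> / k)" "sqrt (\<beta> / m)" w])
      show "0 < sqrt (\<beta> / k)" "0 < sqrt (\<beta> / m)" using \<beta> k m by auto
      show "sqrt (\<beta> / k) * companion_radius T \<beta> ^ n \<le> norm ((companion T \<beta> ^^ n) w)" for n
      proof (rule power2_le_imp_le)
        have "\<beta> ^ n * \<beta> \<le> k * (norm ((companion T \<beta> ^^ n) w))\<^sup>2" using up[of "(companion T \<beta> ^^ n) w"] by (simp add: Vn Vw)
        then show "(sqrt (\<beta> / k) * companion_radius T \<beta> ^ n)\<^sup>2 \<le> (norm ((companion T \<beta> ^^ n) w))\<^sup>2"
          using k \<beta> by (simp add: rad power_mult_distrib sn pos_divide_le_eq mult.commute)
      qed simp
      show "norm ((companion T \<beta> ^^ n) w) \<le> sqrt (\<beta> / m) * companion_radius T \<beta> ^ n" for n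
      proof (rule power2_le_imp_le)
        have "m * (norm ((companion T \<beta> ^^ n) w))\<^sup>2 \<le> \<beta> ^ n * \<beta>" using low[of "(companion T \<beta> ^^ n) w"] by (simp add: Vn Vw)
        then show "(norm ((companion T \<beta> ^^ n) w))\<^sup>2 \<le> (sqrt (\<beta> / m) * companion_radius T \<beta> ^ n)\<^sup>2"
          using m \<beta> by (simp add: rad power_mult_distrib sn pos_le_divide_eq mult.commute)
      qed (use \<beta> m in \<open>simp add: rad\<close>)
    qed
  qed
qed

lemma root_limit:
  fixes x :: "nat \<Rightarrow> real"
  assumes "0 < c" "0 < C" "0 < \<rho>" and lo: "\<And>n. n \<ge> N \<Longrightarrow> c * \<rho> ^ n \<le> x n" and hi: "\<And>n. n \<ge> N \<Longrightarrow> x n \<le> C * \<rho> ^ n"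
  shows "(\<lambda>n. root n (x n)) \<longlonglongrightarrow> \<rho>"
proof (rule tendsto_sandwich)
  have lim: "(\<lambda>n. root n c * \<rho>) \<longlonglongrightarrow> \<rho>" if "0 < c" for c
    using tendsto_mult[OF LIMSEQ_root_const[OF that] tendsto_const[of \<rho>]] by simp
  show "(\<lambda>n. root n c * \<rho>) \<longlonglongrightarrow> \<rho>" "(\<lambda>n. root n C * \<rho>) \<longlonglongrightarrow> \<rho>" using lim assms by auto
  have r: "root n c * \<rho> = root n (c * \<rho> ^ n)" if "0 < n" for n c
    using that assms(3) by (simp add: real_root_mult real_root_power_cancel)
  show "\<forall>\<^sub>F n in sequentially. root n c * \<rho> \<le> root n (x n)"
    using eventually_ge_at_top[of "max N 1"] by eventually_elim (use lo in \<open>simp add: r\<close>)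
  show "\<forall>\<^sub>F n in sequentially. root n (x n) \<le> root n C * \<rho>"
    using eventually_ge_at_top[of "max N 1"] by eventually_elim (use hi in \<open>simp add: r\<close>)
qed

subsection \<open>Translating laws\<close>

definition translation :: "'z::real_normed_vector \<Rightarrow> 'z \<Rightarrow> 'z measure" where
  "translation w = (\<lambda>z. return borel (z + w))"

lemma translation_kernel: "markov_kernel (translation (w :: 'a::euclidean_space \<times> 'a))"
  unfolding translation_def by (rule return_kernel) measurable

lemma kernel_apply_translation:
  "\<phi> \<in> borel_measurable borel \<Longrightarrow> kernel_apply (translation w) \<phi> z = \<phi> (z + w)"
  unfolding kernel_apply_def translation_def by (rule integral_return) auto

lemma kernel_nn_translation:
  "\<phi> \<in> borel_measurable borel \<Longrightarrow> kernel_nn (translation w) \<phi> z = \<phi> (z + w)"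
  unfolding translation_def by (rule kernel_nn_return)

lemma integral_translation:
  fixes \<mu> :: "('a::euclidean_space \<times> 'a) measure" and \<phi> :: "'a \<times> 'a \<Rightarrow> real"
  assumes "borel_law \<mu>" "\<phi> \<in> borel_measurable borel" "\<And>x. \<bar>\<phi> x\<bar> \<le> B"
  shows "(\<integral>z. \<phi> z \<partial>bind \<mu> (translation w)) = (\<integral>z. \<phi> (z + w) \<partial>\<mu>)"
  unfolding integral_bind_kernel[OF assms(1) translation_kernel assms(2,3)]
  unfolding kernel_apply_translation[OF assms(2), abs_def] ..

text \<open>A law with bounded second moment charges a fixed ball; there a clamped linear function of slope
  \<open>1 / (2 (r + |\<delta>|))\<close> along \<open>\<delta>\<close> grows by a definite multiple of \<open>|\<delta>|\<close> under the translation, and it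
  decreases nowhere.\<close>

lemma tv_dist_translation_ge:
  fixes \<mu> :: "('a::euclidean_space \<times> 'a) measure"
  assumes \<mu>: "borel_law \<mu>" and r: "0 < r" and mom: "(\<integral>\<^sup>+z. ennreal ((norm z)\<^sup>2) \<partial>\<mu>) \<le> ennreal (r\<^sup>2 / 2)"
  shows "norm \<delta> / (4 * (r + norm \<delta>)) \<le> tv_dist \<mu> (bind \<mu> (translation \<delta>))"
proof (cases "\<delta> = 0")
  case True
  have "0 \<le> tv_dist \<mu> (bind \<mu> (translation \<delta>))"
    by (rule tv_dist_nonneg[OF \<mu> borel_law_bind[OF \<mu> translation_kernel]])
  then show ?thesis using True by simp
next
  case False
  interpret prob_space \<mu> using \<mu> by (rule borel_lawD)
  note borel_lawD(2)[OF \<mu>, measurable_cong]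
  have sp: "space \<mu> = UNIV" by (rule borel_lawD(3)[OF \<mu>])
  define n where "n = norm \<delta>"
  have n: "0 < n" using False by (simp add: n_def)
  define u where "u = (1 / n) *\<^sub>R \<delta>"
  have nu: "norm u = 1" using n by (simp add: u_def n_def)
  have ud: "inner u \<delta> = n" using n by (simp add: u_def n_def power2_norm_eq_inner[symmetric] power2_eq_square)
  define D where "D = 2 * (r + n)"
  have D: "0 < D" using r n by (simp add: D_def)
  define \<psi> where "\<psi> z = max 0 (min 1 (1 / 2 + inner u z / D))" for z
  have \<psi>m [measurable]: "\<psi> \<in> borel_measurable borel" unfolding \<psi>_def by measurable
  have \<psi>01: "0 \<le> \<psi> z" "\<psi> z \<le> 1" for z by (auto simp: \<psi>_def)
  have shift: "inner u (z + \<delta>) / D = inner u z / D + n / D" for z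
    by (simp add: inner_add_right ud add_divide_distrib)
  have clamp: "q \<le> max 0 (min 1 (1 / 2 + (a + q))) - max 0 (min 1 (1 / 2 + a))"
    if "- p \<le> a" "a \<le> p" "p + q = 1 / 2" "0 < q" "0 < p" for a p q :: real
    using that by (auto simp: max_def min_def)
  have inc: "n / D * indicator (cball 0 r) z \<le> \<psi> (z + \<delta>) - \<psi> z" for z
  proof (cases "z \<in> cball 0 r")
    case True
    then have "\<bar>inner u z\<bar> \<le> r" using Cauchy_Schwarz_ineq2[of u z] nu by simp
    then have "(- r) / D \<le> inner u z / D" "inner u z / D \<le> r / D"
      using D by (intro divide_right_mono; linarith)+
    then have "- (r / D) \<le> inner u z / D" "inner u z / D \<le> r / D" by simp_all
    moreover have "r / D + n / D = 1 / 2" using r n by (simp add: D_def flip: add_divide_distrib)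
    moreover have "0 < n / D" "0 < r / D" using n r D by auto
    ultimately have "n / D \<le> \<psi> (z + \<delta>) - \<psi> z" unfolding \<psi>_def shift by (intro clamp)
    then show ?thesis using True by (simp add: indicator_def)
  next
    case False
    have "0 < n / D" using n D by auto
    then show ?thesis using False unfolding \<psi>_def shift by (simp add: indicator_def)
  qed
  have out: "measure \<mu> {z. r < norm z} \<le> 1 / 2"
  proof -
    have "ennreal (r\<^sup>2) * emeasure \<mu> {z. r < norm z} = (\<integral>\<^sup>+z. ennreal (r\<^sup>2) * indicator {z. r < norm z} z \<partial>\<mu>)"
      by (simp add: nn_integral_cmult_indicator)
    also have "\<dots> \<le> (\<integral>\<^sup>+z. ennreal ((norm z)\<^sup>2) \<partial>\<mu>)"
      using r by (intro nn_integral_mono) (auto simp: indicator_def intro!: ennreal_leI power_mono)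
    also have "\<dots> \<le> ennreal (r\<^sup>2 / 2)" by (rule mom)
    finally have "ennreal (r\<^sup>2 * measure \<mu> {z. r < norm z}) \<le> ennreal (r\<^sup>2 / 2)"
      by (simp add: emeasure_eq_measure ennreal_mult')
    then have "r\<^sup>2 * measure \<mu> {z. r < norm z} \<le> r\<^sup>2 * (1 / 2)" by (simp add: ennreal_le_iff)
    then have "measure \<mu> {z. r < norm z} \<le> 1 / 2" using r by (simp only: mult_le_cancel_left_pos zero_less_power)
    then show ?thesis .
  qed
  have "cball 0 r = UNIV - {z::'a \<times> 'a. r < norm z}" by auto
  then have "measure \<mu> (cball 0 r) = 1 - measure \<mu> {z. r < norm z}"
    using prob_compl[of "{z. r < norm z}"] by (simp add: sp)
  then have half: "1 / 2 \<le> measure \<mu> (cball 0 r)" using out by simp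
  have i: "integrable \<mu> \<psi>" by (rule borel_law_integrable[OF \<mu> \<psi>m, of 1]) (use \<psi>01 in \<open>auto simp: abs_le_iff intro: order_trans\<close>)
  have i': "integrable \<mu> (\<lambda>z. \<psi> (z + \<delta>))" by (rule borel_law_integrable[OF \<mu>, of _ 1]) (use \<psi>01 in \<open>auto simp: abs_le_iff intro: order_trans\<close>)
  have ic: "integrable \<mu> (\<lambda>z. n / D * indicator (cball 0 r) z)"
    by (intro integrable_mult_right borel_law_integrable[OF \<mu>, of _ 1]) auto
  have "n / (4 * (r + n)) = n / D * (1 / 2)" by (simp add: D_def)
  also have "\<dots> \<le> n / D * measure \<mu> (cball 0 r)" using half n D by (intro mult_left_mono) auto
  also have "\<dots> = (\<integral>z. n / D * indicator (cball 0 r) z \<partial>\<mu>)" by (simp add: sp)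
  also have "\<dots> \<le> (\<integral>z. \<psi> (z + \<delta>) - \<psi> z \<partial>\<mu>)"
    by (rule integral_mono) (use i i' ic inc in auto)
  also have "\<dots> = (\<integral>z. \<psi> z \<partial>bind \<mu> (translation \<delta>)) - (\<integral>z. \<psi> z \<partial>\<mu>)"
    using i i' by (subst integral_translation[OF \<mu> \<psi>m, of 1]) (use \<psi>01 in \<open>auto simp: abs_le_iff intro: order_trans\<close>)
  also have "\<dots> \<le> tv_dist \<mu> (bind \<mu> (translation \<delta>))"
    using integral_diff_le_tv_dist[OF \<mu> borel_law_bind[OF \<mu> translation_kernel] \<psi>m \<psi>01, of \<delta>] by linarith
  finally show ?thesis by (simp add: n_def)
qed

subsection \<open>The linear chain\<close>

lemma heavy_ball_linear: "heavy_ball \<beta> s (\<lambda>x. l *\<^sub>R x) = companion (1 + \<beta> - s * l) \<beta>"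
  by (rule ext) (simp add: heavy_ball_def companion_def algebra_simps)

lemma kernel_nn_noisy_heavy_ball:
  assumes "borel_law \<nu>" "G \<in> borel_measurable borel" "\<phi> \<in> borel_measurable borel"
  shows "kernel_nn (noisy_heavy_ball \<beta> s G e f \<nu>) \<phi> z
    = (\<integral>\<^sup>+N. \<phi> (heavy_ball \<beta> s G z + (e *\<^sub>R N, f *\<^sub>R N)) \<partial>\<nu>)"
  unfolding kernel_nn_def by (rule nn_integral_noisy_heavy_ball[OF assms])

lemma kernel_apply_noisy_heavy_ball:
  assumes "borel_law \<nu>" and [measurable]: "G \<in> borel_measurable borel" "\<phi> \<in> borel_measurable borel"
  shows "kernel_apply (noisy_heavy_ball \<beta> s G e f \<nu>) \<phi> z
    = (\<integral>N. \<phi> (heavy_ball \<beta> s G z + (e *\<^sub>R N, f *\<^sub>R N)) \<partial>\<nu>)"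
  unfolding kernel_apply_def noisy_heavy_ball_def
  using borel_lawD(2)[OF assms(1)] by (intro integral_distr) (auto cong: measurable_cong_sets)

context
  fixes \<nu> :: "'a::euclidean_space measure" and \<beta> s l e m :: real
  assumes \<nu>: "smooth_noise \<nu>" and e: "0 < e" and s: "0 \<le> s" and \<beta>: "0 < \<beta>" "\<beta> < 1"
    and T: "\<bar>1 + \<beta> - s * l\<bar> < 1 + \<beta>" and m: "0 \<le> m" "(1 - m) * (1 - \<beta> * m) \<ge> 0"
begin

private abbreviation (input) "S \<equiv> noisy_heavy_ball \<beta> s (\<lambda>x. l *\<^sub>R x) e (- m * e) \<nu>"
private abbreviation (input) "T \<equiv> 1 + \<beta> - s * l"
private abbreviation (input) "M \<equiv> companion T \<beta> :: 'a \<times> 'a \<Rightarrow> 'a \<times> 'a"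

private lemma G: "(\<lambda>x::'a. l *\<^sub>R x) \<in> borel_measurable borel" by measurable

lemma linear_chain_kernel: "markov_kernel S"
  by (rule noisy_heavy_ball_kernel[OF smooth_noise.law[OF \<nu>] G])

text \<open>Translating the initial state translates the whole trajectory of the linear chain, with the same noise,
  by the noiseless trajectory of \<open>w\<close>.\<close>

lemma linear_chain_translation:
  assumes \<mu>: "borel_law \<mu>"
  shows "iterate_kernel S (bind \<mu> (translation w)) n = bind (iterate_kernel S \<mu> n) (translation ((M ^^ n) w))"
proof (induction n)
  case (Suc n)
  let ?\<mu> = "iterate_kernel S \<mu> n" and ?w = "(M ^^ n) w"
  have l: "borel_law ?\<mu>" by (rule borel_law_iterate[OF \<mu> linear_chain_kernel])
  note t = translation_kernel
  have eq: "translation ?w \<rhd> S = S \<rhd> translation (M ?w)"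
  proof (rule kernel_eqI)
    fix \<phi> :: "'a \<times> 'a \<Rightarrow> ennreal" and z
    assume \<phi> [measurable]: "\<phi> \<in> borel_measurable borel"
    have p: "(\<lambda>z. \<phi> (z + M ?w)) \<in> borel_measurable borel" by measurable
    have "kernel_nn (translation ?w \<rhd> S) \<phi> z = (\<integral>\<^sup>+N. \<phi> (M (z + ?w) + (e *\<^sub>R N, (- m * e) *\<^sub>R N)) \<partial>\<nu>)"
      unfolding kernel_nn_then[OF t linear_chain_kernel \<phi>]
        kernel_nn_translation[OF kernel_nn_measurable[OF linear_chain_kernel \<phi>]]
        kernel_nn_noisy_heavy_ball[OF smooth_noise.law[OF \<nu>] G \<phi>] heavy_ball_linear ..
    also have "\<dots> = kernel_nn (S \<rhd> translation (M ?w)) \<phi> z"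
      unfolding kernel_nn_then[OF linear_chain_kernel t \<phi>] kernel_nn_translation[OF \<phi>, abs_def]
        kernel_nn_noisy_heavy_ball[OF smooth_noise.law[OF \<nu>] G p] heavy_ball_linear
      by (simp add: linear_add[OF companion_linear] add_ac)
    finally show "kernel_nn (translation ?w \<rhd> S) \<phi> z = kernel_nn (S \<rhd> translation (M ?w)) \<phi> z" .
  qed (intro markov_kernel_then t linear_chain_kernel)+
  have "iterate_kernel S (bind \<mu> (translation w)) (Suc n) = bind (bind ?\<mu> (translation ?w)) S" by (simp only: iterate_kernel_Suc Suc)
  also have "\<dots> = bind ?\<mu> (translation ?w \<rhd> S)" by (rule bind_kernel_then[OF l t linear_chain_kernel, symmetric])
  also have "\<dots> = bind (bind ?\<mu> S) (translation (M ?w))" unfolding eq by (rule bind_kernel_then[OF l linear_chain_kernel t])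
  finally show ?case by simp
qed simp

text \<open>Two noise vectors reach every direction: \<open>\<delta>\<close> is the image of a pair of noise translations, of
  size comparable to \<open>\<delta>\<close>, because the determinant \<open>1 + m T + \<beta> m\<^sup>2\<close> does not vanish. Hence two steps
  blur every translation.\<close>

lemma two_step_blurs_translation:
  obtains C where "0 \<le> C" "\<And>\<mu> \<delta>. borel_law \<mu> \<Longrightarrow>
    tv_dist (bind (bind \<mu> S) S) (bind (bind (bind \<mu> S) S) (translation \<delta>)) \<le> C * norm \<delta>"
proof -
  interpret smooth_noise \<nu> by (rule \<nu>)
  obtain C where C: "0 \<le> C" "\<And>\<phi> c. \<phi> \<in> borel_measurable borel \<Longrightarrow> (\<And>x. 0 \<le> \<phi> x \<and> \<phi> x \<le> (1::real)) \<Longrightarrow>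
      \<bar>(\<integral>x. \<phi> (c + x) \<partial>\<nu>) - (\<integral>x. \<phi> x \<partial>\<nu>)\<bar> \<le> C * norm c"
    using shift by blast
  define b where "b N = (e *\<^sub>R N, (- m * e) *\<^sub>R N)" for N :: 'a
  have badd: "b (x + y) = b x + b y" for x y by (simp add: b_def scaleR_add_right)
  have bm [measurable]: "b \<in> borel_measurable borel" unfolding b_def by measurable
  have Mm [measurable]: "M \<in> borel_measurable borel"
    unfolding heavy_ball_linear[symmetric] by measurable
  define \<Delta> where "\<Delta> = 1 + m * (T + \<beta> * m)"
  have \<Delta>: "0 < \<Delta>"
  proof -
    have p: "m * (1 + \<beta>) \<le> 1 + \<beta> * m\<^sup>2" using m by (simp add: power2_eq_square algebra_simps)
    show ?thesis
    proof (cases "m = 0")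
      case False
      then have "m * (- T) < m * (1 + \<beta>)" using T m by (intro mult_strict_left_mono) auto
      then show ?thesis using p by (simp add: \<Delta>_def power2_eq_square algebra_simps)
    qed (simp add: \<Delta>_def)
  qed
  define k2 where "k2 = (1 + \<bar>T + \<beta> * m\<bar>) / (e * \<Delta>)"
  define k1 where "k1 = 1 / e + m * k2"
  have k: "0 \<le> k2" "0 \<le> k1" using e \<Delta> m by (auto simp: k1_def k2_def)
  have blur: "\<bar>(\<integral>z. \<phi> (z + \<delta>) \<partial>bind (bind \<mu> S) S) - (\<integral>z. \<phi> z \<partial>bind (bind \<mu> S) S)\<bar> \<le> C * (k1 + k2) * norm \<delta>"
    if \<mu>: "borel_law \<mu>" and \<phi> [measurable]: "\<phi> \<in> borel_measurable borel"
      and \<phi>01: "\<And>x. 0 \<le> \<phi> x \<and> \<phi> x \<le> 1" for \<mu> \<delta> and \<phi> :: "'a \<times> 'a \<Rightarrow> real"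
  proof -
    obtain x y where xy: "\<delta> = (x, y)" by (cases \<delta>)
    have nxy: "norm x \<le> norm \<delta>" "norm y \<le> norm \<delta>" unfolding xy by (rule norm_fst_le norm_snd_le)+
    (* The solution of M (b c1) + b c2 = (x, y), where the second component gives c1 in terms of c2. *)
    define c2 where "c2 = (1 / (e * \<Delta>)) *\<^sub>R (x - (T + \<beta> * m) *\<^sub>R y)"
    define c1 where "c1 = (1 / e) *\<^sub>R y + m *\<^sub>R c2"
    have "norm (x - (T + \<beta> * m) *\<^sub>R y) \<le> (1 + \<bar>T + \<beta> * m\<bar>) * norm \<delta>"
    proof -
      have "norm (x - (T + \<beta> * m) *\<^sub>R y) \<le> norm x + \<bar>T + \<beta> * m\<bar> * norm y"
        using norm_triangle_ineq4[of x "(T + \<beta> * m) *\<^sub>R y"] by simp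
      also have "\<dots> \<le> norm \<delta> + \<bar>T + \<beta> * m\<bar> * norm \<delta>" using nxy by (intro add_mono mult_left_mono) auto
      finally show ?thesis by (simp add: distrib_right)
    qed
    then have n2: "norm c2 \<le> k2 * norm \<delta>"
      using e \<Delta> by (simp add: c2_def k2_def divide_right_mono)
    have "norm c1 \<le> 1 / e * norm y + m * norm c2"
      using norm_triangle_ineq[of "(1 / e) *\<^sub>R y" "m *\<^sub>R c2"] e m by (simp add: c1_def)
    also have "\<dots> \<le> 1 / e * norm \<delta> + m * (k2 * norm \<delta>)" using nxy n2 e m by (intro add_mono mult_left_mono) auto
    finally have n1: "norm c1 \<le> k1 * norm \<delta>" by (simp add: k1_def distrib_right mult.assoc)
    have hit: "M (b c1) + b c2 = \<delta>"
    proof -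
      have y: "e *\<^sub>R c1 - (m * e) *\<^sub>R c2 = y" using e by (simp add: c1_def scaleR_add_right algebra_simps)
      define t where "t = T"
      have "(t * e + \<beta> * m * e) *\<^sub>R c1 + e *\<^sub>R c2 = (t + \<beta> * m) *\<^sub>R (e *\<^sub>R c1 - (m * e) *\<^sub>R c2) + (e * \<Delta>) *\<^sub>R c2"
        unfolding \<Delta>_def t_def[symmetric] by (simp add: algebra_simps)
      also have "(e * \<Delta>) *\<^sub>R c2 = x - (t + \<beta> * m) *\<^sub>R y" using e \<Delta> by (simp add: c2_def t_def)
      finally have x: "(t * e + \<beta> * m * e) *\<^sub>R c1 + e *\<^sub>R c2 = x" by (simp add: y)
      have "M (b c1) + b c2 = ((t * e + \<beta> * m * e) *\<^sub>R c1 + e *\<^sub>R c2, e *\<^sub>R c1 - (m * e) *\<^sub>R c2)"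
        unfolding companion_def b_def t_def[symmetric] by (simp add: scaleR_add_left mult.assoc)
      then show ?thesis by (simp only: x y xy)
    qed
    define \<phi>' where "\<phi>' x = \<phi> (x + \<delta>)" for x
    have \<phi>'m [measurable]: "\<phi>' \<in> borel_measurable borel" unfolding \<phi>'_def by measurable
    have \<phi>'01: "0 \<le> \<phi>' x \<and> \<phi>' x \<le> 1" for x using \<phi>01 by (simp add: \<phi>'_def)
    note Sk = linear_chain_kernel
    have ka: "kernel_apply S F x = (\<integral>N. F (M x + b N) \<partial>\<nu>)" if "F \<in> borel_measurable borel" for F x
      unfolding kernel_apply_noisy_heavy_ball[OF law G that] heavy_ball_linear b_def ..
    have sh: "\<bar>(\<integral>N. F (p + b (c + N)) \<partial>\<nu>) - (\<integral>N. F (p + b N) \<partial>\<nu>)\<bar> \<le> C * norm c"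
      if F [measurable]: "F \<in> borel_measurable borel" and "\<And>x. 0 \<le> F x \<and> F x \<le> (1::real)" for F p c
      by (rule C(2)[of "\<lambda>N. F (p + b N)"]) (use that(2) in auto)
    define A A' where "A = kernel_apply S \<phi>" and "A' = kernel_apply S \<phi>'"
    have Am [measurable]: "A \<in> borel_measurable borel" "A' \<in> borel_measurable borel"
      unfolding A_def A'_def using Sk by measurable
    have A01: "0 \<le> A x \<and> A x \<le> 1" "0 \<le> A' x \<and> A' x \<le> 1" for x
      unfolding A_def A'_def using kernel_apply_bounds[OF Sk \<phi>, of 0 1] kernel_apply_bounds[OF Sk \<phi>'m, of 0 1] \<phi>01 \<phi>'01 by auto
    have inner_step: "\<bar>A' x - A (x + b c1)\<bar> \<le> C * norm c2" for x
    proof -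
      have "A' x = (\<integral>N. \<phi> (M (x + b c1) + b (c2 + N)) \<partial>\<nu>)"
        unfolding A'_def ka[OF \<phi>'m] \<phi>'_def by (simp add: hit[symmetric] badd linear_add[OF companion_linear] add_ac)
      moreover have "A (x + b c1) = (\<integral>N. \<phi> (M (x + b c1) + b N) \<partial>\<nu>)" unfolding A_def by (rule ka[OF \<phi>])
      ultimately show ?thesis using sh[OF \<phi> \<phi>01] by simp
    qed
    have outer_step: "\<bar>kernel_apply S A' z - kernel_apply S A z\<bar> \<le> C * (k1 + k2) * norm \<delta>" for z
    proof -
      have sm [measurable]: "(\<lambda>x. A (x + b c1)) \<in> borel_measurable borel" by measurable
      have "\<bar>kernel_apply S A' z - kernel_apply S (\<lambda>x. A (x + b c1)) z\<bar> \<le> C * norm c2"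
        unfolding kernel_apply_def
        by (rule borel_law_integral_diff_le[OF markov_kernel_law[OF Sk] Am(2) sm, of 1])
          (use A01 inner_step in \<open>auto simp: abs_le_iff intro: order_trans\<close>)
      moreover have "\<bar>kernel_apply S (\<lambda>x. A (x + b c1)) z - kernel_apply S A z\<bar> \<le> C * norm c1"
        unfolding ka[OF sm] ka[OF Am(1)] using sh[OF Am(1) A01(1), of "M z" c1] by (simp add: badd add_ac)
      ultimately have "\<bar>kernel_apply S A' z - kernel_apply S A z\<bar> \<le> C * (norm c1 + norm c2)"
        by (simp add: distrib_left)
      also have "\<dots> \<le> C * (k1 * norm \<delta> + k2 * norm \<delta>)" using n1 n2 C(1) by (intro mult_left_mono add_mono) auto
      finally show ?thesis by (simp add: algebra_simps)
    qed
    have two: "(\<integral>z. F z \<partial>bind (bind \<mu> S) S) = (\<integral>z. kernel_apply S (kernel_apply S F) z \<partial>\<mu>)"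
      if F: "F \<in> borel_measurable borel" and F01: "\<And>x. 0 \<le> F x \<and> F x \<le> 1" for F
    proof -
      have m: "kernel_apply S F \<in> borel_measurable borel" using F Sk by measurable
      have b: "\<bar>kernel_apply S F x\<bar> \<le> 1" "\<bar>F x\<bar> \<le> 1" for x
        using kernel_apply_bounds[OF Sk F, of 0 1] F01 by (auto simp: abs_le_iff intro: order_trans)
      show ?thesis
        using integral_bind_kernel[OF borel_law_bind[OF \<mu> Sk] Sk F b(2)] integral_bind_kernel[OF \<mu> Sk m b(1)] by (rule trans)
    qed
    have b1: "\<bar>kernel_apply S F x\<bar> \<le> 1" if "F \<in> borel_measurable borel" "\<And>x. 0 \<le> F x \<and> F x \<le> 1" for F x
      using kernel_apply_bounds[OF Sk that(1), of 0 1] that(2) by (auto simp: abs_le_iff intro: order_trans)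
    have "\<bar>(\<integral>z. kernel_apply S A' z \<partial>\<mu>) - (\<integral>z. kernel_apply S A z \<partial>\<mu>)\<bar> \<le> C * (k1 + k2) * norm \<delta>"
      by (rule borel_law_integral_diff_le[OF \<mu> _ _ b1 b1 outer_step]) (use Am A01 Sk in measurable)
    then show ?thesis using two[OF \<phi>'m \<phi>'01] two[OF \<phi> \<phi>01] by (simp add: A_def A'_def \<phi>'_def[abs_def])
  qed
  show thesis
  proof (rule that)
    show "0 \<le> C * (k1 + k2)" using C(1) k by simp
    fix \<mu> :: "('a \<times> 'a) measure" and \<delta> :: "'a \<times> 'a" assume \<mu>: "borel_law \<mu>"
    let ?\<mu> = "bind (bind \<mu> S) S"
    have l: "borel_law ?\<mu>" by (intro borel_law_bind \<mu> linear_chain_kernel)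
    show "tv_dist ?\<mu> (bind ?\<mu> (translation \<delta>)) \<le> C * (k1 + k2) * norm \<delta>"
    proof (rule tv_dist_le[OF l])
      fix A :: "('a \<times> 'a) set" assume A: "A \<in> sets borel"
      have "measure (bind ?\<mu> (translation \<delta>)) A = (\<integral>z. indicator A (z + \<delta>) \<partial>?\<mu>)"
        unfolding measure_eq_integral_indicator[OF borel_law_bind[OF l translation_kernel] A]
        by (rule integral_translation[OF l, of _ 1]) (use A in auto)
      moreover have "measure ?\<mu> A = (\<integral>z. indicator A z \<partial>?\<mu>)" by (rule measure_eq_integral_indicator[OF l A])
      moreover have "\<bar>(\<integral>z. indicator A (z + \<delta>) \<partial>?\<mu>) - (\<integral>z. indicator A z \<partial>?\<mu>)\<bar> \<le> C * (k1 + k2) * norm \<delta>"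
        by (rule blur[OF \<mu>]) (use A in auto)
      ultimately show "\<bar>measure ?\<mu> A - measure (bind ?\<mu> (translation \<delta>)) A\<bar> \<le> C * (k1 + k2) * norm \<delta>"
        by (simp only: abs_minus_commute)
    qed
  qed
qed

text \<open>The distance between the chains started from a law and from its translate along the mode \<open>w\<close> is
  therefore, up to constants, the length of the mode.\<close>

lemma linear_chain_tv_rate:
  fixes \<mu> :: "('a \<times> 'a) measure"
  assumes \<mu>: "borel_law \<mu>" and mom: "(\<integral>\<^sup>+z. ennreal ((norm z)\<^sup>2) \<partial>\<mu>) \<le> ennreal Q"
  obtains c C w where "0 < c" "0 < C"
    "\<And>n. c * companion_radius T \<beta> ^ n \<le> tv_dist (iterate_kernel S \<mu> n) (iterate_kernel S (bind \<mu> (translation w)) n)"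
    "\<And>n. tv_dist (iterate_kernel S \<mu> (n + 2)) (iterate_kernel S (bind \<mu> (translation w)) (n + 2)) \<le> C * companion_radius T \<beta> ^ (n + 2)"
proof -
  note Sk = linear_chain_kernel
  obtain w :: "'a \<times> 'a" and c C where w: "0 < c" "0 < C"
    "\<And>n. c * companion_radius T \<beta> ^ n \<le> norm ((M ^^ n) w)" "\<And>n. norm ((M ^^ n) w) \<le> C * companion_radius T \<beta> ^ n"
    by (rule companion_mode[OF \<beta>(1), where T="1 + \<beta> - s * l" and 'a='a]) blast
  obtain J :: "'a \<times> 'a \<Rightarrow> 'a \<times> 'a" and r j k where J: "bounded_linear J" "0 < r" "r < 1" "0 < j" "0 < k"
    "\<And>z. j * norm z \<le> norm (J z)" "\<And>z. norm (J z) \<le> k * norm z"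
    "\<And>a b. norm (J (T *\<^sub>R a - \<beta> *\<^sub>R b, a)) \<le> r * norm (J (a, b))"
    by (rule companion_contraction[OF \<beta> T, where 'a='a]) blast
  obtain D where D: "0 < D" "\<And>z. (\<integral>\<^sup>+w. ennreal ((norm (J w))\<^sup>2) \<partial>S z) \<le> ennreal (r * (norm (J z))\<^sup>2 + D)"
  proof -
    obtain D where "0 < D" "\<And>G g B z. G \<in> borel_measurable borel \<Longrightarrow> 0 \<le> B \<Longrightarrow>
      (\<And>x. G x = l *\<^sub>R x + g x) \<Longrightarrow> (\<And>x. norm (g x) \<le> B) \<Longrightarrow>
      (\<integral>\<^sup>+w. ennreal ((norm (J w))\<^sup>2) \<partial>noisy_heavy_ball \<beta> s G e (- m * e) \<nu> z) \<le> ennreal (r * (norm (J z))\<^sup>2 + D * (1 + B\<^sup>2))"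
      by (rule heavy_ball_drift[OF \<nu> J(1,2,3,5,7), of \<beta> s l e "- m * e"]) (use J(8) s in auto)
    from this(1) this(2)[OF G, of 0 "\<lambda>_. 0"] show thesis by (intro that) auto
  qed
  have Jm [measurable]: "J \<in> borel_measurable borel"
    using linear_continuous_on[OF J(1)] by (rule borel_measurable_continuous_onI)
  define E where "E = max (k\<^sup>2 * \<bar>Q\<bar>) (D / (1 - r))"
  have E0: "0 \<le> E" using D J by (simp add: E_def le_max_iff_disj)
  have "(\<integral>\<^sup>+z. ennreal ((norm (J z))\<^sup>2) \<partial>\<mu>) \<le> (\<integral>\<^sup>+z. ennreal (k\<^sup>2) * ennreal ((norm z)\<^sup>2) \<partial>\<mu>)"
  proof (rule nn_integral_mono)
    fix z
    have "(norm (J z))\<^sup>2 \<le> (k * norm z)\<^sup>2" using J(7) by (intro power_mono) auto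
    then show "ennreal ((norm (J z))\<^sup>2) \<le> ennreal (k\<^sup>2) * ennreal ((norm z)\<^sup>2)"
      by (simp add: power_mult_distrib ennreal_leI flip: ennreal_mult)
  qed
  also have "\<dots> = ennreal (k\<^sup>2) * (\<integral>\<^sup>+z. ennreal ((norm z)\<^sup>2) \<partial>\<mu>)"
    using borel_lawD(2)[OF \<mu>] by (intro nn_integral_cmult) (auto cong: measurable_cong_sets)
  also have "\<dots> \<le> ennreal (k\<^sup>2) * ennreal \<bar>Q\<bar>"
    using mom by (intro mult_left_mono order_trans[OF mom] ennreal_leI) auto
  also have "\<dots> \<le> ennreal E" by (simp add: E_def ennreal_leI flip: ennreal_mult)
  finally have E: "(\<integral>\<^sup>+z. ennreal ((norm (J z))\<^sup>2) \<partial>iterate_kernel S \<mu> n) \<le> ennreal E" for n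
    by (intro drift_iterate_law[OF Sk _ _ _ _ _ D(2) \<mu>]) (use J D in \<open>auto simp: E_def\<close>)
  define R where "R = sqrt (2 * (E / j\<^sup>2) + 1)"
  have p: "0 < 2 * (E / j\<^sup>2) + 1" using E0 J by (simp add: add_nonneg_pos)
  have "R\<^sup>2 = 2 * (E / j\<^sup>2) + 1" unfolding R_def by (rule real_sqrt_pow2) (use p in linarith)
  moreover have "0 < R" unfolding R_def using p by (rule real_sqrt_gt_zero)
  ultimately have R: "0 < R" "E / j\<^sup>2 \<le> R\<^sup>2 / 2" by linarith+
  define \<mu>n where "\<mu>n n = iterate_kernel S \<mu> n" for n
  have l: "borel_law (\<mu>n n)" for n unfolding \<mu>n_def by (rule borel_law_iterate[OF \<mu> Sk])
  have mom': "(\<integral>\<^sup>+z. ennreal ((norm z)\<^sup>2) \<partial>\<mu>n n) \<le> ennreal (R\<^sup>2 / 2)" for n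
  proof -
    have "(\<integral>\<^sup>+z. ennreal ((norm z)\<^sup>2) \<partial>\<mu>n n) \<le> (\<integral>\<^sup>+z. ennreal (1 / j\<^sup>2) * ennreal ((norm (J z))\<^sup>2) \<partial>\<mu>n n)"
    proof (rule nn_integral_mono)
      fix z
      have "(j * norm z)\<^sup>2 \<le> (norm (J z))\<^sup>2" using J(4,6) by (intro power_mono) auto
      then show "ennreal ((norm z)\<^sup>2) \<le> ennreal (1 / j\<^sup>2) * ennreal ((norm (J z))\<^sup>2)"
        using J(4) by (simp add: power_mult_distrib pos_le_divide_eq mult.commute ennreal_leI flip: ennreal_mult)
    qed
    also have "\<dots> = ennreal (1 / j\<^sup>2) * (\<integral>\<^sup>+z. ennreal ((norm (J z))\<^sup>2) \<partial>\<mu>n n)"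
      using borel_lawD(2)[OF l] by (intro nn_integral_cmult) (auto cong: measurable_cong_sets)
    also have "\<dots> \<le> ennreal (1 / j\<^sup>2) * ennreal E" unfolding \<mu>n_def by (intro mult_left_mono E) auto
    also have "\<dots> \<le> ennreal (R\<^sup>2 / 2)" using R(2) E0 by (simp add: ennreal_leI flip: ennreal_mult)
    finally show ?thesis .
  qed
  define B where "B = k * norm w / j"
  have B: "norm ((M ^^ n) w) \<le> B" for n
  proof -
    have "norm (J ((M ^^ n) w)) \<le> norm (J w)"
    proof (induction n)
      case (Suc n)
      have "norm (J (M ((M ^^ n) w))) \<le> r * norm (J ((M ^^ n) w))"
        using J(8)[of "fst ((M ^^ n) w)" "snd ((M ^^ n) w)"] by (simp add: companion_def)
      also have "\<dots> \<le> norm (J ((M ^^ n) w))" using J(2,3) by (simp add: mult_left_le_one_le)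
      finally show ?case using Suc by simp
    qed simp
    then have "j * norm ((M ^^ n) w) \<le> k * norm w" using J(6)[of "(M ^^ n) w"] J(7)[of w] by linarith
    then show ?thesis using J(4) by (simp add: B_def pos_le_divide_eq mult.commute)
  qed
  have B0: "0 \<le> B" using B[of 0] norm_ge_zero order_trans by blast
  have tr: "iterate_kernel S (bind \<mu> (translation w)) n = bind (\<mu>n n) (translation ((M ^^ n) w))" for n
    unfolding \<mu>n_def by (rule linear_chain_translation[OF \<mu>])
  obtain C' where C': "0 \<le> C'" "\<And>\<mu> \<delta>. borel_law \<mu> \<Longrightarrow>
    tv_dist (bind (bind \<mu> S) S) (bind (bind (bind \<mu> S) S) (translation \<delta>)) \<le> C' * norm \<delta>"
    using two_step_blurs_translation by blast
  have \<rho>: "0 < companion_radius T \<beta>" by (rule companion_radius_pos[OF \<beta>(1)])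
  show thesis
  proof (rule that[of "c / (4 * (R + B))" "C' * C + 1" w])
    show "0 < c / (4 * (R + B))" using w R B0 by simp
    show "0 < C' * C + 1" using w C' by (simp add: add_nonneg_pos)
    fix n
    let ?d = "norm ((M ^^ n) w)"
    have "c / (4 * (R + B)) * companion_radius T \<beta> ^ n = (c * companion_radius T \<beta> ^ n) / (4 * (R + B))" by simp
    also have "\<dots> \<le> ?d / (4 * (R + B))" using R B0 w(3) by (intro divide_right_mono) auto
    also have "\<dots> \<le> ?d / (4 * (R + ?d))" using R B[of n] B0 by (intro divide_left_mono mult_pos_pos add_pos_nonneg) auto
    also have "\<dots> \<le> tv_dist (\<mu>n n) (bind (\<mu>n n) (translation ((M ^^ n) w)))"
      by (rule tv_dist_translation_ge[OF l R(1) mom'])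
    finally show "c / (4 * (R + B)) * companion_radius T \<beta> ^ n
        \<le> tv_dist (iterate_kernel S \<mu> n) (iterate_kernel S (bind \<mu> (translation w)) n)"
      unfolding tr by (simp add: \<mu>n_def)
    have "tv_dist (\<mu>n (n + 2)) (bind (\<mu>n (n + 2)) (translation ((M ^^ (n + 2)) w))) \<le> C' * norm ((M ^^ (n + 2)) w)"
      using C'(2)[OF l[of n], of "(M ^^ (n + 2)) w"] by (simp add: \<mu>n_def numeral_2_eq_2)
    also have "\<dots> \<le> C' * (C * companion_radius T \<beta> ^ (n + 2))" by (intro mult_left_mono w C')
    also have "\<dots> \<le> (C' * C + 1) * companion_radius T \<beta> ^ (n + 2)" using \<rho> by (simp add: distrib_right mult.assoc)
    finally show "tv_dist (iterate_kernel S \<mu> (n + 2)) (iterate_kernel S (bind \<mu> (translation w)) (n + 2))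
        \<le> (C' * C + 1) * companion_radius T \<beta> ^ (n + 2)"
      unfolding tr by (simp add: \<mu>n_def)
  qed
qed

end

lemma grad_quadratic_potential: "grad (quadratic_potential l) = (\<lambda>x::'a::euclidean_space. l *\<^sub>R x)"
proof
  fix x :: 'a
  have "GDERIV (quadratic_potential l) x :> l *\<^sub>R x"
    unfolding gderiv_def quadratic_potential_def[abs_def] power2_norm_eq_inner
    by (auto intro!: derivative_eq_intros simp: fun_eq_iff inner_commute)
  then show "grad (quadratic_potential l) x = l *\<^sub>R x" by (rule grad_eqI)
qed

text \<open>Up to its first and last part, the chain of the splitting is the linear chain, and these parts do not
  increase total variation; so the distances along the two chains differ by an index shift only. The initial
  states are \<open>0\<close> and one whose image under the first part is the mode \<open>w\<close>.\<close>

theorem quadratic_tv_rate: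
  fixes S :: splitting
  assumes h: "0 < h" and \<gamma>: "0 < \<gamma>" and \<beta>: "\<beta> = exp (- \<gamma> * h)" and s: "s = s_param S h \<beta>"
    and l: "0 < s * l" "s * l < 2 * (1 + \<beta>)"
  defines "Q \<equiv> splitting_kernel S (quadratic_potential l :: 'a::euclidean_space \<Rightarrow> real) h \<gamma>"
  obtains z z' where "(\<lambda>n. root n (tv_dist (law_at Q z n) (law_at Q z' n))) \<longlonglongrightarrow> companion_radius (1 + \<beta> - s * l) \<beta>"
proof -
  let ?U = "quadratic_potential l :: 'a \<Rightarrow> real"
  define G where "G = (\<lambda>x::'a. l *\<^sub>R x)"
  have gU: "grad ?U = G" unfolding G_def by (rule grad_quadratic_potential)
  have Gm: "grad ?U \<in> borel_measurable borel" unfolding gU G_def by measurable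
  note b = beta_bounds[OF Gm h \<gamma> \<beta>]
  define L where "L = pre_kernel S ?U h \<gamma>"
  define K where "K = post_kernel S ?U h \<gamma>"
  have Lk: "markov_kernel L" unfolding L_def by (rule pre_kernel_markov[OF Gm h \<gamma> \<beta>])
  have Kk: "markov_kernel K" unfolding K_def by (rule post_kernel_markov[OF Gm h \<gamma> \<beta>])
  have Q: "Q = L \<rhd> K" unfolding Q_def L_def K_def by (rule splitting_eq_pre_post[OF Gm h \<gamma> \<beta>])
  define m where "m = noise_memory S \<beta>"
  define \<nu> where "\<nu> = (step_noise S \<beta> :: 'a measure)"
  define P where "P = noisy_heavy_ball \<beta> s (\<lambda>x. l *\<^sub>R x) (noise_gain S h) (- m * noise_gain S h) \<nu>"
  have KL: "K \<rhd> L = P"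
    unfolding K_def L_def P_def m_def \<nu>_def s using post_pre_eq_heavy_ball[OF Gm h \<gamma> \<beta>] by (simp add: gU G_def)
  have \<nu>: "smooth_noise \<nu>" unfolding \<nu>_def
    using b by (cases S) (auto intro!: smooth_noise_gauss_mix simp: power_less_one_iff)
  have e: "0 < noise_gain S h" using h by (cases S) auto
  have s0: "0 \<le> s" unfolding s using b by (cases S) auto
  have m: "0 \<le> m" "0 \<le> (1 - m) * (1 - \<beta> * m)" unfolding m_def using b by (cases S; simp)+
  have T: "\<bar>1 + \<beta> - s * l\<bar> < 1 + \<beta>" unfolding abs_less_iff using l by auto
  note chain = \<nu> e s0 b T m
  obtain M2 where M2: "0 \<le> M2" "(\<integral>\<^sup>+x. ennreal ((norm x)\<^sup>2) \<partial>(std_gaussian :: 'a measure)) \<le> ennreal M2"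
    by (rule std_gaussian_second_moment)
  define g where "g = (\<lambda>\<xi>::'a. (fst (pre_gain S h \<beta>) *\<^sub>R \<xi>, snd (pre_gain S h \<beta>) *\<^sub>R \<xi>))"
  have gm [measurable]: "g \<in> borel_measurable borel" unfolding g_def by measurable
  have L: "L z = distr std_gaussian borel (\<lambda>\<xi>. pre_map S G h \<beta> z + g \<xi>)" for z
    unfolding L_def g_def using pre_kernel_affine[OF Gm h \<gamma> \<beta>] by (simp add: gU)
  have p0: "pre_map S G h \<beta> 0 = 0"
    using pre_map_linear[of S l h \<beta> 0 0] by (simp add: G_def)
  have mom: "(\<integral>\<^sup>+z. ennreal ((norm z)\<^sup>2) \<partial>L 0) \<le> ennreal (((fst (pre_gain S h \<beta>))\<^sup>2 + (snd (pre_gain S h \<beta>))\<^sup>2) * M2)"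
    (is "_ \<le> ennreal (?c * M2)")
  proof -
    have "(\<integral>\<^sup>+z. ennreal ((norm z)\<^sup>2) \<partial>L 0) = (\<integral>\<^sup>+\<xi>. ennreal ((norm (g \<xi>))\<^sup>2) \<partial>std_gaussian)"
      unfolding L p0 by (simp add: nn_integral_distr)
    also have "\<dots> = (\<integral>\<^sup>+\<xi>. ennreal ?c * ennreal ((norm \<xi>)\<^sup>2) \<partial>(std_gaussian :: 'a measure))"
      by (rule nn_integral_cong) (simp add: norm_Pair_power2 g_def power_mult_distrib distrib_right flip: ennreal_mult)
    also have "\<dots> = ennreal ?c * (\<integral>\<^sup>+\<xi>. ennreal ((norm \<xi>)\<^sup>2) \<partial>(std_gaussian :: 'a measure))"
      by (rule nn_integral_cmult) measurable
    also have "\<dots> \<le> ennreal ?c * ennreal M2" by (intro mult_left_mono M2) auto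
    finally show ?thesis using M2 by (simp add: ennreal_mult)
  qed
  let ?\<rho> = "companion_radius (1 + \<beta> - s * l) \<beta>"
  obtain c C w where w: "0 < c" "0 < C"
    "\<And>n. c * ?\<rho> ^ n \<le> tv_dist (iterate_kernel P (L 0) n) (iterate_kernel P (bind (L 0) (translation w)) n)"
    "\<And>n. tv_dist (iterate_kernel P (L 0) (n + 2)) (iterate_kernel P (bind (L 0) (translation w)) (n + 2)) \<le> C * ?\<rho> ^ (n + 2)"
  proof -
    note rate = linear_chain_tv_rate[OF chain markov_kernel_law[OF Lk] mom, folded P_def]
    show thesis by (rule rate) (rule that)
  qed
  obtain z where z: "pre_map S G h \<beta> z = w"
  proof -
    obtain C where "\<And>(G::'a \<Rightarrow> 'a) a b. \<exists>z. pre_map S G h \<beta> z = (a, b) \<and> norm z \<le> C * (norm a + norm b + norm (G b))"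
      by (rule pre_map_surj[OF h b(1), where 'a='a]) blast
    from this[of G "fst w" "snd w"] show thesis using that by auto
  qed
  have Lz: "L z = bind (L 0) (translation w)"
  proof -
    have "bind (L 0) (translation w) = distr (L 0) borel (\<lambda>x. x + w)"
      unfolding translation_def by (rule bind_return_distr') (auto simp: L)
    also have "\<dots> = L z" unfolding L p0 z by (simp add: distr_distr comp_def add.commute)
    finally show ?thesis ..
  qed
  define t where "t n = tv_dist (iterate_kernel P (L 0) n) (iterate_kernel P (L z) n)" for n
  note t = w(3,4)[folded Lz, folded t_def]
  define q where "q n = tv_dist (law_at Q 0 n) (law_at Q z n)" for n
  have lq: "borel_law (law_at Q x n)" for x n
    unfolding law_at_eq Q by (intro borel_law_iterate borel_law_return markov_kernel_then Lk Kk)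
  have swap: "bind (law_at Q x n) L = iterate_kernel P (L x) n" for x n
    unfolding law_at_eq Q iterate_swap[OF borel_law_return Lk Kk] KL bind_return_kernel[OF Lk] ..
  have swap': "law_at Q x (Suc n) = bind (iterate_kernel P (L x) n) K" for x n
    unfolding law_at_eq Q iterate_swap_Suc[OF borel_law_return Lk Kk] KL bind_return_kernel[OF Lk] ..
  have lt: "borel_law (iterate_kernel P (L x) n)" for x n
    unfolding KL[symmetric] by (intro borel_law_iterate markov_kernel_law[OF Lk] markov_kernel_then Lk Kk)
  have lo: "t n \<le> q n" for n
    unfolding t_def q_def swap[symmetric] by (rule tv_dist_bind_le[OF lq lq Lk])
  have hi: "q (Suc n) \<le> t n" for n
    unfolding t_def q_def swap' by (rule tv_dist_bind_le[OF lt lt Kk])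
  have \<rho>: "0 < ?\<rho>" by (rule companion_radius_pos[OF b(1)])
  have "(\<lambda>n. root n (q n)) \<longlonglongrightarrow> ?\<rho>"
  proof (rule root_limit[of c "C / ?\<rho>" ?\<rho> 3])
    show "c * ?\<rho> ^ n \<le> q n" for n using t(1)[of n] lo[of n] by linarith
    show "q n \<le> C / ?\<rho> * ?\<rho> ^ n" if n: "n \<ge> 3" for n
    proof -
      obtain j where j: "n = Suc (j + 2)" using n by (metis add.commute le_Suc_ex numeral_3_eq_3 plus_nat.simps(2) numeral_2_eq_2)
      have "q n \<le> C * ?\<rho> ^ (j + 2)" unfolding j using hi[of "j + 2"] t(2)[of j] by linarith
      also have "\<dots> = C / ?\<rho> * ?\<rho> ^ n" unfolding j using \<rho> by simp
      finally show ?thesis .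
    qed
  qed (use w \<rho> in auto)
  then show thesis using that[of 0 z] by (simp add: q_def)
qed

section \<open>Metastability around a cycle\<close>

lemma ennreal_sqrt_le:
  assumes "x \<le> ennreal (C\<^sup>2)" "0 \<le> C"
  shows "ennreal_sqrt x \<le> ennreal C"
proof -
  obtain y where y: "x = ennreal y" "0 \<le> y" using assms(1) by (cases x) (auto simp: top_unique)
  then have "y \<le> C\<^sup>2" using assms(1) by (simp add: ennreal_le_iff)
  then have "sqrt y \<le> C" using assms(2) by (simp add: real_le_lsqrt)
  then show ?thesis unfolding ennreal_sqrt_def y(1) using y(2) by (auto intro: ennreal_leI)
qed

text \<open>The product coupling is the only coupling with a Dirac mass; its cost is the second moment around the
  point.\<close>

lemma W2_return_le:
  fixes z :: "'a::euclidean_space \<times> 'a"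
  assumes \<pi>: "borel_law \<pi>" and C: "0 \<le> C" and le: "(\<integral>\<^sup>+w. ennreal ((dist z w)\<^sup>2) \<partial>\<pi>) \<le> ennreal (C\<^sup>2)"
  shows "W2 (return borel z) \<pi> \<le> ennreal C"
proof -
  interpret prob_space \<pi> using \<pi> by (rule borel_lawD)
  note s [measurable_cong] = borel_lawD(2)[OF \<pi>]
  let ?N = "return borel z \<Otimes>\<^sub>M \<pi>"
  define \<pi>0 where "\<pi>0 = distr \<pi> ?N (\<lambda>w. (z, w))"
  have m [measurable]: "(\<lambda>w. (z, w)) \<in> \<pi> \<rightarrow>\<^sub>M ?N" by measurable
  have "prob_space \<pi>0" unfolding \<pi>0_def by (rule prob_space_distr) measurable
  then have 1: "\<pi>0 \<in> space (prob_algebra ?N)" by (simp add: space_prob_algebra \<pi>0_def)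
  have 2: "distr \<pi>0 (return borel z) fst = return borel z"
  proof -
    have "distr \<pi>0 (return borel z) fst = distr \<pi> (return borel z) (\<lambda>w. z)"
      unfolding \<pi>0_def distr_distr[OF measurable_fst m] by (simp add: comp_def)
    also have "\<dots> = return borel z"
    proof (rule measure_eqI)
      fix A assume "A \<in> sets (distr \<pi> (return borel z) (\<lambda>w. z))"
      then have A: "A \<in> sets borel" by simp
      show "emeasure (distr \<pi> (return borel z) (\<lambda>w. z)) A = emeasure (return borel z) A"
        using A emeasure_space_1 borel_lawD(3)[OF \<pi>] by (subst emeasure_distr) (auto simp: indicator_def vimage_def)
    qed simp
    finally show ?thesis .
  qed
  have 3: "distr \<pi>0 \<pi> snd = \<pi>"
    unfolding \<pi>0_def by (subst distr_distr) (auto simp: comp_def distr_id2)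
  have "\<pi>0 \<in> couplings (return borel z) \<pi>" unfolding couplings_def using 1 2 3 by simp
  then have "W2 (return borel z) \<pi> \<le> ennreal_sqrt (\<integral>\<^sup>+ (z, w). ennreal ((dist z w)\<^sup>2) \<partial>\<pi>0)"
    unfolding W2_def by (rule INF_lower)
  also have "(\<integral>\<^sup>+ (z, w). ennreal ((dist z w)\<^sup>2) \<partial>\<pi>0) = (\<integral>\<^sup>+w. ennreal ((dist z w)\<^sup>2) \<partial>\<pi>)"
  proof -
    have "(\<lambda>(x, w). ennreal ((dist x w)\<^sup>2)) \<in> borel_measurable (borel \<Otimes>\<^sub>M borel :: (('a \<times> 'a) \<times> ('a \<times> 'a)) measure)"
      by measurable
    then have [measurable]: "(\<lambda>(x, w). ennreal ((dist x w)\<^sup>2)) \<in> borel_measurable ?N"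
      by (simp cong: measurable_cong_sets sets_pair_measure_cong add: s)
    show ?thesis unfolding \<pi>0_def by (subst nn_integral_distr) auto
  qed
  also have "ennreal_sqrt (\<integral>\<^sup>+w. ennreal ((dist z w)\<^sup>2) \<partial>\<pi>) \<le> ennreal C" by (rule ennreal_sqrt_le[OF le C])
  finally show ?thesis .
qed

text \<open>\<open>K\<close> maps invariant laws of \<open>K \<rhd> L\<close> to invariant laws of \<open>L \<rhd> K\<close>, and \<open>L\<close> maps them back; so existence
  and uniqueness pass from the skeleton to the splitting.\<close>

lemma invariant_law_swap:
  assumes L: "markov_kernel L" and K: "markov_kernel K"
    and \<pi>: "borel_law \<pi>" "bind \<pi> (K \<rhd> L) = \<pi>"
    and unique: "\<And>\<pi>'. borel_law \<pi>' \<Longrightarrow> bind \<pi>' (K \<rhd> L) = \<pi>' \<Longrightarrow> \<pi>' = \<pi>"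
  shows "invariant_law (L \<rhd> K) (bind \<pi> K)"
    and "invariant_law (L \<rhd> K) \<pi>' \<Longrightarrow> \<pi>' = bind \<pi> K"
    and "bind (bind \<pi> K) L = \<pi>"
proof -
  note l = borel_law_bind[OF \<pi>(1) K]
  show restored: "bind (bind \<pi> K) L = \<pi>" using \<pi>(2) bind_kernel_then[OF \<pi>(1) K L] by simp
  show "invariant_law (L \<rhd> K) (bind \<pi> K)"
    unfolding invariant_law_def using l bind_kernel_then[OF l L K] restored by simp
  assume "invariant_law (L \<rhd> K) \<pi>'"
  then have \<pi>': "borel_law \<pi>'" "bind \<pi>' (L \<rhd> K) = \<pi>'" by (auto simp: invariant_law_def)
  have l': "borel_law (bind \<pi>' L)" by (rule borel_law_bind[OF \<pi>'(1) L])
  have e: "bind (bind \<pi>' L) K = \<pi>'" using \<pi>'(2) bind_kernel_then[OF \<pi>'(1) L K] by simp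
  have "bind \<pi>' L = \<pi>"
    by (rule unique[OF l']) (simp add: bind_kernel_then[OF l' K L] e)
  then show "\<pi>' = bind \<pi> K" using e by simp
qed

text \<open>If every point of \<open>W\<close> is sent into \<open>W'\<close> except for a probability \<open>\<epsilon>\<close>, the mass of \<open>W\<close>
  arrives in \<open>W'\<close> up to \<open>\<epsilon>\<close>.\<close>

lemma measure_bind_transfer:
  fixes P :: "'z::topological_space \<Rightarrow> 'z measure"
  assumes \<mu>: "borel_law \<mu>" and P: "markov_kernel P" and W: "W \<in> sets borel" "W' \<in> sets borel"
    and stay: "\<And>z. z \<in> W \<Longrightarrow> 1 - \<epsilon> \<le> measure (P z) W'" and \<epsilon>: "0 \<le> \<epsilon>"
  shows "measure \<mu> W - \<epsilon> \<le> measure (bind \<mu> P) W'"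
proof -
  interpret prob_space \<mu> using \<mu> by (rule borel_lawD)
  note borel_lawD(2)[OF \<mu>, measurable_cong]
  have ind: "(indicator A :: 'z \<Rightarrow> real) \<in> borel_measurable borel" if "A \<in> sets borel" for A using that by simp
  have app: "kernel_apply P (indicator W') z = measure (P z) W'" for z
    unfolding kernel_apply_def by (rule measure_eq_integral_indicator[OF markov_kernel_law[OF P] W(2), symmetric])
  have i: "integrable \<mu> (indicator W :: 'z \<Rightarrow> real)" by (rule borel_law_integrable[OF \<mu> ind[OF W(1)], of 1]) (simp add: indicator_def)
  have m: "kernel_apply P (indicator W') \<in> borel_measurable borel" by (rule kernel_apply_measurable[OF P ind[OF W(2)]])
  have i': "integrable \<mu> (kernel_apply P (indicator W'))"
    by (rule borel_law_integrable[OF \<mu> m, of 1]) (use prob_space.prob_le_1[OF borel_lawD(1)[OF markov_kernel_law[OF P]]] in \<open>simp add: app\<close>)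
  have "measure \<mu> W - \<epsilon> = (\<integral>z. indicator W z - \<epsilon> \<partial>\<mu>)"
    using i W(1) prob_space borel_lawD(3)[OF \<mu>] by simp
  also have "\<dots> \<le> (\<integral>z. kernel_apply P (indicator W') z \<partial>\<mu>)"
  proof (rule integral_mono)
    fix z
    show "indicator W z - \<epsilon> \<le> kernel_apply P (indicator W') z"
      unfolding app using stay[of z] \<epsilon> order_trans[of "- \<epsilon>" 0 "measure (P z) W'"] by (cases "z \<in> W") auto
  qed (use i i' in auto)
  also have "\<dots> = measure (bind \<mu> P) W'" by (rule measure_bind_kernel[OF \<mu> P W(2), symmetric])
  finally show ?thesis .
qed

text \<open>A family of sets visited in turn: a law started in the first one stays in step with the family for
  a time of order \<open>1 / \<epsilon>\<close>, whereas an invariant law cannot give one of them more than about half of its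
  mass, since the next one is disjoint and has almost the same mass.\<close>

lemma metastable_tv_lower:
  fixes P :: "'z::topological_space \<Rightarrow> 'z measure" and W :: "nat \<Rightarrow> 'z set"
  assumes P: "markov_kernel P" and W: "\<And>k. W k \<in> sets borel"
    and stay: "\<And>k z. z \<in> W k \<Longrightarrow> 1 - \<epsilon> \<le> measure (P z) (W (Suc k))" and \<epsilon>: "0 \<le> \<epsilon>"
    and disj: "\<And>k. W k \<inter> W (Suc k) = {}"
    and \<mu>: "borel_law \<mu>" "1 - \<epsilon> \<le> measure \<mu> (W 0)"
    and \<pi>: "borel_law \<pi>" "bind \<pi> P = \<pi>"
  shows "1 / 2 - (real n + 3 / 2) * \<epsilon> \<le> tv_dist (iterate_kernel P \<mu> n) \<pi>"
proof -
  interpret prob_space \<pi> using \<pi>(1) by (rule borel_lawD)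
  have "1 - (real n + 1) * \<epsilon> \<le> measure (iterate_kernel P \<mu> n) (W n)"
  proof (induction n)
    case (Suc n)
    have "measure (iterate_kernel P \<mu> n) (W n) - \<epsilon> \<le> measure (bind (iterate_kernel P \<mu> n) P) (W (Suc n))"
      by (rule measure_bind_transfer[OF borel_law_iterate[OF \<mu>(1) P] P W W stay \<epsilon>])
    then show ?case using Suc by (simp add: algebra_simps)
  qed (use \<mu> in simp)
  moreover have "measure \<pi> (W n) \<le> (1 + \<epsilon>) / 2"
  proof -
    have "measure \<pi> (W n) - \<epsilon> \<le> measure \<pi> (W (Suc n))"
      using measure_bind_transfer[OF \<pi>(1) P W W stay \<epsilon>, of n] \<pi>(2) by simp
    moreover have "measure \<pi> (W n) + measure \<pi> (W (Suc n)) = measure \<pi> (W n \<union> W (Suc n))"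
      using W borel_lawD(2)[OF \<pi>(1)] disj by (intro finite_measure_Union[symmetric]) auto
    moreover have "measure \<pi> (W n \<union> W (Suc n)) \<le> 1" by (rule prob_le_1)
    ultimately show ?thesis by argo
  qed
  moreover have "\<bar>measure (iterate_kernel P \<mu> n) (W n) - measure \<pi> (W n)\<bar> \<le> tv_dist (iterate_kernel P \<mu> n) \<pi>"
    by (rule tv_dist_ge[OF borel_law_iterate[OF \<mu>(1) P] \<pi>(1) W])
  moreover have "(real n + 1) * \<epsilon> + \<epsilon> / 2 = (real n + 3 / 2) * \<epsilon>" by (simp add: algebra_simps)
  ultimately show ?thesis by argo
qed

text \<open>At time zero no rate is needed: a law charges one of two given points with mass at most one half.\<close>

lemma tv_dist_return_ge_half:
  fixes \<pi> :: "'z::t1_space measure"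
  assumes \<pi>: "borel_law \<pi>" and "z \<noteq> z'"
  shows "\<exists>w\<in>{z, z'}. 1 / 2 \<le> tv_dist (return borel w) \<pi>"
proof -
  interpret prob_space \<pi> using \<pi> by (rule borel_lawD)
  have b: "{w} \<in> sets borel" for w :: 'z by (intro borel_closed) simp
  have ge: "1 - measure \<pi> {w} \<le> tv_dist (return borel w) \<pi>" for w
    using tv_dist_ge[OF borel_law_return \<pi> b[of w], of w] b[of w] by (simp add: measure_return)
  have "measure \<pi> {z} + measure \<pi> {z'} = measure \<pi> ({z} \<union> {z'})"
    using b borel_lawD(2)[OF \<pi>] assms(2) by (intro finite_measure_Union[symmetric]) auto
  also have "\<dots> \<le> 1" by (rule prob_le_1)
  finally have "measure \<pi> {z} \<le> 1 / 2 \<or> measure \<pi> {z'} \<le> 1 / 2" by argo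
  then show ?thesis using ge[of z] ge[of z'] by auto
qed

text \<open>The chain driven by a force \<open>G\<close> that is a bounded perturbation \<open>g\<close> of the identity, constant near each point
  of the cycle \<open>c\<close> of the noiseless recursion. \<open>J\<close> defines a norm that the linear recursion contracts by
  \<open>r\<close>.\<close>

locale cyclic_heavy_ball =
  fixes \<nu> :: "(real^2) measure" and \<beta> s \<kappa> e m :: real and G g :: "real^2 \<Rightarrow> real^2" and G' and c :: "int \<Rightarrow> real^2"
    and \<rho> B d :: real and J :: "(real^2) \<times> (real^2) \<Rightarrow> (real^2) \<times> (real^2)" and r j k :: real
  assumes \<nu>: "smooth_noise \<nu>" and e: "0 < e" and m: "0 \<le> m" and \<beta>: "0 < \<beta>" and s: "0 < s" and \<kappa>: "0 \<le> \<kappa>"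
    and small: "m * s * \<kappa> < (1 + m) * (1 + \<beta> * m)"
    and deriv: "\<And>x. (G has_derivative G' x) (at x)" and cont: "\<And>v. continuous_on UNIV (\<lambda>x. G' x v)"
    and lip: "\<And>x y. norm (G x - G y) \<le> \<kappa> * norm (x - y)"
    and G: "\<And>x. G x = x + g x" and g: "\<And>x. norm (g x) \<le> B" "0 \<le> B"
    and cycle: "\<And>i. c (i + 1) = (1 + \<beta>) *\<^sub>R c i - \<beta> *\<^sub>R c (i - 1) - s *\<^sub>R G (c i)"
    and \<rho>: "0 < \<rho>" "\<And>i x. dist (c i) x \<le> \<rho> \<Longrightarrow> g x = g (c i)"
    and d: "0 < d" "\<And>i. dist (c i) (c (i + 1)) = d"
    and J: "bounded_linear J" "0 < r" "r < 1" "0 < j" "0 < k"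
      "\<And>z. j * norm z \<le> norm (J z)" "\<And>z. norm (J z) \<le> k * norm z"
      "\<And>a b. norm (J ((1 + \<beta> - s) *\<^sub>R a - \<beta> *\<^sub>R b, a)) \<le> r * norm (J (a, b))"
begin

text \<open>The gradient of the potential dilated by \<open>R\<close>; the cycle is dilated with it, whereas the noise keeps its
  size.\<close>

definition force :: "real \<Rightarrow> real^2 \<Rightarrow> real^2" where "force R x = R *\<^sub>R G (x /\<^sub>R R)"

definition chain :: "real \<Rightarrow> (real^2) kernel" where
  "chain R = noisy_heavy_ball \<beta> s (force R) e (- m * e) \<nu>"

lemma force: "0 < R \<Longrightarrow> force R x = x + R *\<^sub>R g (x /\<^sub>R R)"
  by (simp add: force_def G scaleR_add_right)

lemma force_perturbation: "0 < R \<Longrightarrow> norm (R *\<^sub>R g (x /\<^sub>R R)) \<le> R * B"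
  using g by (simp add: mult_left_mono)

lemma force_growth: "0 < R \<Longrightarrow> norm (force R x) \<le> norm x + R * B"
  unfolding force by (rule order_trans[OF norm_triangle_ineq add_left_mono[OF force_perturbation]])

lemma force_lipschitz: "0 < R \<Longrightarrow> norm (force R x - force R y) \<le> \<kappa> * norm (x - y)"
proof -
  assume R: "0 < R"
  have "norm (force R x - force R y) = R * norm (G (x /\<^sub>R R) - G (y /\<^sub>R R))"
    using R by (simp add: force_def flip: scaleR_diff_right)
  also have "\<dots> \<le> R * (\<kappa> * norm (x /\<^sub>R R - y /\<^sub>R R))" using R lip by (intro mult_left_mono) auto
  also have "\<dots> = \<kappa> * norm (x - y)" using R by (simp flip: scaleR_diff_right)
  finally show ?thesis .
qed

lemma force_derivative:
  assumes R: "0 < R"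
  shows "(force R has_derivative G' (x /\<^sub>R R)) (at x)" and "continuous_on UNIV (\<lambda>x. G' (x /\<^sub>R R) v)"
proof -
  have "((\<lambda>x. G (x /\<^sub>R R)) has_derivative (\<lambda>h. G' (x /\<^sub>R R) (h /\<^sub>R R))) (at x)"
    by (rule has_derivative_compose[OF _ deriv, of "\<lambda>x. x /\<^sub>R R" "\<lambda>h. h /\<^sub>R R"]) (auto intro!: derivative_eq_intros)
  from has_derivative_scaleR_right[OF this, of R]
  have "(force R has_derivative (\<lambda>h. R *\<^sub>R G' (x /\<^sub>R R) (h /\<^sub>R R))) (at x)" by (simp add: force_def[abs_def])
  moreover have "R *\<^sub>R G' (x /\<^sub>R R) (h /\<^sub>R R) = G' (x /\<^sub>R R) h" for h
    using R linear_scale[OF has_derivative_linear[OF deriv], of "x /\<^sub>R R" "1 / R" h] by (simp add: divide_inverse)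
  ultimately show "(force R has_derivative G' (x /\<^sub>R R)) (at x)" by simp
  show "continuous_on UNIV (\<lambda>x. G' (x /\<^sub>R R) v)"
    by (rule continuous_on_compose2[OF cont]) (auto intro!: continuous_intros)
qed

lemma force_measurable: "0 < R \<Longrightarrow> force R \<in> borel_measurable borel"
  using force_derivative(1)
  by (meson borel_measurable_continuous_onI continuous_at_imp_continuous_on has_derivative_continuous)

lemma chain_kernel: "0 < R \<Longrightarrow> markov_kernel (chain R)"
  unfolding chain_def by (rule noisy_heavy_ball_kernel[OF smooth_noise.law[OF \<nu>] force_measurable])

lemma J_measurable [measurable]: "J \<in> borel_measurable borel"
  using linear_continuous_on[OF J(1)] by (rule borel_measurable_continuous_onI)

text \<open>The drift constant of the dilated force is of order \<open>1 + R\<^sup>2\<close>, and so is the second moment.\<close>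

lemma chain_invariant_law:
  obtains D where "0 < D" "\<And>R. 1 \<le> R \<Longrightarrow> \<exists>\<pi>. borel_law \<pi> \<and> bind \<pi> (chain R) = \<pi> \<and>
    (\<forall>\<pi>'. borel_law \<pi>' \<longrightarrow> bind \<pi>' (chain R) = \<pi>' \<longrightarrow> \<pi>' = \<pi>) \<and>
    (\<integral>\<^sup>+z. ennreal ((norm z)\<^sup>2) \<partial>\<pi>) \<le> ennreal (D * (1 + R)\<^sup>2)"
proof -
  obtain D where D: "0 < D" "\<And>G g B z. G \<in> borel_measurable borel \<Longrightarrow> 0 \<le> B \<Longrightarrow>
      (\<And>x. G x = 1 *\<^sub>R x + g x) \<Longrightarrow> (\<And>x. norm (g x) \<le> B) \<Longrightarrow>
      (\<integral>\<^sup>+w. ennreal ((norm (J w))\<^sup>2) \<partial>noisy_heavy_ball \<beta> s G e (- m * e) \<nu> z) \<le> ennreal (r * (norm (J z))\<^sup>2 + D * (1 + B\<^sup>2))"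
    by (rule heavy_ball_drift[OF \<nu> J(1,2,3,5,7), of \<beta> s 1 e "- m * e"]) (use J(8) s in auto)
  define D' where "D' = D * (1 + B\<^sup>2) / (1 - r) / j\<^sup>2"
  have "0 < D'" unfolding D'_def using D J by (intro divide_pos_pos mult_pos_pos add_pos_nonneg) auto
  moreover have "\<exists>\<pi>. borel_law \<pi> \<and> bind \<pi> (chain R) = \<pi> \<and>
    (\<forall>\<pi>'. borel_law \<pi>' \<longrightarrow> bind \<pi>' (chain R) = \<pi>' \<longrightarrow> \<pi>' = \<pi>) \<and>
    (\<integral>\<^sup>+z. ennreal ((norm z)\<^sup>2) \<partial>\<pi>) \<le> ennreal (D' * (1 + R)\<^sup>2)" if R: "1 \<le> R" for R
  proof -
    have R0: "0 < R" using R by simp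
    define V where "V z = (norm (J z))\<^sup>2" for z
    have Vm [measurable]: "V \<in> borel_measurable borel" unfolding V_def by measurable
    have V_nonneg: "0 \<le> V z" for z by (simp add: V_def)
    define K where "K = D * (1 + (R * B)\<^sup>2)"
    have K: "0 < K" unfolding K_def using D by (simp add: add_pos_nonneg)
    have drift: "(\<integral>\<^sup>+w. ennreal (V w) \<partial>chain R z) \<le> ennreal (r * V z + K)" for z
      unfolding V_def K_def chain_def
      by (rule D(2)[OF force_measurable[OF R0], of _ "\<lambda>x. R *\<^sub>R g (x /\<^sub>R R)"])
        (use R0 g force[OF R0] force_perturbation[OF R0] in auto)
    have minor: "\<exists>\<eta> a. sets \<eta> = sets borel \<and> emeasure \<eta> UNIV = ennreal a \<and> 0 < a \<and>
      (\<forall>z A. V z \<le> t \<longrightarrow> A \<in> sets borel \<longrightarrow> emeasure \<eta> A \<le> emeasure (bind (chain R z) (chain R)) A)" for t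
    proof -
      obtain \<eta> a where \<eta>: "sets \<eta> = sets borel" "emeasure \<eta> UNIV = ennreal a" "0 < a"
        "\<And>z A. norm z \<le> sqrt t / j \<Longrightarrow> A \<in> sets borel \<Longrightarrow> emeasure \<eta> A \<le> emeasure (bind (chain R z) (chain R)) A"
        using noisy_heavy_ball_minorised[OF \<nu> e m less_imp_le[OF s] less_imp_le[OF \<beta>] \<kappa> force_derivative[OF R0] force_lipschitz[OF R0] small, of "sqrt t / j"]
        unfolding chain_def by blast
      have "norm z \<le> sqrt t / j" if "V z \<le> t" for z
      proof -
        have "norm (J z) \<le> sqrt t" using that by (simp add: V_def real_le_rsqrt)
        then have "j * norm z \<le> sqrt t" using J(6)[of z] by linarith
        then show ?thesis using J(4) by (simp add: pos_le_divide_eq mult.commute)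
      qed
      then show ?thesis using \<eta> by blast
    qed
    obtain \<pi> where \<pi>: "borel_law \<pi>" "bind \<pi> (chain R) = \<pi>"
      "\<And>\<pi>'. borel_law \<pi>' \<Longrightarrow> bind \<pi>' (chain R) = \<pi>' \<Longrightarrow> \<pi>' = \<pi>"
      "(\<integral>\<^sup>+w. ennreal (V w) \<partial>\<pi>) \<le> ennreal (V 0 + K / (1 - r))"
      by (rule two_step_invariant_law[OF chain_kernel[OF R0] Vm V_nonneg less_imp_le[OF J(2)] J(3) K drift minor, where ?x0.0=0]) blast
    have V0: "V 0 = 0" using linear_0[OF bounded_linear.linear[OF J(1)]] by (simp add: V_def)
    note borel_lawD(2)[OF \<pi>(1), measurable_cong]
    have "(\<integral>\<^sup>+z. ennreal ((norm z)\<^sup>2) \<partial>\<pi>) \<le> (\<integral>\<^sup>+z. ennreal (1 / j\<^sup>2) * ennreal (V z) \<partial>\<pi>)"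
    proof (rule nn_integral_mono)
      fix z
      have "(j * norm z)\<^sup>2 \<le> V z" unfolding V_def using J(4,6) by (intro power_mono) auto
      then show "ennreal ((norm z)\<^sup>2) \<le> ennreal (1 / j\<^sup>2) * ennreal (V z)"
        using J(4) by (simp add: power_mult_distrib pos_le_divide_eq mult.commute ennreal_leI V_def flip: ennreal_mult)
    qed
    also have "\<dots> = ennreal (1 / j\<^sup>2) * (\<integral>\<^sup>+z. ennreal (V z) \<partial>\<pi>)" by (rule nn_integral_cmult) measurable
    also have "\<dots> \<le> ennreal (1 / j\<^sup>2) * ennreal (K / (1 - r))" using \<pi>(4) by (intro mult_left_mono) (simp_all add: V0)
    also have "\<dots> = ennreal (1 / j\<^sup>2 * (K / (1 - r)))" using K J(3) by (intro ennreal_mult[symmetric]) auto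
    also have "\<dots> \<le> ennreal (D' * (1 + R)\<^sup>2)"
    proof (rule ennreal_leI)
      have "1 \<le> (1 + R)\<^sup>2" "R\<^sup>2 \<le> (1 + R)\<^sup>2" using R by (auto intro: power_mono)
      then have "1 + R\<^sup>2 * B\<^sup>2 \<le> (1 + R)\<^sup>2 + (1 + R)\<^sup>2 * B\<^sup>2" by (intro add_mono mult_right_mono) auto
      then have "K \<le> D * (1 + B\<^sup>2) * (1 + R)\<^sup>2"
        unfolding K_def mult.assoc using D by (intro mult_left_mono) (auto simp: power_mult_distrib algebra_simps)
      then have "K / (1 - r) / j\<^sup>2 \<le> D * (1 + B\<^sup>2) * (1 + R)\<^sup>2 / (1 - r) / j\<^sup>2" using J(3) by (intro divide_right_mono) auto
      then show "1 / j\<^sup>2 * (K / (1 - r)) \<le> D' * (1 + R)\<^sup>2" by (simp add: D'_def mult.commute)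
    qed
    finally show ?thesis using \<pi>(1-3) by blast
  qed
  ultimately show thesis by (rule that)
qed

text \<open>The first bound keeps the well inside the region where the perturbation is constant, the second one
  separates consecutive wells.\<close>

definition well_radius :: real where "well_radius = min (j * \<rho>) (j * d / 3)"

definition centre :: "real \<Rightarrow> int \<Rightarrow> (real^2) \<times> (real^2)" where "centre R i = (R *\<^sub>R c i, R *\<^sub>R c (i - 1))"

definition well :: "real \<Rightarrow> int \<Rightarrow> ((real^2) \<times> (real^2)) set" where
  "well R i = {z. norm (J (z - centre R i)) \<le> R * well_radius}"

lemma well_radius_pos: "0 < well_radius"
  using J \<rho> d by (simp add: well_radius_def)

lemma well_borel: "well R i \<in> sets borel"
  unfolding well_def by measurable

lemma norm_in_well: "z \<in> well R i \<Longrightarrow> j * norm (z - centre R i) \<le> R * well_radius"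
  using J(6)[of "z - centre R i"] by (simp add: well_def)

lemma wells_disjoint:
  assumes R: "0 < R"
  shows "well R i \<inter> well R (i + 1) = {}"
proof (rule ccontr)
  assume "well R i \<inter> well R (i + 1) \<noteq> {}"
  then obtain z where z: "z \<in> well R i" "z \<in> well R (i + 1)" by blast
  have "R * d = dist (fst (centre R i)) (fst (centre R (i + 1)))"
    using R d(2)[of i] by (simp add: centre_def dist_norm flip: scaleR_diff_right)
  also have "\<dots> \<le> dist (centre R i) (centre R (i + 1))" by (rule dist_fst_le)
  also have "\<dots> \<le> norm (z - centre R i) + norm (z - centre R (i + 1))"
    by (metis dist_norm dist_triangle2 dist_commute)
  finally have "j * (R * d) \<le> j * norm (z - centre R i) + j * norm (z - centre R (i + 1))"
    using J(4) by (simp flip: distrib_left)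
  also have "\<dots> \<le> 2 * (R * well_radius)" using z[THEN norm_in_well] by linarith
  also have "\<dots> \<le> 2 * (R * (j * d / 3))" using R by (intro mult_left_mono) (auto simp: well_radius_def)
  finally show False using R d J(4) by (simp add: field_simps)
qed

text \<open>Inside a well the perturbation of the linear force is constant, so the deviation from the cycle is
  mapped by the linear recursion and shrinks; only an exceptionally large noise leads out.\<close>

lemma heavy_ball_in_well:
  assumes R: "0 < R" and z: "z \<in> well R i"
  shows "norm (J (heavy_ball \<beta> s (force R) z - centre R (i + 1))) \<le> r * (R * well_radius)"
proof -
  define u v where "u = fst z - R *\<^sub>R c i" and "v = snd z - R *\<^sub>R c (i - 1)"
  have zuv: "z - centre R i = (u, v)" by (simp add: u_def v_def centre_def prod_eq_iff)
  have "j * norm u \<le> j * norm (u, v)" using J(4) norm_fst_le[of u v] by (intro mult_left_mono) auto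
  also have "\<dots> \<le> R * (j * \<rho>)"
  proof -
    have "R * well_radius \<le> R * (j * \<rho>)" using R by (intro mult_left_mono) (auto simp: well_radius_def)
    then show ?thesis using norm_in_well[OF z] unfolding zuv by linarith
  qed
  finally have "norm u \<le> R * \<rho>" using J(4) by (simp add: mult.left_commute)
  moreover have "c i - fst z /\<^sub>R R = - (u /\<^sub>R R)" using R by (simp add: u_def algebra_simps)
  ultimately have "dist (c i) (fst z /\<^sub>R R) \<le> \<rho>" using R by (simp add: dist_norm pos_divide_le_eq mult.commute divide_inverse_commute[symmetric])
  then have gz: "g (fst z /\<^sub>R R) = g (c i)" by (rule \<rho>(2))
  have "heavy_ball \<beta> s (force R) z - centre R (i + 1) = ((1 + \<beta> - s) *\<^sub>R u - \<beta> *\<^sub>R v, u)"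
    unfolding heavy_ball_def centre_def force[OF R] gz cycle[of i]
    by (simp add: G u_def v_def algebra_simps)
  then have "norm (J (heavy_ball \<beta> s (force R) z - centre R (i + 1))) \<le> r * norm (J (u, v))" using J(8) by simp
  also have "\<dots> \<le> r * (R * well_radius)" using z J(2) unfolding well_def zuv[symmetric] by (intro mult_left_mono) auto
  finally show ?thesis .
qed

text \<open>Noise of size at most \<open>R q / t\<close> does not lead out of a well whose margin is \<open>R q\<close>. The noise direction
  \<open>(x, y)\<close> and the law \<open>\<mu>\<close> are left open because the initial part of the splitting adds noise of its own.\<close>

lemma noise_stays:
  assumes \<mu>: "borel_law \<mu>" and tail: "\<And>t. 0 \<le> t \<Longrightarrow> measure \<mu> {x. t < norm x} \<le> C * exp (- a * t\<^sup>2)"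
    and t: "0 < t" "k * (\<bar>x\<bar> + \<bar>y\<bar>) \<le> t" and R: "0 < R" and q: "0 \<le> q"
    and p: "norm (J (p - centre R i)) + R * q \<le> R * well_radius"
  shows "1 - C * exp (- (a * (q / t)\<^sup>2) * R\<^sup>2) \<le> measure (distr \<mu> borel (\<lambda>N. p + (x *\<^sub>R N, y *\<^sub>R N))) (well R i)"
proof -
  interpret prob_space \<mu> using \<mu> by (rule borel_lawD)
  note borel_lawD(2)[OF \<mu>, measurable_cong]
  let ?f = "\<lambda>N. p + (x *\<^sub>R N, y *\<^sub>R N)"
  have fm [measurable]: "?f \<in> \<mu> \<rightarrow>\<^sub>M borel" by measurable
  have in_well: "?f N \<in> well R i" if N: "norm N \<le> R * (q / t)" for N
  proof -
    have "norm (J (x *\<^sub>R N, y *\<^sub>R N)) \<le> k * norm (x *\<^sub>R N, y *\<^sub>R N)" by (rule J(7))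
    also have "\<dots> \<le> k * (norm (x *\<^sub>R N) + norm (y *\<^sub>R N))"
      by (rule mult_left_mono[OF norm_Pair_le]) (use J(5) in simp)
    also have "\<dots> = k * (\<bar>x\<bar> + \<bar>y\<bar>) * norm N" by (simp add: algebra_simps)
    also have "\<dots> \<le> t * norm N" using t(2) by (rule mult_right_mono) simp
    also have "\<dots> \<le> t * (R * (q / t))" using t N by (intro mult_left_mono) auto
    also have "\<dots> = R * q" using t by simp
    finally have nn: "norm (J (x *\<^sub>R N, y *\<^sub>R N)) \<le> R * q" .
    have "?f N - centre R i = (p - centre R i) + (x *\<^sub>R N, y *\<^sub>R N)" by simp
    then have "J (?f N - centre R i) = J (p - centre R i) + J (x *\<^sub>R N, y *\<^sub>R N)"
      by (simp only: linear_add[OF bounded_linear.linear[OF J(1)]])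
    then have "norm (J (?f N - centre R i)) \<le> norm (J (p - centre R i)) + norm (J (x *\<^sub>R N, y *\<^sub>R N))"
      by (simp only: norm_triangle_ineq)
    then show ?thesis using nn p by (simp add: well_def)
  qed
  have "1 - C * exp (- (a * (q / t)\<^sup>2) * R\<^sup>2) \<le> 1 - measure \<mu> {x. R * (q / t) < norm x}"
    using tail[of "R * (q / t)"] R q t by (simp add: power_mult_distrib power_divide mult_ac)
  also have "\<dots> = measure \<mu> (UNIV - {x. R * (q / t) < norm x})"
    using prob_compl[of "{x. R * (q / t) < norm x}"] borel_lawD(3)[OF \<mu>] by simp
  also have "\<dots> \<le> measure \<mu> (?f -` well R i \<inter> space \<mu>)"
  proof (rule finite_measure_mono)
    show "UNIV - {x. R * (q / t) < norm x} \<subseteq> ?f -` well R i \<inter> space \<mu>" using in_well borel_lawD(3)[OF \<mu>] by auto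
    show "?f -` well R i \<inter> space \<mu> \<in> sets \<mu>" by (rule measurable_sets[OF fm well_borel])
  qed
  also have "\<dots> = measure (distr \<mu> borel ?f) (well R i)" by (rule measure_distr[OF fm well_borel, symmetric])
  finally show ?thesis .
qed

lemma chain_stays:
  obtains a C where "0 < a" "0 \<le> C"
    "\<And>R i z. 0 < R \<Longrightarrow> z \<in> well R i \<Longrightarrow> 1 - C * exp (- a * R\<^sup>2) \<le> measure (chain R z) (well R (i + 1))"
proof -
  interpret smooth_noise \<nu> by (rule \<nu>)
  obtain a C where tail: "0 < a" "0 \<le> C" "\<And>t. 0 \<le> t \<Longrightarrow> measure \<nu> {x. t < norm x} \<le> C * exp (- a * t\<^sup>2)"
    using tail by blast
  define t where "t = k * (\<bar>e\<bar> + \<bar>- m * e\<bar>)"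
  have t: "0 < t" using J(5) e by (simp add: t_def add_pos_nonneg)
  define q where "q = (1 - r) * well_radius"
  have q: "0 < q" using J(3) well_radius_pos by (simp add: q_def)
  have "1 - C * exp (- (a * (q / t)\<^sup>2) * R\<^sup>2) \<le> measure (chain R z) (well R (i + 1))"
    if R: "0 < R" and z: "z \<in> well R i" for R i z
    unfolding chain_def noisy_heavy_ball_def
    by (rule noise_stays[OF law tail(3) t _ R less_imp_le[OF q]])
      (use heavy_ball_in_well[OF R z] in \<open>auto simp: t_def q_def algebra_simps\<close>)
  then show thesis using tail t q by (intro that[of "a * (q / t)\<^sup>2" C]) auto
qed

end

text \<open>The invariant laws of the splitting and of its skeleton correspond, and the first part of the step does
  not increase total variation, so the skeleton's slow mixing is passed on. The initial state is the one whose
  image under the first part is the centre of a well, and its distance to the invariant law is controlled by second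
  moments.\<close>

theorem cyclic_potential_metastable:
  fixes S :: splitting and U :: "real^2 \<Rightarrow> real" and G g :: "real^2 \<Rightarrow> real^2" and c :: "int \<Rightarrow> real^2"
    and h \<gamma> \<beta> s \<kappa> \<rho> B d :: real
  assumes h: "0 < h" and \<gamma>: "0 < \<gamma>" and \<beta>: "\<beta> = exp (- \<gamma> * h)" and s: "s = s_param S h \<beta>"
    and \<kappa>: "1 \<le> \<kappa>" and s\<kappa>: "0 < s" "s * \<kappa> < 2 * (1 + \<beta>)"
    and C: "\<And>k. C_k k U" and GU: "\<And>x. GDERIV U x :> G x"
    and lo: "\<And>x y. (norm (x - y))\<^sup>2 \<le> inner (G x - G y) (x - y)"
    and hi: "\<And>x y. inner (G x - G y) (x - y) \<le> \<kappa> * (norm (x - y))\<^sup>2"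
    and lip: "\<And>x y. norm (G x - G y) \<le> \<kappa> * norm (x - y)"
    and G: "\<And>x. G x = x + g x" and g: "\<And>x. norm (g x) \<le> B" "0 \<le> B"
    and cycle: "\<And>i. c (i + 1) = (1 + \<beta>) *\<^sub>R c i - \<beta> *\<^sub>R c (i - 1) - s *\<^sub>R G (c i)"
    and \<rho>: "0 < \<rho>" "\<And>i x. dist (c i) x \<le> \<rho> \<Longrightarrow> g x = g (c i)"
    and c1: "\<And>i. norm (c i) = 1" and d: "0 < d" "\<And>i. dist (c i) (c (i + 1)) = d"
  shows "\<exists>c\<^sub>0>0. \<exists>C\<^sub>0>0. \<forall>R::real. R \<ge> 1 \<longrightarrow> dilate R U \<in> potentials \<kappa> \<and>
        (\<exists>\<pi>. invariant_law (splitting_kernel S (dilate R U) h \<gamma>) \<pi> \<and>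
             (\<forall>\<pi>'. invariant_law (splitting_kernel S (dilate R U) h \<gamma>) \<pi>' \<longrightarrow> \<pi>' = \<pi>) \<and>
             (\<exists>z. W2 (return borel z) \<pi> \<le> ennreal (C\<^sub>0 * (1 + R)) \<and>
                  (\<forall>n::nat. int n \<le> \<lfloor>N_prefactor S * exp (c\<^sub>0 * R\<^sup>2)\<rfloor> \<longrightarrow>
                     tv_dist (law_at (splitting_kernel S (dilate R U) h \<gamma>) z n) \<pi> \<ge> 3/8)))"
proof -
  have b: "0 < \<beta>" "\<beta> < 1" using h \<gamma> by (auto simp: \<beta>)
  have "s * 1 \<le> s * \<kappa>" using s\<kappa>(1) \<kappa> by (intro mult_left_mono) auto
  then have "s < 2 * (1 + \<beta>)" using s\<kappa>(2) by linarith
  then have T: "\<bar>1 + \<beta> - s\<bar> < 1 + \<beta>" unfolding abs_less_iff using s\<kappa>(1) by auto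
  obtain J :: "(real^2) \<times> (real^2) \<Rightarrow> (real^2) \<times> (real^2)" and r j k where J: "bounded_linear J" "0 < r" "r < 1" "0 < j" "0 < k"
    "\<And>z. j * norm z \<le> norm (J z)" "\<And>z. norm (J z) \<le> k * norm z"
    "\<And>a b. norm (J ((1 + \<beta> - s) *\<^sub>R a - \<beta> *\<^sub>R b, a)) \<le> r * norm (J (a, b))"
    by (rule companion_contraction[OF b T, where 'a="real^2"]) blast
  obtain G' where G': "\<And>x. (G has_derivative G' x) (at x)" "\<And>v. continuous_on UNIV (\<lambda>x. G' x v)"
    using smooth_gradient[OF C GU] by blast
  define m where "m = noise_memory S \<beta>"
  define e where "e = noise_gain S h"
  define \<nu> where "\<nu> = (step_noise S \<beta> :: (real^2) measure)"
  have \<nu>: "smooth_noise \<nu>" unfolding \<nu>_def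
    using b by (cases S) (auto intro!: smooth_noise_gauss_mix simp: power_less_one_iff)
  have e: "0 < e" using h unfolding e_def by (cases S) auto
  have m: "m = 0 \<or> m = 1 / \<beta>" unfolding m_def by (cases S) auto
  then have m0: "0 \<le> m" using b by auto
  have small: "m * s * \<kappa> < (1 + m) * (1 + \<beta> * m)"
    using m
  proof
    assume "m = 1 / \<beta>"
    then have m1: "\<beta> * m = 1" "0 < m" using b by auto
    have "m * (s * \<kappa>) < m * (2 * (1 + \<beta>))" using s\<kappa>(2) m1(2) by (rule mult_strict_left_mono)
    also have "\<dots> = (1 + m) * (1 + \<beta> * m)" using m1(1) by (simp add: algebra_simps)
    finally show ?thesis by (simp add: mult.assoc)
  qed simp
  have \<kappa>0: "0 \<le> \<kappa>" using \<kappa> by simp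
  note \<beta>_eq = \<beta> and s_eq = s
  interpret cyclic_heavy_ball \<nu> \<beta> s \<kappa> e m G g G' c \<rho> B d J r j k
    by (rule cyclic_heavy_ball.intro; fact \<nu> e m0 b(1) s\<kappa>(1) \<kappa>0 small G' lip G g cycle \<rho> d J)
  let ?L = "\<lambda>R. pre_kernel S (dilate R U) h \<gamma>" and ?K = "\<lambda>R. post_kernel S (dilate R U) h \<gamma>"
  have grad: "grad (dilate R U) = force R" if "1 \<le> R" for R
    using dilate_potentials(2)[OF C GU lo hi] that by (simp add: force_def[abs_def])
  have gradm: "grad (dilate R U) \<in> borel_measurable borel" if "1 \<le> R" for R
    unfolding grad[OF that] using that by (intro force_measurable) simp
  note Lk = pre_kernel_markov[OF gradm h \<gamma> \<beta>_eq, where S=S] and Kk = post_kernel_markov[OF gradm h \<gamma> \<beta>_eq, where S=S]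
  note Q = splitting_eq_pre_post[OF gradm h \<gamma> \<beta>_eq, where S=S]
  have KL: "?K R \<rhd> ?L R = chain R" if "1 \<le> R" for R
    unfolding post_pre_eq_heavy_ball[OF gradm[OF that] h \<gamma> \<beta>_eq] chain_def grad[OF that]
      m_def[symmetric] e_def[symmetric] \<nu>_def[symmetric] s_eq[symmetric] ..
  obtain D where D: "0 < D" "\<And>R. 1 \<le> R \<Longrightarrow> \<exists>\<pi>. borel_law \<pi> \<and> bind \<pi> (chain R) = \<pi> \<and>
    (\<forall>\<pi>'. borel_law \<pi>' \<longrightarrow> bind \<pi>' (chain R) = \<pi>' \<longrightarrow> \<pi>' = \<pi>) \<and>
    (\<integral>\<^sup>+z. ennreal ((norm z)\<^sup>2) \<partial>\<pi>) \<le> ennreal (D * (1 + R)\<^sup>2)"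
    by (rule chain_invariant_law) blast
  obtain C1 where C1: "0 < C1" "\<And>(U :: real^2 \<Rightarrow> real) b. 1 \<le> b \<Longrightarrow> grad U \<in> borel_measurable borel \<Longrightarrow>
    (\<And>x. norm (grad U x) \<le> norm x + B * sqrt b) \<Longrightarrow> quadratic_growth C1 b (post_kernel S U h \<gamma>)"
    by (rule post_kernel_growth[where B=B and S=S and h=h and \<gamma>=\<gamma> and 'a="real^2"]) blast
  obtain C2 where C2: "0 < C2" "\<And>(G::real^2 \<Rightarrow> real^2) a b. \<exists>z. pre_map S G h \<beta> z = (a, b) \<and> norm z \<le> C2 * (norm a + norm b + norm (G b))"
    by (rule pre_map_surj[OF h b(1), where 'a="real^2"]) blast
  obtain \<alpha> A where A: "0 < \<alpha>" "0 \<le> A"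
    "\<And>R i z. 0 < R \<Longrightarrow> z \<in> well R i \<Longrightarrow> 1 - A * exp (- \<alpha> * R\<^sup>2) \<le> measure (chain R z) (well R (i + 1))"
    by (rule chain_stays) blast
  obtain \<alpha>' A' where A': "0 < \<alpha>'" "0 \<le> A'"
    "\<And>R z. 1 \<le> R \<Longrightarrow> pre_map S (force R) h \<beta> z = centre R 0 \<Longrightarrow> 1 - A' * exp (- \<alpha>' * R\<^sup>2) \<le> measure (?L R z) (well R 0)"
  proof -
    obtain a C where tail: "0 < a" "0 \<le> C" "\<And>t. 0 \<le> t \<Longrightarrow> measure (std_gaussian :: (real^2) measure) {x. t < norm x} \<le> C * exp (- a * t\<^sup>2)"
    proof (rule that[of "1 / 4" "sqrt 2 ^ DIM(real^2)"])
      show "measure (std_gaussian :: (real^2) measure) {x. t < norm x} \<le> sqrt 2 ^ DIM(real^2) * exp (- (1 / 4) * t\<^sup>2)"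
        if "0 \<le> t" for t
        by (rule exp_moment_tail[OF std_gaussian_law _ _ _ that]) (use std_gaussian_exp_moment[where 'a="real^2"] in simp_all)
    qed simp_all
    define x y where "x = fst (pre_gain S h \<beta>)" and "y = snd (pre_gain S h \<beta>)"
    define t where "t = k * (\<bar>x\<bar> + \<bar>y\<bar>) + 1"
    have t: "0 < t" using J(5) by (simp add: t_def add_nonneg_pos)
    have "1 - C * exp (- (a * (well_radius / t)\<^sup>2) * R\<^sup>2) \<le> measure (?L R z) (well R 0)"
      if R: "1 \<le> R" and z: "pre_map S (force R) h \<beta> z = centre R 0" for R z
      unfolding pre_kernel_affine[OF gradm[OF R] h \<gamma> \<beta>_eq] grad[OF R] z x_def[symmetric] y_def[symmetric]
      by (rule noise_stays[OF std_gaussian_law tail(3) t _ _ less_imp_le[OF well_radius_pos]])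
        (use R linear_0[OF bounded_linear.linear[OF J(1)]] in \<open>auto simp: t_def\<close>)
    then show thesis using tail t well_radius_pos by (intro that[of "a * (well_radius / t)\<^sup>2" C]) auto
  qed
  define D' where "D' = C1 * (1 + D)"
  have D': "0 < D'" using C1 D by (simp add: D'_def)
  have inv: "\<exists>\<pi>' \<pi>. borel_law \<pi>' \<and> bind \<pi>' (chain R) = \<pi>' \<and> borel_law \<pi> \<and> bind \<pi> (?L R) = \<pi>' \<and>
     invariant_law (splitting_kernel S (dilate R U) h \<gamma>) \<pi> \<and>
     (\<forall>\<pi>'. invariant_law (splitting_kernel S (dilate R U) h \<gamma>) \<pi>' \<longrightarrow> \<pi>' = \<pi>) \<and>
     (\<integral>\<^sup>+z. ennreal ((norm z)\<^sup>2) \<partial>\<pi>) \<le> ennreal (D' * (1 + R)\<^sup>2)" if R: "1 \<le> R" for R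
  proof -
    obtain \<pi>' where \<pi>': "borel_law \<pi>'" "bind \<pi>' (chain R) = \<pi>'"
      "\<And>\<pi>. borel_law \<pi> \<Longrightarrow> bind \<pi> (chain R) = \<pi> \<Longrightarrow> \<pi> = \<pi>'"
      "(\<integral>\<^sup>+z. ennreal ((norm z)\<^sup>2) \<partial>\<pi>') \<le> ennreal (D * (1 + R)\<^sup>2)"
      using D(2)[OF R] by blast
    note swap = invariant_law_swap[OF Lk[OF R] Kk[OF R] \<pi>'(1), unfolded KL[OF R], OF \<pi>'(2,3), folded Q[OF R]]
    interpret prob_space \<pi>' using \<pi>'(1) by (rule borel_lawD)
    note borel_lawD(2)[OF \<pi>'(1), measurable_cong]
    let ?b = "(1 + R)\<^sup>2"
    have growth: "quadratic_growth C1 ?b (?K R)"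
    proof (rule C1(2)[OF _ gradm[OF R]])
      show "1 \<le> ?b" using R by (intro one_le_power) simp
      fix x
      have "norm (grad (dilate R U) x) \<le> norm x + R * B"
        using force_growth[of R x] R by (simp add: grad[OF R])
      also have "R * B \<le> B * sqrt ?b" using R g(2) by (simp add: algebra_simps)
      finally show "norm (grad (dilate R U) x) \<le> norm x + B * sqrt ?b" by simp
    qed
    have "(\<integral>\<^sup>+z. ennreal ((norm z)\<^sup>2) \<partial>bind \<pi>' (?K R)) \<le> (\<integral>\<^sup>+z. ennreal (?b + (norm z)\<^sup>2) \<partial>bind \<pi>' (?K R))"
      by (intro nn_integral_mono ennreal_leI) simp
    also have "\<dots> = (\<integral>\<^sup>+z. kernel_nn (?K R) (\<lambda>w. ennreal (?b + (norm w)\<^sup>2)) z \<partial>\<pi>')"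
      unfolding kernel_nn_def by (rule nn_integral_bind_kernel[OF \<pi>'(1) Kk[OF R]]) measurable
    also have "\<dots> \<le> (\<integral>\<^sup>+z. ennreal C1 * (ennreal ?b + ennreal ((norm z)\<^sup>2)) \<partial>\<pi>')"
      using growth C1(1) unfolding quadratic_growth_def by (intro nn_integral_mono) (auto simp: ennreal_mult ennreal_plus)
    also have "\<dots> = ennreal C1 * (ennreal ?b + (\<integral>\<^sup>+z. ennreal ((norm z)\<^sup>2) \<partial>\<pi>'))"
      by (simp add: nn_integral_cmult nn_integral_add emeasure_space_1)
    also have "\<dots> \<le> ennreal C1 * (ennreal ?b + ennreal (D * ?b))" using \<pi>'(4) by (intro mult_left_mono add_left_mono) auto
    also have "\<dots> = ennreal (C1 * (?b + D * ?b))" using C1 D by (simp add: ennreal_mult ennreal_plus)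
    also have "C1 * (?b + D * ?b) = D' * ?b" by (simp add: D'_def algebra_simps)
    finally show ?thesis
      using \<pi>'(1,2) swap borel_law_bind[OF \<pi>'(1) Kk[OF R]] by blast
  qed
  have law_L: "bind (law_at (splitting_kernel S (dilate R U) h \<gamma>) z n) (?L R) = iterate_kernel (chain R) (?L R z) n"
    if R: "1 \<le> R" for R z n
    unfolding law_at_eq Q[OF R] iterate_swap[OF borel_law_return Lk[OF R] Kk[OF R]] KL[OF R] bind_return_kernel[OF Lk[OF R]] ..
  define Z where "Z = C2 * (3 + B) + 1"
  have Z: "1 \<le> Z" using C2 g by (simp add: Z_def)
  define \<alpha>\<^sub>0 where "\<alpha>\<^sub>0 = min \<alpha> \<alpha>' / 2"
  define A\<^sub>0 where "A\<^sub>0 = A + A'"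
  have \<alpha>\<^sub>0: "0 < \<alpha>\<^sub>0" and A\<^sub>0: "0 \<le> A\<^sub>0" using A A' by (auto simp: \<alpha>\<^sub>0_def A\<^sub>0_def)
  (* Beyond this threshold the exponential beats its prefactor; below it the number of steps rounds to zero. *)
  define M where "M = max 1 (ln (24 * A\<^sub>0 + 1) / \<alpha>\<^sub>0)"
  have M: "1 \<le> M" "ln (24 * A\<^sub>0 + 1) \<le> \<alpha>\<^sub>0 * M" using \<alpha>\<^sub>0 by (auto simp: M_def max_def field_simps)
  define c\<^sub>0 where "c\<^sub>0 = min \<alpha>\<^sub>0 (1 / M)"
  have c\<^sub>0: "0 < c\<^sub>0" using \<alpha>\<^sub>0 M by (auto simp: c\<^sub>0_def)
  define C\<^sub>0 where "C\<^sub>0 = sqrt (2 * (Z\<^sup>2 + D'))"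
  have C\<^sub>0: "0 < C\<^sub>0" "C\<^sub>0\<^sup>2 = 2 * (Z\<^sup>2 + D')" using Z D' by (auto simp: C\<^sub>0_def add_nonneg_pos)
  have pre: "0 < N_prefactor S" "N_prefactor S \<le> 1 / 16" by (cases S; simp)+
  show ?thesis
  proof (rule exI[of _ c\<^sub>0], rule conjI[OF c\<^sub>0], rule exI[of _ C\<^sub>0], intro conjI C\<^sub>0(1) allI impI)
    fix R :: real assume R: "1 \<le> R"
    then have R0: "0 < R" by simp
    show "dilate R U \<in> potentials \<kappa>" using dilate_potentials(1)[OF C GU lo hi] R by simp
    obtain \<pi>' \<pi> where \<pi>: "borel_law \<pi>'" "bind \<pi>' (chain R) = \<pi>'" "borel_law \<pi>" "bind \<pi> (?L R) = \<pi>'"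
      "invariant_law (splitting_kernel S (dilate R U) h \<gamma>) \<pi>"
      "\<forall>\<pi>'. invariant_law (splitting_kernel S (dilate R U) h \<gamma>) \<pi>' \<longrightarrow> \<pi>' = \<pi>"
      "(\<integral>\<^sup>+z. ennreal ((norm z)\<^sup>2) \<partial>\<pi>) \<le> ennreal (D' * (1 + R)\<^sup>2)"
      using inv[OF R] by blast
    have near: "W2 (return borel z) \<pi> \<le> ennreal (C\<^sub>0 * (1 + R))" if z: "norm z \<le> Z * (1 + R)" for z
    proof (rule W2_return_le[OF \<pi>(3)])
      interpret prob_space \<pi> using \<pi>(3) by (rule borel_lawD)
      note borel_lawD(2)[OF \<pi>(3), measurable_cong]
      show "0 \<le> C\<^sub>0 * (1 + R)" using C\<^sub>0 R by simp
      have "(\<integral>\<^sup>+w. ennreal ((dist z w)\<^sup>2) \<partial>\<pi>) \<le> (\<integral>\<^sup>+w. ennreal (2 * (norm z)\<^sup>2) + 2 * ennreal ((norm w)\<^sup>2) \<partial>\<pi>)"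
      proof (rule nn_integral_mono)
        fix w
        have "(dist z w)\<^sup>2 \<le> 2 * (norm z)\<^sup>2 + 2 * (norm w)\<^sup>2" using norm_add_square[of z "- w"] by (simp add: dist_norm)
        then have "ennreal ((dist z w)\<^sup>2) \<le> ennreal (2 * (norm z)\<^sup>2 + 2 * (norm w)\<^sup>2)" by (rule ennreal_leI)
        then show "ennreal ((dist z w)\<^sup>2) \<le> ennreal (2 * (norm z)\<^sup>2) + 2 * ennreal ((norm w)\<^sup>2)"
          by (simp add: ennreal_plus ennreal_mult)
      qed
      also have "\<dots> = ennreal (2 * (norm z)\<^sup>2) + 2 * (\<integral>\<^sup>+w. ennreal ((norm w)\<^sup>2) \<partial>\<pi>)"
        by (simp add: nn_integral_cmult nn_integral_add emeasure_space_1)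
      also have "\<dots> \<le> ennreal (2 * (norm z)\<^sup>2) + 2 * ennreal (D' * (1 + R)\<^sup>2)" using \<pi>(7) by (intro add_left_mono mult_left_mono) auto
      also have "\<dots> = ennreal (2 * (norm z)\<^sup>2 + 2 * (D' * (1 + R)\<^sup>2))" using D' by (simp add: ennreal_plus ennreal_mult)
      also have "\<dots> \<le> ennreal ((C\<^sub>0 * (1 + R))\<^sup>2)"
      proof (rule ennreal_leI)
        have "(norm z)\<^sup>2 \<le> (Z * (1 + R))\<^sup>2" using z by (intro power_mono) auto
        then show "2 * (norm z)\<^sup>2 + 2 * (D' * (1 + R)\<^sup>2) \<le> (C\<^sub>0 * (1 + R))\<^sup>2"
          unfolding power_mult_distrib C\<^sub>0(2) by (simp add: algebra_simps)
      qed
      finally show "(\<integral>\<^sup>+w. ennreal ((dist z w)\<^sup>2) \<partial>\<pi>) \<le> ennreal ((C\<^sub>0 * (1 + R))\<^sup>2)" .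
    qed
    let ?Q = "splitting_kernel S (dilate R U) h \<gamma>"
    have "\<exists>z. norm z \<le> Z * (1 + R) \<and>
        (\<forall>n::nat. int n \<le> \<lfloor>N_prefactor S * exp (c\<^sub>0 * R\<^sup>2)\<rfloor> \<longrightarrow> 3 / 8 \<le> tv_dist (law_at ?Q z n) \<pi>)"
    proof (cases "M \<le> R\<^sup>2")
      case True
      obtain z where z: "pre_map S (force R) h \<beta> z = centre R 0"
        "norm z \<le> C2 * (norm (R *\<^sub>R c 0) + norm (R *\<^sub>R c (0 - 1)) + norm (force R (R *\<^sub>R c (0 - 1))))"
        using C2(2)[of "force R" "R *\<^sub>R c 0" "R *\<^sub>R c (0 - 1)"] by (auto simp: centre_def)
      define X where "X = exp (\<alpha>\<^sub>0 * R\<^sup>2)"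
      define \<epsilon> where "\<epsilon> = A\<^sub>0 / X\<^sup>2"
      have X: "1 \<le> X" using \<alpha>\<^sub>0 by (simp add: X_def)
      have "24 * A\<^sub>0 + 1 = exp (ln (24 * A\<^sub>0 + 1))" using A\<^sub>0 by simp
      also have "\<dots> \<le> X" unfolding X_def exp_le_cancel_iff
        using M(2) mult_left_mono[OF True, of \<alpha>\<^sub>0] \<alpha>\<^sub>0 by linarith
      finally have AX: "24 * A\<^sub>0 \<le> X" by simp
      have X2: "exp (- (2 * \<alpha>\<^sub>0) * R\<^sup>2) = 1 / X\<^sup>2"
        by (simp add: X_def exp_minus field_simps flip: exp_double)
      have small: "x * exp (- y * R\<^sup>2) \<le> \<epsilon>" if "x \<le> A\<^sub>0" "0 \<le> x" "2 * \<alpha>\<^sub>0 \<le> y" for x y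
      proof -
        have "exp (- y * R\<^sup>2) \<le> exp (- (2 * \<alpha>\<^sub>0) * R\<^sup>2)" using that by (simp add: mult_right_mono)
        then have "x * exp (- y * R\<^sup>2) \<le> A\<^sub>0 * (1 / X\<^sup>2)" unfolding X2[symmetric] using that by (intro mult_mono) auto
        then show ?thesis by (simp add: \<epsilon>_def)
      qed
      have \<epsilon>A: "A * exp (- \<alpha> * R\<^sup>2) \<le> \<epsilon>" "A' * exp (- \<alpha>' * R\<^sup>2) \<le> \<epsilon>"
        by (rule small; use A A' in \<open>simp add: A\<^sub>0_def \<alpha>\<^sub>0_def\<close>)+
      have \<epsilon>0: "0 \<le> \<epsilon>" using A\<^sub>0 by (simp add: \<epsilon>_def)
      have \<epsilon>X: "\<epsilon> * X \<le> 1 / 24" using AX X by (simp add: \<epsilon>_def power2_eq_square pos_divide_le_eq)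
      have "3 / 8 \<le> tv_dist (law_at ?Q z n) \<pi>" if n: "int n \<le> \<lfloor>N_prefactor S * exp (c\<^sub>0 * R\<^sup>2)\<rfloor>" for n
      proof -
        have "real n \<le> N_prefactor S * exp (c\<^sub>0 * R\<^sup>2)" using n by linarith
        also have "\<dots> \<le> 1 / 16 * X"
          unfolding X_def using pre by (intro mult_mono) (auto simp: c\<^sub>0_def mult_right_mono)
        finally have "real n * \<epsilon> \<le> 1 / 16 * X * \<epsilon>" using \<epsilon>0 by (rule mult_right_mono)
        also have "\<dots> \<le> 1 / 384" using \<epsilon>X by (simp add: mult.commute)
        (* With n at most X/16 and 24 \<epsilon> X at most 1, the total loss is at most 1/384 + 1/16 < 1/8. *)
        finally have "real n * \<epsilon> \<le> 1 / 384" .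
        moreover have "\<epsilon> \<le> 1 / 24" using \<epsilon>X mult_left_mono[OF X \<epsilon>0] by linarith
        moreover have "(real n + 3 / 2) * \<epsilon> = real n * \<epsilon> + 3 / 2 * \<epsilon>" by (rule distrib_right)
        moreover have "1 / 2 - (real n + 3 / 2) * \<epsilon> \<le> tv_dist (iterate_kernel (chain R) (?L R z) n) \<pi>'"
        proof (rule metastable_tv_lower[of _ "\<lambda>i. well R (int i)"])
          show "1 - \<epsilon> \<le> measure (chain R w) (well R (int (Suc i)))" if "w \<in> well R (int i)" for i w
            using A(3)[of R w "int i"] that R \<epsilon>A(1) by (simp add: add.commute)
          show "well R (int i) \<inter> well R (int (Suc i)) = {}" for i
            using wells_disjoint[of R "int i"] R by (simp add: add.commute)
          show "1 - \<epsilon> \<le> measure (?L R z) (well R (int 0))" using A'(3)[OF R z(1)] \<epsilon>A(2) by simp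
        qed (fact \<epsilon>0 \<pi>(1) \<pi>(2) chain_kernel[OF R0] well_borel markov_kernel_law[OF Lk[OF R]])+
        moreover have "tv_dist (bind (law_at ?Q z n) (?L R)) (bind \<pi> (?L R)) \<le> tv_dist (law_at ?Q z n) \<pi>"
          by (rule tv_dist_bind_le[OF _ \<pi>(3) Lk[OF R]])
            (simp add: law_at_eq borel_law_iterate borel_law_return splitting_markov[OF gradm[OF R] h \<gamma> \<beta>_eq])
        ultimately show ?thesis unfolding law_L[OF R] \<pi>(4) by argo
      qed
      moreover have "norm z \<le> Z * (1 + R)"
      proof -
        have "norm (force R (R *\<^sub>R c (0 - 1))) \<le> R + R * B"
          using force_growth[of R "R *\<^sub>R c (0 - 1)"] R c1 by simp
        then have "norm z \<le> C2 * (R + R + (R + R * B))"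
          using z(2) C2(1) R c1 by (elim order_trans) (intro mult_left_mono add_mono, auto)
        also have "\<dots> = (C2 * (3 + B)) * R" by (simp add: algebra_simps)
        also have "\<dots> \<le> Z * (1 + R)" using C2 g R by (intro mult_mono) (auto simp: Z_def)
        finally show ?thesis .
      qed
      ultimately show ?thesis by blast
    next
      case False
      have "c\<^sub>0 * R\<^sup>2 \<le> 1 / M * M" using False M by (intro mult_mono) (auto simp: c\<^sub>0_def)
      then have "exp (c\<^sub>0 * R\<^sup>2) \<le> exp 1" using M by simp
      also have "\<dots> \<le> (3::real)" by (rule exp_le)
      finally have "N_prefactor S * exp (c\<^sub>0 * R\<^sup>2) \<le> 1 / 16 * 3" using pre by (intro mult_mono) auto
      then have n0: "n = 0" if "int n \<le> \<lfloor>N_prefactor S * exp (c\<^sub>0 * R\<^sup>2)\<rfloor>" for n using that by linarith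
      have "(0, 0) \<noteq> (c 0, 0 :: real^2)" using c1[of 0] by auto
      from tv_dist_return_ge_half[OF \<pi>(3) this]
      obtain z where z: "z \<in> {(0, 0), (c 0, 0)}" "1 / 2 \<le> tv_dist (return borel z) \<pi>" by (rule bexE)
      have "norm z \<le> 1" using z(1) c1[of 0] by (auto simp: norm_Pair)
      also have "1 \<le> Z * (1 + R)" using Z R mult_mono[of 1 Z 1 "1 + R"] by simp
      finally have "norm z \<le> Z * (1 + R)" .
      moreover have "3 / 8 \<le> tv_dist (law_at ?Q z n) \<pi>"
        if "int n \<le> \<lfloor>N_prefactor S * exp (c\<^sub>0 * R\<^sup>2)\<rfloor>" for n
        unfolding n0[OF that] law_at_def using z(2) by simp
      ultimately show ?thesis by blast
    qed
    then obtain z where z: "norm z \<le> Z * (1 + R)"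
      "\<forall>n::nat. int n \<le> \<lfloor>N_prefactor S * exp (c\<^sub>0 * R\<^sup>2)\<rfloor> \<longrightarrow> 3 / 8 \<le> tv_dist (law_at ?Q z n) \<pi>" by blast
    show "\<exists>\<pi>. invariant_law ?Q \<pi> \<and> (\<forall>\<pi>'. invariant_law ?Q \<pi>' \<longrightarrow> \<pi>' = \<pi>) \<and>
       (\<exists>z. W2 (return borel z) \<pi> \<le> ennreal (C\<^sub>0 * (1 + R)) \<and>
         (\<forall>n::nat. int n \<le> \<lfloor>N_prefactor S * exp (c\<^sub>0 * R\<^sup>2)\<rfloor> \<longrightarrow> 3 / 8 \<le> tv_dist (law_at ?Q z n) \<pi>))"
      using \<pi>(5,6) near[OF z(1)] z(2) by blast
  qed
qed

section \<open>The dichotomy\<close>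

text \<open>If the slowest quadratic mode is at least as slow as \<open>q\<close>, the first alternative holds. Otherwise already the
  mode of stiffness one is faster than \<open>q\<close>; this bounds \<open>s \<kappa>\<close> from below by \<open>C\<^sub>s (1 - \<beta>)\<close>, which
  leaves room for a potential with an attracting cycle.\<close>

theorem theorem6p6:
  fixes S :: splitting and h \<gamma> \<beta> s C\<^sub>s \<kappa> q :: real
  assumes "h > 0" and "\<gamma> > 0"
    and "\<beta> = exp (- \<gamma> * h)" and "s = s_param S h \<beta>"
    and "C\<^sub>s > (3 + sqrt 5)\<^sup>2" and "\<kappa> \<ge> 2 * C\<^sub>s"
    and "q = (1 - C\<^sub>s / \<kappa>) / (1 + C\<^sub>s / \<kappa>)"
    and "0 < s" and "s < 2 * (1 + \<beta>) / \<kappa>"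
  shows
    "(\<exists>l\<in>{1..\<kappa>}. \<exists>z z' :: (real^2) \<times> (real^2).
        (\<lambda>n. root n (tv_dist (law_at (splitting_kernel S (quadratic_potential l) h \<gamma>) z n)
                             (law_at (splitting_kernel S (quadratic_potential l) h \<gamma>) z' n)))
          \<longlonglongrightarrow> rho_q s \<beta> \<kappa>
        \<and> rho_q s \<beta> \<kappa> \<ge> q)
   \<or> (\<exists>U \<in> (potentials \<kappa> :: (real^2 \<Rightarrow> real) set). \<exists>c\<^sub>0>0. \<exists>C\<^sub>0>0. \<forall>R::real. R \<ge> 1 \<longrightarrow>
        dilate R U \<in> potentials \<kappa> \<and>
        (\<exists>\<pi>. invariant_law (splitting_kernel S (dilate R U) h \<gamma>) \<pi> \<and>
             (\<forall>\<pi>'. invariant_law (splitting_kernel S (dilate R U) h \<gamma>) \<pi>' \<longrightarrow> \<pi>' = \<pi>) \<and>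
             (\<exists>z. W2 (return borel z) \<pi> \<le> ennreal (C\<^sub>0 * (1 + R)) \<and>
                  (\<forall>n::nat. int n \<le> \<lfloor>N_prefactor S * exp (c\<^sub>0 * R\<^sup>2)\<rfloor> \<longrightarrow>
                     tv_dist (law_at (splitting_kernel S (dilate R U) h \<gamma>) z n) \<pi> \<ge> 3/8))))"
    (is "?quadratic \<or> ?cyclic")
proof -
  note h = assms(1) and \<gamma> = assms(2) and \<beta> = assms(3) and s_eq = assms(4) and s = assms(8)
  have b: "0 < \<beta>" "\<beta> < 1" using h \<gamma> by (auto simp: \<beta>)
  have C: "27 < C\<^sub>s"
  proof -
    have "(3 + sqrt 5)\<^sup>2 = 14 + 6 * sqrt (5::real)" by (simp add: power2_sum)
    (* 27 = 14 + 6 * (13 / 6) *)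
    moreover have "(13 / 6)\<^sup>2 < (5::real)" by (simp add: power2_eq_square)
    then have "13 / 6 < sqrt (5::real)" by (rule real_less_rsqrt)
    ultimately show ?thesis using assms(5) by linarith
  qed
  then have \<kappa>: "54 \<le> \<kappa>" using assms(6) by linarith
  then have \<kappa>1: "1 \<le> \<kappa>" by simp
  have s\<kappa>: "s * \<kappa> < 2 * (1 + \<beta>)" using assms(9) \<kappa> by (simp add: pos_less_divide_eq)
  show ?thesis
  proof (cases "q \<le> rho_q s \<beta> \<kappa>")
    case True
    obtain l where l: "l \<in> {1..\<kappa>}" "rho_q s \<beta> \<kappa> = companion_radius (1 + \<beta> - s * l) \<beta>"
      using rho_q_attained[OF b(1) less_imp_le[OF s] \<kappa>1] by blast
    have "0 < s * l" using s l(1) by simp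
    moreover have "s * l \<le> s * \<kappa>" using s l(1) by (intro mult_left_mono) auto
    then have "s * l < 2 * (1 + \<beta>)" using s\<kappa> by linarith
    ultimately have "\<exists>z z' :: (real^2) \<times> (real^2).
      (\<lambda>n. root n (tv_dist (law_at (splitting_kernel S (quadratic_potential l) h \<gamma>) z n)
        (law_at (splitting_kernel S (quadratic_potential l) h \<gamma>) z' n))) \<longlonglongrightarrow> companion_radius (1 + \<beta> - s * l) \<beta>"
      by (rule quadratic_tv_rate[OF h \<gamma> \<beta> s_eq, where 'a="real^2"]) (intro exI)
    then have ?quadratic unfolding l(2)[symmetric] using l(1) True by blast
    then show ?thesis ..
  next
    case False
    have \<rho>q: "companion_radius (1 + \<beta> - s * 1) \<beta> < q"
      using rho_q_ge[OF b(1) less_imp_le[OF s] \<kappa>1, of 1] False \<kappa>1 by auto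
    have q\<kappa>: "\<kappa> * (1 - q) = C\<^sub>s * (1 + q)" and q01: "0 < q" "q < 1"
    proof -
      have p: "0 < \<kappa>" "0 < \<kappa> + C\<^sub>s" "C\<^sub>s < \<kappa>" using \<kappa> C assms(6) by auto
      then have "1 - C\<^sub>s / \<kappa> = (\<kappa> - C\<^sub>s) / \<kappa>" "1 + C\<^sub>s / \<kappa> = (\<kappa> + C\<^sub>s) / \<kappa>" by (simp_all add: field_simps)
      then have q: "q = (\<kappa> - C\<^sub>s) / (\<kappa> + C\<^sub>s)" using assms(7) p by simp
      show "\<kappa> * (1 - q) = C\<^sub>s * (1 + q)" unfolding q using p by (simp add: field_simps)
      show "0 < q" "q < 1" unfolding q using p C by simp_all
    qed
    (* The roots for stiffness one lie below q: their product gives \<beta> < q^2, and positivity of the characteristic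
       polynomial at q bounds s from below. *)
    have \<beta>q: "\<beta> < q\<^sup>2"
    proof -
      have "sqrt \<beta> < q" using companion_radius_ge[OF b(1), of "1 + \<beta> - s * 1"] \<rho>q by linarith
      then have "(sqrt \<beta>)\<^sup>2 < q\<^sup>2" using b by (intro power_strict_mono) auto
      then show ?thesis using b by simp
    qed
    have pos: "0 < q\<^sup>2 - (1 + \<beta> - s) * q + \<beta>"
      using characteristic_positive[OF b(1), of "1 + \<beta> - s" q] \<rho>q by simp
    have lower: "C\<^sub>s * (1 - \<beta>) < s * \<kappa>"
    proof -
      have "(1 - q) * (q - \<beta>) < s * q" using pos by (simp add: power2_eq_square algebra_simps)
      then have "\<kappa> * ((1 - q) * (q - \<beta>)) < \<kappa> * (s * q)" using \<kappa> by (intro mult_strict_left_mono) auto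
      moreover have "\<kappa> * ((1 - q) * (q - \<beta>)) = C\<^sub>s * ((1 + q) * (q - \<beta>))"
        using q\<kappa> by (metis mult.assoc)
      moreover have "C\<^sub>s * ((1 - \<beta>) * q) \<le> C\<^sub>s * ((1 + q) * (q - \<beta>))"
        using \<beta>q C by (intro mult_left_mono) (auto simp: power2_eq_square algebra_simps)
      ultimately have "(C\<^sub>s * (1 - \<beta>)) * q < (s * \<kappa>) * q" by (simp add: mult_ac)
      then show ?thesis using q01 by simp
    qed
    have ?cyclic
    proof (rule cone_condition[OF b s \<kappa> less_imp_le[OF C] s\<kappa> lower])
      fix K :: nat and X y :: real
      assume K: "2 \<le> K" "0 \<le> y"
      "s * (\<kappa> - 1) * X = (1 + \<beta>) * (1 - cos (2 * pi / real K)) - s"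
      "s * (\<kappa> - 1) * y = (1 - \<beta>) * sin (2 * pi / real K)"
      "y * cos (pi / real K) < (X - X\<^sup>2 - y\<^sup>2) * sin (pi / real K)"
      have \<kappa>2: "1 < \<kappa>" using \<kappa> by simp
      show ?cyclic
      proof (rule cyclic_potential[OF K(1) \<kappa>2 s less_imp_le[OF b(2)] K(3,4,2,5)])
        fix U :: "real^2 \<Rightarrow> real" and G g :: "real^2 \<Rightarrow> real^2" and c :: "int \<Rightarrow> real^2" and \<rho> B d :: real
        assume U: "\<And>k. C_k k U" "\<And>x. GDERIV U x :> G x"
          "\<And>x y. (norm (x - y))\<^sup>2 \<le> inner (G x - G y) (x - y)"
          "\<And>x y. inner (G x - G y) (x - y) \<le> \<kappa> * (norm (x - y))\<^sup>2"
          "\<And>x y. norm (G x - G y) \<le> \<kappa> * norm (x - y)"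
          "\<And>x. G x = x + g x" "\<And>x. norm (g x) \<le> B" "0 \<le> B"
          "\<And>k. c (k + 1) = (1 + \<beta>) *\<^sub>R c k - \<beta> *\<^sub>R c (k - 1) - s *\<^sub>R G (c k)"
          "0 < \<rho>" "\<And>k x. dist (c k) x \<le> \<rho> \<Longrightarrow> g x = g (c k)"
          "\<And>k. norm (c k) = 1" "0 < d" "\<And>k. dist (c k) (c (k + 1)) = d"
        have "dilate 1 U = U" by (simp add: dilate_def fun_eq_iff)
        then have "U \<in> potentials \<kappa>" using dilate_potentials(1)[OF U(1-4), of 1] by simp
        with cyclic_potential_metastable[OF h \<gamma> \<beta> s_eq \<kappa>1 s s\<kappa> U] show ?cyclic by (rule bexI)
      qed
    qed
    then show ?thesis ..
  qed
qed

end
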